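(* Given $\epsilon>0$ there exists a neighborhood $\mathcal U_\epsilon$ of $S^{2m-1}$ in $\mathbf{Conv}(2m)$ such that if $S\in\mathcal U_\epsilon$ then every $P\in\mathcal P(S)$ satisfies $\mathcal A(P)\in[\pi-\epsilon,\pi+\epsilon]$ (short orbits) or $\mathcal A(P)>\epsilon^{-1}$ (long orbits). In the case $m=2$, given any $k\ge1$ there exists a neighborhood $\mathcal U_{\epsilon,k}\subset\mathcal U_\epsilon$ of $S^3$ such that if $S\in\mathcal U_{\epsilon,k}$ then $\mathrm{link}(P,P')\ge k$ whenever $P\in\mathcal P(S)$ is short and $P'\in\mathcal P(S)$ is long.
   Context: $\mathbb R^{2m}$ has coordinates $(q_1,p_1,\dots,q_m,p_m)$, standard symplectic form $\omega_0=\sum_i dq_i\wedge dp_i$ and standard Liouville form $\lambda_0=\frac12\sum_i(q_idp_i-p_idq_i)$. $S^{2m-1}\subset\mathbb R^{2m}$ is the unit sphere. $\mathbf{Conv}(2m)$ is the set of closed and strictly convex hypersurfaces of class $C^2$ in $\mathbb R^{2m}$, equipped with the $C^2$-topology. Each $S\in\mathbf{Conv}(2m)$ is oriented as the boundary of the bounded connected component of $\mathbb R^{2m}\setminus S$. A closed characteristic on $S$ is a closed leaf of the line field $TS^{\bot}\subset TS$, where $\bot$ denotes the $\omega_0$-symplectic orthogonal; these are precisely the geometric images of closed Hamiltonian orbits, for any Hamiltonian realizing $S$ as a regular energy level. $\mathcal P(S)$ is the set of closed characteristics on $S$, whose elements are thought of as first iterates (prime, simply covered) of periodic orbits of a Hamiltonian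 system. The action of $P\in\mathcal P(S)$ is $\mathcal A(P)=\int_P\lambda_0$, where $P$ is oriented so that its action is positive (for $S$ near $S^{2m-1}$ this is its orientation as a Reeb orbit of $\lambda_0|_S$). For $m=2$, $\mathrm{link}(P,P')$ is the linking number of the oriented knots $P,P'$ in the oriented 3-sphere $S$.
   Formalization: In the linking claim, "P' long" means action > 1/ε and not in [π−ε, π+ε]; this changes nothing if π+ε ≤ 1/ε. For larger ε such as ε = 1 the ranges overlap, and on the round S^3 every Hopf fibre is both short and long with linking number 1, so the literal claim fails. *)

theory Defs
  imports "HOL-Analysis.Analysis"
begin

section \<open>The standard symplectic vector space\<close>

text \<open>
  The space R^(2m) with its coordinates (q_1, p_1, ..., q_m, p_m) is the Euclidean space
  \<open>(real \<times> real) ^ 'm\<close> with \<open>m = CARD('m)\<close>: the \<open>i\<close>-th component of \<open>x\<close> is the pair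
  \<open>(q_i, p_i)\<close>.
\<close>

definition symp_form :: "(real \<times> real) ^ 'm::finite \<Rightarrow> (real \<times> real) ^ 'm \<Rightarrow> real" where
  "symp_form v w = (\<Sum>i\<in>UNIV. fst (v $ i) * snd (w $ i) - snd (v $ i) * fst (w $ i))"

definition liouville_form :: "(real \<times> real) ^ 'm::finite \<Rightarrow> (real \<times> real) ^ 'm \<Rightarrow> real" where
  "liouville_form x v =
     1/2 * (\<Sum>i\<in>UNIV. fst (x $ i) * snd (v $ i) - snd (x $ i) * fst (v $ i))"

definition symp_orth :: "((real \<times> real) ^ 'm::finite) set \<Rightarrow> ((real \<times> real) ^ 'm) set" where
  "symp_orth W = {v. \<forall>w\<in>W. symp_form v w = 0}"

text \<open>
  The 4-form \<open>\<omega>\<^sub>0 \<and> \<omega>\<^sub>0 / 2\<close>. For \<open>m = 2\<close> it is the determinant with respect to the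
  coordinates \<open>(q_1, p_1, q_2, p_2)\<close>, and it does not depend on which of the two elements of
  \<open>'m\<close> comes first.
\<close>

definition symp_vol4 :: "(real \<times> real) ^ 'm::finite \<Rightarrow> (real \<times> real) ^ 'm \<Rightarrow>
    (real \<times> real) ^ 'm \<Rightarrow> (real \<times> real) ^ 'm \<Rightarrow> real" where
  "symp_vol4 a b c d =
     symp_form a b * symp_form c d - symp_form a c * symp_form b d + symp_form a d * symp_form b c"


section \<open>Convex hypersurfaces and the \<open>C\<^sup>2\<close>-topology\<close>

definition C2_on :: "'a::real_normed_vector set \<Rightarrow> ('a \<Rightarrow> 'b::real_normed_vector) \<Rightarrow> bool" where
  "C2_on U f \<longleftrightarrow> (\<exists>(f' :: 'a \<Rightarrow> 'a \<Rightarrow>\<^sub>L 'b) (f'' :: 'a \<Rightarrow> 'a \<Rightarrow>\<^sub>L 'a \<Rightarrow>\<^sub>L 'b).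
     (\<forall>x\<in>U. (f has_derivative blinfun_apply (f' x)) (at x) \<and>
             (f' has_derivative blinfun_apply (f'' x)) (at x)) \<and>
     continuous_on U f'')"

definition C2_hypersurface :: "'a::euclidean_space set \<Rightarrow> bool" where
  "C2_hypersurface S \<longleftrightarrow> (\<forall>x\<in>S. \<exists>U (f :: 'a \<Rightarrow> real).
     open U \<and> x \<in> U \<and> C2_on U f \<and> S \<inter> U = {y \<in> U. f y = 0} \<and>
     (\<forall>y\<in>U. \<not> (f has_derivative (\<lambda>_. 0)) (at y)))"

definition strictly_convex_body :: "'a::euclidean_space set \<Rightarrow> bool" where
  "strictly_convex_body K \<longleftrightarrow> compact K \<and> interior K \<noteq> {} \<and>
     (\<forall>x\<in>K. \<forall>y\<in>K. x \<noteq> y \<longrightarrow> open_segment x y \<subseteq> interior K)"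

definition Conv :: "((real \<times> real) ^ 'm::finite) set set" where
  "Conv = {S. C2_hypersurface S \<and> (\<exists>K. strictly_convex_body K \<and> S = frontier K)}"

definition C2_less :: "('a::real_normed_vector \<Rightarrow> 'b::real_normed_vector) \<Rightarrow> real \<Rightarrow> bool" where
  "C2_less v \<delta> \<longleftrightarrow> (\<exists>(v' :: 'a \<Rightarrow> 'a \<Rightarrow>\<^sub>L 'b) (v'' :: 'a \<Rightarrow> 'a \<Rightarrow>\<^sub>L 'a \<Rightarrow>\<^sub>L 'b).
     (\<forall>x. (v has_derivative blinfun_apply (v' x)) (at x) \<and>
          (v' has_derivative blinfun_apply (v'' x)) (at x) \<and>
          norm (v x) < \<delta> \<and> norm (v' x) < \<delta> \<and> norm (v'' x) < \<delta>) \<and>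
     continuous_on UNIV v'')"

text \<open>
  Two hypersurfaces are \<open>C\<^sup>2\<close>-close if one is the image of the other under a map of the ambient
  space that is \<open>C\<^sup>2\<close>-close to the identity. (Such maps and \<open>C\<^sup>2\<close>-small perturbations of the
  inclusion of \<open>S\<close> give the same notion, by extension from \<open>S\<close> to the ambient space.)
  The sets \<open>C2_nbhd S \<delta>\<close>, \<open>\<delta> > 0\<close>, form a neighbourhood basis of \<open>S\<close> in \<open>Conv\<close>.
\<close>

definition C2_nbhd :: "((real \<times> real) ^ 'm::finite) set \<Rightarrow> real \<Rightarrow> ((real \<times> real) ^ 'm) set set" where
  "C2_nbhd S \<delta> = {S' \<in> Conv. \<exists>v. C2_less v \<delta> \<and> S' = (\<lambda>x. x + v x) ` S}"

definition C2_topology :: "((real \<times> real) ^ 'm::finite) set topology" where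
  "C2_topology = topology (\<lambda>\<U>. \<U> \<subseteq> Conv \<and> (\<forall>S\<in>\<U>. \<exists>\<delta>>0. C2_nbhd S \<delta> \<subseteq> \<U>))"

lemma C2_nbhd_mono:
  assumes "\<delta> \<le> \<delta>'"
  shows "C2_nbhd S \<delta> \<subseteq> C2_nbhd S \<delta>'"
  using assms unfolding C2_nbhd_def C2_less_def by (smt (verit, best) Collect_mono_iff)

lemma openin_C2_topology:
  "openin C2_topology \<U> \<longleftrightarrow> \<U> \<subseteq> Conv \<and> (\<forall>S\<in>\<U>. \<exists>\<delta>>0. C2_nbhd S \<delta> \<subseteq> \<U>)"
proof -
  have "istopology (\<lambda>\<U> :: ((real \<times> real) ^ 'a) set set.
          \<U> \<subseteq> Conv \<and> (\<forall>S\<in>\<U>. \<exists>\<delta>>0. C2_nbhd S \<delta> \<subseteq> \<U>))" (is "istopology ?P")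
    unfolding istopology_def
  proof (intro conjI allI impI)
    fix A B :: "((real \<times> real) ^ 'a) set set"
    assume A: "?P A" and B: "?P B"
    show "A \<inter> B \<subseteq> Conv" using A by blast
    show "\<forall>S\<in>A \<inter> B. \<exists>\<delta>>0. C2_nbhd S \<delta> \<subseteq> A \<inter> B"
    proof
      fix S assume S: "S \<in> A \<inter> B"
      obtain a where a: "a > 0" "C2_nbhd S a \<subseteq> A" using A S by blast
      obtain b where b: "b > 0" "C2_nbhd S b \<subseteq> B" using B S by blast
      have "C2_nbhd S (min a b) \<subseteq> A \<inter> B"
        using a(2) b(2) C2_nbhd_mono[of "min a b" a S] C2_nbhd_mono[of "min a b" b S] by auto
      then show "\<exists>\<delta>>0. C2_nbhd S \<delta> \<subseteq> A \<inter> B" using a(1) b(1) by (intro exI[of _ "min a b"]) auto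
    qed
  next
    fix \<K> :: "((real \<times> real) ^ 'a) set set set"
    assume K: "\<forall>A\<in>\<K>. ?P A"
    show "\<Union>\<K> \<subseteq> Conv" using K by blast
    show "\<forall>S\<in>\<Union>\<K>. \<exists>\<delta>>0. C2_nbhd S \<delta> \<subseteq> \<Union>\<K>"
    proof
      fix S assume "S \<in> \<Union>\<K>"
      then obtain A where A: "A \<in> \<K>" "S \<in> A" by blast
      then obtain \<delta> where "\<delta> > 0" "C2_nbhd S \<delta> \<subseteq> A" using K by blast
      then show "\<exists>\<delta>>0. C2_nbhd S \<delta> \<subseteq> \<Union>\<K>" using A(1) by blast
    qed
  qed
  then show ?thesis unfolding C2_topology_def by (simp add: topology_inverse')
qed


section \<open>Closed characteristics and their action\<close>

definition tangent_space :: "'a::real_normed_vector set \<Rightarrow> 'a \<Rightarrow> 'a set" where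
  "tangent_space S x =
     {v. \<exists>c :: real \<Rightarrow> 'a. c 0 = x \<and> (\<forall>t. c t \<in> S) \<and> (c has_vector_derivative v) (at 0)}"

abbreviation velocity :: "(real \<Rightarrow> 'a::real_normed_vector) \<Rightarrow> real \<Rightarrow> 'a" where
  "velocity \<gamma> t \<equiv> vector_derivative \<gamma> (at t)"

text \<open>Simply covered regular loops, i.e. \<open>C\<^sup>1\<close>-embeddings of the circle \<open>\<real>/\<int>\<close>.\<close>

definition regular_loop :: "(real \<Rightarrow> 'a::real_normed_vector) \<Rightarrow> bool" where
  "regular_loop \<gamma> \<longleftrightarrow> \<gamma> C1_differentiable_on UNIV \<and> (\<forall>t. velocity \<gamma> t \<noteq> 0) \<and>
     (\<forall>t. \<gamma> (t + 1) = \<gamma> t) \<and> inj_on \<gamma> {0..<1}"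

text \<open>
  The closed leaves of the line field \<open>(TS)\<^sup>\<bottom>\<close> are the embedded circles in \<open>S\<close> that are
  everywhere tangent to it.
\<close>

definition closed_characteristics ::
    "((real \<times> real) ^ 'm::finite) set \<Rightarrow> ((real \<times> real) ^ 'm) set set" where
  "closed_characteristics S = {range \<gamma> | \<gamma>. regular_loop \<gamma> \<and>
     (\<forall>t. \<gamma> t \<in> S \<and> velocity \<gamma> t \<in> symp_orth (tangent_space S (\<gamma> t)))}"

definition loop_action :: "(real \<Rightarrow> (real \<times> real) ^ 'm::finite) \<Rightarrow> real" where
  "loop_action \<gamma> = integral {0..1} (\<lambda>t. liouville_form (\<gamma> t) (velocity \<gamma> t))"

text \<open>
  A parametrization of the knot \<open>P\<close> that induces the orientation for which the action is positive.
  The quantities below defined through it do not depend on the choice.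
\<close>

definition oriented_param :: "((real \<times> real) ^ 'm::finite) set \<Rightarrow> real \<Rightarrow> (real \<times> real) ^ 'm" where
  "oriented_param P = (SOME \<gamma>. regular_loop \<gamma> \<and> range \<gamma> = P \<and> 0 < loop_action \<gamma>)"

definition char_action :: "((real \<times> real) ^ 'm::finite) set \<Rightarrow> real" where
  "char_action P = loop_action (oriented_param P)"


section \<open>Linking numbers in the 3-sphere \<open>S\<close>\<close>

text \<open>
  The linking number of two disjoint oriented knots in the oriented 3-sphere \<open>S\<close> (case \<open>m = 2\<close>)
  is the linking number of their images under an orientation preserving diffeomorphism from
  \<open>S - {x}\<close> to an oriented Euclidean 3-space, where \<open>x \<in> S\<close> lies on neither knot; in the
  3-space it is given by the Gauss linking integral. As \<open>S\<close> is a strictly convex hypersurface, the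
  diffeomorphism can be taken to be the stereographic projection from \<open>x\<close> onto the hyperplane
  orthogonal to the inward unit normal \<open>\<nu>\<close> at \<open>x\<close>.

  Orientations: \<open>S\<close> is oriented as the boundary of \<open>inside S\<close>, the bounded component of the
  complement, by the outward-normal-first rule. The outward normal at a point \<open>y \<noteq> x\<close> of \<open>S\<close> has
  positive inner product with \<open>y - x\<close>, so the projection preserves orientations if the hyperplane
  has the 3-dimensional volume form \<open>symp_vol4 \<nu>\<close>.
\<close>

definition inward_normal :: "'a::euclidean_space set \<Rightarrow> 'a \<Rightarrow> 'a" where
  "inward_normal S x = (THE \<nu>. norm \<nu> = 1 \<and> (\<forall>w\<in>tangent_space S x. \<nu> \<bullet> w = 0) \<and>
     (\<forall>\<^sub>F t in at_right 0. x + t *\<^sub>R \<nu> \<in> inside S))"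

definition stereographic :: "'a::euclidean_space \<Rightarrow> 'a \<Rightarrow> 'a \<Rightarrow> 'a" where
  "stereographic x \<nu> y = (1 / (\<nu> \<bullet> (y - x))) *\<^sub>R (y - x) - \<nu>"

text \<open>
  The Gauss integral \<open>1/(4 \<pi>) \<integral>\<integral> det(\<alpha>(s) - \<beta>(t), \<alpha>'(s), \<beta>'(t)) / |\<alpha>(s) - \<beta>(t)|\<^sup>3 ds dt\<close>
  of two disjoint loops in the oriented Euclidean 3-space \<open>\<nu>\<^sup>\<bottom>\<close>. It is an integer.
\<close>

definition gauss_linking :: "(real \<times> real) ^ 'm::finite \<Rightarrow>
    (real \<Rightarrow> (real \<times> real) ^ 'm) \<Rightarrow> (real \<Rightarrow> (real \<times> real) ^ 'm) \<Rightarrow> real" where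
  "gauss_linking \<nu> \<alpha> \<beta> = 1 / (4 * pi) *
     integral {0..1} (\<lambda>s. integral {0..1} (\<lambda>t.
       symp_vol4 \<nu> (\<alpha> s - \<beta> t) (velocity \<alpha> s) (velocity \<beta> t) / norm (\<alpha> s - \<beta> t) ^ 3))"

definition link :: "((real \<times> real) ^ 'm::finite) set \<Rightarrow> ((real \<times> real) ^ 'm) set \<Rightarrow>
    ((real \<times> real) ^ 'm) set \<Rightarrow> real" where
  "link S P P' =
     (let x = (SOME x. x \<in> S - (P \<union> P')); \<nu> = inward_normal S x
      in gauss_linking \<nu> (stereographic x \<nu> \<circ> oriented_param P) (stereographic x \<nu> \<circ> oriented_param P'))"


section \<open>Short and long orbits\<close>

text \<open>
  The two ranges are disjoint if \<open>\<pi> + \<epsilon> \<le> 1 / \<epsilon>\<close>. For larger \<open>\<epsilon>\<close> they overlap; statements about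
  pairs of a short and a long orbit then have to exclude long orbits that are also short.
\<close>

definition short_orbit :: "real \<Rightarrow> ((real \<times> real) ^ 'm::finite) set \<Rightarrow> bool" where
  "short_orbit \<epsilon> P \<longleftrightarrow> char_action P \<in> {pi - \<epsilon>..pi + \<epsilon>}"

definition long_orbit :: "real \<Rightarrow> ((real \<times> real) ^ 'm::finite) set \<Rightarrow> bool" where
  "long_orbit \<epsilon> P \<longleftrightarrow> char_action P > 1 / \<epsilon>"

end

theory Submission
  imports Defs
begin

text \<open>
  Pulled back to the unit sphere by the diffeomorphism \<open>x \<mapsto> x + v x\<close>, the characteristics of a
  hypersurface \<open>C\<^sup>2\<close>-close to the sphere become, after a change of time, trajectories of a Lipschitz
  vector field that is \<open>C\<^sup>1\<close>-close to the Hopf field \<open>z \<mapsto> \<i> z\<close>. In the frame rotating with the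
  Hopf flow such a trajectory moves slowly, and so does the difference of two trajectories. Applied to a
  trajectory and its own time shifts, this forces a prime period that is not very large to be close to
  \<open>2 \<pi>\<close>; the action is close to half the period.

  For \<open>m = 2\<close> the linking number, an integral over a torus, is the degree of a map of the torus into the
  punctured 3-space; it is invariant under homotopies and can be computed on the round sphere. A short
  orbit is there a graph \<open>z\<^sub>2 = q(z\<^sub>1)\<close> with \<open>q\<close> small, and the shear \<open>(z\<^sub>1, z\<^sub>2) \<mapsto> (z\<^sub>1, z\<^sub>2 - q(z\<^sub>1))\<close>
  makes it the circle \<open>z\<^sub>2 = 0\<close>. The linking number becomes the winding number of \<open>z\<^sub>2 - q(z\<^sub>1)\<close> along the
  other orbit. As the difference of two trajectories rotates with speed close to 1, the argument of this
  quantity increases with speed at least 1/2, so the winding number grows linearly with the period.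
\<close>

section \<open>The degree of a map from the torus to punctured 3-space\<close>

text \<open>Three obstacles shape the proof: the knots are only C^1, \<open>link\<close> fixes its
  centre of projection by an arbitrary choice, and it projects along the normal of the perturbed
  surface. Regularity: all torus maps used are sums of products of a function of s and a function of
  t. Their mixed second derivative exists even where the pure ones do not, and no other second
  derivative enters when the solid angle integral is differentiated along a homotopy. Rays: the
  degree depends only on the ray through each value, so a difference of two stereographic images may
  be multiplied by positive functions. Cleared of denominators it makes sense for any three nonzero
  vectors of distinct directions; isotopies may therefore leave the sphere, as the shear does, and
  the centre may move. Frames: the hyperplane orthogonal to the centre x varies with x. Quaternion
  multiplication by the conjugate of x identifies all these hyperplanes with one oriented R^3,
  linearly in x.\<close>

lemma integral_flux_invariant:
  fixes E P Q A B :: "real \<Rightarrow> real \<Rightarrow> real \<Rightarrow> real"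
  assumes cont: "continuous_on ({0..1} \<times> UNIV \<times> UNIV) (\<lambda>(\<tau>,s,t). P \<tau> s t)"
                "continuous_on ({0..1} \<times> UNIV \<times> UNIV) (\<lambda>(\<tau>,s,t). Q \<tau> s t)"
                "continuous_on ({0..1} \<times> UNIV \<times> UNIV) (\<lambda>(\<tau>,s,t). E \<tau> s t)"
    and E: "\<And>\<tau> s t. 0 \<le> \<tau> \<Longrightarrow> \<tau> \<le> 1 \<Longrightarrow>
              ((\<lambda>\<tau>. E \<tau> s t) has_real_derivative P \<tau> s t + Q \<tau> s t) (at \<tau>)"
    and A: "\<And>\<tau> s t. 0 \<le> \<tau> \<Longrightarrow> \<tau> \<le> 1 \<Longrightarrow> ((\<lambda>s. A \<tau> s t) has_real_derivative P \<tau> s t) (at s)"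
    and B: "\<And>\<tau> s t. 0 \<le> \<tau> \<Longrightarrow> \<tau> \<le> 1 \<Longrightarrow> ((\<lambda>t. B \<tau> s t) has_real_derivative Q \<tau> s t) (at t)"
    and Ap: "\<And>\<tau> t. 0 \<le> \<tau> \<Longrightarrow> \<tau> \<le> 1 \<Longrightarrow> A \<tau> 1 t = A \<tau> 0 t"
    and Bp: "\<And>\<tau> s. 0 \<le> \<tau> \<Longrightarrow> \<tau> \<le> 1 \<Longrightarrow> B \<tau> s 1 = B \<tau> s 0"
  shows "integral {0..1} (\<lambda>s. integral {0..1} (\<lambda>t. E 1 s t)) =
         integral {0..1} (\<lambda>s. integral {0..1} (\<lambda>t. E 0 s t))"
proof -
  \<comment> \<open>One joint continuity in the various groupings of the variables that the lemmas
    on parametric and iterated integrals expect.\<close>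
  have c1: "continuous_on (cbox 0 1) (\<lambda>\<tau>. R \<tau> s t)" and
    c2: "continuous_on (cbox (a,0) (a,1)) (\<lambda>(_::real,t). R \<tau> s t)" and
    c3: "continuous_on (cbox (0,0) (1,1)) (\<lambda>(t,\<tau>). R \<tau> s t)" and
    c4: "continuous_on (cbox (0,0) (1,1)) (\<lambda>(s,\<tau>). R \<tau> s t)" and
    c5: "continuous_on (UNIV \<times> cbox 0 1) (\<lambda>(s,t). R \<tau> s t)" and
    c6: "continuous_on ((UNIV\<times>UNIV) \<times> cbox 0 1) (\<lambda>((s,t),\<tau>). R \<tau> s t)"
    if "continuous_on ({0..1} \<times> UNIV \<times> UNIV) (\<lambda>(\<tau>,s,t). R \<tau> s t)" "0 \<le> \<tau>" "\<tau> \<le> 1"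
    for R :: "real \<Rightarrow> real \<Rightarrow> real \<Rightarrow> real" and \<tau> s t a
  proof -
    have *: "continuous_on X (\<lambda>x. R (f x) (g x) (h x))" if "continuous_on X f" "continuous_on X g"
      "continuous_on X h" "\<And>x. x \<in> X \<Longrightarrow> f x \<in> {0..1}" for X :: "'z::topological_space set" and f g h
    proof -
      have "continuous_on X (\<lambda>x. (\<lambda>(\<tau>,s,t). R \<tau> s t) (f x, g x, h x))"
        by (rule continuous_on_compose2[OF \<open>continuous_on _ (\<lambda>(\<tau>,s,t). R \<tau> s t)\<close>])
           (use that in \<open>auto intro!: continuous_intros\<close>)
      then show ?thesis by simp
    qed
    show "continuous_on (cbox 0 1) (\<lambda>\<tau>. R \<tau> s t)" by (rule *) (auto intro!: continuous_intros)
    show "continuous_on (cbox (a,0) (a,1)) (\<lambda>(_::real,t). R \<tau> s t)" unfolding case_prod_beta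
      by (rule *) (use that in \<open>auto intro!: continuous_intros\<close>)
    show "continuous_on (cbox (0,0) (1,1)) (\<lambda>(t,\<tau>). R \<tau> s t)" unfolding case_prod_beta
      by (rule *) (auto intro!: continuous_intros simp: cbox_Pair_eq)
    show "continuous_on (cbox (0,0) (1,1)) (\<lambda>(s,\<tau>). R \<tau> s t)" unfolding case_prod_beta
      by (rule *) (auto intro!: continuous_intros simp: cbox_Pair_eq)
    show "continuous_on (UNIV \<times> cbox 0 1) (\<lambda>(s,t). R \<tau> s t)" unfolding case_prod_beta
      by (rule *) (use that in \<open>auto intro!: continuous_intros\<close>)
    show "continuous_on ((UNIV\<times>UNIV) \<times> cbox 0 1) (\<lambda>((s,t),\<tau>). R \<tau> s t)" unfolding case_prod_beta
      by (rule *) (auto intro!: continuous_intros)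
  qed
  have i1: "(\<lambda>\<tau>. R \<tau> s t) integrable_on {0..1}"
    if "continuous_on ({0..1} \<times> UNIV \<times> UNIV) (\<lambda>(\<tau>,s,t). R \<tau> s t)"
    for R :: "real \<Rightarrow> real \<Rightarrow> real \<Rightarrow> real" and s t
    using integrable_continuous[OF c1[OF that, of 0]] by simp
  have d6: "continuous_on (UNIV\<times>UNIV) (\<lambda>(s,t). integral {0..1} (\<lambda>\<tau>. R \<tau> s t))"
    if "continuous_on ({0..1} \<times> UNIV \<times> UNIV) (\<lambda>(\<tau>,s,t). R \<tau> s t)"
    for R :: "real \<Rightarrow> real \<Rightarrow> real \<Rightarrow> real"
  proof -
    have "continuous_on (UNIV\<times>UNIV) (\<lambda>x. integral (cbox 0 1) (\<lambda>\<tau>. case x of (s,t) \<Rightarrow> R \<tau> s t))"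
      apply (rule integral_continuous_on_param)
      using c6[OF that, of 0] by (simp add: case_prod_beta)
    then show ?thesis by (simp add: case_prod_beta)
  qed
  have i2: "R s integrable_on {0..1}" and i3: "(\<lambda>s. integral {0..1} (R s)) integrable_on {0..1}"
    and i4: "integral {0..1} (\<lambda>s. integral {0..1} (R s)) = integral {0..1} (\<lambda>t. integral {0..1} (\<lambda>s. R s t))"
    if "continuous_on (UNIV\<times>UNIV) (\<lambda>(s,t). R s t)" for R :: "real \<Rightarrow> real \<Rightarrow> real" and s
  proof -
    have *: "continuous_on X (\<lambda>x. R (f x) (g x))" if "continuous_on X f" "continuous_on X g"
      for X :: "'z::topological_space set" and f g
    proof -
      have "continuous_on X (\<lambda>x. (\<lambda>(s,t). R s t) (f x, g x))"
        by (rule continuous_on_compose2[OF \<open>continuous_on _ (\<lambda>(s,t). R s t)\<close>])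
           (use that in \<open>auto intro!: continuous_intros\<close>)
      then show ?thesis by simp
    qed
    show "R s integrable_on {0..1}"
      by (rule integrable_continuous_interval, rule *) (auto intro!: continuous_intros)
    have "continuous_on {0..1} (\<lambda>s. integral (cbox 0 1) (R s))"
      apply (rule integral_continuous_on_param)
      unfolding case_prod_beta by (rule *) (auto intro!: continuous_intros)
    then show "(\<lambda>s. integral {0..1} (R s)) integrable_on {0..1}"
      using integrable_continuous_interval by simp
    have "continuous_on (cbox (0,0) (1,1)) (\<lambda>(s,t). R s t)"
      unfolding case_prod_beta by (rule *) (auto intro!: continuous_intros)
    from integral_swap_continuous[OF this]
    show "integral {0..1} (\<lambda>s. integral {0..1} (R s)) = integral {0..1} (\<lambda>t. integral {0..1} (\<lambda>s. R s t))"
      by simp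
  qed
  define IP where "IP s t = integral {0..1} (\<lambda>\<tau>. P \<tau> s t)" for s t
  define IQ where "IQ s t = integral {0..1} (\<lambda>\<tau>. Q \<tau> s t)" for s t
  have IPc: "continuous_on (UNIV\<times>UNIV) (\<lambda>(s,t). IP s t)" and IQc: "continuous_on (UNIV\<times>UNIV) (\<lambda>(s,t). IQ s t)"
    unfolding IP_def IQ_def using d6 cont by blast+
  have diff: "E 1 s t = E 0 s t + (IP s t + IQ s t)" for s t
  proof -
    have "((\<lambda>\<tau>. P \<tau> s t + Q \<tau> s t) has_integral (E 1 s t - E 0 s t)) {0..1}"
      by (rule fundamental_theorem_of_calculus)
         (auto intro!: has_field_derivative_at_within[OF E] simp flip: has_real_derivative_iff_has_vector_derivative)
    then have "E 1 s t - E 0 s t = integral {0..1} (\<lambda>\<tau>. P \<tau> s t + Q \<tau> s t)"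
      by (simp add: integral_unique)
    also have "\<dots> = IP s t + IQ s t" unfolding IP_def IQ_def
      by (rule integral_add) (use i1 cont in blast)+
    finally show ?thesis by simp
  qed
  have E0c: "continuous_on (UNIV\<times>UNIV) (\<lambda>(s,t). E 0 s t)"
  proof -
    have "continuous_on (UNIV\<times>UNIV) (\<lambda>x. (\<lambda>(\<tau>,s,t). E \<tau> s t) (0, fst x, snd x))"
      by (rule continuous_on_compose2[OF cont(3)]) (auto intro!: continuous_intros)
    then show ?thesis by (simp add: case_prod_beta)
  qed
  have IPQc: "continuous_on (UNIV\<times>UNIV) (\<lambda>(s,t). IP s t + IQ s t)"
    using continuous_on_add[OF IPc IQc] by (simp add: case_prod_beta)
  \<comment> \<open>After exchanging the order of integration, the inner integral is that of the
    s-derivative of \<open>A\<close>, which vanishes because \<open>A\<close> has equal values at 0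
    and 1. \<open>Q0\<close> is the same for t and \<open>B\<close>.\<close>
  have P0: "integral {0..1} (\<lambda>s. IP s t) = 0" for t
  proof -
    have "integral {0..1} (\<lambda>s. IP s t) = integral {0..1} (\<lambda>\<tau>. integral {0..1} (\<lambda>s. P \<tau> s t))"
      unfolding IP_def using integral_swap_continuous[OF c4[OF cont(1), of 0 t]] by simp
    also have "\<dots> = integral {0..1} (\<lambda>\<tau>::real. 0)"
    proof (rule Henstock_Kurzweil_Integration.integral_cong)
      fix \<tau> :: real assume \<tau>: "\<tau> \<in> {0..1}"
      have "((\<lambda>s. P \<tau> s t) has_integral (A \<tau> 1 t - A \<tau> 0 t)) {0..1}"
        by (rule fundamental_theorem_of_calculus)
           (use \<tau> in \<open>auto intro!: has_field_derivative_at_within[OF A] simp flip: has_real_derivative_iff_has_vector_derivative\<close>)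
      then show "integral {0..1} (\<lambda>s. P \<tau> s t) = 0" using Ap \<tau> by (simp add: integral_unique)
    qed
    finally show ?thesis by simp
  qed
  have Q0: "integral {0..1} (\<lambda>t. IQ s t) = 0" for s
  proof -
    have "integral {0..1} (\<lambda>t. IQ s t) = integral {0..1} (\<lambda>\<tau>. integral {0..1} (\<lambda>t. Q \<tau> s t))"
      unfolding IQ_def using integral_swap_continuous[OF c3[OF cont(2), of 0 s]] by simp
    also have "\<dots> = integral {0..1} (\<lambda>\<tau>::real. 0)"
    proof (rule Henstock_Kurzweil_Integration.integral_cong)
      fix \<tau> :: real assume \<tau>: "\<tau> \<in> {0..1}"
      have "((\<lambda>t. Q \<tau> s t) has_integral (B \<tau> s 1 - B \<tau> s 0)) {0..1}"
        by (rule fundamental_theorem_of_calculus)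
           (use \<tau> in \<open>auto intro!: has_field_derivative_at_within[OF B] simp flip: has_real_derivative_iff_has_vector_derivative\<close>)
      then show "integral {0..1} (\<lambda>t. Q \<tau> s t) = 0" using Bp \<tau> by (simp add: integral_unique)
    qed
    finally show ?thesis by simp
  qed
  have "integral {0..1} (\<lambda>s. integral {0..1} (\<lambda>t. E 1 s t)) =
     integral {0..1} (\<lambda>s. integral {0..1} (E 0 s) + (integral {0..1} (IP s) + integral {0..1} (IQ s)))"
    unfolding diff using i2 E0c IPc IQc by (subst integral_add; (simp add: integrable_add)?)+
  also have "\<dots> = integral {0..1} (\<lambda>s. integral {0..1} (E 0 s)) +
     (integral {0..1} (\<lambda>s. integral {0..1} (IP s)) + integral {0..1} (\<lambda>s. integral {0..1} (IQ s)))"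
    using i3 E0c IPc IQc by (subst integral_add; (simp add: integrable_add)?)+
  also have "\<dots> = integral {0..1} (\<lambda>s. integral {0..1} (E 0 s))"
    using i4[OF IPc] P0 Q0 by simp
  finally show ?thesis .
qed

section \<open>The solid angle form and the degree integral\<close>

type_synonym r3 = "real \<times> complex"

text \<open>The coordinates are ordered as \<open>fst\<close>, \<open>Re\<close>, \<open>Im\<close>.
  Three-space is encoded with a complex factor to fit \<open>cvec\<close> below, whose values
  consist of an imaginary part and a complex determinant.\<close>

definition det3 :: "r3 \<Rightarrow> r3 \<Rightarrow> r3 \<Rightarrow> real" where
  "det3 u v w =
     fst u * (Re (snd v) * Im (snd w) - Im (snd v) * Re (snd w))
   - Re (snd u) * (fst v * Im (snd w) - Im (snd v) * fst w)
   + Im (snd u) * (fst v * Re (snd w) - Re (snd v) * fst w)"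

lemma det3_has_derivative:
  assumes "(u has_vector_derivative u') (at x)" "(v has_vector_derivative v') (at x)"
    "(w has_vector_derivative w') (at x)"
  shows "((\<lambda>x. det3 (u x) (v x) (w x)) has_real_derivative
     det3 u' (v x) (w x) + det3 (u x) v' (w x) + det3 (u x) (v x) w') (at x)"
proof -
  have f: "((\<lambda>x. fst (f x)) has_real_derivative fst f') (at x)"
    "((\<lambda>x. Re (snd (f x))) has_real_derivative Re (snd f')) (at x)"
    "((\<lambda>x. Im (snd (f x))) has_real_derivative Im (snd f')) (at x)"
    if "(f has_vector_derivative f') (at x)" for f :: "real \<Rightarrow> r3" and f'
    unfolding has_real_derivative_iff_has_vector_derivative
    by (auto intro!: bounded_linear.has_vector_derivative[OF _ that] bounded_linear_fst
      bounded_linear_Re bounded_linear_Im bounded_linear_compose[OF bounded_linear_Re bounded_linear_snd]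
      bounded_linear_compose[OF bounded_linear_Im bounded_linear_snd])
  show ?thesis unfolding det3_def
    by (rule derivative_eq_intros f[OF assms(1)] f[OF assms(2)] f[OF assms(3)] refl)+ (simp add: algebra_simps)
qed

lemma has_real_derivative_norm:
  fixes F :: "real \<Rightarrow> 'a::real_inner"
  assumes "(F has_vector_derivative F') (at x)" "F x \<noteq> 0"
  shows "((\<lambda>x. norm (F x)) has_real_derivative (F x \<bullet> F') / norm (F x)) (at x)"
proof -
  have "((\<lambda>x. norm (F x)) has_derivative (\<lambda>h. (h *\<^sub>R F') \<bullet> sgn (F x))) (at x)"
    using has_derivative_compose[OF assms(1)[unfolded has_vector_derivative_def]
        has_derivative_norm[OF assms(2)]] by simp
  then show ?thesis unfolding has_field_derivative_def
    by (rule has_derivative_eq_rhs) (auto simp: sgn_div_norm inner_commute divide_inverse)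
qed

text \<open>The differentiated quantity is the solid angle form of punctured 3-space at the point
  \<open>F\<close>, evaluated on the vectors \<open>v\<close> and \<open>w\<close>.\<close>

lemma omega_has_derivative:
  fixes F :: "real \<Rightarrow> r3"
  assumes "(F has_vector_derivative F') (at x)" "(v has_vector_derivative v') (at x)"
    "(w has_vector_derivative w') (at x)" "F x \<noteq> 0"
  shows "((\<lambda>x. det3 (F x) (v x) (w x) / norm (F x) ^ 3) has_real_derivative
     (det3 F' (v x) (w x) + det3 (F x) v' (w x) + det3 (F x) (v x) w') / norm (F x) ^ 3
     - 3 * (F x \<bullet> F') * det3 (F x) (v x) (w x) / norm (F x) ^ 5) (at x)"
proof -
  note n = has_real_derivative_norm[OF assms(1,4)]
  have nz: "norm (F x) \<noteq> 0" using assms by simp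
  show ?thesis
    apply (rule DERIV_cong[OF DERIV_divide[OF det3_has_derivative[OF assms(1-3)] DERIV_power[OF n]]])
    using nz apply simp
    using nz by (simp add: field_simps eval_nat_numeral)
qed

text \<open>Cramer's rule expands \<open>F\<close> in \<open>g\<close>, \<open>u\<close>,
  \<open>v\<close> with determinants as coefficients; this is the inner product of that expansion
  with \<open>F\<close>. It is the algebra behind the closedness of the solid angle form.\<close>

lemma det3_cyclic_inner:
  "(F \<bullet> g) * det3 F u v + (F \<bullet> u) * det3 F v g + (F \<bullet> v) * det3 F g u = (F \<bullet> F) * det3 g u v"
  unfolding det3_def inner_prod_def inner_complex_def by (simp add: algebra_simps)

text \<open>Among the second derivatives only the mixed one is required: for
  \<open>\<alpha> s - \<beta> t\<close> with C^1 curves it is 0, whereas the pure ones may fail to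
  exist.\<close>

definition torus_map :: "(real \<Rightarrow> real \<Rightarrow> r3) \<Rightarrow> bool" where
  "torus_map f \<longleftrightarrow> (\<exists>fs ft fst.
     (\<forall>s t. ((\<lambda>s. f s t) has_vector_derivative fs s t) (at s) \<and>
            ((\<lambda>t. f s t) has_vector_derivative ft s t) (at t) \<and>
            ((\<lambda>t. fs s t) has_vector_derivative fst s t) (at t) \<and>
            ((\<lambda>s. ft s t) has_vector_derivative fst s t) (at s) \<and>
            f (s + 1) t = f s t \<and> f s (t + 1) = f s t) \<and>
     continuous_on UNIV (\<lambda>(s,t). f s t) \<and> continuous_on UNIV (\<lambda>(s,t). fs s t) \<and>
     continuous_on UNIV (\<lambda>(s,t). ft s t) \<and> continuous_on UNIV (\<lambda>(s,t). fst s t))"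

text \<open>The pullback of the solid angle form, divided by the area 4 pi of the unit sphere: the
  degree of f / |f| as a map from the torus to the sphere.\<close>

definition torus_degree :: "(real \<Rightarrow> real \<Rightarrow> r3) \<Rightarrow> real" where
  "torus_degree f = 1 / (4 * pi) * integral {0..1} (\<lambda>s. integral {0..1} (\<lambda>t.
     det3 (f s t) (vector_derivative (\<lambda>s. f s t) (at s)) (vector_derivative (\<lambda>t. f s t) (at t))
       / norm (f s t) ^ 3))"

lemma torus_map_add:
  assumes "torus_map f" "torus_map g"
  shows "torus_map (\<lambda>s t. f s t + g s t)"
proof -
  obtain fs ft fst' where f: "\<forall>s t. ((\<lambda>s. f s t) has_vector_derivative fs s t) (at s) \<and>
            ((\<lambda>t. f s t) has_vector_derivative ft s t) (at t) \<and>
            ((\<lambda>t. fs s t) has_vector_derivative fst' s t) (at t) \<and>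
            ((\<lambda>s. ft s t) has_vector_derivative fst' s t) (at s) \<and>
            f (s + 1) t = f s t \<and> f s (t + 1) = f s t"
     "continuous_on UNIV (\<lambda>(s,t). f s t)" "continuous_on UNIV (\<lambda>(s,t). fs s t)"
     "continuous_on UNIV (\<lambda>(s,t). ft s t)" "continuous_on UNIV (\<lambda>(s,t). fst' s t)"
    using assms(1) unfolding torus_map_def by blast
  obtain gs gt gst where g: "\<forall>s t. ((\<lambda>s. g s t) has_vector_derivative gs s t) (at s) \<and>
            ((\<lambda>t. g s t) has_vector_derivative gt s t) (at t) \<and>
            ((\<lambda>t. gs s t) has_vector_derivative gst s t) (at t) \<and>
            ((\<lambda>s. gt s t) has_vector_derivative gst s t) (at s) \<and>
            g (s + 1) t = g s t \<and> g s (t + 1) = g s t"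
     "continuous_on UNIV (\<lambda>(s,t). g s t)" "continuous_on UNIV (\<lambda>(s,t). gs s t)"
     "continuous_on UNIV (\<lambda>(s,t). gt s t)" "continuous_on UNIV (\<lambda>(s,t). gst s t)"
    using assms(2) unfolding torus_map_def by blast
  show ?thesis unfolding torus_map_def
    apply (rule exI[of _ "\<lambda>s t. fs s t + gs s t"], rule exI[of _ "\<lambda>s t. ft s t + gt s t"],
        rule exI[of _ "\<lambda>s t. fst' s t + gst s t"])
    using f g continuous_on_add[OF f(2) g(2)] continuous_on_add[OF f(3) g(3)]
      continuous_on_add[OF f(4) g(4)] continuous_on_add[OF f(5) g(5)]
    by (auto intro!: has_vector_derivative_add simp: case_prod_beta)
qed

lemma torus_map_product:
  fixes a :: "real \<Rightarrow> real" and u :: "real \<Rightarrow> r3"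
  assumes a: "\<And>t. (a has_real_derivative a' t) (at t)" "continuous_on UNIV a'" "\<And>t. a (t + 1) = a t"
    and u: "\<And>s. (u has_vector_derivative u' s) (at s)" "continuous_on UNIV u'" "\<And>s. u (s + 1) = u s"
  shows "torus_map (\<lambda>s t. a t *\<^sub>R u s)" "torus_map (\<lambda>s t. a s *\<^sub>R u t)"
proof -
  have ac: "continuous_on UNIV a" and uc: "continuous_on UNIV u"
    using a(1) u(1) by (meson DERIV_isCont continuous_at_imp_continuous_on has_vector_derivative_continuous)+
  have c: "continuous_on UNIV (\<lambda>(s,t). b t *\<^sub>R v s)" "continuous_on UNIV (\<lambda>(s,t). b s *\<^sub>R v t)"
    if "continuous_on UNIV b" "continuous_on UNIV v" for b :: "real \<Rightarrow> real" and v :: "real \<Rightarrow> r3"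
    unfolding case_prod_beta using that
    by (auto intro!: continuous_intros continuous_on_compose2[OF that(1)] continuous_on_compose2[OF that(2)])
  have dl: "((\<lambda>t. a t *\<^sub>R w) has_vector_derivative a' t *\<^sub>R w) (at t)" for t and w :: r3
    using has_vector_derivative_scaleR[OF a(1) has_vector_derivative_const] by simp
  have dr: "((\<lambda>s. b *\<^sub>R u s) has_vector_derivative b *\<^sub>R u' s) (at s)" for s b
    using bounded_linear.has_vector_derivative[OF bounded_linear_scaleR_right u(1)] .
  show "torus_map (\<lambda>s t. a t *\<^sub>R u s)" unfolding torus_map_def
    apply (rule exI[of _ "\<lambda>s t. a t *\<^sub>R u' s"], rule exI[of _ "\<lambda>s t. a' t *\<^sub>R u s"],
        rule exI[of _ "\<lambda>s t. a' t *\<^sub>R u' s"])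
    using c ac uc a u dl dr by auto
  show "torus_map (\<lambda>s t. a s *\<^sub>R u t)" unfolding torus_map_def
    apply (rule exI[of _ "\<lambda>s t. a' s *\<^sub>R u t"], rule exI[of _ "\<lambda>s t. a s *\<^sub>R u' t"],
        rule exI[of _ "\<lambda>s t. a' s *\<^sub>R u' t"])
    using c ac uc a u dl dr by auto
qed


text \<open>Closedness of the solid angle form along a homotopy with velocity \<open>g\<close>. In
  the sum of the three numerators all terms containing second derivatives or derivatives of
  \<open>g\<close> cancel by antisymmetry, and 3 \<open>det3 g Fs Ft\<close> remains; Cramer's rule
  matches it with the terms over \<open>norm F ^ 5\<close>.\<close>

lemma straight_line_identity:
  fixes F :: r3
  assumes "F \<noteq> 0"
  shows "(det3 g Fs Ft + det3 F gs Ft + det3 F Fs gt) / norm F ^ 3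
     - 3 * (F \<bullet> g) * det3 F Fs Ft / norm F ^ 5 =
    - ((det3 Fs Ft g + det3 F Fst g + det3 F Ft gs) / norm F ^ 3
     - 3 * (F \<bullet> Fs) * det3 F Ft g / norm F ^ 5)
    - ((det3 Ft g Fs + det3 F gt Fs + det3 F g Fst) / norm F ^ 3
     - 3 * (F \<bullet> Ft) * det3 F g Fs / norm F ^ 5)"
proof -
  have n: "norm F \<noteq> 0" using assms by simp
  have "norm F ^ 2 * (det3 g Fs Ft + det3 F gs Ft + det3 F Fs gt + (det3 Fs Ft g + det3 F Fst g + det3 F Ft gs)
      + (det3 Ft g Fs + det3 F gt Fs + det3 F g Fst)) = 3 * ((F \<bullet> F) * det3 g Fs Ft)"
    unfolding power2_norm_eq_inner det3_def by (simp add: algebra_simps)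
  also have "\<dots> = 3 * ((F \<bullet> g) * det3 F Fs Ft + (F \<bullet> Fs) * det3 F Ft g + (F \<bullet> Ft) * det3 F g Fs)"
    by (simp only: det3_cyclic_inner[of F g Fs Ft])
  finally have e: "norm F ^ 2 * (det3 g Fs Ft + det3 F gs Ft + det3 F Fs gt + (det3 Fs Ft g + det3 F Fst g + det3 F Ft gs)
      + (det3 Ft g Fs + det3 F gt Fs + det3 F g Fst)) =
      3 * ((F \<bullet> g) * det3 F Fs Ft + (F \<bullet> Fs) * det3 F Ft g + (F \<bullet> Ft) * det3 F g Fs)" .
  have *: "a / N ^ 3 - 3 * i * d / N ^ 5 = - (b / N ^ 3 - 3 * i2 * d2 / N ^ 5) - (c / N ^ 3 - 3 * i3 * d3 / N ^ 5)"
    if "N ^ 2 * (a + b + c) = 3 * (i * d + i2 * d2 + i3 * d3)" "N \<noteq> 0" for a b c i d i2 d2 i3 d3 N :: real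
  proof -
    have "(a + b + c) / N ^ 3 = N ^ 2 * (a + b + c) / N ^ 5"
      using that(2) by (simp add: field_simps eval_nat_numeral)
    also have "\<dots> = 3 * i * d / N ^ 5 + 3 * i2 * d2 / N ^ 5 + 3 * i3 * d3 / N ^ 5"
      using that(1) by (simp add: add_divide_distrib algebra_simps)
    finally show ?thesis by (simp add: add_divide_distrib)
  qed
  show ?thesis by (rule *[OF e n])
qed

lemma continuous_on_det3 [continuous_intros]:
  assumes "continuous_on S u" "continuous_on S v" "continuous_on S w"
  shows "continuous_on S (\<lambda>x. det3 (u x) (v x) (w x))"
  unfolding det3_def using assms by (intro continuous_intros)

lemma torus_degree_straight_line:
  assumes "torus_map f" "torus_map g"
    and nz: "\<And>\<tau> s t. 0 \<le> \<tau> \<Longrightarrow> \<tau> \<le> 1 \<Longrightarrow> (1 - \<tau>) *\<^sub>R f s t + \<tau> *\<^sub>R g s t \<noteq> 0"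
  shows "torus_degree g = torus_degree f"
proof -
  obtain fs ft fst' where f: "\<And>s t. ((\<lambda>s. f s t) has_vector_derivative fs s t) (at s)"
            "\<And>s t. ((\<lambda>t. f s t) has_vector_derivative ft s t) (at t)"
            "\<And>s t. ((\<lambda>t. fs s t) has_vector_derivative fst' s t) (at t)"
            "\<And>s t. ((\<lambda>s. ft s t) has_vector_derivative fst' s t) (at s)"
            "\<And>s t. f (s + 1) t = f s t" "\<And>s t. f s (t + 1) = f s t"
     "continuous_on UNIV (\<lambda>(s,t). f s t)" "continuous_on UNIV (\<lambda>(s,t). fs s t)"
     "continuous_on UNIV (\<lambda>(s,t). ft s t)" "continuous_on UNIV (\<lambda>(s,t). fst' s t)"
    using assms(1) unfolding torus_map_def by blast
  obtain gs gt gst where g: "\<And>s t. ((\<lambda>s. g s t) has_vector_derivative gs s t) (at s)"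
            "\<And>s t. ((\<lambda>t. g s t) has_vector_derivative gt s t) (at t)"
            "\<And>s t. ((\<lambda>t. gs s t) has_vector_derivative gst s t) (at t)"
            "\<And>s t. ((\<lambda>s. gt s t) has_vector_derivative gst s t) (at s)"
            "\<And>s t. g (s + 1) t = g s t" "\<And>s t. g s (t + 1) = g s t"
     "continuous_on UNIV (\<lambda>(s,t). g s t)" "continuous_on UNIV (\<lambda>(s,t). gs s t)"
     "continuous_on UNIV (\<lambda>(s,t). gt s t)" "continuous_on UNIV (\<lambda>(s,t). gst s t)"
    using assms(2) unfolding torus_map_def by blast
  \<comment> \<open>The partial derivatives inherit both periods; the equality of \<open>A\<close>
    and \<open>B\<close> on opposite sides of the square depends on it.\<close>
  have ps: "fs (s+1) t = fs s t" "ft (s+1) t = ft s t" "fs s (t+1) = fs s t" "ft s (t+1) = ft s t"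
    if d: "\<And>s t. ((\<lambda>s. f s t) has_vector_derivative fs s t) (at s)"
          "\<And>s t. ((\<lambda>t. f s t) has_vector_derivative ft s t) (at t)"
          "\<And>s t. f (s + 1) t = f s t" "\<And>s t. f s (t + 1) = f s t"
    for f fs ft :: "real \<Rightarrow> real \<Rightarrow> r3" and s t
  proof -
    have *: "h' (s+1) = h' s" if "\<And>s. (h has_vector_derivative h' s) (at s)" "\<And>s. h (s+1) = h s"
      for h h' :: "real \<Rightarrow> r3" and s
    proof -
      have "((h \<circ> (\<lambda>s. s + 1)) has_vector_derivative 1 *\<^sub>R h' (s+1)) (at s)"
        by (rule vector_diff_chain_at) (auto intro!: derivative_eq_intros that(1))
      moreover have "h \<circ> (\<lambda>s. s + 1) = h" using that(2) by auto
      ultimately show ?thesis using that(1) vector_derivative_unique_at by fastforce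
    qed
    show "fs (s+1) t = fs s t" "ft s (t+1) = ft s t" using *[OF d(1)] *[OF d(2)] d by auto
    have "(\<lambda>t. f (s+1) t) = (\<lambda>t. f s t)" "(\<lambda>s. f s (t+1)) = (\<lambda>s. f s t)" using d by auto
    then show "ft (s+1) t = ft s t" "fs s (t+1) = fs s t"
      using d(1,2) vector_derivative_unique_at by metis+
  qed
  define F where "F \<tau> s t = (1 - \<tau>) *\<^sub>R f s t + \<tau> *\<^sub>R g s t" for \<tau> s t
  define Fs where "Fs \<tau> s t = (1 - \<tau>) *\<^sub>R fs s t + \<tau> *\<^sub>R gs s t" for \<tau> s t
  define Ft where "Ft \<tau> s t = (1 - \<tau>) *\<^sub>R ft s t + \<tau> *\<^sub>R gt s t" for \<tau> s t
  define Fst where "Fst \<tau> s t = (1 - \<tau>) *\<^sub>R fst' s t + \<tau> *\<^sub>R gst s t" for \<tau> s t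
  define k where "k s t = g s t - f s t" for s t
  define ks where "ks s t = gs s t - fs s t" for s t
  define kt where "kt s t = gt s t - ft s t" for s t
  have vc: "((\<lambda>x. (1 - \<tau>) *\<^sub>R u x + \<tau> *\<^sub>R v x) has_vector_derivative (1 - \<tau>) *\<^sub>R u' + \<tau> *\<^sub>R v') (at x)"
    if "(u has_vector_derivative u') (at x)" "(v has_vector_derivative v') (at x)"
    for u v :: "real \<Rightarrow> r3" and u' v' \<tau> x
    by (intro has_vector_derivative_add bounded_linear.has_vector_derivative[OF bounded_linear_scaleR_right] that)
  have vt: "((\<lambda>\<tau>. (1 - \<tau>) *\<^sub>R u + \<tau> *\<^sub>R v) has_vector_derivative v - u) (at \<tau>)" for u v :: r3 and \<tau>
    by (auto intro!: derivative_eq_intros simp: algebra_simps)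
  have D: "((\<lambda>s. F \<tau> s t) has_vector_derivative Fs \<tau> s t) (at s)"
    "((\<lambda>t. F \<tau> s t) has_vector_derivative Ft \<tau> s t) (at t)"
    "((\<lambda>t. Fs \<tau> s t) has_vector_derivative Fst \<tau> s t) (at t)"
    "((\<lambda>s. Ft \<tau> s t) has_vector_derivative Fst \<tau> s t) (at s)"
    "((\<lambda>s. k s t) has_vector_derivative ks s t) (at s)"
    "((\<lambda>t. k s t) has_vector_derivative kt s t) (at t)" for \<tau> s t
    unfolding F_def Fs_def Ft_def Fst_def k_def ks_def kt_def
    by (intro vc has_vector_derivative_diff f g)+
  have T: "((\<lambda>\<tau>. F \<tau> s t) has_vector_derivative k s t) (at \<tau>)"
    "((\<lambda>\<tau>. Fs \<tau> s t) has_vector_derivative ks s t) (at \<tau>)"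
    "((\<lambda>\<tau>. Ft \<tau> s t) has_vector_derivative kt s t) (at \<tau>)" for \<tau> s t
    unfolding F_def Fs_def Ft_def k_def ks_def kt_def by (rule vt)+
  \<comment> \<open>\<open>P\<close> and \<open>Q\<close> are the derivatives in s and t of
    \<open>A\<close> and \<open>B\<close> below, which are the solid angle form contracted with the
    velocity \<open>k\<close> of the homotopy.\<close>
  define P where "P \<tau> s t = - ((det3 (Fs \<tau> s t) (Ft \<tau> s t) (k s t) + det3 (F \<tau> s t) (Fst \<tau> s t) (k s t) + det3 (F \<tau> s t) (Ft \<tau> s t) (ks s t)) / norm (F \<tau> s t) ^ 3
     - 3 * (F \<tau> s t \<bullet> Fs \<tau> s t) * det3 (F \<tau> s t) (Ft \<tau> s t) (k s t) / norm (F \<tau> s t) ^ 5)" for \<tau> s t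
  define Q where "Q \<tau> s t = - ((det3 (Ft \<tau> s t) (k s t) (Fs \<tau> s t) + det3 (F \<tau> s t) (kt s t) (Fs \<tau> s t) + det3 (F \<tau> s t) (k s t) (Fst \<tau> s t)) / norm (F \<tau> s t) ^ 3
     - 3 * (F \<tau> s t \<bullet> Ft \<tau> s t) * det3 (F \<tau> s t) (k s t) (Fs \<tau> s t) / norm (F \<tau> s t) ^ 5)" for \<tau> s t
  define E where "E \<tau> s t = det3 (F \<tau> s t) (Fs \<tau> s t) (Ft \<tau> s t) / norm (F \<tau> s t) ^ 3" for \<tau> s t
  define A where "A \<tau> s t = - (det3 (F \<tau> s t) (Ft \<tau> s t) (k s t) / norm (F \<tau> s t) ^ 3)" for \<tau> s t
  define B where "B \<tau> s t = - (det3 (F \<tau> s t) (k s t) (Fs \<tau> s t) / norm (F \<tau> s t) ^ 3)" for \<tau> s t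
  have Fnz: "F \<tau> s t \<noteq> 0" if "0 \<le> \<tau>" "\<tau> \<le> 1" for \<tau> s t using nz[OF that] by (simp add: F_def)
  have cf: "continuous_on X (\<lambda>(\<tau>,s,t). h s t)" if "continuous_on UNIV (\<lambda>(s,t). h s t)"
    for h :: "real \<Rightarrow> real \<Rightarrow> r3" and X :: "(real \<times> real \<times> real) set"
  proof -
    have "continuous_on X (\<lambda>x. (\<lambda>(s,t). h s t) (snd x))"
      by (rule continuous_on_compose2[OF that]) (auto intro!: continuous_intros)
    then show ?thesis by (simp add: case_prod_beta)
  qed
  have CC: "continuous_on X (\<lambda>(\<tau>,s,t). F \<tau> s t)" "continuous_on X (\<lambda>(\<tau>,s,t). Fs \<tau> s t)"
     "continuous_on X (\<lambda>(\<tau>,s,t). Ft \<tau> s t)" "continuous_on X (\<lambda>(\<tau>,s,t). Fst \<tau> s t)"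
     "continuous_on X (\<lambda>(\<tau>,s,t). k s t)" "continuous_on X (\<lambda>(\<tau>,s,t). ks s t)" "continuous_on X (\<lambda>(\<tau>,s,t). kt s t)"
     for X
    unfolding F_def Fs_def Ft_def Fst_def k_def ks_def kt_def case_prod_beta
    by (intro continuous_intros cf[unfolded case_prod_beta] f(7-10)[unfolded case_prod_beta] g(7-10)[unfolded case_prod_beta])+
  note CC = CC[unfolded case_prod_beta]
  have "integral {0..1} (\<lambda>s. integral {0..1} (\<lambda>t. E 1 s t)) =
        integral {0..1} (\<lambda>s. integral {0..1} (\<lambda>t. E 0 s t))"
  proof (rule integral_flux_invariant[of P Q E A B])
    show "continuous_on ({0..1} \<times> UNIV \<times> UNIV) (\<lambda>(\<tau>,s,t). P \<tau> s t)"
      unfolding P_def case_prod_beta by (intro continuous_intros CC) (auto simp: Fnz)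
    show "continuous_on ({0..1} \<times> UNIV \<times> UNIV) (\<lambda>(\<tau>,s,t). Q \<tau> s t)"
      unfolding Q_def case_prod_beta by (intro continuous_intros CC) (auto simp: Fnz)
    show "continuous_on ({0..1} \<times> UNIV \<times> UNIV) (\<lambda>(\<tau>,s,t). E \<tau> s t)"
      unfolding E_def case_prod_beta by (intro continuous_intros CC) (auto simp: Fnz)
    fix \<tau> s t :: real assume \<tau>: "0 \<le> \<tau>" "\<tau> \<le> 1"
    have "P \<tau> s t + Q \<tau> s t = (det3 (k s t) (Fs \<tau> s t) (Ft \<tau> s t) + det3 (F \<tau> s t) (ks s t) (Ft \<tau> s t) + det3 (F \<tau> s t) (Fs \<tau> s t) (kt s t)) / norm (F \<tau> s t) ^ 3
      - 3 * (F \<tau> s t \<bullet> k s t) * det3 (F \<tau> s t) (Fs \<tau> s t) (Ft \<tau> s t) / norm (F \<tau> s t) ^ 5"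
      unfolding P_def Q_def
      by (subst straight_line_identity[OF Fnz[OF \<tau>], where g = "k s t" and Fs = "Fs \<tau> s t" and Ft = "Ft \<tau> s t"
          and gs = "ks s t" and gt = "kt s t" and Fst = "Fst \<tau> s t"]) simp
    then show "((\<lambda>\<tau>. E \<tau> s t) has_real_derivative P \<tau> s t + Q \<tau> s t) (at \<tau>)"
      unfolding E_def by (intro DERIV_cong[OF omega_has_derivative[OF T Fnz[OF \<tau>]]]) simp
    show "((\<lambda>s. A \<tau> s t) has_real_derivative P \<tau> s t) (at s)"
      unfolding A_def P_def by (intro DERIV_minus omega_has_derivative D Fnz \<tau>)
    show "((\<lambda>t. B \<tau> s t) has_real_derivative Q \<tau> s t) (at t)"
      unfolding B_def Q_def by (intro DERIV_minus omega_has_derivative D Fnz \<tau>)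
    show "A \<tau> 1 t = A \<tau> 0 t"
      using ps[OF f(1,2,5,6), of 0] ps[OF g(1,2,5,6), of 0] f(5)[of 0] g(5)[of 0]
      by (simp add: A_def F_def Ft_def k_def)
    show "B \<tau> s 1 = B \<tau> s 0"
      using ps[OF f(1,2,5,6), of _ 0] ps[OF g(1,2,5,6), of _ 0] f(6)[of _ 0] g(6)[of _ 0]
      by (simp add: B_def F_def Fs_def k_def)
  qed
  then show ?thesis
    unfolding torus_degree_def E_def F_def Fs_def Ft_def
    by (simp add: vector_derivative_at[OF f(1)] vector_derivative_at[OF f(2)] vector_derivative_at[OF g(1)]
       vector_derivative_at[OF g(2)])
qed

text \<open>Continuity in \<tau> is enough: on a fine subdivision consecutive maps differ by less
  than their distance from the origin, so the segment between them misses it and the differentiable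
  case applies.\<close>

lemma torus_degree_homotopy:
  fixes f :: "real \<Rightarrow> real \<Rightarrow> real \<Rightarrow> r3"
  assumes tm: "\<And>\<tau>. 0 \<le> \<tau> \<Longrightarrow> \<tau> \<le> 1 \<Longrightarrow> torus_map (f \<tau>)"
    and cont: "continuous_on ({0..1} \<times> UNIV \<times> UNIV) (\<lambda>(\<tau>,s,t). f \<tau> s t)"
    and nz: "\<And>\<tau> s t. 0 \<le> \<tau> \<Longrightarrow> \<tau> \<le> 1 \<Longrightarrow> f \<tau> s t \<noteq> 0"
  shows "torus_degree (f 1) = torus_degree (f 0)"
proof -
  let ?K = "{0..1::real} \<times> {0..1::real} \<times> {0..1::real}"
  have K: "compact ?K" by (intro compact_Times) auto
  have cK: "continuous_on ?K (\<lambda>(\<tau>,s,t). f \<tau> s t)" by (rule continuous_on_subset[OF cont]) auto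
  \<comment> \<open>Periodicity moves every point into the unit cube, where compactness provides the
    lower bound \<open>m\<close> and uniform continuity.\<close>
  have per: "f \<tau> s t = f \<tau> (frac s) (frac t)" if "0 \<le> \<tau>" "\<tau> \<le> 1" for \<tau> s t
  proof -
    have p: "f \<tau> (s + 1) t = f \<tau> s t" "f \<tau> s (t + 1) = f \<tau> s t" for s t
      using tm[OF that] unfolding torus_map_def by blast+
    have pn: "h (x + of_int n) = h x" if "\<And>x. h (x + 1) = h x" for h :: "real \<Rightarrow> r3" and x n
    proof (induction n rule: int_induct[of _ 0])
      case (step1 i) then show ?case using that[of "x + of_int i"] by (simp add: add.assoc)
    next
      case (step2 i) then show ?case using that[of "x + of_int (i - 1)"] by (simp add: algebra_simps)
    qed auto
    have "f \<tau> (frac s) (frac t) = f \<tau> (frac s + of_int \<lfloor>s\<rfloor>) (frac t)"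
      by (rule pn[symmetric, of "\<lambda>s. f \<tau> s (frac t)"]) (rule p)
    also have "\<dots> = f \<tau> (frac s + of_int \<lfloor>s\<rfloor>) (frac t + of_int \<lfloor>t\<rfloor>)"
      by (rule pn[symmetric, of "f \<tau> (frac s + of_int \<lfloor>s\<rfloor>)"]) (rule p)
    finally show ?thesis by (simp add: frac_def)
  qed
  obtain m where m: "m > 0" "\<And>\<tau> s t. (\<tau>,s,t) \<in> ?K \<Longrightarrow> m \<le> norm (f \<tau> s t)"
  proof -
    have "continuous_on ?K (\<lambda>x. norm ((\<lambda>(\<tau>,s,t). f \<tau> s t) x))" using cK by (rule continuous_on_norm)
    from continuous_attains_inf[OF K _ this]
    obtain x where x: "x \<in> ?K" "\<forall>y\<in>?K. norm ((\<lambda>(\<tau>,s,t). f \<tau> s t) x) \<le> norm ((\<lambda>(\<tau>,s,t). f \<tau> s t) y)" by auto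
    show ?thesis by (rule that[of "norm ((\<lambda>(\<tau>,s,t). f \<tau> s t) x)"]) (use x nz in \<open>auto simp: case_prod_beta\<close>)
  qed
  obtain d where d: "d > 0" "\<And>x x'. x \<in> ?K \<Longrightarrow> x' \<in> ?K \<Longrightarrow> dist x' x < d \<Longrightarrow>
      dist ((\<lambda>(\<tau>,s,t). f \<tau> s t) x') ((\<lambda>(\<tau>,s,t). f \<tau> s t) x) < m"
    using compact_uniformly_continuous[OF cK K] m(1) unfolding uniformly_continuous_on_def by blast
  have close: "norm (f \<tau> s t - f \<tau>' s t) < norm (f \<tau>' s t)"
    if "\<bar>\<tau> - \<tau>'\<bar> < d" "0 \<le> \<tau>" "\<tau> \<le> 1" "0 \<le> \<tau>'" "\<tau>' \<le> 1" for \<tau> \<tau>' s t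
  proof -
    have fr: "0 \<le> frac u \<and> frac u \<le> 1" for u :: real using frac_lt_1[of u] by simp
    have "dist (f \<tau> (frac s) (frac t)) (f \<tau>' (frac s) (frac t)) < m"
      using d(2)[of "(\<tau>', frac s, frac t)" "(\<tau>, frac s, frac t)"] that fr
      by (auto simp: dist_Pair_Pair dist_real_def)
    also have "m \<le> norm (f \<tau>' (frac s) (frac t))" using m(2) that fr by auto
    finally show ?thesis
      by (simp only: dist_norm per[OF that(2,3), of s t] per[OF that(4,5), of s t])
  qed
  obtain N :: nat where N: "N > 0" "1 / real N < d"
    using reals_Archimedean[OF d(1)] by (metis inverse_eq_divide zero_less_Suc)
  have "torus_degree (f (real i / real N)) = torus_degree (f 0)" if "i \<le> N" for i
    using that
  proof (induction i)
    case (Suc i)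
    let ?a = "real i / real N" and ?b = "real (Suc i) / real N"
    have "?b - ?a = 1 / real N" by (simp add: diff_divide_distrib[symmetric])
    then have "\<bar>?b - ?a\<bar> < d" using N by simp
    then have ab: "0 \<le> ?a" "?a \<le> 1" "0 \<le> ?b" "?b \<le> 1" "\<bar>?b - ?a\<bar> < d"
      using Suc.prems N(1) by simp_all
    have "torus_degree (f ?b) = torus_degree (f ?a)"
    proof (rule torus_degree_straight_line[OF tm tm])
      fix \<tau> s t :: real assume \<tau>: "0 \<le> \<tau>" "\<tau> \<le> 1"
      show "(1 - \<tau>) *\<^sub>R f ?a s t + \<tau> *\<^sub>R f ?b s t \<noteq> 0"
      proof
        assume "(1 - \<tau>) *\<^sub>R f ?a s t + \<tau> *\<^sub>R f ?b s t = 0"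
        then have "f ?a s t = - (\<tau> *\<^sub>R (f ?b s t - f ?a s t))" by (simp add: algebra_simps)
        then have "norm (f ?a s t) = norm (- (\<tau> *\<^sub>R (f ?b s t - f ?a s t)))" by (rule arg_cong)
        also have "\<dots> = \<tau> * norm (f ?b s t - f ?a s t)" using \<tau> by simp
        also have "\<dots> \<le> 1 * norm (f ?b s t - f ?a s t)" by (rule mult_right_mono) (use \<tau> in auto)
        finally show False using close[OF ab(5,3,4,1,2), of s t] by simp
      qed
    qed (use ab in auto)
    then show ?case using Suc by simp
  qed simp
  from this[of N] show ?thesis using N by simp
qed

section \<open>Antiderivatives and continuous arguments\<close>

lemma has_integral_DERIV:
  fixes f :: "real \<Rightarrow> real"
  assumes "\<And>x. (f has_real_derivative f' x) (at x)" "a \<le> b"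
  shows "(f' has_integral (f b - f a)) {a..b}"
proof (rule fundamental_theorem_of_calculus)
  fix x assume "x \<in> {a..b}"
  show "(f has_vector_derivative f' x) (at x within {a..b})"
    using assms(1)[of x] unfolding has_real_derivative_iff_has_vector_derivative
    by (rule has_vector_derivative_at_within)
qed (rule assms)

lemma continuous_antiderivative:
  fixes g :: "real \<Rightarrow> real"
  assumes "continuous_on UNIV g"
  obtains G where "\<And>x. (G has_real_derivative g x) (at x)" "G 0 = a"
proof -
  define G where "G x = a + (LBINT y=ereal 0..x. g y)" for x :: real
  have "(G has_real_derivative g x) (at x)" for x
  proof -
    let ?l = "- \<bar>x\<bar> - 1" and ?u = "\<bar>x\<bar> + 1"
    have "((\<lambda>u. LBINT y=ereal 0..u. g y) has_vector_derivative g x) (at x within {?l..?u})"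
      by (rule interval_integral_FTC2) (auto intro: continuous_on_subset[OF assms])
    moreover have "at x within {?l..?u} = at x"
      by (rule at_within_interior) (auto simp: interior_atLeastAtMost_real)
    ultimately show ?thesis unfolding G_def has_real_derivative_iff_has_vector_derivative
      by (auto intro!: derivative_eq_intros)
  qed
  moreover have "G 0 = a" by (simp add: G_def zero_ereal_def)
  ultimately show ?thesis using that by blast
qed

text \<open>A logarithm of w is obtained by integrating w'/w rather than by lifting to a covering,
  so the derivative of the argument is known explicitly.\<close>

lemma polar_lift:
  fixes w w' :: "real \<Rightarrow> complex"
  assumes w: "\<And>t. (w has_vector_derivative w' t) (at t)" "continuous_on UNIV w'" "\<And>t. w t \<noteq> 0"
  obtains \<theta> where "\<And>t. (\<theta> has_real_derivative Im (w' t / w t)) (at t)"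
    "\<And>t. w t = of_real (norm (w t)) * cis (\<theta> t)" "continuous_on UNIV (\<lambda>t. Im (w' t / w t))" "\<theta> 0 = Arg (w 0)"
proof -
  have wc: "continuous_on UNIV w"
    using w(1) by (meson continuous_at_imp_continuous_on has_vector_derivative_continuous)
  have c: "continuous_on UNIV (\<lambda>t. Re (w' t / w t))" "continuous_on UNIV (\<lambda>t. Im (w' t / w t))"
    using w wc by (auto intro!: continuous_intros)
  obtain L where L: "\<And>x. (L has_real_derivative Re (w' x / w x)) (at x)" "L 0 = ln (norm (w 0))"
    using continuous_antiderivative[OF c(1)] by blast
  obtain \<theta> where T: "\<And>x. (\<theta> has_real_derivative Im (w' x / w x)) (at x)" "\<theta> 0 = Arg (w 0)"
    using continuous_antiderivative[OF c(2)] by blast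
  \<comment> \<open>The quotient of w by the candidate exponential has derivative 0 and starts at
    1.\<close>
  define u where "u t = w t * exp (- Complex (L t) (\<theta> t))" for t
  have "(u has_vector_derivative 0) (at t)" for t
  proof -
    have "((\<lambda>t. - Complex (L t) (\<theta> t)) has_vector_derivative - (w' t / w t)) (at t)"
    proof -
      have "((\<lambda>t. of_real (L t) + \<i> * of_real (\<theta> t)) has_vector_derivative
          of_real (Re (w' t / w t)) + \<i> * of_real (Im (w' t / w t))) (at t)"
        using L(1)[of t] T(1)[of t] by (auto intro!: derivative_eq_intros simp: has_real_derivative_iff_has_vector_derivative)
      then show ?thesis
        by (intro has_vector_derivative_minus) (simp add: Complex_eq complex_eq_iff flip: complex_eq)
    qed
    then have "((exp \<circ> (\<lambda>t. - Complex (L t) (\<theta> t))) has_vector_derivative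
        - (w' t / w t) * exp (- Complex (L t) (\<theta> t))) (at t)"
      by (rule field_vector_diff_chain_at) (rule DERIV_exp)
    from has_vector_derivative_mult[OF w(1)[of t] this]
    show ?thesis using w(3)[of t] unfolding u_def[abs_def] by (simp add: o_def)
  qed
  then obtain k where "\<And>t. t \<in> UNIV \<Longrightarrow> u t = k"
    using has_vector_derivative_zero_constant[of UNIV u] by auto
  then have "u t = u 0" for t by simp
  moreover have "u 0 = 1"
  proof -
    have "Complex (L 0) (\<theta> 0) = Ln (w 0)"
      unfolding L(2) T(2) using w(3)[of 0] by (simp add: complex_eq_iff Arg_eq_Im_Ln)
    then show ?thesis unfolding u_def using w(3)[of 0] by (simp add: exp_minus)
  qed
  ultimately have ut: "u t = 1" for t by simp
  have polar: "w t = of_real (exp (L t)) * cis (\<theta> t)" for t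
  proof -
    have "w t = exp (Complex (L t) (\<theta> t))"
      using ut[of t] unfolding u_def by (simp add: exp_minus field_simps)
    then show ?thesis by (simp add: exp_eq_polar)
  qed
  have "w t = of_real (norm (w t)) * cis (\<theta> t)" for t
  proof -
    have "norm (w t) = exp (L t)" by (subst polar) (simp add: norm_mult)
    then show ?thesis using polar[of t] by simp
  qed
  then show ?thesis using that T c by blast
qed

section \<open>A model torus map of known degree, built from squares of positive parts\<close>

lemma DERIV_max0_sq: "((\<lambda>x. (max 0 x)\<^sup>2) has_real_derivative 2 * max 0 x) (at (x::real))"
proof (cases "x = 0")
  case False
  consider "x > 0" | "x < 0" using False by linarith
  then show ?thesis
  proof cases
    case 1
    have "((\<lambda>x. x\<^sup>2) has_real_derivative 2 * max 0 x) (at x)" using 1 by (auto intro!: derivative_eq_intros)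
    then show ?thesis
      by (rule has_field_derivative_transform_within_open[of _ _ _ "{0<..}"]) (use 1 in auto)
  next
    case 2
    have "((\<lambda>x. 0) has_real_derivative 2 * max 0 x) (at x)" using 2 by (auto intro!: derivative_eq_intros)
    then show ?thesis
      by (rule has_field_derivative_transform_within_open[of _ _ _ "{..<0}"]) (use 2 in auto)
  qed
next
  case True
  have "((\<lambda>h. (max 0 h)\<^sup>2 / h) \<longlongrightarrow> 0) (at (0::real))"
  proof (rule tendsto_0_le[where K = 1])
    show "((\<lambda>h. h) \<longlongrightarrow> 0) (at (0::real))" by (rule tendsto_ident_at)
    show "\<forall>\<^sub>F h in at (0::real). norm ((max 0 h)\<^sup>2 / h) \<le> norm h * 1"
      by (rule always_eventually) (auto simp: max_def power2_eq_square)
  qed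
  then show ?thesis unfolding True by (simp add: DERIV_def)
qed

text \<open>While cos x \<le> 0, radius and height trace a unit half circle, because sin^2 (1 +
  cos^2) + cos^4 = 1. While cos x \<ge> 0, the radius is 0. Squaring the positive parts keeps both
  regimes C^1 across the transition.\<close>

definition model_radius :: "real \<Rightarrow> real" where "model_radius x = (max 0 (- cos x))\<^sup>2"
definition model_cutoff :: "real \<Rightarrow> real" where "model_cutoff x = (max 0 (cos x))\<^sup>2"
definition model_height :: "real \<Rightarrow> real" where "model_height x = - sin x * sqrt (1 + (cos x)\<^sup>2)"

lemma model_derivatives:
  "(model_radius has_real_derivative 2 * max 0 (- cos x) * sin x) (at x)"
  "(model_cutoff has_real_derivative - (2 * max 0 (cos x) * sin x)) (at x)"
  "(model_height has_real_derivative - 2 * cos x ^ 3 / sqrt (1 + (cos x)\<^sup>2)) (at x)"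
proof -
  show "(model_radius has_real_derivative 2 * max 0 (- cos x) * sin x) (at x)"
    unfolding model_radius_def[abs_def]
    by (rule DERIV_chain2[OF DERIV_max0_sq]) (auto intro!: derivative_eq_intros)
  show "(model_cutoff has_real_derivative - (2 * max 0 (cos x) * sin x)) (at x)"
    unfolding model_cutoff_def[abs_def]
    by (rule DERIV_cong[OF DERIV_chain2[OF DERIV_max0_sq DERIV_cos]]) auto
  have p: "1 + (cos x)\<^sup>2 > 0" by (simp add: add_pos_nonneg)
  have s: "(sin x)\<^sup>2 = 1 - (cos x)\<^sup>2" by (simp add: sin_squared_eq)
  have "(model_height has_real_derivative
      - cos x * sqrt (1 + (cos x)\<^sup>2) + (sin x)\<^sup>2 * cos x / sqrt (1 + (cos x)\<^sup>2)) (at x)"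
    unfolding model_height_def[abs_def]
    by (rule DERIV_cong[OF DERIV_mult[OF DERIV_minus[OF DERIV_sin] DERIV_chain2[OF DERIV_real_sqrt[OF p]
          DERIV_add[OF DERIV_const DERIV_power[OF DERIV_cos]]]]])
       (simp add: field_simps power2_eq_square)
  moreover have "- cos x * sqrt (1 + (cos x)\<^sup>2) + (sin x)\<^sup>2 * cos x / sqrt (1 + (cos x)\<^sup>2) =
     - 2 * cos x ^ 3 / sqrt (1 + (cos x)\<^sup>2)"
  proof -
    have "sqrt (1 + (cos x)\<^sup>2) = (1 + (cos x)\<^sup>2) / sqrt (1 + (cos x)\<^sup>2)" using p by (simp add: real_div_sqrt)
    then have "- cos x * sqrt (1 + (cos x)\<^sup>2) + (sin x)\<^sup>2 * cos x / sqrt (1 + (cos x)\<^sup>2) =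
      (- cos x * (1 + (cos x)\<^sup>2) + (sin x)\<^sup>2 * cos x) / sqrt (1 + (cos x)\<^sup>2)"
      by (metis (no_types, opaque_lifting) add_divide_distrib times_divide_eq_right)
    also have "- cos x * (1 + (cos x)\<^sup>2) + (sin x)\<^sup>2 * cos x = - 2 * cos x ^ 3"
      unfolding s by (simp add: algebra_simps power2_eq_square power3_eq_cube)
    finally show ?thesis .
  qed
  ultimately show "(model_height has_real_derivative - 2 * cos x ^ 3 / sqrt (1 + (cos x)\<^sup>2)) (at x)" by simp
qed

text \<open>Where cos x < 0, the density is the derivative of \<open>model_height\<close>, which
  rises from -1 to 1 on that half period; elsewhere the density is 0. Hence the increment 2 per
  period.\<close>

lemma model_density_antiderivative:
  obtains G where "\<And>x. (G has_real_derivative 2 * max 0 (- cos x) ^ 3 / sqrt (1 + (cos x)\<^sup>2)) (at x)"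
    "\<And>x n. G (x + 2 * pi * of_int n) = G x + 2 * of_int n"
proof -
  let ?g = "\<lambda>x. 2 * max 0 (- cos x) ^ 3 / sqrt (1 + (cos x)\<^sup>2)"
  have p: "1 + (cos x)\<^sup>2 > 0" for x :: real by (simp add: add_pos_nonneg)
  then have nz: "1 + (cos x)\<^sup>2 \<noteq> 0" for x :: real by (metis less_irrefl)
  have "continuous_on UNIV ?g" by (intro continuous_intros) (use nz in auto)
  then obtain G where G: "\<And>x. (G has_real_derivative ?g x) (at x)" "G 0 = 0"
    using continuous_antiderivative by blast
  have const: "H b = H a" if "a \<le> b" "\<And>x. a \<le> x \<Longrightarrow> x \<le> b \<Longrightarrow> (H has_real_derivative 0) (at x)"
    for H :: "real \<Rightarrow> real" and a b
  proof -
    have "\<exists>c. \<forall>x\<in>{a..b}. H x = c"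
    proof (rule has_field_derivative_zero_constant)
      fix x assume "x \<in> {a..b}"
      then show "(H has_real_derivative 0) (at x within {a..b})"
        by (intro has_field_derivative_at_within[OF that(2)]) auto
    qed simp
    then show ?thesis using that(1) by auto
  qed
  have g0: "?g x = 0" if "0 \<le> cos x" for x using that by simp
  have "G (pi/2) = G 0"
  proof (rule const[of 0 "pi/2" G])
    fix x :: real assume "0 \<le> x" "x \<le> pi/2"
    then have "cos x \<ge> 0" by (intro cos_ge_zero) auto
    then show "(G has_real_derivative 0) (at x)" by (intro DERIV_cong[OF G(1) g0])
  qed (use pi_gt_zero in linarith)
  moreover have "G (2*pi) = G (3/2*pi)"
  proof (rule const[of "3/2*pi" "2*pi" G])
    fix x assume x: "3/2*pi \<le> x" "x \<le> 2*pi"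
    have "cos (2*pi - x) \<ge> 0" by (rule cos_ge_zero) (use x in auto)
    then have "0 \<le> cos x" by (simp add: cos_diff)
    then show "(G has_real_derivative 0) (at x)" by (intro DERIV_cong[OF G(1) g0])
  qed (use pi_gt_zero in linarith)
  moreover have "G (3/2*pi) - model_height (3/2*pi) = G (pi/2) - model_height (pi/2)"
  proof (rule const[of _ _ "\<lambda>x. G x - model_height x"])
    fix x assume x: "pi/2 \<le> x" "x \<le> 3/2*pi"
    have "cos (x - pi) \<ge> 0" by (rule cos_ge_zero) (use x in auto)
    then have "cos x \<le> 0" by (simp add: cos_diff)
    then have "?g x = - 2 * cos x ^ 3 / sqrt (1 + (cos x)\<^sup>2)" by (simp add: max_def power3_eq_cube)
    then show "((\<lambda>x. G x - model_height x) has_real_derivative 0) (at x)"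
      using DERIV_diff[OF G(1) model_derivatives(3), of x] by simp
  qed (use pi_gt_zero in linarith)
  moreover have "model_height (pi/2) = -1" "model_height (3/2*pi) = 1"
  proof -
    have "sin (3/2*pi) = -1" "cos (3/2*pi) = 0"
      using sin_add[of pi "pi/2"] cos_add[of pi "pi/2"] by (simp_all add: field_simps)
    then show "model_height (pi/2) = -1" "model_height (3/2*pi) = 1" by (simp_all add: model_height_def)
  qed
  ultimately have G2: "G (2*pi) = 2" using G(2) by linarith
  have step: "G (x + 2*pi) = G x + 2" for x
  proof -
    have d: "((\<lambda>x. G (x + 2*pi) - G x) has_real_derivative 0) (at x)" for x
    proof -
      have "((\<lambda>x. G (x + 2*pi)) has_real_derivative ?g (x + 2*pi)) (at x)"
        using G(1)[of "x + 2*pi"] by (rule DERIV_shift[THEN iffD1])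
      from DERIV_diff[OF this G(1)[of x]] show ?thesis by simp
    qed
    have "G (x + 2*pi) - G x = G (0 + 2*pi) - G 0"
    proof (cases "x \<le> 0")
      case True
      show ?thesis by (rule sym, rule const[of x 0 "\<lambda>x. G (x + 2*pi) - G x"]) (use True d in auto)
    next
      case False
      show ?thesis by (rule const[of 0 x "\<lambda>x. G (x + 2*pi) - G x"]) (use False d in auto)
    qed
    then show ?thesis using G2 G(2) by simp
  qed
  have "G (x + 2 * pi * of_int n) = G x + 2 * of_int n" for x n
  proof (induction n rule: int_induct[of _ 0])
    case (step1 i)
    have e: "x + 2 * pi * of_int (i + 1) = (x + 2 * pi * of_int i) + 2 * pi" by (simp add: algebra_simps)
    show ?case unfolding e step step1(2) by simp
  next
    case (step2 i)
    have e: "x + 2 * pi * of_int i = (x + 2 * pi * of_int (i - 1)) + 2 * pi" by (simp add: algebra_simps)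
    have "G (x + 2 * pi * of_int i) = G (x + 2 * pi * of_int (i - 1)) + 2" unfolding e by (rule step)
    moreover have "2 * of_int (i - 1) = 2 * of_int i - (2::real)" by simp
    ultimately show ?case using step2(2) by linarith
  qed simp
  then show ?thesis using that G by blast
qed

text \<open>Where cos (\<Theta> t) < 0, this is a point of the unit sphere whose longitude turns
  with \<theta> s and whose latitude depends on \<Theta> t; elsewhere it depends on t alone. The
  factor 1 gives the second summand the shape of \<open>torus_map_product\<close>.\<close>

definition model_map :: "(real \<Rightarrow> real) \<Rightarrow> (real \<Rightarrow> real) \<Rightarrow> (real \<Rightarrow> complex) \<Rightarrow> real \<Rightarrow> real \<Rightarrow> r3" where
  "model_map \<theta> \<Theta> b s t = model_radius (\<Theta> t) *\<^sub>R (0, - cis (\<theta> s)) +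
     1 *\<^sub>R (model_height (\<Theta> t), model_cutoff (\<Theta> t) *\<^sub>R b t)"

lemma model_periodic:
  "model_radius (x + 2 * pi * of_int n) = model_radius x"
  "model_cutoff (x + 2 * pi * of_int n) = model_cutoff x"
  "model_height (x + 2 * pi * of_int n) = model_height x"
proof -
  have "sin (x + 2 * pi * of_int n) = sin x" "cos (x + 2 * pi * of_int n) = cos x"
    by (simp_all only: sin_add cos_add sin_int_2pin cos_int_2pin)
  then show "model_radius (x + 2 * pi * of_int n) = model_radius x"
  "model_cutoff (x + 2 * pi * of_int n) = model_cutoff x"
  "model_height (x + 2 * pi * of_int n) = model_height x"
    by (simp_all add: model_radius_def model_cutoff_def model_height_def)
qed

text \<open>The density is a product of a function of s and a function of t. The first integrates to
  2 pi, the second to 2 n, and the degree is their product over 4 pi.\<close>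

lemma model_map_degree:
  fixes n :: int
  assumes th: "\<And>s. (\<theta> has_real_derivative \<theta>' s) (at s)" "continuous_on UNIV \<theta>'" "\<And>s. \<theta> (s + 1) = \<theta> s + 2 * pi"
    and Th: "\<And>s. (\<Theta> has_real_derivative \<Theta>' s) (at s)" "continuous_on UNIV \<Theta>'"
      "\<And>s. \<Theta> (s + 1) = \<Theta> s + 2 * pi * of_int n"
    and b: "\<And>s. (b has_vector_derivative b' s) (at s)" "continuous_on UNIV b'" "\<And>s. b (s + 1) = b s"
  shows "torus_map (model_map \<theta> \<Theta> b)" "torus_degree (model_map \<theta> \<Theta> b) = of_int n"
proof -
  have Thc: "continuous_on UNIV \<Theta>" and thc: "continuous_on UNIV \<theta>" and bc: "continuous_on UNIV b"
    using th Th b by (meson DERIV_isCont continuous_at_imp_continuous_on has_vector_derivative_continuous)+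
  have p: "1 + (cos x)\<^sup>2 > 0" for x :: real by (simp add: add_pos_nonneg)
  then have nz: "1 + (cos x)\<^sup>2 \<noteq> 0" for x :: real by (metis less_irrefl)
  define R' where "R' t = 2 * max 0 (- cos (\<Theta> t)) * sin (\<Theta> t) * \<Theta>' t" for t
  define C' where "C' t = - (2 * max 0 (cos (\<Theta> t)) * sin (\<Theta> t)) * \<Theta>' t" for t
  define H' where "H' t = - 2 * cos (\<Theta> t) ^ 3 / sqrt (1 + (cos (\<Theta> t))\<^sup>2) * \<Theta>' t" for t
  have R: "((\<lambda>t. model_radius (\<Theta> t)) has_real_derivative R' t) (at t)" for t
    unfolding R'_def by (rule DERIV_chain2[OF model_derivatives(1) Th(1)])
  have C: "((\<lambda>t. model_cutoff (\<Theta> t)) has_real_derivative C' t) (at t)" for t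
    unfolding C'_def by (rule DERIV_chain2[OF model_derivatives(2) Th(1)])
  have H: "((\<lambda>t. model_height (\<Theta> t)) has_real_derivative H' t) (at t)" for t
    unfolding H'_def by (rule DERIV_chain2[OF model_derivatives(3) Th(1)])
  have cs: "((\<lambda>s. - cis (\<theta> s)) has_vector_derivative - (\<theta>' s *\<^sub>R (\<i> * cis (\<theta> s)))) (at s)" for s
  proof -
    have "(cis has_vector_derivative (\<i> * cis (\<theta> s))) (at (\<theta> s))"
      unfolding has_vector_derivative_def by (rule has_derivative_eq_rhs[OF has_derivative_cis[OF has_derivative_ident]]) auto
    from vector_diff_chain_at[OF th(1)[unfolded has_real_derivative_iff_has_vector_derivative] this]
    show ?thesis by (intro has_vector_derivative_minus) (simp add: o_def)
  qed
  have u1: "((\<lambda>s. (0::real, - cis (\<theta> s))) has_vector_derivative (0, - (\<theta>' s *\<^sub>R (\<i> * cis (\<theta> s))))) (at s)" for s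
    by (intro has_vector_derivative_Pair cs has_vector_derivative_const)
  have u2: "((\<lambda>t. (model_height (\<Theta> t), model_cutoff (\<Theta> t) *\<^sub>R b t)) has_vector_derivative
      (H' t, model_cutoff (\<Theta> t) *\<^sub>R b' t + C' t *\<^sub>R b t)) (at t)" for t
    by (intro has_vector_derivative_Pair has_vector_derivative_scaleR C b H[unfolded has_real_derivative_iff_has_vector_derivative])
  have Rc: "continuous_on UNIV R'" "continuous_on UNIV C'" "continuous_on UNIV H'"
    "continuous_on UNIV (\<lambda>t. model_cutoff (\<Theta> t))"
    unfolding R'_def[abs_def] C'_def[abs_def] H'_def[abs_def] model_cutoff_def
    by (intro continuous_intros Thc Th(2); use nz in simp)+
  show "torus_map (model_map \<theta> \<Theta> b)"
    unfolding model_map_def[abs_def]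
  proof (intro torus_map_add torus_map_product(1)[OF R _ _ u1] torus_map_product(2)[OF DERIV_const _ _ u2])
    show "continuous_on UNIV R'" by (rule Rc)
    show "continuous_on UNIV (\<lambda>s. (0, - (\<theta>' s *\<^sub>R (\<i> * cis (\<theta> s)))))"
      by (intro continuous_intros th(2) thc)
    show "continuous_on UNIV (\<lambda>s. (H' s, model_cutoff (\<Theta> s) *\<^sub>R b' s + C' s *\<^sub>R b s))"
      by (intro continuous_intros Rc b(2) bc)
  qed (auto simp: th(3) Th(3) model_periodic b(3) cis.ctr)
  have ds: "vector_derivative (\<lambda>s. model_map \<theta> \<Theta> b s t) (at s) =
      model_radius (\<Theta> t) *\<^sub>R (0, - (\<theta>' s *\<^sub>R (\<i> * cis (\<theta> s))))" for s t
    unfolding model_map_def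
    by (rule vector_derivative_at, rule has_vector_derivative_eq_rhs)
       (rule has_vector_derivative_add bounded_linear.has_vector_derivative[OF bounded_linear_scaleR_right u1]
          has_vector_derivative_const | simp)+
  have dt: "vector_derivative (\<lambda>t. model_map \<theta> \<Theta> b s t) (at t) =
      R' t *\<^sub>R (0, - cis (\<theta> s)) + (H' t, model_cutoff (\<Theta> t) *\<^sub>R b' t + C' t *\<^sub>R b t)" for s t
  proof -
    have "((\<lambda>t. model_radius (\<Theta> t) *\<^sub>R v) has_vector_derivative R' t *\<^sub>R v) (at t)" for v :: r3
      using has_vector_derivative_scaleR[OF R[of t] has_vector_derivative_const, of v] by simp
    from has_vector_derivative_add[OF this u2[of t]] show ?thesis
      unfolding model_map_def scaleR_one by (rule vector_derivative_at)
  qed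
  obtain G where G: "\<And>x. (G has_real_derivative 2 * max 0 (- cos x) ^ 3 / sqrt (1 + (cos x)\<^sup>2)) (at x)"
    "\<And>x n. G (x + 2 * pi * of_int n) = G x + 2 * of_int n"
    using model_density_antiderivative by blast
  have dens: "det3 (model_map \<theta> \<Theta> b s t) (vector_derivative (\<lambda>s. model_map \<theta> \<Theta> b s t) (at s))
      (vector_derivative (\<lambda>t. model_map \<theta> \<Theta> b s t) (at t)) / norm (model_map \<theta> \<Theta> b s t) ^ 3
      = \<theta>' s * (2 * max 0 (- cos (\<Theta> t)) ^ 3 / sqrt (1 + (cos (\<Theta> t))\<^sup>2) * \<Theta>' t)" for s t
  proof (cases "cos (\<Theta> t) < 0")
    \<comment> \<open>The radius vanishes, hence also the derivative in s; the path in t traced here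
      carries no solid angle.\<close>
    case False
    then show ?thesis unfolding ds by (simp add: model_radius_def det3_def)
  next
    case True
    define c where "c = cos (\<Theta> t)"
    define q where "q = sqrt (1 + c\<^sup>2)"
    have q: "q \<noteq> 0" "q * q = 1 + c\<^sup>2" using nz[of "\<Theta> t"] p[of "\<Theta> t"] by (auto simp: q_def c_def)
    have sn: "sin (\<Theta> t) * sin (\<Theta> t) = 1 - c\<^sup>2" unfolding c_def by (metis power2_eq_square sin_squared_eq)
    have m: "model_map \<theta> \<Theta> b s t = (- sin (\<Theta> t) * q, - (c\<^sup>2 *\<^sub>R cis (\<theta> s)))"
      using True by (simp add: model_map_def model_radius_def model_height_def model_cutoff_def q_def c_def max_def)
    have "(norm (model_map \<theta> \<Theta> b s t))\<^sup>2 = (sin (\<Theta> t) * sin (\<Theta> t)) * (q * q) + c ^ 4"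
      unfolding m norm_Pair by (simp add: power2_eq_square power4_eq_xxxx)
    also have "\<dots> = 1" unfolding sn q(2) by (simp add: algebra_simps power4_eq_xxxx power2_eq_square)
    finally have n1: "norm (model_map \<theta> \<Theta> b s t) = 1" by (simp add: power2_eq_1_iff) (use norm_ge_zero in smt)
    have cst: "(cos (\<theta> s))\<^sup>2 + (sin (\<theta> s))\<^sup>2 = 1" by simp
    have "det3 (model_map \<theta> \<Theta> b s t) (vector_derivative (\<lambda>s. model_map \<theta> \<Theta> b s t) (at s))
      (vector_derivative (\<lambda>t. model_map \<theta> \<Theta> b s t) (at t)) =
       det3 (- sin (\<Theta> t) * q, - (c\<^sup>2 *\<^sub>R cis (\<theta> s))) (0, - (c\<^sup>2 *\<^sub>R \<theta>' s *\<^sub>R (\<i> * cis (\<theta> s))))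
         (- 2 * c ^ 3 / q * \<Theta>' t, (2 * c * sin (\<Theta> t) * \<Theta>' t) *\<^sub>R cis (\<theta> s))"
      unfolding m ds dt R'_def H'_def C'_def using True
      by (simp add: model_radius_def model_cutoff_def q_def c_def max_def)
    also have "\<dots> = \<theta>' s * \<Theta>' t * ((cos (\<theta> s))\<^sup>2 + (sin (\<theta> s))\<^sup>2) *
        (c ^ 4 * (- 2 * c ^ 3 / q) - 2 * c ^ 3 * (sin (\<Theta> t) * sin (\<Theta> t)) * q)"
    proof -
      have "det3 (- S * q, - (c\<^sup>2 *\<^sub>R Complex A B)) (0, - (c\<^sup>2 *\<^sub>R x *\<^sub>R (\<i> * Complex A B)))
         (- 2 * c ^ 3 / q * y, (2 * c * S * y) *\<^sub>R Complex A B) =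
         x * y * (A\<^sup>2 + B\<^sup>2) * (c ^ 4 * (- 2 * c ^ 3 / q) - 2 * c ^ 3 * (S * S) * q)" for S A B x y
        unfolding det3_def by (simp add: algebra_simps power2_eq_square eval_nat_numeral add_divide_distrib)
      then show ?thesis unfolding cis.code .
    qed
    also have "c ^ 4 * (- 2 * c ^ 3 / q) - 2 * c ^ 3 * (sin (\<Theta> t) * sin (\<Theta> t)) * q =
        (- 2 * c ^ 3) * (c ^ 4 + (sin (\<Theta> t) * sin (\<Theta> t)) * (q * q)) / q"
      using q(1) by (simp add: field_simps)
    also have "c ^ 4 + (sin (\<Theta> t) * sin (\<Theta> t)) * (q * q) = 1"
      unfolding sn q(2) by (simp add: algebra_simps power4_eq_xxxx power2_eq_square)
    finally show ?thesis unfolding n1 using True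
      by (simp add: c_def q_def max_def power3_eq_cube)
  qed
  have IT: "((\<lambda>t. 2 * max 0 (- cos (\<Theta> t)) ^ 3 / sqrt (1 + (cos (\<Theta> t))\<^sup>2) * \<Theta>' t) has_integral (G (\<Theta> 1) - G (\<Theta> 0))) {0..1}"
    by (rule has_integral_DERIV[OF DERIV_chain2[OF G(1) Th(1)]]) simp
  have "G (\<Theta> 1) - G (\<Theta> 0) = 2 * of_int n" using Th(3)[of 0] G(2) by simp
  note IT = IT[unfolded this]
  have IS: "(\<theta>' has_integral (\<theta> 1 - \<theta> 0)) {0..1}"
    by (rule has_integral_DERIV[OF th(1)]) simp
  have e: "\<theta> 1 - \<theta> 0 = 2 * pi" using th(3)[of 0] by simp
  note IS = has_integral_mult_left[OF IS[unfolded e], of "2 * of_int n"]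
  have "torus_degree (model_map \<theta> \<Theta> b) = 1 / (4 * pi) * (2 * pi * (2 * of_int n))"
    unfolding torus_degree_def dens integral_unique[OF has_integral_mult_right[OF IT]]
      integral_unique[OF IS] ..
  also have "\<dots> = of_int n" by simp
  finally show "torus_degree (model_map \<theta> \<Theta> b) = of_int n" .
qed

section \<open>Linking in the round 3-sphere\<close>

type_synonym c2 = "complex \<times> complex"

definition herm :: "c2 \<Rightarrow> c2 \<Rightarrow> complex" where
  "herm a x = fst a * cnj (fst x) + snd a * cnj (snd x)"

definition det2 :: "c2 \<Rightarrow> c2 \<Rightarrow> complex" where
  "det2 x a = fst x * snd a - snd x * fst a"

text \<open>With x and a read as the quaternions x1 + j x2 and a1 + j a2, this is the imaginary part
  of conj(x) a, whose real part is \<open>x \<bullet> a\<close>. For a unit vector x it maps the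
  hyperplane orthogonal to x isometrically onto R^3, and it is linear in x.\<close>

definition cvec :: "c2 \<Rightarrow> c2 \<Rightarrow> r3" where
  "cvec x a = (Im (herm a x), det2 x a)"

text \<open>For unit vectors this is the difference of the stereographic images of a and b from x,
  multiplied by \<open>(1 - x \<bullet> a) * (1 - x \<bullet> b)\<close>. The norms make it
  homogeneous in each vector, so that its ray depends only on the three directions.\<close>

definition stereo_diff :: "c2 \<Rightarrow> c2 \<Rightarrow> c2 \<Rightarrow> r3" where
  "stereo_diff a b x = (norm b * norm x - x \<bullet> b) *\<^sub>R cvec x a - (norm a * norm x - x \<bullet> a) *\<^sub>R cvec x b"

definition same_dir :: "'a::real_vector \<Rightarrow> 'a \<Rightarrow> bool" where
  "same_dir a b \<longleftrightarrow> (\<exists>r>0. b = r *\<^sub>R a)"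

definition c1_loop :: "(real \<Rightarrow> 'a::real_normed_vector) \<Rightarrow> bool" where
  "c1_loop a \<longleftrightarrow> (\<exists>a'. (\<forall>t. (a has_vector_derivative a' t) (at t)) \<and> continuous_on UNIV a' \<and>
     (\<forall>t. a (t + 1) = a t))"

section \<open>Algebra of the quaternionic frame and injectivity of the projection\<close>

lemma inner_c2_herm: "(x::c2) \<bullet> a = Re (herm a x)"
  by (simp add: herm_def inner_prod_def inner_complex_def algebra_simps)

lemma cvec_linear: "cvec x (a + b) = cvec x a + cvec x b" "cvec x (r *\<^sub>R a) = r *\<^sub>R cvec x a"
  "cvec x (- a) = - cvec x a" "cvec x (a - b) = cvec x a - cvec x b"
  by (simp_all add: cvec_def herm_def det2_def algebra_simps scaleR_conv_of_real)

lemma norm_cvec: "(norm (cvec x a))\<^sup>2 + (x \<bullet> a)\<^sup>2 = (norm a)\<^sup>2 * (norm x)\<^sup>2"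
  unfolding power2_norm_eq_inner cvec_def inner_c2_herm inner_prod_def inner_complex_def herm_def det2_def
  by (simp add: algebra_simps power2_eq_square)

lemma bounded_linear_cvec: "bounded_linear (cvec x)"
proof -
  have "norm (cvec x a) \<le> norm a * norm x" for a
  proof (rule power2_le_imp_le)
    show "(norm (cvec x a))\<^sup>2 \<le> (norm a * norm x)\<^sup>2"
      using norm_cvec[of x a] zero_le_power2[of "x \<bullet> a"] unfolding power_mult_distrib by linarith
  qed simp
  then show ?thesis by (intro bounded_linear_intro[of _ "norm x"]) (simp_all add: cvec_linear)
qed

lemma same_dir_iff:
  fixes a x :: "'a::real_inner"
  assumes "a \<noteq> 0" "x \<noteq> 0" "norm a * norm x - x \<bullet> a = 0"
  shows "same_dir a x"
proof -
  have "norm x *\<^sub>R a = norm a *\<^sub>R x"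
    using assms(3) norm_cauchy_schwarz_eq[of x a] by (simp add: mult.commute)
  then have "(1 / norm a) *\<^sub>R norm x *\<^sub>R a = (1 / norm a) *\<^sub>R norm a *\<^sub>R x" by (rule arg_cong)
  then have "x = (norm x / norm a) *\<^sub>R a" using assms(1) by simp
  then show ?thesis unfolding same_dir_def using assms by (intro exI[of _ "norm x / norm a"]) auto
qed

text \<open>Stereographic projection is injective on directions. The length of
  \<open>cvec x a\<close> is determined by inner products, so a zero forces \<beta> a and \<alpha> b
  to have the same inner product with x as well as the same image under \<open>cvec x\<close>; by
  \<open>norm_cvec\<close> they are equal.\<close>

lemma stereo_diff_nonzero:
  assumes nz: "a \<noteq> 0" "b \<noteq> 0" "x \<noteq> 0" and d: "\<not> same_dir a b" "\<not> same_dir a x" "\<not> same_dir b x"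
  shows "stereo_diff a b x \<noteq> 0"
proof
  assume f0: "stereo_diff a b x = 0"
  define \<alpha> where "\<alpha> = norm a * norm x - x \<bullet> a"
  define \<beta> where "\<beta> = norm b * norm x - x \<bullet> b"
  have pos: "\<alpha> > 0" "\<beta> > 0"
    using same_dir_iff[of a x] same_dir_iff[of b x] nz d norm_cauchy_schwarz[of x a] norm_cauchy_schwarz[of x b]
    unfolding \<alpha>_def \<beta>_def by (force simp: mult.commute)+
  have eq: "\<beta> *\<^sub>R cvec x a = \<alpha> *\<^sub>R cvec x b" using f0 by (simp add: stereo_diff_def \<alpha>_def \<beta>_def)
  have na: "(norm (cvec x a))\<^sup>2 = \<alpha> * (norm a * norm x + x \<bullet> a)"
    using norm_cvec[of x a] by (simp add: \<alpha>_def algebra_simps power2_eq_square)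
  have nb: "(norm (cvec x b))\<^sup>2 = \<beta> * (norm b * norm x + x \<bullet> b)"
    using norm_cvec[of x b] by (simp add: \<beta>_def algebra_simps power2_eq_square)
  have "(norm (\<beta> *\<^sub>R cvec x a))\<^sup>2 = (norm (\<alpha> *\<^sub>R cvec x b))\<^sup>2" using eq by simp
  then have "\<beta>\<^sup>2 * (\<alpha> * (norm a * norm x + x \<bullet> a)) = \<alpha>\<^sup>2 * (\<beta> * (norm b * norm x + x \<bullet> b))"
    by (simp add: power_mult_distrib na nb)
  then have "(\<alpha> * \<beta>) * (\<beta> * (norm a * norm x + x \<bullet> a)) = (\<alpha> * \<beta>) * (\<alpha> * (norm b * norm x + x \<bullet> b))"
    by (simp add: power2_eq_square ac_simps)
  then have e1: "\<beta> * (norm a * norm x + x \<bullet> a) = \<alpha> * (norm b * norm x + x \<bullet> b)" using pos by simp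
  have e2: "\<beta> * (norm a * norm x - x \<bullet> a) = \<alpha> * (norm b * norm x - x \<bullet> b)"
    by (simp add: \<alpha>_def[symmetric] \<beta>_def[symmetric])
  have "\<beta> * (x \<bullet> a) = \<alpha> * (x \<bullet> b)" using e1 e2 by (simp add: algebra_simps)
  then have i0: "x \<bullet> (\<beta> *\<^sub>R a - \<alpha> *\<^sub>R b) = 0" by (simp add: inner_diff_right)
  have "cvec x (\<beta> *\<^sub>R a - \<alpha> *\<^sub>R b) = 0" using eq by (simp add: cvec_linear)
  then have "norm (\<beta> *\<^sub>R a - \<alpha> *\<^sub>R b) = 0" using norm_cvec[of x "\<beta> *\<^sub>R a - \<alpha> *\<^sub>R b"] i0 nz(3) by simp
  then have "\<beta> *\<^sub>R a = \<alpha> *\<^sub>R b" by simp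
  then have "(1 / \<alpha>) *\<^sub>R \<beta> *\<^sub>R a = (1 / \<alpha>) *\<^sub>R \<alpha> *\<^sub>R b" by (rule arg_cong)
  then have "b = (\<beta> / \<alpha>) *\<^sub>R a" using pos(1) by simp
  moreover have "\<beta> / \<alpha> > 0" using pos by simp
  ultimately show False using d(1) unfolding same_dir_def by blast
qed

section \<open>C^1 loops and the torus maps built from them\<close>

lemma c1_loop_continuous: "c1_loop a \<Longrightarrow> continuous_on UNIV a"
  unfolding c1_loop_def by (blast intro: continuous_at_imp_continuous_on has_vector_derivative_continuous)

lemma c1_loop_bounded_linear:
  assumes "bounded_linear h" "c1_loop a"
  shows "c1_loop (\<lambda>t. h (a t))"
proof -
  obtain a' where "\<And>t. (a has_vector_derivative a' t) (at t)" "continuous_on UNIV a'" "\<And>t. a (t + 1) = a t"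
    using assms(2) unfolding c1_loop_def by blast
  then show ?thesis unfolding c1_loop_def
    by (intro exI[of _ "\<lambda>t. h (a' t)"])
       (auto intro: bounded_linear.has_vector_derivative[OF assms(1)] bounded_linear.continuous_on[OF assms(1)])
qed

lemma c1_loop_const: "c1_loop (\<lambda>t. k)"
  unfolding c1_loop_def by (rule exI[of _ "\<lambda>_. 0"]) auto

lemma c1_loop_add: "c1_loop a \<Longrightarrow> c1_loop b \<Longrightarrow> c1_loop (\<lambda>t. a t + b t)"
  unfolding c1_loop_def
  by (elim exE conjE, rule_tac x = "\<lambda>t. a' t + a'' t" for a' a'' in exI)
     (auto intro!: has_vector_derivative_add continuous_on_add)

lemma c1_loop_diff: "c1_loop a \<Longrightarrow> c1_loop b \<Longrightarrow> c1_loop (\<lambda>t. a t - b t)"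
  using c1_loop_add[of a "\<lambda>t. - b t"] c1_loop_bounded_linear[OF bounded_linear_minus[OF bounded_linear_ident], of b]
  by simp

lemma c1_loop_Pair: "c1_loop a \<Longrightarrow> c1_loop b \<Longrightarrow> c1_loop (\<lambda>t. (a t, b t))"
  unfolding c1_loop_def
  by (elim exE conjE, rule_tac x = "\<lambda>t. (a' t, a'' t)" for a' a'' in exI)
     (auto intro!: has_vector_derivative_Pair continuous_on_Pair)

lemma c1_loop_scaleR:
  fixes a :: "real \<Rightarrow> real" and b :: "real \<Rightarrow> 'a::real_normed_vector"
  assumes "c1_loop a" "c1_loop b" shows "c1_loop (\<lambda>t. a t *\<^sub>R b t)"
proof -
  obtain a' b' where d: "\<And>t. (a has_real_derivative a' t) (at t)" "continuous_on UNIV a'" "\<And>t. a (t+1) = a t"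
    "\<And>t. (b has_vector_derivative b' t) (at t)" "continuous_on UNIV b'" "\<And>t. b (t+1) = b t"
    using assms unfolding c1_loop_def has_real_derivative_iff_has_vector_derivative by blast
  show ?thesis unfolding c1_loop_def
    by (rule exI[of _ "\<lambda>t. a t *\<^sub>R b' t + a' t *\<^sub>R b t"])
       (auto intro!: has_vector_derivative_scaleR continuous_intros d
          c1_loop_continuous[OF assms(1)] c1_loop_continuous[OF assms(2)] simp: d(3,6))
qed

lemma c1_loop_norm:
  fixes a :: "real \<Rightarrow> 'a::real_inner"
  assumes "c1_loop a" "\<And>t. a t \<noteq> 0"
  shows "c1_loop (\<lambda>t. norm (a t))"
proof -
  obtain a' where d: "\<And>t. (a has_vector_derivative a' t) (at t)" "continuous_on UNIV a'" "\<And>t. a (t+1) = a t"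
    using assms unfolding c1_loop_def by blast
  show ?thesis unfolding c1_loop_def
    by (rule exI[of _ "\<lambda>t. (a t \<bullet> a' t) / norm (a t)"])
       (use assms(2) in \<open>auto intro!: has_real_derivative_norm[unfolded has_real_derivative_iff_has_vector_derivative]
          continuous_intros d(1,2) c1_loop_continuous[OF assms(1)] simp: d(3)\<close>)
qed

lemma torus_map_loops:
  assumes "c1_loop a" "c1_loop u" "c1_loop b" "c1_loop v"
  shows "torus_map (\<lambda>s t. a t *\<^sub>R u s + b s *\<^sub>R v t)"
proof (rule torus_map_add)
  show "torus_map (\<lambda>s t. a t *\<^sub>R u s)"
    using assms(1,2) unfolding c1_loop_def has_real_derivative_iff_has_vector_derivative[symmetric]
    by (elim exE conjE) (rule torus_map_product(1); blast)
  show "torus_map (\<lambda>s t. b s *\<^sub>R v t)"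
    using assms(3,4) unfolding c1_loop_def has_real_derivative_iff_has_vector_derivative[symmetric]
    by (elim exE conjE) (rule torus_map_product(2); blast)
qed

lemma torus_map_stereo_diff:
  assumes "c1_loop a" "c1_loop b" "\<And>t. a t \<noteq> 0" "\<And>t. b t \<noteq> 0"
  shows "torus_map (\<lambda>s t. stereo_diff (a s) (b t) x)"
proof -
  have l: "c1_loop (\<lambda>t. norm (c t) * norm x - x \<bullet> c t)" if "c1_loop c" "\<And>t. c t \<noteq> 0" for c
    by (intro c1_loop_diff c1_loop_bounded_linear[OF bounded_linear_mult_left] c1_loop_norm that
        c1_loop_bounded_linear[OF bounded_linear_inner_right])
  have "torus_map (\<lambda>s t. (norm (b t) * norm x - x \<bullet> b t) *\<^sub>R cvec x (a s) +
      (norm (a s) * norm x - x \<bullet> a s) *\<^sub>R cvec x (- b t))"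
    by (intro torus_map_loops l assms c1_loop_bounded_linear[OF bounded_linear_cvec]
        c1_loop_bounded_linear[OF bounded_linear_minus[OF bounded_linear_ident]])
  then show ?thesis by (simp add: stereo_diff_def cvec_linear)
qed

text \<open>Isotopy invariance of linking in its conic form: the vectors may leave the sphere and
  the centre may move, provided that the directions of the two knots and of the centre never
  meet.\<close>

lemma stereo_diff_degree_homotopy:
  fixes a b :: "real \<Rightarrow> real \<Rightarrow> c2" and x :: "real \<Rightarrow> c2"
  assumes loops: "\<And>\<tau>. 0 \<le> \<tau> \<Longrightarrow> \<tau> \<le> 1 \<Longrightarrow> c1_loop (a \<tau>)" "\<And>\<tau>. 0 \<le> \<tau> \<Longrightarrow> \<tau> \<le> 1 \<Longrightarrow> c1_loop (b \<tau>)"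
    and cont: "continuous_on ({0..1} \<times> UNIV) (\<lambda>(\<tau>,s). a \<tau> s)" "continuous_on ({0..1} \<times> UNIV) (\<lambda>(\<tau>,s). b \<tau> s)"
      "continuous_on {0..1} x"
    and nz: "\<And>\<tau> s. 0 \<le> \<tau> \<Longrightarrow> \<tau> \<le> 1 \<Longrightarrow> a \<tau> s \<noteq> 0 \<and> b \<tau> s \<noteq> 0 \<and> x \<tau> \<noteq> 0"
    and dir: "\<And>\<tau> s t. 0 \<le> \<tau> \<Longrightarrow> \<tau> \<le> 1 \<Longrightarrow> \<not> same_dir (a \<tau> s) (b \<tau> t)"
      "\<And>\<tau> s t. 0 \<le> \<tau> \<Longrightarrow> \<tau> \<le> 1 \<Longrightarrow> \<not> same_dir (a \<tau> s) (x \<tau>)"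
      "\<And>\<tau> s t. 0 \<le> \<tau> \<Longrightarrow> \<tau> \<le> 1 \<Longrightarrow> \<not> same_dir (b \<tau> s) (x \<tau>)"
  shows "torus_degree (\<lambda>s t. stereo_diff (a 1 s) (b 1 t) (x 1)) = torus_degree (\<lambda>s t. stereo_diff (a 0 s) (b 0 t) (x 0))"
proof (rule torus_degree_homotopy[of "\<lambda>\<tau> s t. stereo_diff (a \<tau> s) (b \<tau> t) (x \<tau>)"])
  fix \<tau> :: real assume t: "0 \<le> \<tau>" "\<tau> \<le> 1"
  show "torus_map (\<lambda>s t. stereo_diff (a \<tau> s) (b \<tau> t) (x \<tau>))"
    by (rule torus_map_stereo_diff) (use loops nz t in auto)
  fix s t' show "stereo_diff (a \<tau> s) (b \<tau> t') (x \<tau>) \<noteq> 0"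
    by (rule stereo_diff_nonzero) (use nz dir t in auto)
next
  let ?X = "{0..1} \<times> UNIV \<times> UNIV :: (real \<times> real \<times> real) set"
  have c1: "continuous_on ?X (\<lambda>p. a (fst p) (fst (snd p)))"
    using continuous_on_compose2[OF cont(1), of ?X "\<lambda>p. (fst p, fst (snd p))"]
    by (force intro!: continuous_intros)
  have c2: "continuous_on ?X (\<lambda>p. b (fst p) (snd (snd p)))"
    using continuous_on_compose2[OF cont(2), of ?X "\<lambda>p. (fst p, snd (snd p))"]
    by (force intro!: continuous_intros)
  have c3: "continuous_on ?X (\<lambda>p. x (fst p))"
    using continuous_on_compose2[OF cont(3), of ?X fst] by (force intro!: continuous_intros)
  show "continuous_on ?X (\<lambda>(\<tau>, s, t). stereo_diff (a \<tau> s) (b \<tau> t) (x \<tau>))"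
    unfolding case_prod_beta stereo_diff_def cvec_def herm_def det2_def
    by (intro continuous_intros c1 c2 c3)
qed

text \<open>With the first knot in the line z2 = 0 and the centre on the positive axis of z2, the
  difference map and the model map have corresponding dominant terms, so that the segment between
  their values never meets the origin.\<close>

lemma linking_model:
  fixes y :: "real \<Rightarrow> complex" and b :: "real \<Rightarrow> c2" and n :: int
  assumes b: "c1_loop b" "\<And>t. snd (b t) \<noteq> 0" "\<And>t. fst (b t) = 0 \<Longrightarrow> \<not> (Im (snd (b t)) = 0 \<and> Re (snd (b t)) > 0)"
    and y: "c1_loop y" "\<And>s. y s \<noteq> 0" "\<And>s. y s = of_real (norm (y s)) * cis (\<theta> s)"
    and th: "\<And>s. (\<theta> has_real_derivative \<theta>' s) (at s)" "continuous_on UNIV \<theta>'" "\<And>s. \<theta> (s + 1) = \<theta> s + 2 * pi"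
    and Th: "\<And>s. (\<Theta> has_real_derivative \<Theta>' s) (at s)" "continuous_on UNIV \<Theta>'"
      "\<And>s. \<Theta> (s + 1) = \<Theta> s + 2 * pi * of_int n"
      "\<And>t. snd (b t) = of_real (norm (snd (b t))) * cis (\<Theta> t)"
    and r: "r > 0"
  shows "torus_degree (\<lambda>s t. stereo_diff (y s, 0) (b t) (0, of_real r)) = of_int n"
proof -
  define B1 where "B1 t = fst (b t)" for t
  define B2 where "B2 t = snd (b t)" for t
  have b1: "c1_loop B1" unfolding B1_def[abs_def] by (rule c1_loop_bounded_linear[OF bounded_linear_fst b(1)])
  obtain B1' where B1: "\<And>t. (B1 has_vector_derivative B1' t) (at t)" "continuous_on UNIV B1'" "\<And>t. B1 (t + 1) = B1 t"
    using b1 unfolding c1_loop_def by blast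
  note model = model_map_degree[OF th Th(1-3) B1]
  have ynz: "c1_loop (\<lambda>s. (y s, 0::complex))" "\<And>s. (y s, 0::complex) \<noteq> 0"
    using c1_loop_Pair[OF y(1) c1_loop_const] y(2) by (auto simp: zero_prod_def)
  have bnz: "\<And>t. b t \<noteq> 0" using b(2) by (metis snd_zero)
  have "torus_degree (\<lambda>s t. stereo_diff (y s, 0) (b t) (0, of_real r)) = torus_degree (model_map \<theta> \<Theta> B1)"
  proof (rule torus_degree_straight_line[OF model(1) torus_map_stereo_diff[OF ynz(1) b(1) ynz(2) bnz]])
    fix \<tau> s t :: real assume \<tau>: "0 \<le> \<tau>" "\<tau> \<le> 1"
    \<comment> \<open>\<tau> times the positive factor that \<open>sd\<close> splits off. The two
      maps enter the segment with weights 1 - \<tau> and K, which are never both 0.\<close>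
    define K where "K = \<tau> * (r * (r * norm (y s)))"
    define N where "N = norm (b t)"
    have K: "K \<ge> 0" "K + (1 - \<tau>) > 0"
    proof -
      have p: "r * (r * norm (y s)) > 0" using r y(2)[of s] by simp
      show K0: "K \<ge> 0" unfolding K_def using \<tau> p by simp
      show "K + (1 - \<tau>) > 0"
      proof (cases "\<tau> = 1")
        case True then show ?thesis using p by (simp add: K_def)
      next
        case False then show ?thesis using K0 \<tau> by simp
      qed
    qed
    have ys: "y s = of_real (norm (y s)) * cis (\<theta> s)" by (rule y(3))
    have B2: "B2 t = of_real (norm (B2 t)) * cis (\<Theta> t)" unfolding B2_def by (rule Th(4))
    have n2: "norm (B2 t) > 0" using b(2)[of t] by (simp add: B2_def)
    have N: "N\<^sup>2 = (norm (B1 t))\<^sup>2 + (norm (B2 t))\<^sup>2"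
      unfolding N_def B1_def B2_def by (simp add: norm_prod_def)
    have sd: "stereo_diff (y s, 0) (b t) (0, of_real r) = (r * (r * norm (y s))) *\<^sub>R
       ((N - Re (B2 t)) *\<^sub>R (0, - cis (\<theta> s)) + (- Im (B2 t), B1 t))"
    proof -
      have "stereo_diff (w, 0) (b t) (0, of_real r) = (r * r) *\<^sub>R
         ((N - Re (B2 t)) *\<^sub>R (0, - w) + norm w *\<^sub>R (- Im (B2 t), B1 t))" for w
        unfolding stereo_diff_def cvec_def herm_def det2_def N_def B1_def B2_def
        using r by (simp add: norm_Pair inner_prod_def inner_complex_def scaleR_conv_of_real algebra_simps)
      note g = this[of "y s"]
      have e: "(0::real, - y s) = norm (y s) *\<^sub>R (0, - cis (\<theta> s))"
        using ys by (simp add: scaleR_conv_of_real)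
      show ?thesis unfolding g e by (simp only: scaleR_add_right scaleR_scaleR mult_ac)
    qed
    show "(1 - \<tau>) *\<^sub>R model_map \<theta> \<Theta> B1 s t + \<tau> *\<^sub>R stereo_diff (y s, 0) (b t) (0, of_real r) \<noteq> 0"
    proof
      assume z: "(1 - \<tau>) *\<^sub>R model_map \<theta> \<Theta> B1 s t + \<tau> *\<^sub>R stereo_diff (y s, 0) (b t) (0, of_real r) = 0"
      have z1: "(1 - \<tau>) * model_height (\<Theta> t) - K * Im (B2 t) = 0"
        using arg_cong[OF z, of fst] by (simp add: sd model_map_def K_def)
      have z2: "- (((1 - \<tau>) * model_radius (\<Theta> t) + K * (N - Re (B2 t))) *\<^sub>R cis (\<theta> s)) +
          ((1 - \<tau>) * model_cutoff (\<Theta> t) + K) *\<^sub>R B1 t = 0"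
        using arg_cong[OF z, of snd] by (simp add: sd model_map_def K_def algebra_simps)
      \<comment> \<open>Both maps have a height of the sign of - sin (\<Theta> t), so a zero of the
        combination forces sin (\<Theta> t) = 0.\<close>
      have "Im (B2 t) = norm (B2 t) * sin (\<Theta> t)" by (subst B2) simp
      then have "sin (\<Theta> t) * ((1 - \<tau>) * sqrt (1 + (cos (\<Theta> t))\<^sup>2) + K * norm (B2 t)) = 0"
        using z1 by (simp add: model_height_def algebra_simps)
      moreover have "(1 - \<tau>) * sqrt (1 + (cos (\<Theta> t))\<^sup>2) + K * norm (B2 t) > 0"
      proof (cases "\<tau> = 1")
        case True then show ?thesis using K n2 by simp
      next
        case False
        have "sqrt (1 + (cos (\<Theta> t))\<^sup>2) > 0" by (simp add: add_pos_nonneg)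
        then show ?thesis using False \<tau> K n2 by (intro add_pos_nonneg mult_pos_pos mult_nonneg_nonneg) auto
      qed
      ultimately have s0: "sin (\<Theta> t) = 0" by simp
      then have "cos (\<Theta> t) = 1 \<or> cos (\<Theta> t) = -1" using sin_cos_squared_add[of "\<Theta> t"] by (simp add: power2_eq_1_iff)
      then show False
      proof
        \<comment> \<open>The model has no rotating term here, and N < |B1| + |B2| lets the term
          with \<open>B1\<close> outweigh the rotating term of the other map.\<close>
        assume c: "cos (\<Theta> t) = 1"
        have re: "Re (B2 t) = norm (B2 t)" "Im (B2 t) = 0" by (subst B2, simp add: c s0)+
        have b1nz: "norm (B1 t) > 0" using b(3)[of t] re n2 by (auto simp: B1_def B2_def)
        have "N\<^sup>2 < (norm (B1 t) + norm (B2 t))\<^sup>2" unfolding N using b1nz n2 by (simp add: power2_sum)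
        then have lt: "N < norm (B1 t) + norm (B2 t)" by (rule power2_less_imp_less) simp
        have ge: "N \<ge> norm (B2 t)" by (rule power2_le_imp_le) (simp add: N, simp add: N_def)
        have "((1 - \<tau>) + K) *\<^sub>R B1 t = (K * (N - norm (B2 t))) *\<^sub>R cis (\<theta> s)"
          using z2 by (simp add: model_radius_def model_cutoff_def c re)
        then have "norm (((1 - \<tau>) + K) *\<^sub>R B1 t) = norm ((K * (N - norm (B2 t))) *\<^sub>R cis (\<theta> s))" by (rule arg_cong)
        then have e: "((1 - \<tau>) + K) * norm (B1 t) = K * (N - norm (B2 t))"
          using K \<tau> ge by simp
        show False
        proof (cases "K = 0")
          case True then show False using e b1nz K by simp
        next
          case False
          then have "K * (N - norm (B2 t)) < K * norm (B1 t)" using K lt by simp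
          also have "\<dots> \<le> ((1 - \<tau>) + K) * norm (B1 t)" using \<tau> by (intro mult_right_mono) auto
          finally show False using e by simp
        qed
      next
        \<comment> \<open>The model has no \<open>B1\<close> term here, and N + |B2| > |B1| lets the
          rotating term win.\<close>
        assume c: "cos (\<Theta> t) = -1"
        have re: "Re (B2 t) = - norm (B2 t)" by (subst B2, simp add: c s0)
        have ge: "N \<ge> norm (B1 t)" by (rule power2_le_imp_le) (simp add: N, simp add: N_def)
        have "K *\<^sub>R B1 t = ((1 - \<tau>) + K * (N + norm (B2 t))) *\<^sub>R cis (\<theta> s)"
          using z2 by (simp add: model_radius_def model_cutoff_def c re)
        then have "norm (K *\<^sub>R B1 t) = norm (((1 - \<tau>) + K * (N + norm (B2 t))) *\<^sub>R cis (\<theta> s))" by (rule arg_cong)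
        moreover have "(1 - \<tau>) + K * (N + norm (B2 t)) \<ge> 0" using \<tau> K by (simp add: N_def)
        ultimately have e: "K * norm (B1 t) = (1 - \<tau>) + K * (N + norm (B2 t))" using K by simp
        have "K * norm (B1 t) \<le> K * N" using K ge by (intro mult_left_mono) auto
        then have "(1 - \<tau>) + K * norm (B2 t) \<le> 0" using e by (simp add: algebra_simps)
        moreover have "(1 - \<tau>) + K * norm (B2 t) > 0"
          using K \<tau> n2 by (cases "\<tau> = 1") (auto intro: add_pos_nonneg)
        ultimately show False by simp
      qed
    qed
  qed
  then show ?thesis using model(2) by simp
qed

definition shear :: "(complex \<Rightarrow> complex) \<Rightarrow> real \<Rightarrow> c2 \<Rightarrow> c2" where
  "shear q \<tau> z = (fst z, snd z - \<tau> *\<^sub>R q (fst z))"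

text \<open>
  The isotopy \<open>shear q\<close> moves the knot \<open>y\<close> into a complex line; a linear isotopy then moves
  the centre of projection to a multiple of \<open>(0, 1)\<close>.
\<close>

lemma linking_winding:
  fixes y b :: "real \<Rightarrow> c2" and n :: int
  assumes y: "c1_loop y" "\<And>s. norm (y s) = 1" and b: "c1_loop b" "\<And>s. norm (b s) = 1" and x: "norm x = 1"
    and qc: "continuous_on UNIV q" and qy: "c1_loop (\<lambda>s. q (fst (y s)))" and qb: "c1_loop (\<lambda>s. q (fst (b s)))"
    and inj: "\<And>\<tau> z w. 0 \<le> \<tau> \<Longrightarrow> \<tau> \<le> 1 \<Longrightarrow> norm z = 1 \<Longrightarrow> norm w = 1 \<Longrightarrow> same_dir (shear q \<tau> z) (shear q \<tau> w) \<Longrightarrow> z = w"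
    and snz: "\<And>\<tau> z. 0 \<le> \<tau> \<Longrightarrow> \<tau> \<le> 1 \<Longrightarrow> norm z = 1 \<Longrightarrow> shear q \<tau> z \<noteq> 0"
    and yq: "\<And>s. snd (y s) = q (fst (y s))" "\<And>s. fst (y s) = of_real (norm (fst (y s))) * cis (\<theta> s)"
    and xq: "snd x \<noteq> q (fst x)" and bq: "\<And>t. snd (b t) \<noteq> q (fst (b t))"
    and th: "\<And>s. (\<theta> has_real_derivative \<theta>' s) (at s)" "continuous_on UNIV \<theta>'" "\<And>s. \<theta> (s + 1) = \<theta> s + 2 * pi"
    and Th: "\<And>s. (\<Theta> has_real_derivative \<Theta>' s) (at s)" "continuous_on UNIV \<Theta>'"
      "\<And>s. \<Theta> (s + 1) = \<Theta> s + 2 * pi * of_int n"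
      "\<And>t. snd (b t) - q (fst (b t)) = of_real (norm (snd (b t) - q (fst (b t)))) * cis (\<Theta> t)"
    and disj: "\<And>s t. y s \<noteq> b t" "\<And>s. y s \<noteq> x" "\<And>t. b t \<noteq> x"
  shows "torus_degree (\<lambda>s t. stereo_diff (y s) (b t) x) = of_int n"
proof -
  let ?S = "shear q 1"
  have sh0: "shear q 0 z = z" for z by (simp add: shear_def)
  have sl: "c1_loop (\<lambda>s. shear q \<tau> (c s))" if "c1_loop c" "c1_loop (\<lambda>s. q (fst (c s)))" for c \<tau>
    unfolding shear_def
    by (intro c1_loop_Pair c1_loop_diff c1_loop_bounded_linear[OF bounded_linear_fst]
        c1_loop_bounded_linear[OF bounded_linear_snd] c1_loop_bounded_linear[OF bounded_linear_scaleR_right] that)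
  have shc: "continuous_on X (\<lambda>p. shear q (f p) (g p))" if "continuous_on X f" "continuous_on X g"
    for X :: "'z::topological_space set" and f g
    unfolding shear_def
    by (intro continuous_intros that continuous_on_compose2[OF qc]) auto
  have cc: "continuous_on X (\<lambda>p. c (snd p))" if "c1_loop c" for c :: "real \<Rightarrow> c2" and X :: "(real \<times> real) set"
    by (rule continuous_on_compose2[OF c1_loop_continuous[OF that]]) (auto intro!: continuous_intros)
  have h1: "torus_degree (\<lambda>s t. stereo_diff (?S (y s)) (?S (b t)) (?S x)) =
    torus_degree (\<lambda>s t. stereo_diff (shear q 0 (y s)) (shear q 0 (b t)) (shear q 0 x))"
  proof (rule stereo_diff_degree_homotopy[of "\<lambda>\<tau> s. shear q \<tau> (y s)" "\<lambda>\<tau> s. shear q \<tau> (b s)" "\<lambda>\<tau>. shear q \<tau> x"])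
    show "continuous_on ({0..1} \<times> UNIV) (\<lambda>(\<tau>, s). shear q \<tau> (y s))"
         "continuous_on ({0..1} \<times> UNIV) (\<lambda>(\<tau>, s). shear q \<tau> (b s))"
         "continuous_on {0..1} (\<lambda>\<tau>. shear q \<tau> x)"
      unfolding case_prod_beta by (intro shc cc y b continuous_intros)+
  qed (use sl y b qy qb snz x inj disj in blast)+
  \<comment> \<open>The linear isotopy \<open>M\<close> fixes the line z2 = 0, which contains the
    sheared knot. At time 1 it clears the first coordinate of the sheared centre, using the ratio
    \<mu>, and turns its second coordinate by - \<phi> onto the positive axis.\<close>
  define \<mu> where "\<mu> = fst (?S x) / snd (?S x)"
  define \<phi> where "\<phi> = Arg (snd (?S x))"
  define M where "M \<tau> z = (fst z - \<tau> *\<^sub>R (\<mu> * snd z), cis (- \<tau> * \<phi>) * snd z)" for \<tau> :: real and z :: c2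
  have M0: "M 0 z = z" for z by (simp add: M_def)
  have Mnz: "M \<tau> z \<noteq> 0" if "z \<noteq> 0" for \<tau> z
    using that by (cases z) (auto simp: M_def zero_prod_def)
  have Mlin: "M \<tau> (r *\<^sub>R z) = r *\<^sub>R M \<tau> z" for \<tau> r z by (simp add: M_def algebra_simps scaleR_conv_of_real)
  have Minj: "z = w" if "M \<tau> z = M \<tau> w" for \<tau> z w
    using that by (cases z; cases w) (auto simp: M_def)
  have Mdir: "same_dir z w" if "same_dir (M \<tau> z) (M \<tau> w)" for \<tau> z w
    using that unfolding same_dir_def by (metis Mlin Minj)
  have Ml: "c1_loop (\<lambda>s. M \<tau> (c s))" if "c1_loop c" for c \<tau>
    unfolding M_def
    by (intro c1_loop_Pair c1_loop_diff c1_loop_bounded_linear[OF bounded_linear_fst]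
        c1_loop_bounded_linear[OF bounded_linear_snd] c1_loop_bounded_linear[OF bounded_linear_scaleR_right]
        c1_loop_bounded_linear[OF bounded_linear_mult_right] that)
  have Mc: "continuous_on X (\<lambda>p. M (f p) (g p))" if "continuous_on X f" "continuous_on X g"
    for X :: "'z::topological_space set" and f g
    unfolding M_def by (intro continuous_intros that)
  have sy: "c1_loop (\<lambda>s. ?S (y s))" and sb: "c1_loop (\<lambda>s. ?S (b s))" using sl y b qy qb by auto
  have h2: "torus_degree (\<lambda>s t. stereo_diff (M 1 (?S (y s))) (M 1 (?S (b t))) (M 1 (?S x))) =
    torus_degree (\<lambda>s t. stereo_diff (M 0 (?S (y s))) (M 0 (?S (b t))) (M 0 (?S x)))"
  proof (rule stereo_diff_degree_homotopy[of "\<lambda>\<tau> s. M \<tau> (?S (y s))" "\<lambda>\<tau> s. M \<tau> (?S (b s))" "\<lambda>\<tau>. M \<tau> (?S x)"])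
    show "continuous_on ({0..1} \<times> UNIV) (\<lambda>(\<tau>, s). M \<tau> (?S (y s)))"
         "continuous_on ({0..1} \<times> UNIV) (\<lambda>(\<tau>, s). M \<tau> (?S (b s)))"
         "continuous_on {0..1} (\<lambda>\<tau>. M \<tau> (?S x))"
      unfolding case_prod_beta by (intro Mc cc[OF sy] cc[OF sb] continuous_intros)+
  next
    have i: "\<not> same_dir (?S z) (?S w)" if "norm z = 1" "norm w = 1" "z \<noteq> w" for z w
      using inj[of 1 z w] that by auto
    fix \<tau> s t :: real
    show "\<not> same_dir (M \<tau> (?S (y s))) (M \<tau> (?S (b t)))" using Mdir i y(2) b(2) disj(1) by blast
    show "\<not> same_dir (M \<tau> (?S (y s))) (M \<tau> (?S x))" using Mdir i y(2) x disj(2) by blast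
    show "\<not> same_dir (M \<tau> (?S (b s))) (M \<tau> (?S x))" using Mdir i b(2) x disj(3) by blast
    show "M \<tau> (?S (y s)) \<noteq> 0 \<and> M \<tau> (?S (b s)) \<noteq> 0 \<and> M \<tau> (?S x) \<noteq> 0"
      using Mnz snz[of 1] y(2) b(2) x by auto
  qed (use Ml sy sb in auto)
  define r where "r = norm (snd (?S x))"
  have sxnz: "snd (?S x) \<noteq> 0" using xq by (simp add: shear_def)
  then have r: "r > 0" by (simp add: r_def)
  have "cis (- \<phi>) * snd (?S x) = of_real r"
  proof -
    have "snd (?S x) = of_real r * cis \<phi>" unfolding r_def \<phi>_def
      by (metis Arg_eq cis_conv_exp sxnz)
    then show ?thesis by (simp add: cis_mult)
  qed
  then have Mx: "M 1 (?S x) = (0, of_real r)" using sxnz by (simp add: M_def \<mu>_def)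
  have My: "M 1 (?S (y s)) = (fst (y s), 0)" for s
    by (simp add: M_def shear_def yq(1))
  have ynz: "fst (y s) \<noteq> 0" for s
    using snz[of 1 "y s"] y(2) by (auto simp: shear_def yq(1) zero_prod_def)
  have "torus_degree (\<lambda>s t. stereo_diff (fst (y s), 0) (M 1 (?S (b t))) (0, of_real r)) = of_int n"
  \<comment> \<open>The rotation by - \<phi> shifts the argument \<Theta> by a constant, which does
    not change its increment over a period.\<close>
  proof (rule linking_model[where \<Theta> = "\<lambda>t. \<Theta> t - \<phi>", OF Ml[OF sb] _ _ _ ynz yq(2) th _ Th(2) _ _ r])
    fix t
    show "snd (M 1 (?S (b t))) \<noteq> 0" using bq[of t] by (simp add: M_def shear_def)
    show "c1_loop (\<lambda>s. fst (y s))" by (rule c1_loop_bounded_linear[OF bounded_linear_fst y(1)])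
    show "((\<lambda>t. \<Theta> t - \<phi>) has_real_derivative \<Theta>' t) (at t)"
      by (rule DERIV_cong[OF DERIV_diff[OF Th(1) DERIV_const]]) simp
    show "\<Theta> (t + 1) - \<phi> = \<Theta> t - \<phi> + 2 * pi * of_int n" using Th(3)[of t] by simp
    show "snd (M 1 (?S (b t))) = of_real (norm (snd (M 1 (?S (b t))))) * cis (\<Theta> t - \<phi>)"
    proof -
      have "snd (M 1 (?S (b t))) = cis (- \<phi>) * (snd (b t) - q (fst (b t)))" by (simp add: M_def shear_def)
      moreover have "norm (snd (M 1 (?S (b t)))) = norm (snd (b t) - q (fst (b t)))"
        by (simp add: M_def shear_def norm_mult)
      moreover have "cis (- \<phi>) * (snd (b t) - q (fst (b t))) =
          of_real (norm (snd (b t) - q (fst (b t)))) * cis (\<Theta> t - \<phi>)"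
        by (subst Th(4)) (simp add: cis_mult)
      ultimately show ?thesis by simp
    qed
    \<comment> \<open>A point with first coordinate 0 and positive second coordinate has the
      direction of the moved centre; injectivity of the isotopies on directions would make it equal
      to x.\<close>
    assume f0: "fst (M 1 (?S (b t))) = 0"
    show "\<not> (Im (snd (M 1 (?S (b t)))) = 0 \<and> Re (snd (M 1 (?S (b t)))) > 0)"
    proof
      assume "Im (snd (M 1 (?S (b t)))) = 0 \<and> Re (snd (M 1 (?S (b t)))) > 0"
      then have "same_dir (M 1 (?S (b t))) (M 1 (?S x))" unfolding Mx same_dir_def using r f0
        by (intro exI[of _ "r / Re (snd (M 1 (?S (b t))))"]) (auto simp: prod_eq_iff complex_eq_iff)
      then have "same_dir (?S (b t)) (?S x)" by (rule Mdir)
      then show False using inj[of 1 "b t" x] b(2) x disj(3) by auto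
    qed
  qed
  then show ?thesis using h1 h2 unfolding sh0 M0 Mx My by simp
qed

section \<open>Hypersurfaces close to the unit sphere\<close>

definition cplx :: "(real \<times> real) ^ 'm::finite \<Rightarrow> (real \<times> real) ^ 'm" where
  "cplx x = (\<chi> i. (- snd (x $ i), fst (x $ i)))"

lemma cplx_linear: "cplx (x + y) = cplx x + cplx y" "cplx (r *\<^sub>R x) = r *\<^sub>R cplx x"
  "cplx (- x) = - cplx x" "cplx (x - y) = cplx x - cplx y" "cplx 0 = 0" "cplx (cplx x) = - x"
  by (simp_all add: cplx_def vec_eq_iff prod_eq_iff)

lemma inner_cplx_cplx [simp]: "cplx x \<bullet> cplx y = x \<bullet> y"
  by (simp add: cplx_def inner_vec_def inner_prod_def add.commute)

lemma norm_cplx [simp]: "norm (cplx x) = norm x"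
  by (simp add: norm_eq_sqrt_inner)

lemma inner_cplx_left: "cplx x \<bullet> y = - (x \<bullet> cplx y)"
  by (metis cplx_linear(6) inner_cplx_cplx inner_minus_left minus_minus)

lemma inner_cplx_self [simp]: "cplx x \<bullet> x = 0" "x \<bullet> cplx x = 0"
  using inner_cplx_left[of x x] by (simp_all add: inner_commute)

lemma symp_form_cplx: "symp_form x y = cplx x \<bullet> y"
  by (simp add: symp_form_def cplx_def inner_vec_def inner_prod_def)

lemma liouville_form_cplx: "liouville_form x y = 1/2 * (cplx x \<bullet> y)"
  by (simp add: liouville_form_def cplx_def inner_vec_def inner_prod_def algebra_simps)

lemma bounded_linear_cplx: "bounded_linear cplx"
  by (rule bounded_linear_intro[of _ 1]) (simp_all add: cplx_linear)

lemma norm_le_of_inner: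
  fixes X :: "'a::real_inner"
  assumes "X \<bullet> X \<le> C * norm X" "C \<ge> 0" shows "norm X \<le> C"
proof (cases "X = 0")
  case False
  then have "norm X * norm X \<le> C * norm X" using assms by (simp add: power2_norm_eq_inner[symmetric] power2_eq_square)
  then show ?thesis using False by simp
qed (use assms in simp)

text \<open>A Lipschitz bound on the derivative stands in for the second derivative: the estimates
  use only this, and it survives composition with a further C^2-small map. The ceiling 1/100 serves
  to absorb linear error terms.\<close>

locale near_sphere =
  fixes v :: "(real \<times> real) ^ 'm::finite \<Rightarrow> (real \<times> real) ^ 'm"
    and v' :: "(real \<times> real) ^ 'm \<Rightarrow> ((real \<times> real) ^ 'm) \<Rightarrow>\<^sub>L ((real \<times> real) ^ 'm)"
    and \<delta> :: real
  assumes small: "0 \<le> \<delta>" "\<delta> \<le> 1/100"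
    and v_deriv: "\<And>x. (v has_derivative blinfun_apply (v' x)) (at x)"
    and v_small: "\<And>x. norm (v x) \<le> \<delta>" "\<And>x. norm (v' x) \<le> \<delta>"
    and v'_lipschitz: "\<And>x y. norm (v' x - v' y) \<le> \<delta> * norm (x - y)"
begin

definition emb :: "(real \<times> real) ^ 'm \<Rightarrow> (real \<times> real) ^ 'm" where "emb x = x + v x"
definition demb :: "(real \<times> real) ^ 'm \<Rightarrow> (real \<times> real) ^ 'm \<Rightarrow> (real \<times> real) ^ 'm" where
  "demb x w = w + v' x w"

lemma emb_deriv: "(emb has_derivative demb x) (at x)"
  unfolding emb_def[abs_def] demb_def[abs_def] by (intro has_derivative_add has_derivative_ident v_deriv)

lemma v_lipschitz: "norm (v a - v b) \<le> \<delta> * norm (a - b)"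
  by (rule differentiable_bound[of UNIV v "\<lambda>x. blinfun_apply (v' x)"])
     (use v_deriv v_small in \<open>auto simp: norm_blinfun.rep_eq[symmetric]\<close>)

lemma emb_lower: "(1 - \<delta>) * norm (a - b) \<le> norm (emb a - emb b)"
proof -
  have "norm (a - b) \<le> norm (emb a - emb b) + norm (v a - v b)"
    unfolding emb_def using norm_triangle_ineq4[of "a + v a - (b + v b)" "v a - v b"] by simp
  then show ?thesis using v_lipschitz[of a b] by (simp add: algebra_simps)
qed

lemma emb_inject [simp]: "emb a = emb b \<longleftrightarrow> a = b"
  using emb_lower[of a b] small by (auto simp: mult_le_0_iff)

lemma demb_linear: "demb x (a + b) = demb x a + demb x b" "demb x (r *\<^sub>R a) = r *\<^sub>R demb x a"
  "demb x (a - b) = demb x a - demb x b"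
  by (simp_all add: demb_def blinfun.bilinear_simps algebra_simps)

lemma demb_near: "norm (demb x w - w) \<le> \<delta> * norm w"
  unfolding demb_def using norm_blinfun[of "v' x" w] v_small(2)[of x]
  by (simp add: order_trans[OF _ mult_right_mono])

lemma demb_upper: "norm (demb x w) \<le> (1 + \<delta>) * norm w"
  using demb_near[of x w] norm_triangle_sub[of "demb x w" w] by (simp add: algebra_simps)

lemma demb_lower: "(1 - \<delta>) * norm w \<le> norm (demb x w)"
  using demb_near[of x w] norm_triangle_sub[of w "demb x w"] by (simp add: norm_minus_commute algebra_simps)

lemma demb_diff: "norm (demb x w - demb y w) \<le> \<delta> * norm (x - y) * norm w"
proof -
  have "norm (demb x w - demb y w) = norm ((v' x - v' y) w)" by (simp add: demb_def blinfun.diff_left)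
  also have "\<dots> \<le> norm (v' x - v' y) * norm w" by (rule norm_blinfun)
  also have "\<dots> \<le> (\<delta> * norm (x - y)) * norm w" by (intro mult_right_mono v'_lipschitz) simp
  finally show ?thesis by simp
qed

lemma demb_inverse:
  obtains g where "bounded_linear g" "\<And>w. g (demb x w) = w" "\<And>w. demb x (g w) = w"
proof -
  have lin: "linear (demb x)" by (rule linearI) (simp_all add: demb_linear)
  have "demb x w = 0 \<Longrightarrow> w = 0" for w using demb_lower[of w x] small by (simp add: mult_le_0_iff)
  then have "inj (demb x)" using lin by (simp add: linear_injective_0)
  from linear_injective_isomorphism[OF lin this] show ?thesis
    using that linear_conv_bounded_linear by blast
qed

lemma emb_surj: "\<exists>z. emb z = p"
proof -
  have "\<exists>!x. p - v x = x"
  proof (rule banach_fix_type[of \<delta>])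
    show "\<forall>x y. dist (p - v x) (p - v y) \<le> \<delta> * dist x y"
      using v_lipschitz by (simp add: dist_norm norm_minus_commute)
  qed (use small in auto)
  then show ?thesis by (auto simp: emb_def algebra_simps)
qed

text \<open>The inverse of \<open>emb\<close>, a bijection of the whole space; it pulls the
  hypersurface and its curves back to the round sphere.\<close>

definition proj :: "(real \<times> real) ^ 'm \<Rightarrow> (real \<times> real) ^ 'm" where "proj p = (SOME z. emb z = p)"

lemma emb_proj [simp]: "emb (proj p) = p"
  unfolding proj_def by (rule someI_ex[OF emb_surj])

lemma proj_emb [simp]: "proj (emb z) = z"
  by (rule emb_inject[THEN iffD1]) simp

lemma proj_lipschitz: "norm (proj p - proj q) \<le> 2 * norm (p - q)"
proof -
  have "(1/2) * norm (proj p - proj q) \<le> (1 - \<delta>) * norm (proj p - proj q)"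
    by (rule mult_right_mono) (use small in auto)
  then show ?thesis using emb_lower[of "proj p" "proj q"] by simp
qed

lemma continuous_proj: "continuous (at p) proj"
proof (rule continuous_within_eps_delta[THEN iffD2, rule_format])
  fix e :: real assume "e > 0"
  then show "\<exists>d>0. \<forall>x'\<in>UNIV. dist x' p < d \<longrightarrow> dist (proj x') (proj p) < e"
    by (intro exI[of _ "e/2"]) (auto simp: dist_norm intro: le_less_trans[OF proj_lipschitz])
qed

lemma pull_back:
  assumes "(\<gamma> has_vector_derivative u) (at t)"
  obtains y' where "((\<lambda>t. proj (\<gamma> t)) has_vector_derivative y') (at t)" "demb (proj (\<gamma> t)) y' = u"
proof -
  obtain g where g: "bounded_linear g" "\<And>w. g (demb (proj (\<gamma> t)) w) = w" "\<And>w. demb (proj (\<gamma> t)) (g w) = w"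
    using demb_inverse by blast
  have "(proj has_derivative g) (at (\<gamma> t))"
    by (rule has_derivative_inverse_basic[OF emb_deriv g(1) _ continuous_proj open_UNIV]) (use g in auto)
  from vector_derivative_diff_chain_within[OF assms has_derivative_at_withinI[OF this]]
  have "((\<lambda>t. proj (\<gamma> t)) has_vector_derivative g u) (at t)" by (simp add: o_def)
  then show ?thesis using that g(3) by blast
qed

text \<open>The mean value inequality for v minus its linear part at x, on a ball about x containing
  a and b. The bound is quadratic and also vanishes when a and b collide; the comparison of
  stereographic projections depends on both features.\<close>

lemma remainder_bound:
  "norm ((v a - v b) - v' x (a - b)) \<le> \<delta> * max (norm (a - x)) (norm (b - x)) * norm (a - b)"
proof -
  let ?r = "max (norm (a - x)) (norm (b - x))"
  have "norm ((v a - v' x a) - (v b - v' x b)) \<le> (\<delta> * ?r) * norm (a - b)"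
  proof (rule differentiable_bound[of "cball x ?r" "\<lambda>z. v z - v' x z" "\<lambda>z w. (v' z - v' x) w"])
    fix z assume z: "z \<in> cball x ?r"
    show "((\<lambda>z. v z - v' x z) has_derivative (\<lambda>w. (v' z - v' x) w)) (at z within cball x ?r)"
      by (rule has_derivative_eq_rhs[OF has_derivative_at_withinI[OF has_derivative_diff[OF v_deriv
            bounded_linear_imp_has_derivative[OF blinfun.bounded_linear_right]]]])
         (simp add: blinfun.diff_left)
    have "norm (v' z - v' x) \<le> \<delta> * norm (z - x)" by (rule v'_lipschitz)
    also have "\<dots> \<le> \<delta> * ?r" using z small by (intro mult_left_mono) (auto simp: dist_norm norm_minus_commute)
    finally show "onorm (blinfun_apply (v' z - v' x)) \<le> \<delta> * ?r" by (simp add: norm_blinfun.rep_eq)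
  qed (auto simp: dist_norm norm_minus_commute)
  then show ?thesis by (simp add: blinfun.diff_right algebra_simps)
qed

text \<open>u is the Hamiltonian direction of |z|^2 / 2 for the symplectic form pulled back by
  \<open>emb\<close>. On the sphere it is symplectically orthogonal to all tangent vectors and spans
  the pulled-back characteristic line; for v = 0 it is the Hopf field \<open>cplx z\<close>. The
  equation also fixes its length.\<close>

definition char_dir :: "(real \<times> real) ^ 'm \<Rightarrow> (real \<times> real) ^ 'm \<Rightarrow> bool" where
  "char_dir z u \<longleftrightarrow> (\<forall>w. cplx (demb z u) \<bullet> demb z w = - (z \<bullet> w))"

lemma demb_form_near: "\<bar>cplx (demb z u) \<bullet> demb z w - cplx u \<bullet> w\<bar> \<le> 3 * \<delta> * norm u * norm w"
proof -
  have "cplx (demb z u) \<bullet> demb z w - cplx u \<bullet> w =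
      cplx (demb z u - u) \<bullet> demb z w + cplx u \<bullet> (demb z w - w)"
    by (simp add: cplx_linear inner_diff_left inner_diff_right)
  then have "\<bar>cplx (demb z u) \<bullet> demb z w - cplx u \<bullet> w\<bar> \<le>
      norm (cplx (demb z u - u)) * norm (demb z w) + norm (cplx u) * norm (demb z w - w)"
    using Cauchy_Schwarz_ineq2[of "cplx (demb z u - u)" "demb z w"] Cauchy_Schwarz_ineq2[of "cplx u" "demb z w - w"]
    by linarith
  also have "\<dots> \<le> (\<delta> * norm u) * (2 * norm w) + norm u * (\<delta> * norm w)"
  proof (intro add_mono mult_mono)
    show "norm (demb z w) \<le> 2 * norm w"
      using demb_upper[of z w] mult_right_mono[of "1 + \<delta>" 2 "norm w"] small by simp
  qed (use demb_near small in auto)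
  finally show ?thesis by (simp add: algebra_simps)
qed

lemma demb_form_diff:
  "\<bar>cplx (demb z u) \<bullet> demb z w - cplx (demb y u) \<bullet> demb y w\<bar> \<le> 3 * \<delta> * norm (z - y) * norm u * norm w"
proof -
  have up: "norm (demb z w) \<le> (3/2) * norm w" for z w
    using demb_upper[of z w] mult_right_mono[of "1 + \<delta>" "3/2" "norm w"] small by simp
  have "cplx (demb z u) \<bullet> demb z w - cplx (demb y u) \<bullet> demb y w =
      cplx (demb z u - demb y u) \<bullet> demb z w + cplx (demb y u) \<bullet> (demb z w - demb y w)"
    by (simp add: cplx_linear inner_diff_left inner_diff_right)
  then have "\<bar>cplx (demb z u) \<bullet> demb z w - cplx (demb y u) \<bullet> demb y w\<bar> \<le>
      norm (cplx (demb z u - demb y u)) * norm (demb z w) + norm (cplx (demb y u)) * norm (demb z w - demb y w)"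
    using Cauchy_Schwarz_ineq2[of "cplx (demb z u - demb y u)" "demb z w"]
      Cauchy_Schwarz_ineq2[of "cplx (demb y u)" "demb z w - demb y w"]
    by linarith
  also have "\<dots> \<le> (\<delta> * norm (z - y) * norm u) * ((3/2) * norm w) + ((3/2) * norm u) * (\<delta> * norm (z - y) * norm w)"
    by (intro add_mono mult_mono) (use demb_diff up small in auto)
  finally show ?thesis by (simp add: algebra_simps)
qed

text \<open>Testing the defining equation with \<open>cplx u + z\<close> bounds the norm of this
  very vector by the deviation of the pulled-back form from the standard one.\<close>

lemma char_dir_near:
  assumes "char_dir z u" "norm z = 1"
  shows "norm (u - cplx z) \<le> 6 * \<delta>"
proof -
  let ?X = "cplx u + z"
  have "?X \<bullet> ?X = - (cplx (demb z u) \<bullet> demb z ?X - cplx u \<bullet> ?X)"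
    using assms(1) unfolding char_dir_def by (simp add: inner_add_left)
  also have "\<dots> \<le> 3 * \<delta> * norm u * norm ?X" using demb_form_near[of z u ?X] by linarith
  finally have "norm ?X \<le> 3 * \<delta> * norm u" by (intro norm_le_of_inner) (use small in auto)
  moreover have "norm ?X = norm (u - cplx z)"
    using norm_cplx[of "u - cplx z"] by (simp add: cplx_linear)
  ultimately have e: "norm (u - cplx z) \<le> 3 * \<delta> * norm u" by simp
  have "norm u \<le> norm (u - cplx z) + 1" using norm_triangle_sub[of u "cplx z"] assms(2) by simp
  moreover have "3 * \<delta> * norm u \<le> (1/2) * norm u" using small by (intro mult_right_mono) auto
  ultimately have "norm u \<le> 2" using e by linarith
  then have "3 * \<delta> * norm u \<le> 3 * \<delta> * 2" using small by (intro mult_left_mono) auto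
  then show ?thesis using e by simp
qed

lemma char_dir_norm: "char_dir z u \<Longrightarrow> norm z = 1 \<Longrightarrow> norm u \<le> 2"
  using char_dir_near[of z u] norm_triangle_sub[of u "cplx z"] small by simp

text \<open>The difference of the two defining equations, tested with
  \<open>cplx (u - w) + (z - y)\<close>, leaves two errors: the deviation of the form on u - w, and
  its change between z and y, where the Lipschitz bound on \<open>v'\<close> enters. Since |u - w|
  \<le> 2 |z - y|, each contributes 6 \<delta> |z - y|.\<close>

lemma char_dir_lipschitz:
  assumes "char_dir z u" "norm z = 1" "char_dir y w" "norm y = 1"
  shows "norm ((u - w) - cplx (z - y)) \<le> 12 * \<delta> * norm (z - y)"
proof -
  let ?X = "cplx (u - w) + (z - y)"
  have "cplx (demb z (u - w)) \<bullet> demb z X =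
      - ((z - y) \<bullet> X) - (cplx (demb z w) \<bullet> demb z X - cplx (demb y w) \<bullet> demb y X)" for X
  proof -
    have "cplx (demb z (u - w)) \<bullet> demb z X = cplx (demb z u) \<bullet> demb z X - cplx (demb z w) \<bullet> demb z X"
      by (simp add: demb_linear cplx_linear inner_diff_left)
    moreover have "cplx (demb z u) \<bullet> demb z X = - (z \<bullet> X)" "cplx (demb y w) \<bullet> demb y X = - (y \<bullet> X)"
      using assms(1,3) unfolding char_dir_def by blast+
    ultimately show ?thesis by (simp add: inner_diff_left)
  qed
  note this[of ?X]
  then have "?X \<bullet> ?X = - (cplx (demb z (u - w)) \<bullet> demb z ?X - cplx (u - w) \<bullet> ?X)
      - (cplx (demb z w) \<bullet> demb z ?X - cplx (demb y w) \<bullet> demb y ?X)"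
    by (simp add: inner_add_left)
  also have "\<dots> \<le> (3 * \<delta> * norm (u - w) + 3 * \<delta> * norm (z - y) * norm w) * norm ?X"
    using demb_form_near[of z "u - w" ?X] demb_form_diff[of z w ?X y] by (simp add: algebra_simps)
  finally have "norm ?X \<le> 3 * \<delta> * norm (u - w) + 3 * \<delta> * norm (z - y) * norm w"
    by (intro norm_le_of_inner) (use small in auto)
  also have "\<dots> \<le> 3 * \<delta> * norm (u - w) + 3 * \<delta> * norm (z - y) * 2"
    using char_dir_norm[OF assms(3,4)] small by (intro add_mono mult_left_mono) auto
  finally have X: "norm ?X \<le> 3 * \<delta> * norm (u - w) + 6 * \<delta> * norm (z - y)" by simp
  moreover have "norm ?X = norm ((u - w) - cplx (z - y))"
  proof -
    have "cplx ((u - w) - cplx (z - y)) = ?X" by (simp add: cplx_linear algebra_simps)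
    then show ?thesis using norm_cplx by metis
  qed
  ultimately have e: "norm ((u - w) - cplx (z - y)) \<le> 3 * \<delta> * norm (u - w) + 6 * \<delta> * norm (z - y)" by simp
  have a: "norm (u - w) \<le> norm ((u - w) - cplx (z - y)) + norm (z - y)"
    using norm_triangle_sub[of "u - w" "cplx (z - y)"] by simp
  have b: "3 * \<delta> * norm (u - w) \<le> (1/4) * norm (u - w)" "6 * \<delta> * norm (z - y) \<le> (1/4) * norm (z - y)"
    using small by (intro mult_right_mono; simp)+
  have "norm (u - w) \<le> 2 * norm (z - y)" using a b e norm_ge_zero[of "z - y"] by linarith
  then have "3 * \<delta> * norm (u - w) \<le> 3 * \<delta> * (2 * norm (z - y))" using small by (intro mult_left_mono) auto
  then show ?thesis using e by simp
qed

text \<open>On the round sphere the pairing is \<open>cplx z \<bullet> cplx z\<close>, that is 1. Up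
  to the factor 1/2 it is the Liouville form along the characteristic direction, so the action is
  close to half the period.\<close>

lemma action_density_near:
  assumes "char_dir z u" "norm z = 1"
  shows "\<bar>cplx (emb z) \<bullet> demb z u - 1\<bar> \<le> 12 * \<delta>"
proof -
  have "1 = cplx z \<bullet> cplx z" using assms(2) by (simp add: norm_eq_sqrt_inner)
  then have "cplx (emb z) \<bullet> demb z u - 1 = cplx (v z) \<bullet> demb z u + cplx z \<bullet> (demb z u - u) + cplx z \<bullet> (u - cplx z)"
    by (simp add: emb_def cplx_linear inner_add_left inner_diff_right)
  moreover have "\<bar>cplx (v z) \<bullet> demb z u\<bar> \<le> \<delta> * 4"
  proof -
    have "norm (demb z u) \<le> 4"
      using demb_upper[of z u] char_dir_norm[OF assms] small mult_mono[of "1 + \<delta>" 2 "norm u" 2] by simp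
    then have "norm (cplx (v z)) * norm (demb z u) \<le> \<delta> * 4" using v_small(1)[of z] small by (intro mult_mono) auto
    then show ?thesis using Cauchy_Schwarz_ineq2[of "cplx (v z)" "demb z u"] by linarith
  qed
  moreover have "\<bar>cplx z \<bullet> (demb z u - u)\<bar> \<le> \<delta> * 2"
    using Cauchy_Schwarz_ineq2[of "cplx z" "demb z u - u"] demb_near[of z u] char_dir_norm[OF assms] small assms(2)
      mult_left_mono[of "norm u" 2 \<delta>] by simp
  moreover have "\<bar>cplx z \<bullet> (u - cplx z)\<bar> \<le> 6 * \<delta>"
    using Cauchy_Schwarz_ineq2[of "cplx z" "u - cplx z"] char_dir_near[OF assms] assms(2) by simp
  ultimately show ?thesis by linarith
qed

definition surf :: "((real \<times> real) ^ 'm) set" where "surf = emb ` sphere 0 1"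

lemma in_surf_iff: "p \<in> surf \<longleftrightarrow> norm (proj p) = 1"
proof
  assume "norm (proj p) = 1"
  then show "p \<in> surf" unfolding surf_def by (intro image_eqI[of _ _ "proj p"]) auto
qed (auto simp: surf_def)

lemma tangent_space_surf:
  assumes "norm z = 1"
  shows "tangent_space surf (emb z) = {demb z w |w. z \<bullet> w = 0}"
proof (intro set_eqI iffI)
  fix u assume "u \<in> tangent_space surf (emb z)"
  then obtain c where c: "c 0 = emb z" "\<And>t. c t \<in> surf" "(c has_vector_derivative u) (at 0)"
    unfolding tangent_space_def by blast
  obtain y' where y': "((\<lambda>t. proj (c t)) has_vector_derivative y') (at 0)" "demb (proj (c 0)) y' = u"
    using pull_back[OF c(3)] by blast
  have "((\<lambda>t. proj (c t) \<bullet> proj (c t)) has_real_derivative (proj (c 0) \<bullet> y' + y' \<bullet> proj (c 0))) (at 0)"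
    unfolding has_real_derivative_iff_has_vector_derivative
    by (rule bounded_bilinear.has_vector_derivative[OF bounded_bilinear_inner y'(1) y'(1)])
  moreover have "(\<lambda>t. proj (c t) \<bullet> proj (c t)) = (\<lambda>t. 1)"
    using c(2) unfolding in_surf_iff by (auto simp: norm_eq_1)
  ultimately have "proj (c 0) \<bullet> y' + y' \<bullet> proj (c 0) = 0"
    by (metis DERIV_const DERIV_unique)
  then have "z \<bullet> y' = 0" by (simp add: c(1) inner_commute)
  then show "u \<in> {demb z w |w. z \<bullet> w = 0}" using y'(2) c(1) by auto
next
  fix u assume "u \<in> {demb z w |w. z \<bullet> w = 0}"
  then obtain w where w: "u = demb z w" "z \<bullet> w = 0" by blast
  \<comment> \<open>\<open>tangent_space\<close> asks for a curve that stays in \<open>surf\<close>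
    for all times; the straight line z + t w divided by its norm \<open>k t\<close> provides one,
    and \<open>k\<close> is stationary at 0 because w is orthogonal to z.\<close>
  define k where "k t = norm (z + t *\<^sub>R w)" for t :: real
  have nz: "z + t *\<^sub>R w \<noteq> 0" for t
  proof
    assume "z + t *\<^sub>R w = 0"
    then have "z \<bullet> (z + t *\<^sub>R w) = 0" by simp
    then show False using w(2) assms by (simp add: inner_add_right norm_eq_1)
  qed
  have d1: "((\<lambda>t. z + t *\<^sub>R w) has_vector_derivative w) (at 0)" by (auto intro!: derivative_eq_intros)
  have dk: "((\<lambda>t. inverse (k t)) has_real_derivative 0) (at 0)"
  proof -
    have "((\<lambda>t. norm (z + t *\<^sub>R w)) has_derivative (\<lambda>h. (h *\<^sub>R w) \<bullet> sgn (z + 0 *\<^sub>R w))) (at 0)"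
      using has_derivative_compose[OF d1[unfolded has_vector_derivative_def] has_derivative_norm] nz[of 0] by simp
    then have "(k has_real_derivative 0) (at 0)"
      unfolding has_field_derivative_def k_def[abs_def]
      by (rule has_derivative_eq_rhs) (use assms w(2) in \<open>auto simp: sgn_div_norm inner_commute\<close>)
    from DERIV_inverse'[OF this] show ?thesis using assms by (simp add: k_def)
  qed
  have "((\<lambda>t. inverse (k t) *\<^sub>R (z + t *\<^sub>R w)) has_vector_derivative w) (at 0)"
    using has_vector_derivative_scaleR[OF dk d1] assms by (simp add: k_def)
  then have "((emb \<circ> (\<lambda>t. inverse (k t) *\<^sub>R (z + t *\<^sub>R w))) has_vector_derivative demb z w) (at 0)"
    by (rule vector_derivative_diff_chain_within)
       (use has_derivative_at_withinI[OF emb_deriv[of z]] assms in \<open>simp add: k_def\<close>)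
  moreover have "norm (inverse (k t) *\<^sub>R (z + t *\<^sub>R w)) = 1" for t using nz[of t] by (simp add: k_def)
  ultimately show "u \<in> tangent_space surf (emb z)"
    unfolding tangent_space_def w(1) surf_def
    by (intro CollectI exI[of _ "emb \<circ> (\<lambda>t. inverse (k t) *\<^sub>R (z + t *\<^sub>R w))"]) (use assms in \<open>auto simp: k_def\<close>)
qed

lemma characteristic_pull_back:
  assumes "\<gamma> C1_differentiable_on UNIV" "\<And>t. velocity \<gamma> t \<noteq> 0" "\<And>t. \<gamma> t \<in> surf"
    and "\<And>t. velocity \<gamma> t \<in> symp_orth (tangent_space surf (\<gamma> t))"
  obtains y c u where "\<And>t. \<gamma> t = emb (y t)" "\<And>t. norm (y t) = 1"
    "\<And>t. (y has_vector_derivative c t *\<^sub>R u t) (at t)" "\<And>t. char_dir (y t) (u t)"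
    "continuous_on UNIV c" "\<And>t. c t \<noteq> (0::real)" "continuous_on UNIV (\<lambda>t. c t *\<^sub>R u t)"
    "\<And>t. velocity \<gamma> t = c t *\<^sub>R demb (y t) (u t)"
proof -
  define y where "y t = proj (\<gamma> t)" for t
  obtain D where D: "\<And>t. (\<gamma> has_vector_derivative D t) (at t)" "continuous_on UNIV D"
    using assms(1) unfolding C1_differentiable_on_def by blast
  have vel: "velocity \<gamma> t = D t" for t by (rule vector_derivative_at[OF D(1)])
  have "\<exists>y'. (y has_vector_derivative y') (at t) \<and> demb (y t) y' = D t" for t
    unfolding y_def[abs_def] using pull_back[OF D(1)[of t]] by metis
  then obtain y' where y': "\<And>t. (y has_vector_derivative y' t) (at t)" "\<And>t. demb (y t) (y' t) = D t" by metis
  have yn: "norm (y t) = 1" for t using assms(3) by (simp add: in_surf_iff y_def)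
  have ge: "\<gamma> t = emb (y t)" for t by (simp add: y_def)
  \<comment> \<open>The symplectic pairing with the velocity kills all tangent vectors, hence is a
    multiple of the inner product with \<open>y t\<close>; the factor is read off at w =
    \<open>y t\<close>.\<close>
  define c where "c t = - (cplx (D t) \<bullet> demb (y t) (y t))" for t
  have key: "cplx (D t) \<bullet> demb (y t) w = - c t * (y t \<bullet> w)" for t w
  proof -
    let ?w = "w - (y t \<bullet> w) *\<^sub>R y t"
    have "y t \<bullet> ?w = 0" using yn[of t] by (simp add: inner_diff_right norm_eq_1)
    then have "demb (y t) ?w \<in> tangent_space surf (\<gamma> t)" unfolding ge tangent_space_surf[OF yn] by blast
    then have "cplx (D t) \<bullet> demb (y t) ?w = 0"
      using assms(4)[of t] unfolding symp_orth_def symp_form_cplx vel by blast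
    then show ?thesis by (simp add: demb_linear inner_diff_right c_def)
  qed
  \<comment> \<open>With c = 0 the pulled-back form would annihilate a nonzero \<open>y' t\<close>;
    its closeness to the standard form, tested on \<open>cplx (y' t)\<close>, excludes this.\<close>
  have cnz: "c t \<noteq> 0" for t
  proof
    assume "c t = 0"
    then have z: "cplx (demb (y t) (y' t)) \<bullet> demb (y t) (cplx (y' t)) = 0" using key[of t] y'(2) by simp
    have "norm (y' t) * norm (y' t) \<le> 3 * \<delta> * norm (y' t) * norm (y' t)"
      using demb_form_near[of "y t" "y' t" "cplx (y' t)"] z
      by (simp add: power2_norm_eq_inner[symmetric] power2_eq_square)
    then have "(1 - 3 * \<delta>) * (norm (y' t) * norm (y' t)) \<le> 0" by (simp add: algebra_simps)
    then have "y' t = 0" using small by (simp add: mult_le_0_iff)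
    then have "D t = 0" using y'(2)[of t] demb_linear(2)[of "y t" 0 0] by simp
    then show False using assms(2)[of t] vel by simp
  qed
  define u where "u t = (1 / c t) *\<^sub>R y' t" for t
  have cu: "c t *\<^sub>R u t = y' t" for t using cnz by (simp add: u_def)
  have cd: "char_dir (y t) (u t)" for t unfolding char_dir_def
  proof
    fix w
    have "cplx (demb (y t) (u t)) \<bullet> demb (y t) w = (1 / c t) * (cplx (D t) \<bullet> demb (y t) w)"
      unfolding u_def y'(2)[symmetric] by (simp add: demb_linear cplx_linear)
    also have "\<dots> = - (y t \<bullet> w)" unfolding key using cnz[of t] by simp
    finally show "cplx (demb (y t) (u t)) \<bullet> demb (y t) w = - (y t \<bullet> w)" .
  qed
  have yc: "isCont y t" for t using y'(1) has_vector_derivative_continuous by blast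
  have v'c: "isCont v' x" for x
  proof (rule continuous_within_eps_delta[THEN iffD2, rule_format])
    fix e :: real assume "e > 0"
    then show "\<exists>d>0. \<forall>x'\<in>UNIV. dist x' x < d \<longrightarrow> dist (v' x') (v' x) < e"
      using small by (intro exI[of _ e])
        (auto simp: dist_norm intro!: le_less_trans[OF v'_lipschitz] le_less_trans[OF mult_left_le_one_le])
  qed
  have Ac: "isCont (\<lambda>t. demb (y t) (h t)) t" if "isCont h t" for h t
    unfolding demb_def by (intro continuous_intros that isCont_o2[OF yc v'c])
  have Dc: "isCont D t" for t using D(2) by (simp add: continuous_on_eq_continuous_at)
  have cc: "continuous_on UNIV c" unfolding continuous_on_eq_continuous_at[OF open_UNIV] c_def[abs_def]
    by (intro ballI continuous_intros Ac yc isCont_o2[OF Dc] linear_continuous_at bounded_linear_cplx)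
  \<comment> \<open>\<open>y'\<close> is known only through \<open>demb (y t) (y' t) = D t\<close>;
    the uniform lower bound on \<open>demb\<close> turns the continuity of \<open>D\<close> into
    that of \<open>y'\<close>.\<close>
  have "isCont y' t" for t
  proof -
    have b: "norm (y' s - y' t) \<le> 2 * norm (demb (y s) (y' s) - demb (y s) (y' t))" for s
    proof -
      have "(1/2) * norm (y' s - y' t) \<le> (1 - \<delta>) * norm (y' s - y' t)" by (rule mult_right_mono) (use small in auto)
      then show ?thesis using demb_lower[of "y' s - y' t" "y s"] by (simp add: demb_linear)
    qed
    have "((\<lambda>s. D s - demb (y s) (y' t)) \<longlongrightarrow> D t - demb (y t) (y' t)) (at t)"
      by (intro tendsto_diff isContD Dc Ac) simp
    then have "((\<lambda>s. 2 * norm (D s - demb (y s) (y' t))) \<longlongrightarrow> 2 * norm (D t - demb (y t) (y' t))) (at t)"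
      by (rule tendsto_mult_left[OF tendsto_norm])
    then have t0: "((\<lambda>s. 2 * norm (D s - demb (y s) (y' t))) \<longlongrightarrow> 0) (at t)" by (simp add: y'(2))
    have "((\<lambda>s. y' s - y' t) \<longlongrightarrow> 0) (at t)"
      by (rule Lim_null_comparison[OF _ t0]) (use b in \<open>simp add: y'(2)\<close>)
    then show ?thesis by (simp add: isCont_def LIM_zero_iff)
  qed
  then have "continuous_on UNIV y'" by (simp add: continuous_on_eq_continuous_at)
  then show ?thesis
    using that[OF ge yn _ cd cc cnz] y'(1) unfolding cu using y'(2) vel
    by (metis cu demb_linear(2))
qed

end

text \<open>The strict inequality \<delta>' < \<delta> leaves room for one more perturbation of the
  surface, which is what openness in \<open>C2_topology\<close> asks for.\<close>

definition near_nbhd :: "real \<Rightarrow> ((real \<times> real) ^ 'm::finite) set set" where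
  "near_nbhd \<delta> = {S \<in> Conv. \<exists>\<delta>' v v'. \<delta>' < \<delta> \<and> near_sphere v v' \<delta>' \<and> S = near_sphere.surf v}"

text \<open>Following x + v x by x + w x gives x + u x with \<open>u x = v x + w (emb x)\<close>.
  The chain rule bounds u, u' and the Lipschitz constant of u' by \<delta>' + 7 \<eta>, where \<eta>
  is the size of w.\<close>

lemma openin_near_nbhd:
  assumes "\<delta> \<le> 1/100"
  shows "openin C2_topology (near_nbhd \<delta> :: ((real \<times> real) ^ 'm::finite) set set)"
  unfolding openin_C2_topology
proof (intro conjI ballI)
  show "near_nbhd \<delta> \<subseteq> (Conv :: ((real \<times> real) ^ 'm) set set)" unfolding near_nbhd_def by blast
  fix S :: "((real \<times> real) ^ 'm) set" assume "S \<in> near_nbhd \<delta>"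
  then obtain \<delta>' v v' where d': "\<delta>' < \<delta>" and ns: "near_sphere v v' \<delta>'" and S: "S = near_sphere.surf v"
    unfolding near_nbhd_def by blast
  interpret near_sphere v v' \<delta>' by (rule ns)
  \<comment> \<open>An eighth of the gap, so that \<delta>' + 7 \<eta> is still strictly below
    \<delta>.\<close>
  define \<eta> where "\<eta> = (\<delta> - \<delta>') / 8"
  have \<eta>: "\<eta> > 0" "\<delta>' + 8 * \<eta> = \<delta>" using d' by (simp_all add: \<eta>_def field_simps)
  have "C2_nbhd S \<eta> \<subseteq> near_nbhd \<delta>"
  proof
    fix S' assume "S' \<in> C2_nbhd S \<eta>"
    then obtain w where w: "S' \<in> Conv" "C2_less w \<eta>" "S' = (\<lambda>x. x + w x) ` S" unfolding C2_nbhd_def by blast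
    then obtain w' w'' where w': "\<And>x. (w has_derivative blinfun_apply (w' x)) (at x)"
      "\<And>x. (w' has_derivative blinfun_apply (w'' x)) (at x)"
      "\<And>x. norm (w x) < \<eta>" "\<And>x. norm (w' x) < \<eta>" "\<And>x. norm (w'' x) < \<eta>"
      unfolding C2_less_def by blast
    have w'_lip: "norm (w' x - w' y) \<le> \<eta> * norm (x - y)" for x y
      by (rule differentiable_bound[of UNIV w' "\<lambda>x. blinfun_apply (w'' x)"])
         (use w' in \<open>auto simp: norm_blinfun.rep_eq[symmetric] intro: less_imp_le\<close>)
    define u where "u x = v x + w (emb x)" for x
    define D where "D x = id_blinfun + v' x" for x
    define u' where "u' x = v' x + (w' (emb x) o\<^sub>L D x)" for x
    have nD: "norm (D x) \<le> 1 + \<delta>'" for x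
      unfolding D_def using norm_triangle_ineq[of id_blinfun "v' x"] v_small(2)[of x] norm_blinfun_id_le
      by (metis (no_types, opaque_lifting) add_mono order_trans)
    have "near_sphere u u' (\<delta>' + 7 * \<eta>)"
    proof
      show "0 \<le> \<delta>' + 7 * \<eta>" using small \<eta> by simp
      show "\<delta>' + 7 * \<eta> \<le> 1/100" using assms \<eta> by simp
      fix x y
      have "((\<lambda>x. w (emb x)) has_derivative (\<lambda>h. w' (emb x) (demb x h))) (at x)"
        by (rule has_derivative_compose[OF emb_deriv w'(1)])
      from has_derivative_add[OF v_deriv this]
      show "(u has_derivative blinfun_apply (u' x)) (at x)"
        unfolding u_def[abs_def] u'_def D_def by (simp add: blinfun.bilinear_simps demb_def plus_blinfun.rep_eq id_blinfun.rep_eq)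
      show "norm (u x) \<le> \<delta>' + 7 * \<eta>"
        unfolding u_def using norm_triangle_ineq[of "v x" "w (emb x)"] v_small(1)[of x] w'(3)[of "emb x"] \<eta> by linarith
      have c: "norm (w' (emb x) o\<^sub>L D x) \<le> 2 * \<eta>"
      proof -
        have "norm (w' (emb x) o\<^sub>L D x) \<le> norm (w' (emb x)) * norm (D x)" by (rule norm_blinfun_compose)
        also have "\<dots> \<le> \<eta> * 2"
          using w'(4)[of "emb x"] nD[of x] small \<eta> by (intro mult_mono) auto
        finally show ?thesis by simp
      qed
      show "norm (u' x) \<le> \<delta>' + 7 * \<eta>"
        unfolding u'_def using norm_triangle_ineq[of "v' x" "w' (emb x) o\<^sub>L D x"] v_small(2)[of x] c \<eta> by linarith
      have e: "u' x - u' y = (v' x - v' y) + ((w' (emb x) - w' (emb y)) o\<^sub>L D x) + (w' (emb y) o\<^sub>L (v' x - v' y))"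
        unfolding u'_def D_def
        by (intro blinfun_eqI) (simp add: blinfun.bilinear_simps plus_blinfun.rep_eq minus_blinfun.rep_eq)
      have "norm (emb x - emb y) \<le> 2 * norm (x - y)"
      proof -
        have "norm (emb x - emb y) \<le> norm (x - y) + norm (v x - v y)"
          unfolding emb_def using norm_triangle_ineq[of "x - y" "v x - v y"] by (simp add: algebra_simps)
        moreover have "\<delta>' * norm (x - y) \<le> 1 * norm (x - y)" using small by (intro mult_right_mono) auto
        ultimately show ?thesis using v_lipschitz[of x y] by linarith
      qed
      then have "\<eta> * norm (emb x - emb y) \<le> \<eta> * (2 * norm (x - y))" using \<eta> by (intro mult_left_mono) auto
      then have a1: "norm (w' (emb x) - w' (emb y)) \<le> 2 * \<eta> * norm (x - y)"
        using w'_lip[of "emb x" "emb y"] by linarith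
      have "norm ((w' (emb x) - w' (emb y)) o\<^sub>L D x) \<le> norm (w' (emb x) - w' (emb y)) * norm (D x)"
        by (rule norm_blinfun_compose)
      also have "\<dots> \<le> (2 * \<eta> * norm (x - y)) * 2" using a1 nD[of x] small \<eta> by (intro mult_mono) auto
      finally have a2: "norm ((w' (emb x) - w' (emb y)) o\<^sub>L D x) \<le> 4 * \<eta> * norm (x - y)" by simp
      have "norm (w' (emb y) o\<^sub>L (v' x - v' y)) \<le> norm (w' (emb y)) * norm (v' x - v' y)"
        by (rule norm_blinfun_compose)
      also have "\<dots> \<le> \<eta> * (1 * norm (x - y))"
        using w'(4)[of "emb y"] v'_lipschitz[of x y] small \<eta> mult_right_mono[of \<delta>' 1 "norm (x - y)"]
        by (intro mult_mono) auto
      finally have a3: "norm (w' (emb y) o\<^sub>L (v' x - v' y)) \<le> \<eta> * norm (x - y)" by simp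
      have "norm (u' x - u' y) \<le> \<delta>' * norm (x - y) + 4 * \<eta> * norm (x - y) + \<eta> * norm (x - y)"
        unfolding e using a2 a3 v'_lipschitz[of x y] by (intro norm_triangle_le add_mono) auto
      also have "\<dots> \<le> (\<delta>' + 7 * \<eta>) * norm (x - y)" using \<eta> by (simp add: algebra_simps)
      finally show "norm (u' x - u' y) \<le> (\<delta>' + 7 * \<eta>) * norm (x - y)" .
    qed
    moreover have "S' = near_sphere.surf u"
    proof -
      interpret N: near_sphere u u' "\<delta>' + 7 * \<eta>" by fact
      have "N.emb x = emb x + w (emb x)" for x by (simp add: N.emb_def emb_def u_def)
      then show ?thesis unfolding w(3) S surf_def N.surf_def by (simp add: image_image)
    qed
    ultimately show "S' \<in> near_nbhd \<delta>" using w(1) \<eta> unfolding near_nbhd_def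
      by (intro CollectI conjI exI[of _ "\<delta>' + 7 * \<eta>"] exI[of _ u] exI[of _ u']) auto
  qed
  then show "\<exists>\<delta>'>0. C2_nbhd S \<delta>' \<subseteq> near_nbhd \<delta>" using \<eta> by blast
qed

section \<open>The round sphere, and the inside of a convex hypersurface\<close>

lemma sphere_in_Conv: "sphere 0 1 \<in> (Conv :: ((real \<times> real) ^ 'm::finite) set set)"
proof -
  have "C2_hypersurface (sphere (0::(real \<times> real) ^ 'm) 1)" unfolding C2_hypersurface_def
  proof
    fix x :: "(real \<times> real) ^ 'm" assume x: "x \<in> sphere 0 1"
    let ?f = "\<lambda>x::(real \<times> real) ^ 'm. x \<bullet> x - 1"
    let ?f' = "\<lambda>x::(real \<times> real) ^ 'm. 2 *\<^sub>R blinfun_inner_left x"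
    let ?f'' = "Blinfun ?f'"
    have d1: "(?f has_derivative blinfun_apply (?f' y)) (at y)" for y
      by (rule has_derivative_eq_rhs, (rule derivative_intros)+)
         (auto simp: scaleR_blinfun.rep_eq inner_commute)
    have bl: "bounded_linear ?f'" by (rule bounded_linear_compose[OF bounded_linear_scaleR_right bounded_linear_blinfun_inner_left])
    have "C2_on (UNIV - {0}) ?f" unfolding C2_on_def
      by (rule exI[of _ ?f'], rule exI[of _ "\<lambda>_. ?f''"])
         (auto intro!: d1 bounded_linear_imp_has_derivative bl simp: bounded_linear_Blinfun_apply[OF bl])
    moreover have "\<not> (?f has_derivative (\<lambda>_. 0)) (at y)" if "y \<in> UNIV - {0}" for y
    proof
      assume "(?f has_derivative (\<lambda>_. 0)) (at y)"
      then have "blinfun_apply (?f' y) = (\<lambda>_. 0)" using d1 has_derivative_unique by blast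
      then have "blinfun_apply (?f' y) y = 0" by (rule fun_cong)
      then show False using that by (simp add: scaleR_blinfun.rep_eq)
    qed
    ultimately show "\<exists>U (f ::(real \<times> real) ^ 'm \<Rightarrow> real). open U \<and> x \<in> U \<and> C2_on U f \<and> sphere 0 1 \<inter> U = {y \<in> U. f y = 0} \<and>
       (\<forall>y\<in>U. \<not> (f has_derivative (\<lambda>_. 0)) (at y))"
      using x by (intro exI[of _ "UNIV - {0}"] exI[of _ ?f]) (auto simp: norm_eq_1 open_delete)
  qed
  moreover have "strictly_convex_body (cball (0::(real \<times> real) ^ 'm) 1)" unfolding strictly_convex_body_def
  proof (intro conjI ballI impI subsetI)
    fix x y z :: "(real \<times> real) ^ 'm" assume xy: "x \<in> cball 0 1" "y \<in> cball 0 1" "z \<in> open_segment x y"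
    then show "z \<in> interior (cball 0 1)"
      using dist_decreases_open_segment[OF xy(3), of 0] by (auto simp: dist_norm)
  qed auto
  ultimately show ?thesis unfolding Conv_def by (auto intro!: exI[of _ "cball 0 1"])
qed

lemma sphere_in_near_nbhd:
  assumes "\<delta> > 0"
  shows "sphere 0 1 \<in> (near_nbhd \<delta> :: ((real \<times> real) ^ 'm::finite) set set)"
proof -
  have ns: "near_sphere (\<lambda>_. 0) (\<lambda>_::(real \<times> real) ^ 'm. 0) 0" by standard (auto simp: zero_blinfun.rep_eq)
  interpret near_sphere "\<lambda>_. 0" "\<lambda>_::(real \<times> real) ^ 'm. 0" 0 by (rule ns)
  have "surf = sphere 0 1" by (simp add: surf_def emb_def)
  then show ?thesis using sphere_in_Conv ns assms unfolding near_nbhd_def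
    by (intro CollectI conjI exI[of _ "0::real"] exI[of _ "\<lambda>_. 0"]) auto
qed

lemma inside_frontier_strictly_convex:
  fixes K :: "'a::euclidean_space set"
  assumes "strictly_convex_body K"
  shows "convex K" "inside (frontier K) = interior K"
proof -
  show "convex K" unfolding convex_contains_open_segment
    using assms interior_subset unfolding strictly_convex_body_def by (metis empty_subsetI open_segment_idem order_trans)
  then show "inside (frontier K) = interior K"
    using assms compact_imp_bounded unfolding strictly_convex_body_def by (intro inside_frontier_eq_interior) auto
qed

context near_sphere
begin

lemma continuous_on_proj: "continuous_on X proj"
  by (simp add: continuous_at_imp_continuous_on continuous_proj)

text \<open>The continuous function \<open>norm (proj q)\<close> avoids the value 1 off
  \<open>surf\<close>, so it stays below 1 on the component of p, which is therefore
  bounded.\<close>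

lemma inside_surf:
  assumes "norm (proj p) < 1"
  shows "p \<in> inside surf"
proof -
  let ?C = "connected_component_set (- surf) p"
  have "norm (proj q) < 1" if q: "q \<in> ?C" for q
  proof (rule ccontr)
    assume n: "\<not> norm (proj q) < 1"
    have "connected ((\<lambda>q. norm (proj q)) ` ?C)"
      by (intro connected_continuous_image continuous_on_norm continuous_on_proj) simp
    moreover have "norm (proj p) \<in> (\<lambda>q. norm (proj q)) ` ?C"
      using assms q by (auto intro!: imageI simp: in_surf_iff connected_component_refl_eq)
    ultimately have "1 \<in> (\<lambda>q. norm (proj q)) ` ?C"
      using n assms q unfolding connected_iff_interval by (meson imageI less_imp_le not_less)
    then obtain r where "r \<in> ?C" "norm (proj r) = 1" by auto
    then show False using connected_component_subset[of "- surf" p] in_surf_iff by auto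
  qed
  then have "?C \<subseteq> cball 0 2"
  proof (intro subsetI)
    fix q assume "\<And>q. q \<in> ?C \<Longrightarrow> norm (proj q) < 1" "q \<in> ?C"
    then have "norm (proj q) < 1" by blast
    moreover have "norm q \<le> norm (proj q) + norm (v (proj q))"
      using norm_triangle_ineq[of "proj q" "v (proj q)"] emb_proj[of q] by (simp add: emb_def)
    ultimately show "q \<in> cball 0 2" using v_small(1)[of "proj q"] small by simp
  qed
  then have "bounded ?C" using bounded_cball bounded_subset by blast
  then show ?thesis using assms unfolding inside_def by (auto simp: in_surf_iff)
qed

text \<open>n is the outward normal before normalisation: z transported by the adjoint of the
  inverse of \<open>demb z\<close>. In this form its pairing with \<open>demb z w\<close> is exact,
  which the estimate of the projection exploits.\<close>

lemma inward_normal_surf: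
  assumes "surf \<in> Conv" "norm z = 1"
  obtains n where "\<And>w. n \<bullet> demb z w = z \<bullet> w" "norm (n - z) \<le> 2 * \<delta>" "n \<noteq> 0"
    "inward_normal surf (emb z) = - ((1 / norm n) *\<^sub>R n)"
proof -
  obtain K where K: "strictly_convex_body K" "surf = frontier K" using assms(1) unfolding Conv_def by blast
  obtain g where g: "bounded_linear g" "\<And>w. g (demb z w) = w" "\<And>w. demb z (g w) = w"
    using demb_inverse by blast
  define n where "n = adjoint g z"
  have n: "n \<bullet> demb z w = z \<bullet> w" for w
    using adjoint_works[OF bounded_linear.linear[OF g(1)], of "demb z w" z] g(2)
    by (simp add: n_def inner_commute)
  have "n \<bullet> demb z z = 1" using n[of z] assms(2) by (simp add: norm_eq_1)
  then have nz: "n \<noteq> 0" by auto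
  have nn: "norm (n - z) \<le> \<delta> * norm n"
  proof (rule norm_le_of_inner)
    have "(n - z) \<bullet> (n - z) = - (n \<bullet> (demb z (n - z) - (n - z)))"
      using n[of "n - z"] by (simp add: inner_diff_left inner_diff_right)
    also have "\<dots> \<le> norm n * norm (demb z (n - z) - (n - z))"
      using Cauchy_Schwarz_ineq2[of n "demb z (n - z) - (n - z)"] by linarith
    also have "\<dots> \<le> norm n * (\<delta> * norm (n - z))" by (intro mult_left_mono demb_near) simp
    finally show "(n - z) \<bullet> (n - z) \<le> \<delta> * norm n * norm (n - z)" by (simp add: ac_simps)
  qed (use small in simp)
  have "norm n \<le> 2"
  proof -
    have "\<delta> * norm n \<le> (1/2) * norm n" using small by (intro mult_right_mono) auto
    then show ?thesis using nn norm_triangle_sub[of n z] assms(2) by linarith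
  qed
  then have n2: "norm (n - z) \<le> 2 * \<delta>" using nn mult_left_mono[of "norm n" 2 \<delta>] small by simp
  define \<nu> where "\<nu> = - ((1 / norm n) *\<^sub>R n)"
  have nu1: "norm \<nu> = 1" using nz by (simp add: \<nu>_def)
  have tp: "\<forall>w\<in>tangent_space surf (emb z). \<nu> \<bullet> w = 0"
    unfolding tangent_space_surf[OF assms(2)] using n by (auto simp: \<nu>_def)
  \<comment> \<open>Along \<nu> the norm of \<open>proj\<close> decreases to first order, since
    \<open>z \<bullet> y' = n \<bullet> \<nu> < 0\<close>.\<close>
  have ev: "\<forall>\<^sub>F t in at_right 0. emb z + t *\<^sub>R \<nu> \<in> inside surf"
  proof -
    have "((\<lambda>t. emb z + t *\<^sub>R \<nu>) has_vector_derivative \<nu>) (at 0)" by (auto intro!: derivative_eq_intros)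
    then obtain y' where y': "((\<lambda>t. proj (emb z + t *\<^sub>R \<nu>)) has_vector_derivative y') (at 0)"
      "demb (proj (emb z + 0 *\<^sub>R \<nu>)) y' = \<nu>" by (rule pull_back)
    have "z \<bullet> y' = n \<bullet> \<nu>" using n[of y'] y'(2) by simp
    also have "\<dots> < 0" using nz by (simp add: \<nu>_def)
    finally have neg: "z \<bullet> y' < 0" .
    have "((\<lambda>t. proj (emb z + t *\<^sub>R \<nu>) \<bullet> proj (emb z + t *\<^sub>R \<nu>)) has_real_derivative
        (proj (emb z + 0 *\<^sub>R \<nu>) \<bullet> y' + y' \<bullet> proj (emb z + 0 *\<^sub>R \<nu>))) (at 0)"
      unfolding has_real_derivative_iff_has_vector_derivative
      by (rule bounded_bilinear.has_vector_derivative[OF bounded_bilinear_inner y'(1) y'(1)])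
    from DERIV_neg_dec_right[OF this] neg
    obtain d where d: "d > 0" "\<And>h. h > 0 \<Longrightarrow> h < d \<Longrightarrow> proj (emb z + h *\<^sub>R \<nu>) \<bullet> proj (emb z + h *\<^sub>R \<nu>) < z \<bullet> z"
      by (auto simp: inner_commute)
    have "emb z + h *\<^sub>R \<nu> \<in> inside surf" if "h > 0" "h < d" for h
    proof (rule inside_surf)
      have "(norm (proj (emb z + h *\<^sub>R \<nu>)))\<^sup>2 < 1\<^sup>2"
        using d(2)[OF that] assms(2) by (simp add: power2_norm_eq_inner norm_eq_1)
      then show "norm (proj (emb z + h *\<^sub>R \<nu>)) < 1" by (rule power2_less_imp_less) simp
    qed
    then show ?thesis unfolding eventually_at_right_field using d(1) by auto
  qed
  have "inward_normal surf (emb z) = \<nu>" unfolding inward_normal_def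
  proof (rule the_equality)
    show "norm \<nu> = 1 \<and> (\<forall>w\<in>tangent_space surf (emb z). \<nu> \<bullet> w = 0) \<and>
       (\<forall>\<^sub>F t in at_right 0. emb z + t *\<^sub>R \<nu> \<in> inside surf)" using nu1 tp ev by blast
    fix \<mu> assume \<mu>: "norm \<mu> = 1 \<and> (\<forall>w\<in>tangent_space surf (emb z). \<mu> \<bullet> w = 0) \<and>
       (\<forall>\<^sub>F t in at_right 0. emb z + t *\<^sub>R \<mu> \<in> inside surf)"
    define a where "a = \<mu> \<bullet> demb z z"
    have "\<mu> \<bullet> demb z w = (a *\<^sub>R n) \<bullet> demb z w" for w
    proof -
      let ?w = "w - (z \<bullet> w) *\<^sub>R z"
      have "z \<bullet> ?w = 0" using assms(2) by (simp add: inner_diff_right norm_eq_1)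
      then have "demb z ?w \<in> tangent_space surf (emb z)" unfolding tangent_space_surf[OF assms(2)] by blast
      then have "\<mu> \<bullet> demb z ?w = 0" using \<mu> by blast
      then show ?thesis by (simp add: demb_linear inner_diff_right a_def n)
    qed
    then have "\<mu> \<bullet> w = (a *\<^sub>R n) \<bullet> w" for w using g(3) by metis
    then have \<mu>a: "\<mu> = a *\<^sub>R n" by (metis vector_eq_rdot)
    then have an: "\<bar>a\<bar> = 1 / norm n" using \<mu> nz by (simp add: field_simps)
    show "\<mu> = \<nu>"
    proof (cases "a \<ge> 0")
      case False
      then show ?thesis using an unfolding \<mu>a \<nu>_def by (simp add: abs_if) (metis minus_minus scaleR_minus_left)
    next
      case True
      \<comment> \<open>If both unit normals pointed inside, the boundary point would be the
        midpoint of two interior points of the convex body, hence interior itself.\<close>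
      then have "\<mu> = - \<nu>" using an unfolding \<mu>a \<nu>_def by simp
      then have "\<forall>\<^sub>F t in at_right 0. emb z + t *\<^sub>R \<nu> \<in> inside surf \<and> emb z - t *\<^sub>R \<nu> \<in> inside surf"
        using ev \<mu> by (auto intro: eventually_conj)
      then obtain t where "emb z + t *\<^sub>R \<nu> \<in> inside surf" "emb z - t *\<^sub>R \<nu> \<in> inside surf"
        using eventually_happens[of _ "at_right (0::real)"] by (metis (mono_tags, lifting) trivial_limit_at_right_real)
      then have "emb z + t *\<^sub>R \<nu> \<in> interior K" "emb z - t *\<^sub>R \<nu> \<in> interior K"
        unfolding K(2) inside_frontier_strictly_convex(2)[OF K(1)] by auto
      then have "(1/2) *\<^sub>R (emb z + t *\<^sub>R \<nu>) + (1/2) *\<^sub>R (emb z - t *\<^sub>R \<nu>) \<in> interior K"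
        using convex_interior[OF inside_frontier_strictly_convex(1)[OF K(1)]] by (intro convexD) auto
      then have "emb z \<in> interior K" by (simp add: algebra_simps flip: scaleR_left_distrib)
      moreover have "emb z \<in> frontier K" unfolding K(2)[symmetric] surf_def using assms(2) by auto
      ultimately show ?thesis by (simp add: frontier_def)
    qed
  qed
  then show ?thesis using that n n2 nz unfolding \<nu>_def by blast
qed

end

section \<open>Flows close to the Hopf flow\<close>

text \<open>A crude Jordan inequality; its constant is the 3 in the error 3 \<kappa> L of the prime
  period.\<close>

lemma abs_le_3_abs_sin:
  assumes "\<bar>x\<bar> \<le> pi/2" shows "\<bar>x\<bar> \<le> 3 * \<bar>sin x\<bar>"
proof -
  have *: "x \<le> 3 * sin x" if x: "0 \<le> x" "x \<le> pi/2" for x :: real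
  proof (cases "x \<le> pi/3")
    case True
    have "3 * sin 0 - 0 \<le> 3 * sin x - x"
    proof (rule DERIV_nonneg_imp_nondecreasing[OF x(1)])
      fix y assume y: "0 \<le> y" "y \<le> x"
      have "cos (pi/3) \<le> cos y" by (rule cos_monotone_0_pi_le) (use y True in auto)
      then show "\<exists>D. ((\<lambda>y. 3 * sin y - y) has_real_derivative D) (at y) \<and> 0 \<le> D"
        by (intro exI[of _ "3 * cos y - 1"] conjI) (auto intro!: derivative_eq_intros simp: cos_60)
    qed
    then show ?thesis by simp
  next
    case False
    have "sin (pi/3) \<le> sin x" by (rule sin_monotone_2pi_le) (use x False pi_gt_zero in linarith)+
    then have "sqrt 3 \<le> 2 * sin x" by (simp add: sin_60)
    moreover have "4/3 \<le> sqrt 3" by (rule real_le_rsqrt) (simp add: power2_eq_square)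
    ultimately show ?thesis using x(2) pi_half_less_two by linarith
  qed
  show ?thesis
  proof (cases "x \<ge> 0")
    case True then show ?thesis using *[of x] assms sin_ge_zero[of x] by auto
  next
    case False then show ?thesis using *[of "-x"] assms by auto
  qed
qed

lemma periodic_reparametrization:
  fixes \<sigma> c :: "real \<Rightarrow> real"
  assumes d: "\<And>t. (\<sigma> has_real_derivative c t) (at t)" and c: "\<And>t. c t > 0"
    and per: "\<And>t. \<sigma> (t + 1) = \<sigma> t + T" and T: "T > 0"
  obtains \<tau> where "\<And>x. \<sigma> (\<tau> x) = x" "\<And>t. \<tau> (\<sigma> t) = t" "\<And>x. (\<tau> has_real_derivative inverse (c (\<tau> x))) (at x)"
    "\<And>x. \<tau> (x + T) = \<tau> x + 1"
proof -
  have cont: "isCont \<sigma> t" for t using d DERIV_isCont by blast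
  have mono: "\<sigma> a < \<sigma> b" if "a < b" for a b
    by (rule DERIV_pos_imp_increasing[OF that]) (use d c in blast)
  have inj: "a = b" if "\<sigma> a = \<sigma> b" for a b
    using mono[of a b] mono[of b a] that by (cases a b rule: linorder_cases) auto
  have pern: "\<sigma> (t + of_int n) = \<sigma> t + of_int n * T" for t n
  proof (induction n rule: int_induct[of _ 0])
    case (step1 i)
    have "\<sigma> (t + of_int (i + 1)) = \<sigma> ((t + of_int i) + 1)" by (simp add: ac_simps)
    then show ?case unfolding per step1(2) by (simp add: algebra_simps)
  next
    case (step2 i)
    have "\<sigma> (t + of_int i) = \<sigma> ((t + of_int (i - 1)) + 1)" by (simp add: algebra_simps)
    then show ?case unfolding per step2(2) by (simp add: algebra_simps)
  qed simp
  have surj: "\<exists>t. \<sigma> t = x" for x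
  proof -
    \<comment> \<open>\<sigma> moves by T per unit of its argument, so n units in either direction
      carry it beyond x.\<close>
    define n where "n = \<lceil>\<bar>x - \<sigma> 0\<bar> / T\<rceil>"
    have "\<bar>x - \<sigma> 0\<bar> / T \<le> of_int n" unfolding n_def by (rule le_of_int_ceiling)
    then have n: "\<bar>x - \<sigma> 0\<bar> \<le> of_int n * T" using T by (simp add: divide_simps)
    have "0 \<le> \<bar>x - \<sigma> 0\<bar> / T" using T by simp
    then have "n \<ge> 0" unfolding n_def zero_le_ceiling by linarith
    moreover have "\<sigma> (of_int (- n)) \<le> x" "x \<le> \<sigma> (of_int n)" using n pern[of 0 n] pern[of 0 "- n"] by auto
    ultimately show ?thesis using IVT[of \<sigma> "of_int (- n)" x "of_int n"] cont by auto
  qed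
  define \<tau> where "\<tau> x = (SOME t. \<sigma> t = x)" for x
  have st: "\<sigma> (\<tau> x) = x" for x unfolding \<tau>_def by (rule someI_ex[OF surj])
  have ts: "\<tau> (\<sigma> t) = t" for t using inj st by blast
  have "isCont \<tau> (\<sigma> t)" for t by (rule isCont_inverse_function[of 1]) (use ts cont in auto)
  then have ct: "isCont \<tau> x" for x using st by metis
  have "(\<tau> has_real_derivative inverse (c (\<tau> x))) (at x)" for x
    by (rule DERIV_inverse_function[OF d _ _ _ st ct, where a = "x - 1" and b = "x + 1"]) (use c[of "\<tau> x"] in auto)
  moreover have "\<tau> (x + T) = \<tau> x + 1" for x
  proof -
    have "\<sigma> (\<tau> x + 1) = x + T" using per st by simp
    then show ?thesis using ts by metis
  qed
  ultimately show ?thesis using that st ts by blast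
qed

text \<open>The Hopf flow at time t: multiplication by the complex number exp(i t).\<close>

definition rot :: "real \<Rightarrow> (real \<times> real) ^ 'm::finite \<Rightarrow> (real \<times> real) ^ 'm" where
  "rot t z = cos t *\<^sub>R z + sin t *\<^sub>R cplx z"

lemma rot_linear: "rot t (x + y) = rot t x + rot t y" "rot t (x - y) = rot t x - rot t y"
  by (simp_all add: rot_def cplx_linear algebra_simps)

lemma rot_add: "rot s (rot t z) = rot (s + t) z"
  by (simp add: rot_def cplx_linear cos_add sin_add algebra_simps)

lemma rot_0 [simp]: "rot 0 z = z" by (simp add: rot_def)

lemma norm_rot [simp]: "norm (rot t z) = norm z"
proof -
  have "(norm (rot t z))\<^sup>2 = (cos t)\<^sup>2 * (norm z)\<^sup>2 + (sin t)\<^sup>2 * (norm z)\<^sup>2"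
    unfolding power2_norm_eq_inner rot_def
    by (simp add: inner_add_left inner_add_right power2_eq_square)
  also have "\<dots> = (norm z)\<^sup>2" by (simp flip: distrib_right)
  finally show ?thesis by simp
qed

lemma norm_rot_diff: "norm (rot t z - z) = 2 * \<bar>sin (t/2)\<bar> * norm z"
proof -
  have "(norm (rot t z - z))\<^sup>2 = (norm z)\<^sup>2 * ((cos t - 1)\<^sup>2 + (sin t)\<^sup>2)"
  proof -
    have "rot t z - z = (cos t - 1) *\<^sub>R z + sin t *\<^sub>R cplx z" by (simp add: rot_def algebra_simps)
    then have "(norm (rot t z - z))\<^sup>2 = (norm ((cos t - 1) *\<^sub>R z + sin t *\<^sub>R cplx z))\<^sup>2" by simp
    also have "\<dots> = (cos t - 1)\<^sup>2 * (norm z)\<^sup>2 + (sin t)\<^sup>2 * (norm z)\<^sup>2"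
      unfolding power2_norm_eq_inner
      by (simp only: inner_add_left inner_add_right inner_scaleR_left inner_scaleR_right inner_cplx_cplx inner_cplx_self)
         (simp add: power2_eq_square)
    finally show ?thesis by (simp add: distrib_left mult.commute)
  qed
  also have "(cos t - 1)\<^sup>2 + (sin t)\<^sup>2 = 2 - 2 * cos t"
    using sin_cos_squared_add[of t] by (simp add: power2_diff)
  also have "\<dots> = 4 * (sin (t/2))\<^sup>2" using cos_double_sin[of "t/2"] by simp
  also have "(norm z)\<^sup>2 * \<dots> = (2 * \<bar>sin (t/2)\<bar> * norm z)\<^sup>2" by (simp add: power_mult_distrib)
  finally show ?thesis by (rule power2_eq_imp_eq) auto
qed

lemma rot_has_derivative:
  assumes "(d has_vector_derivative d') (at t)"
  shows "((\<lambda>t. rot (- t) (d t)) has_vector_derivative rot (- t) (d' - cplx (d t))) (at t)"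
proof -
  have J: "((\<lambda>t. cplx (d t)) has_vector_derivative cplx d') (at t)"
    by (rule bounded_linear.has_vector_derivative[OF bounded_linear_cplx assms])
  have "((\<lambda>t. cos (- t) *\<^sub>R d t + sin (- t) *\<^sub>R cplx (d t)) has_vector_derivative
      (cos (- t) *\<^sub>R d' + sin (- t) *\<^sub>R d t) + (sin (- t) *\<^sub>R cplx d' + - cos (- t) *\<^sub>R cplx (d t))) (at t)"
    by (intro has_vector_derivative_add has_vector_derivative_scaleR assms J) (auto intro!: derivative_eq_intros)
  then show ?thesis unfolding rot_def by (simp add: cplx_linear algebra_simps)
qed

lemma norm_increment_le:
  fixes w :: "real \<Rightarrow> 'a::euclidean_space"
  assumes "\<And>s. 0 \<le> s \<Longrightarrow> s \<le> t \<Longrightarrow> (w has_vector_derivative w' s) (at s)"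
    "\<And>s. 0 \<le> s \<Longrightarrow> s \<le> t \<Longrightarrow> norm (w' s) \<le> B" "0 \<le> t"
  shows "norm (w t - w 0) \<le> B * t"
proof -
  have "norm (w t - w 0) \<le> B * norm (t - 0)"
  proof (rule differentiable_bound[of "{0..t}" w "\<lambda>s h. h *\<^sub>R w' s"])
    fix s assume "s \<in> {0..t}"
    then show "(w has_derivative (\<lambda>h. h *\<^sub>R w' s)) (at s within {0..t})"
      using assms(1)[of s] by (auto simp: has_vector_derivative_def intro: has_derivative_at_withinI)
    show "onorm (\<lambda>h. h *\<^sub>R w' s) \<le> B"
    proof (rule onorm_le)
      fix h :: real
      have "\<bar>h\<bar> * norm (w' s) \<le> \<bar>h\<bar> * B" using assms(2)[of s] \<open>s \<in> {0..t}\<close> by (intro mult_left_mono) auto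
      then show "norm (h *\<^sub>R w' s) \<le> B * norm h" by (simp add: mult.commute)
    qed
  qed (use assms(3) in auto)
  then show ?thesis using assms(3) by simp
qed

text \<open>In the rotating frame the equation loses its leading term \<open>cplx (d t)\<close>, and
  Gronwall's argument applies to the small rest. The second bound, integrated from the first, says
  that d is almost constant in this frame relative to its own size.\<close>

lemma rotating_gronwall:
  assumes d: "\<And>s. (d has_vector_derivative d' s) (at s)" and \<kappa>: "0 \<le> \<kappa>"
    and b: "\<And>s. norm (d' s - cplx (d s)) \<le> \<kappa> * norm (d s)" and t: "0 \<le> t"
  shows "norm (d t) \<le> exp (\<kappa> * t) * norm (d 0)"
    "norm (rot (- t) (d t) - d 0) \<le> \<kappa> * t * exp (\<kappa> * t) * norm (d 0)"
proof -
  define w where "w t = rot (- t) (d t)" for t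
  define w' where "w' t = rot (- t) (d' t - cplx (d t))" for t
  have w: "(w has_vector_derivative w' s) (at s)" for s
    unfolding w_def[abs_def] w'_def by (rule rot_has_derivative[OF d])
  have nw: "norm (w s) = norm (d s)" "norm (w' s) \<le> \<kappa> * norm (w s)" for s using b by (simp_all add: w_def w'_def)
  have bound: "norm (d t) \<le> exp (\<kappa> * t) * norm (d 0)" if t: "0 \<le> t" for t
  proof -
    \<comment> \<open>The exponential weight turns the differential inequality for the squared norm
      into monotonicity.\<close>
    define f where "f s = (w s \<bullet> w s) * exp (- 2 * \<kappa> * s)" for s
    have "f t \<le> f 0"
    proof (rule DERIV_nonpos_imp_nonincreasing[OF t])
      fix s
      have "((\<lambda>s. w s \<bullet> w s) has_real_derivative (w s \<bullet> w' s + w' s \<bullet> w s)) (at s)"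
        unfolding has_real_derivative_iff_has_vector_derivative
        by (rule bounded_bilinear.has_vector_derivative[OF bounded_bilinear_inner w w])
      then have "(f has_real_derivative (w s \<bullet> w' s + w' s \<bullet> w s) * exp (- 2 * \<kappa> * s) + exp (- 2 * \<kappa> * s) * (- 2 * \<kappa>) * (w s \<bullet> w s)) (at s)"
        unfolding f_def[abs_def] by (rule DERIV_mult) (auto intro!: derivative_eq_intros)
      moreover have "(w s \<bullet> w' s + w' s \<bullet> w s) * exp (- 2 * \<kappa> * s) + exp (- 2 * \<kappa> * s) * (- 2 * \<kappa>) * (w s \<bullet> w s)
          = 2 * exp (- 2 * \<kappa> * s) * (w s \<bullet> w' s - \<kappa> * (w s \<bullet> w s))" by (simp add: inner_commute algebra_simps)
      moreover have "w s \<bullet> w' s - \<kappa> * (w s \<bullet> w s) \<le> 0"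
      proof -
        have "w s \<bullet> w' s \<le> norm (w s) * norm (w' s)" by (rule norm_cauchy_schwarz)
        also have "\<dots> \<le> norm (w s) * (\<kappa> * norm (w s))" by (intro mult_left_mono nw) simp
        also have "\<dots> = \<kappa> * (w s \<bullet> w s)" by (simp add: power2_norm_eq_inner[symmetric] power2_eq_square)
        finally show ?thesis by simp
      qed
      ultimately show "\<exists>D. (f has_real_derivative D) (at s) \<and> D \<le> 0"
        by (metis (no_types, lifting) exp_ge_zero mult_nonneg_nonpos zero_le_mult_iff zero_le_numeral)
    qed
    then have "(norm (d t))\<^sup>2 * exp (- 2 * \<kappa> * t) \<le> (norm (d 0))\<^sup>2"
      by (simp add: f_def power2_norm_eq_inner[symmetric] nw(1))
    then have "(norm (d t))\<^sup>2 \<le> exp (2 * \<kappa> * t) * (norm (d 0))\<^sup>2"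
      by (simp add: exp_minus field_simps)
    also have "\<dots> = (exp (\<kappa> * t) * norm (d 0))\<^sup>2"
      by (simp add: power_mult_distrib exp_double[symmetric] mult.assoc)
    finally show ?thesis by (rule power2_le_imp_le) simp
  qed
  show "norm (d t) \<le> exp (\<kappa> * t) * norm (d 0)" by (rule bound[OF t])
  have "norm (w t - w 0) \<le> (\<kappa> * exp (\<kappa> * t) * norm (d 0)) * t"
  proof (rule norm_increment_le[OF w _ t])
    fix s assume s: "0 \<le> s" "s \<le> t"
    have "norm (w' s) \<le> \<kappa> * (exp (\<kappa> * s) * norm (d 0))"
      using nw(2)[of s] mult_left_mono[OF bound[OF s(1)] \<kappa>] unfolding nw(1) by linarith
    also have "\<dots> \<le> \<kappa> * (exp (\<kappa> * t) * norm (d 0))"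
      using s \<kappa> by (intro mult_left_mono mult_right_mono) (auto intro: mult_left_mono)
    finally show "norm (w' s) \<le> \<kappa> * exp (\<kappa> * t) * norm (d 0)" by simp
  qed
  then show "norm (rot (- t) (d t) - d 0) \<le> \<kappa> * t * exp (\<kappa> * t) * norm (d 0)"
    by (simp add: w_def ac_simps)
qed

text \<open>\<open>R z u\<close> reads: u is the velocity at z. A relation fits because
  \<open>char_dir\<close> determines the velocity only implicitly. \<open>R_lip\<close> states that
  the deviation from the Hopf field is \<kappa>-Lipschitz.\<close>

locale near_rotation =
  fixes R :: "(real \<times> real) ^ 'm::finite \<Rightarrow> (real \<times> real) ^ 'm \<Rightarrow> bool" and \<kappa> :: real
  assumes \<kappa>: "0 \<le> \<kappa>" "\<kappa> \<le> 1/8"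
    and R_near: "\<And>z u. R z u \<Longrightarrow> norm z = 1 \<and> norm (u - cplx z) \<le> \<kappa>"
    and R_lip: "\<And>z u y w. R z u \<Longrightarrow> R y w \<Longrightarrow> norm ((u - w) - cplx (z - y)) \<le> \<kappa> * norm (z - y)"
begin

definition orbit :: "(real \<Rightarrow> (real \<times> real) ^ 'm) \<Rightarrow> bool" where
  "orbit y \<longleftrightarrow> (\<forall>t. \<exists>u. (y has_vector_derivative u) (at t) \<and> R (y t) u)"

lemma orbit_shift: "orbit y \<Longrightarrow> orbit (\<lambda>t. y (t + a))"
  unfolding orbit_def
proof (intro allI)
  fix t assume "\<forall>t. \<exists>u. (y has_vector_derivative u) (at t) \<and> R (y t) u"
  then obtain u where u: "(y has_vector_derivative u) (at (t + a))" "R (y (t + a)) u" by blast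
  have "((y \<circ> (\<lambda>t. t + a)) has_vector_derivative 1 *\<^sub>R u) (at t)"
    by (rule vector_diff_chain_at) (auto intro!: derivative_eq_intros u(1))
  then show "\<exists>u. ((\<lambda>t. y (t + a)) has_vector_derivative u) (at t) \<and> R (y (t + a)) u"
    using u(2) by (auto simp: o_def)
qed

lemma orbit_drift:
  assumes "orbit y" "0 \<le> t"
  shows "norm (rot (- t) (y t) - y 0) \<le> \<kappa> * t"
proof -
  obtain u where u: "\<And>t. (y has_vector_derivative u t) (at t)" "\<And>t. R (y t) (u t)"
    using assms(1) unfolding orbit_def by metis
  have "norm ((\<lambda>t. rot (- t) (y t)) t - (\<lambda>t. rot (- t) (y t)) 0) \<le> \<kappa> * t"
    by (rule norm_increment_le[OF rot_has_derivative[OF u(1)] _ assms(2)]) (use R_near[OF u(2)] in auto)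
  then show ?thesis by simp
qed

lemma orbit_diff:
  assumes "orbit y" "orbit z" "0 \<le> t"
  shows "norm (y t - z t) \<le> exp (\<kappa> * t) * norm (y 0 - z 0)"
    "norm (rot (- t) (y t - z t) - (y 0 - z 0)) \<le> \<kappa> * t * exp (\<kappa> * t) * norm (y 0 - z 0)"
proof -
  obtain u where u: "\<And>t. (y has_vector_derivative u t) (at t)" "\<And>t. R (y t) (u t)"
    using assms(1) unfolding orbit_def by metis
  obtain w where w: "\<And>t. (z has_vector_derivative w t) (at t)" "\<And>t. R (z t) (w t)"
    using assms(2) unfolding orbit_def by metis
  note g = rotating_gronwall[OF has_vector_derivative_diff[OF u(1) w(1)] \<kappa>(1) R_lip[OF u(2) w(2)] assms(3)]
  show "norm (y t - z t) \<le> exp (\<kappa> * t) * norm (y 0 - z 0)"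
    "norm (rot (- t) (y t - z t) - (y 0 - z 0)) \<le> \<kappa> * t * exp (\<kappa> * t) * norm (y 0 - z 0)" using g by auto
qed

text \<open>
  A period \<open>T\<close> not exceeding \<open>L\<close> is close to \<open>2 \<pi> k\<close> with \<open>k \<ge> 1\<close>. The displacements
  \<open>y (s + T / k) - y s\<close> at the times \<open>s = j T / k\<close>, \<open>j < k\<close>, sum up to zero and are all close to each
  other relative to their size. So they vanish, and \<open>T\<close> is not the prime period unless \<open>k = 1\<close>.
\<close>

lemma short_prime_period:
  assumes y: "orbit y" and per: "\<And>t. y (t + T) = y t" and prime: "\<And>s. 0 < s \<Longrightarrow> s < T \<Longrightarrow> y s \<noteq> y 0"
    and T: "0 < T" "T \<le> L" and L: "\<kappa> * L \<le> 1/50"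
  shows "\<bar>T - 2 * pi\<bar> \<le> 3 * \<kappa> * L"
proof -
  have n1: "norm (y t) = 1" for t using y R_near unfolding orbit_def by blast
  have \<kappa>T: "\<kappa> * T \<le> \<kappa> * L" using T \<kappa> by (intro mult_left_mono) auto
  \<comment> \<open>As y returns at time T, the Hopf flow itself moves \<open>y 0\<close> by at most
    \<kappa> T in this time; so T / 2 is close to a multiple of pi.\<close>
  have "rot T (y 0) - y 0 = rot T (y 0 - rot (- T) (y T))"
    using per[of 0] by (simp add: rot_linear rot_add)
  then have "norm (rot T (y 0) - y 0) \<le> \<kappa> * T"
    using orbit_drift[OF y, of T] T by (simp add: norm_minus_commute)
  then have s: "2 * \<bar>sin (T/2)\<bar> \<le> \<kappa> * T" by (simp add: norm_rot_diff n1)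
  define k where "k = round (T / (2*pi))"
  define x where "x = T/2 - pi * of_int k"
  have "\<bar>of_int k - T / (2*pi)\<bar> \<le> 1/2" unfolding k_def by (rule of_int_round_abs_le)
  then have "pi * \<bar>of_int k - T / (2*pi)\<bar> \<le> pi * (1/2)" by (intro mult_left_mono) auto
  moreover have "pi * \<bar>of_int k - T / (2*pi)\<bar> = \<bar>x\<bar>"
  proof -
    have "pi * \<bar>of_int k - T / (2*pi)\<bar> = \<bar>pi * (of_int k - T / (2*pi))\<bar>" by (simp add: abs_mult)
    also have "pi * (of_int k - T / (2*pi)) = - x" by (simp add: x_def algebra_simps)
    finally show ?thesis by simp
  qed
  ultimately have "\<bar>x\<bar> \<le> pi/2" by simp
  then have "\<bar>x\<bar> \<le> 3 * \<bar>sin x\<bar>" by (rule abs_le_3_abs_sin)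
  also have "\<bar>sin x\<bar> = \<bar>sin (T/2)\<bar>"
  proof -
    have sk: "sin (pi * of_int k) = 0" using sin_zero_iff_int2[of "pi * of_int k"] by auto
    then have "(cos (pi * of_int k))\<^sup>2 = 1" using sin_cos_squared_add[of "pi * of_int k"] by simp
    then have c: "\<bar>cos (pi * of_int k)\<bar> = 1" "sin (pi * of_int k) = 0" using sk by (auto simp: power2_eq_1_iff)
    have "sin (T/2) = sin (x + pi * of_int k)" by (simp add: x_def)
    also have "\<dots> = sin x * cos (pi * of_int k)" unfolding sin_add c(2) by simp
    finally show ?thesis using c(1) by (simp add: abs_mult)
  qed
  finally have Tk: "\<bar>T - 2 * pi * of_int k\<bar> \<le> 3 * \<kappa> * T" using s by (simp add: x_def)
  have "k \<ge> 1"
  proof (rule ccontr)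
    assume "\<not> k \<ge> 1"
    moreover have "k \<ge> 0" unfolding k_def using T by (simp add: round_mono[of 0, simplified])
    ultimately have "k = 0" by simp
    \<comment> \<open>A period near 0 contradicts 3 \<kappa> < 1, since the error is proportional to
      T and not to L.\<close>
    then have "T \<le> 3 * \<kappa> * T" using Tk T(1) by (simp only: of_int_0 mult_zero_right diff_0_right abs_of_pos)
    moreover have "3 * \<kappa> * T \<le> (1/2) * T" using \<kappa> T by (intro mult_right_mono) auto
    ultimately show False using T by simp
  qed
  moreover have "\<not> k \<ge> 2"
  proof
    assume k2: "k \<ge> 2"
    define n where "n = nat k"
    have n: "real n = of_int k" "n \<ge> 2" using k2 by (simp_all add: n_def)
    define \<tau> where "\<tau> = T / real n"
    have \<tau>: "0 < \<tau>" "\<tau> < T" "real n * \<tau> = T" using n T by (auto simp: \<tau>_def field_simps)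
    define d where "d t = y (t + \<tau>) - y t" for t
    \<comment> \<open>In the rotating frame the displacement changes by at most 1/25 of its size.
      Leaving the frame at a time close to 2 pi j costs another 2/15, and the sum is below
      1/4.\<close>
    have dd: "norm (d (real j * \<tau>) - d 0) \<le> (1/4) * norm (d 0)" if j: "j < n" for j
    proof -
      let ?t = "real j * \<tau>"
      have t: "0 \<le> ?t" "?t \<le> T" using \<tau> j mult_right_mono[of "real j" "real n" \<tau>] by auto
      have kt: "\<kappa> * ?t \<le> 1/50" using mult_left_mono[OF t(2) \<kappa>(1)] \<kappa>T L by linarith
      have e: "exp (\<kappa> * ?t) \<le> 2"
      proof -
        have kt0: "0 \<le> \<kappa> * ?t" using \<kappa> t by simp
        have "exp (\<kappa> * ?t) \<le> 1 + \<kappa> * ?t + (\<kappa> * ?t)\<^sup>2" by (rule exp_bound) (use kt kt0 in auto)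
        also have "(\<kappa> * ?t)\<^sup>2 \<le> (1/50)\<^sup>2" by (rule power_mono) (use kt kt0 in auto)
        finally show ?thesis using kt by (simp add: power2_eq_square)
      qed
      note o = orbit_diff[OF orbit_shift[OF y, of \<tau>] y t(1)]
      have w: "norm (rot (- ?t) (d ?t) - d 0) \<le> (1/25) * norm (d 0)"
      proof -
        have "norm (rot (- ?t) (d ?t) - d 0) \<le> (\<kappa> * ?t * exp (\<kappa> * ?t)) * norm (d 0)" using o(2) by (simp add: d_def)
        also have "\<dots> \<le> (1/50 * 2) * norm (d 0)" using kt e \<kappa> t by (intro mult_right_mono mult_mono) auto
        finally show ?thesis by simp
      qed
      have "norm (rot (- ?t) (d ?t)) \<le> 2 * norm (d 0)" using w norm_triangle_sub[of "rot (- ?t) (d ?t)" "d 0"] norm_ge_zero[of "d 0"] by linarith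
      then have nd: "norm (d ?t) \<le> 2 * norm (d 0)" by simp
      have rd: "norm (d ?t - rot (- ?t) (d ?t)) = 2 * \<bar>sin (?t / 2)\<bar> * norm (d ?t)"
        using norm_rot_diff[of "- ?t" "d ?t"] by (simp add: norm_minus_commute)
      \<comment> \<open>j \<tau> - 2 pi j is the fraction j / n of T - 2 pi k, so the half angle is
        at most (3/2) \<kappa> T modulo pi.\<close>
      have sn: "\<bar>sin (?t / 2)\<bar> \<le> 1/30"
      proof -
        define a where "a = (?t - 2 * pi * real j) / 2"
        have "?t / 2 = a + real j * pi" by (simp add: a_def field_simps)
        then have "\<bar>sin (?t / 2)\<bar> = \<bar>sin a\<bar>"
          by (simp only: sin_add sin_npi cos_npi) (simp add: abs_mult power_abs)
        then have "\<bar>sin (?t / 2)\<bar> = \<bar>sin ((?t - 2 * pi * real j) / 2)\<bar>" by (simp only: a_def)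
        also have "\<dots> \<le> \<bar>(?t - 2 * pi * real j) / 2\<bar>" by (rule abs_sin_x_le_abs_x)
        also have "?t - 2 * pi * real j = (real j / real n) * (T - 2 * pi * of_int k)"
          using n(2) by (simp add: \<tau>_def n(1)[symmetric] field_simps)
        also have "\<bar>(real j / real n) * (T - 2 * pi * of_int k) / 2\<bar> \<le> 1 * (3 * \<kappa> * T) / 2"
        proof -
          have "\<bar>(real j / real n) * (T - 2 * pi * of_int k)\<bar> \<le> 1 * (3 * \<kappa> * T)"
            unfolding abs_mult using Tk j by (intro mult_mono) auto
          then show ?thesis by simp
        qed
        also have "1 * (3 * \<kappa> * T) / 2 = (3/2) * (\<kappa> * T)" by simp
        also have "\<dots> \<le> 1/30" using \<kappa>T L by linarith
        finally show ?thesis .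
      qed
      have "norm (d ?t - rot (- ?t) (d ?t)) \<le> (2 * (1/30)) * (2 * norm (d 0))"
        unfolding rd using sn nd by (intro mult_mono) auto
      moreover have "norm (d ?t - d 0) \<le> norm (d ?t - rot (- ?t) (d ?t)) + norm (rot (- ?t) (d ?t) - d 0)"
        using norm_triangle_ineq[of "d ?t - rot (- ?t) (d ?t)" "rot (- ?t) (d ?t) - d 0"] by simp
      ultimately show ?thesis using w norm_ge_zero[of "d 0"] by linarith
    qed
    have "(\<Sum>j<n. d (real j * \<tau>)) = (\<Sum>j<n. y (real (Suc j) * \<tau>) - y (real j * \<tau>))"
      by (simp add: d_def algebra_simps)
    also have "\<dots> = y (real n * \<tau>) - y (real 0 * \<tau>)" by (rule sum_lessThan_telescope)
    also have "\<dots> = 0" using \<tau>(3) per[of 0] by simp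
    finally have s0: "(\<Sum>j<n. d (real j * \<tau>)) = 0" .
    have "norm (\<Sum>j<n. d (real j * \<tau>) - d 0) \<le> (\<Sum>j<n. (1/4) * norm (d 0))"
      by (rule sum_norm_le) (use dd in auto)
    moreover have "(\<Sum>j<n. d (real j * \<tau>) - d 0) = - (real n *\<^sub>R d 0)"
      unfolding sum_subtractf s0 by (simp add: sum_constant_scaleR)
    ultimately have "real n * norm (d 0) \<le> real n * ((1/4) * norm (d 0))" by simp
    then have "norm (d 0) \<le> (1/4) * norm (d 0)" using n(2) by simp
    then have "d 0 = 0" by simp
    then have "y \<tau> = y 0" by (simp add: d_def)
    then show False using prime \<tau> by blast
  qed
  ultimately have "k = 1" by simp
  then show ?thesis using Tk \<kappa>T by simp
qed

end

section \<open>Regular loops with the same image\<close>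

lemma regular_loop_eq_iff:
  assumes "regular_loop \<gamma>"
  shows "\<gamma> a = \<gamma> b \<longleftrightarrow> a - b \<in> \<int>"
proof -
  have per: "\<gamma> (t + 1) = \<gamma> t" for t using assms by (simp add: regular_loop_def)
  have pern: "\<gamma> (t + of_int n) = \<gamma> t" for t n
  proof (induction n rule: int_induct[of _ 0])
    case (step1 i) then show ?case using per[of "t + of_int i"] by (simp add: add.assoc)
  next
    case (step2 i) then show ?case using per[of "t + of_int (i - 1)"] by (simp add: algebra_simps)
  qed simp
  have fr: "\<gamma> t = \<gamma> (frac t)" for t
    using pern[of "frac t" "\<lfloor>t\<rfloor>"] by (simp add: frac_def)
  show ?thesis
  proof
    assume "\<gamma> a = \<gamma> b"
    then have "\<gamma> (frac a) = \<gamma> (frac b)" using fr by metis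
    then have "frac a = frac b"
      using assms frac_lt_1 frac_ge_0 unfolding regular_loop_def inj_on_def by (metis atLeastLessThan_iff)
    then have "a - b = of_int (\<lfloor>a\<rfloor> - \<lfloor>b\<rfloor>)" by (simp add: frac_def)
    then show "a - b \<in> \<int>" by (metis Ints_of_int)
  next
    assume "a - b \<in> \<int>"
    then obtain n where "a - b = of_int n" by (elim Ints_cases)
    then have "a = b + of_int n" by simp
    then show "\<gamma> a = \<gamma> b" using pern by simp
  qed
qed

lemma regular_loop_derivative:
  assumes "regular_loop \<gamma>"
  shows "(\<gamma> has_vector_derivative velocity \<gamma> t) (at t)"
  using assms unfolding regular_loop_def C1_differentiable_on_eq vector_derivative_works by simp

text \<open>\<open>oriented_param P\<close> is only known to be some regular loop with image P; this
  lemma transfers tangency to it. Difference quotients of g are multiples of secants of \<gamma>,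
  whose directions converge to the velocity of \<gamma>.\<close>

lemma regular_loop_tangent:
  fixes \<gamma> g :: "real \<Rightarrow> 'a::euclidean_space"
  assumes \<gamma>: "regular_loop \<gamma>" and g: "regular_loop g" and sub: "range g \<subseteq> range \<gamma>"
  obtains s k where "g t = \<gamma> s" "velocity g t = k *\<^sub>R velocity \<gamma> s"
proof -
  obtain s where s: "g t = \<gamma> s" using sub by (metis rangeI imageE subsetD)
  define u where "u = velocity \<gamma> s"
  have u: "(\<gamma> has_vector_derivative u) (at s)" "u \<noteq> 0"
    using regular_loop_derivative[OF \<gamma>] \<gamma> by (auto simp: u_def regular_loop_def)
  define h where "h n = inverse (real (Suc n))" for n
  have h: "h \<longlonglongrightarrow> 0" "\<And>n. h n \<noteq> 0" unfolding h_def using LIMSEQ_inverse_real_of_nat by auto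
  \<comment> \<open>The parameters are kept in a compact window of length one centred at s: the only
    limit in it that differs from s by an integer is s itself.\<close>
  have "\<exists>x\<in>{s - 1/2..s + 1/2}. \<gamma> x = g (t + h n)" for n
  proof -
    obtain a where a: "\<gamma> a = g (t + h n)" using sub by (metis rangeI imageE subsetD)
    define m where "m = \<lfloor>a - s + 1/2\<rfloor>"
    have "\<gamma> (a - of_int m) = \<gamma> a" unfolding regular_loop_eq_iff[OF \<gamma>] by simp
    moreover have "of_int m \<le> a - s + 1/2" "a - s + 1/2 < of_int m + 1" unfolding m_def by linarith+
    ultimately show ?thesis using a by (intro bexI[of _ "a - of_int m"]) auto
  qed
  then obtain x where x: "\<And>n. x n \<in> {s - 1/2..s + 1/2}" "\<And>n. \<gamma> (x n) = g (t + h n)" by metis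
  obtain l r where lr: "l \<in> {s - 1/2..s + 1/2}" "strict_mono (r :: nat \<Rightarrow> nat)" "(x \<circ> r) \<longlonglongrightarrow> l"
    using compact_Icc[of "s - 1/2" "s + 1/2"] x(1) unfolding compact_def by metis
  have hr: "(\<lambda>n. h (r n)) \<longlonglongrightarrow> 0" using LIMSEQ_subseq_LIMSEQ[OF h(1) lr(2)] by (simp add: o_def)
  have gc: "isCont \<gamma> a" "isCont g a" for a
    using regular_loop_derivative \<gamma> g has_vector_derivative_continuous by blast+
  have "(\<lambda>n. \<gamma> (x (r n))) \<longlonglongrightarrow> \<gamma> l" using isCont_tendsto_compose[OF gc(1) lr(3)] by (simp add: o_def)
  moreover have "(\<lambda>n. g (t + h (r n))) \<longlonglongrightarrow> g (t + 0)"
    by (rule isCont_tendsto_compose[OF gc(2)]) (intro tendsto_intros hr)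
  ultimately have "\<gamma> l = g t" unfolding x(2) using LIMSEQ_unique by fastforce
  then have "l - s \<in> \<int>" using s regular_loop_eq_iff[OF \<gamma>] by metis
  then obtain m where "l - s = of_int m" by (elim Ints_cases)
  then have "l = s" using lr(1) by (simp add: field_simps)
  note xs = lr(3)[unfolded this o_def]
  \<comment> \<open>The relative first-order remainder of \<gamma> at s. Division by zero gives it
    the value 0 at s, so it is continuous there, and parameters equal to s need no separate
    treatment.\<close>
  define \<epsilon> where "\<epsilon> y = (1 / (y - s)) *\<^sub>R (\<gamma> y - \<gamma> s - (y - s) *\<^sub>R u)" for y
  have "\<epsilon> \<midarrow>s\<rightarrow> 0"
  proof (rule tendsto_norm_zero_cancel)
    have "((\<lambda>y. norm (\<gamma> y - \<gamma> s - (y - s) *\<^sub>R u) / norm (y - s)) \<longlongrightarrow> 0) (at s)"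
      using u(1) unfolding has_vector_derivative_def has_derivative_iff_norm by simp
    then show "((\<lambda>y. norm (\<epsilon> y)) \<longlongrightarrow> 0) (at s)" by (simp add: \<epsilon>_def divide_inverse mult.commute)
  qed
  then have "isCont \<epsilon> s" by (simp add: isCont_def \<epsilon>_def)
  then have e0: "(\<lambda>n. \<epsilon> (x (r n))) \<longlonglongrightarrow> 0"
    using isCont_tendsto_compose[OF _ xs] by (fastforce simp: \<epsilon>_def)
  have exp: "\<gamma> y - \<gamma> s = (y - s) *\<^sub>R (u + \<epsilon> y)" for y by (cases "y = s") (auto simp: \<epsilon>_def scaleR_right_distrib)
  define q where "q n = (x (r n) - s) / h (r n)" for n
  define Q where "Q n = (1 / h (r n)) *\<^sub>R (g (t + h (r n)) - g t)" for n
  have Qq: "Q n = q n *\<^sub>R (u + \<epsilon> (x (r n)))" for n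
    unfolding Q_def q_def x(2)[symmetric] s exp by simp
  have "Q \<longlonglongrightarrow> velocity g t"
  proof -
    have "((\<lambda>y. norm (g y - g t - (y - t) *\<^sub>R velocity g t) / norm (y - t)) \<longlongrightarrow> 0) (at t)"
      using regular_loop_derivative[OF g, of t] unfolding has_vector_derivative_def has_derivative_iff_norm by simp
    moreover have "filterlim (\<lambda>n. t + h (r n)) (at t) sequentially"
      unfolding filterlim_at using h(2) by (auto intro!: tendsto_eq_intros hr)
    ultimately have "(\<lambda>n. norm (g (t + h (r n)) - g t - h (r n) *\<^sub>R velocity g t) / norm (h (r n))) \<longlonglongrightarrow> 0"
      using filterlim_compose by fastforce
    moreover have "norm (g (t + h (r n)) - g t - h (r n) *\<^sub>R velocity g t) / norm (h (r n)) = norm (Q n - velocity g t)" for n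
    proof -
      have "Q n - velocity g t = (1 / h (r n)) *\<^sub>R (g (t + h (r n)) - g t - h (r n) *\<^sub>R velocity g t)"
        using h(2)[of "r n"] by (simp add: Q_def algebra_simps)
      then show ?thesis by simp
    qed
    ultimately show ?thesis by (simp add: tendsto_norm_zero_iff LIM_zero_iff)
  qed
  note Qlim = this
  \<comment> \<open>Pairing with u isolates the scalar quotients \<open>q n\<close> and shows that
    they converge, to \<open>k\<close>.\<close>
  define k where "k = (velocity g t \<bullet> u) / (u \<bullet> u)"
  have den: "(\<lambda>n. (u + \<epsilon> (x (r n))) \<bullet> u) \<longlonglongrightarrow> u \<bullet> u"
    by (rule tendsto_eq_intros refl e0)+ simp
  have "(\<lambda>n. (Q n \<bullet> u) / ((u + \<epsilon> (x (r n))) \<bullet> u)) \<longlonglongrightarrow> k"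
    unfolding k_def by (intro tendsto_divide tendsto_inner Qlim den tendsto_const) (use u(2) in simp)
  moreover have "\<forall>\<^sub>F n in sequentially. (Q n \<bullet> u) / ((u + \<epsilon> (x (r n))) \<bullet> u) = q n"
  proof -
    have "\<forall>\<^sub>F n in sequentially. (u + \<epsilon> (x (r n))) \<bullet> u \<noteq> 0"
      using tendsto_imp_eventually_ne[OF den, of 0] u(2) by simp
    then show ?thesis by (rule eventually_mono) (simp add: Qq)
  qed
  ultimately have "q \<longlonglongrightarrow> k" using tendsto_cong by fast
  then have "(\<lambda>n. q n *\<^sub>R (u + \<epsilon> (x (r n)))) \<longlonglongrightarrow> k *\<^sub>R (u + 0)"
    by (intro tendsto_intros e0)
  then have "Q \<longlonglongrightarrow> k *\<^sub>R u" unfolding Qq[abs_def] by simp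
  then have "velocity g t = k *\<^sub>R u" using Qlim LIMSEQ_unique by blast
  then show ?thesis using that[OF s] unfolding u_def by blast
qed

section \<open>Closed characteristics as periodic orbits of the pulled-back flow\<close>

context near_sphere
begin

lemma near_rotation_char_dir: "near_rotation (\<lambda>z u. norm z = 1 \<and> char_dir z u) (12 * \<delta>)"
proof
  fix z u assume "norm z = 1 \<and> char_dir z u"
  then show "norm z = 1 \<and> norm (u - cplx z) \<le> 12 * \<delta>" using char_dir_near[of z u] small by simp
qed (use small char_dir_lipschitz in auto)

sublocale NR: near_rotation "\<lambda>z u. norm z = 1 \<and> char_dir z u" "12 * \<delta>"
  by (rule near_rotation_char_dir)

definition characteristic_loop :: "(real \<Rightarrow> (real \<times> real) ^ 'm) \<Rightarrow> bool" where
  "characteristic_loop \<gamma> \<longleftrightarrow> regular_loop \<gamma> \<and>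
     (\<forall>t. \<gamma> t \<in> surf \<and> velocity \<gamma> t \<in> symp_orth (tangent_space surf (\<gamma> t)))"

text \<open>The factor between the velocity of \<gamma> and the image of the normalised direction of
  \<open>char_dir\<close>. Pairing with \<open>demb z z\<close> at z =
  \<open>proj (\<gamma> t)\<close> reads it off, because the normalised direction gives -1
  there.\<close>

definition speed :: "(real \<Rightarrow> (real \<times> real) ^ 'm) \<Rightarrow> real \<Rightarrow> real" where
  "speed \<gamma> t = - (cplx (velocity \<gamma> t) \<bullet> demb (proj (\<gamma> t)) (proj (\<gamma> t)))"

lemma characteristic_loop_pull_back:
  assumes "characteristic_loop \<gamma>"
  shows "\<exists>u. (\<forall>t. norm (proj (\<gamma> t)) = 1) \<and> (\<forall>t. char_dir (proj (\<gamma> t)) (u t)) \<and>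
    (\<forall>t. ((\<lambda>t. proj (\<gamma> t)) has_vector_derivative speed \<gamma> t *\<^sub>R u t) (at t)) \<and>
    continuous_on UNIV (speed \<gamma>) \<and> (\<forall>t. speed \<gamma> t \<noteq> 0) \<and> continuous_on UNIV (\<lambda>t. speed \<gamma> t *\<^sub>R u t) \<and>
    (\<forall>t. velocity \<gamma> t = speed \<gamma> t *\<^sub>R demb (proj (\<gamma> t)) (u t))"
proof -
  have "\<gamma> C1_differentiable_on UNIV" "\<And>t. velocity \<gamma> t \<noteq> 0" "\<And>t. \<gamma> t \<in> surf"
    "\<And>t. velocity \<gamma> t \<in> symp_orth (tangent_space surf (\<gamma> t))"
    using assms unfolding characteristic_loop_def regular_loop_def by auto
  then obtain y c u where *: "\<And>t. \<gamma> t = emb (y t)" "\<And>t. norm (y t) = 1"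
    "\<And>t. (y has_vector_derivative c t *\<^sub>R u t) (at t)" "\<And>t. char_dir (y t) (u t)"
    "continuous_on UNIV c" "\<And>t. c t \<noteq> (0::real)" "continuous_on UNIV (\<lambda>t. c t *\<^sub>R u t)"
    "\<And>t. velocity \<gamma> t = c t *\<^sub>R demb (y t) (u t)"
    using characteristic_pull_back[of \<gamma>] by blast
  have y: "y = (\<lambda>t. proj (\<gamma> t))" using *(1) by auto
  have "speed \<gamma> t = c t" for t
  proof -
    have "cplx (demb (y t) (u t)) \<bullet> demb (y t) (y t) = - 1"
      using *(4)[of t] *(2)[of t] unfolding char_dir_def by (simp add: norm_eq_1)
    then show ?thesis unfolding speed_def *(8) using *(1) by (simp add: cplx_linear)
  qed
  then have c: "c = speed \<gamma>" by auto
  show ?thesis using *[unfolded c y] by blast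
qed

text \<open>The Liouville form along \<gamma> is half the speed times a density within 12 \<delta>
  of 1. The continuous speed has no zero, so it keeps its sign.\<close>

lemma characteristic_loop_action:
  assumes "characteristic_loop \<gamma>"
  shows "(\<And>t. speed \<gamma> t > 0) \<Longrightarrow>
      \<bar>loop_action \<gamma> - integral {0..1} (speed \<gamma>) / 2\<bar> \<le> 6 * \<delta> * integral {0..1} (speed \<gamma>)"
    "(\<And>t. speed \<gamma> t < 0) \<Longrightarrow> loop_action \<gamma> \<le> 0"
    "(\<forall>t. speed \<gamma> t > 0) \<or> (\<forall>t. speed \<gamma> t < 0)"
proof -
  obtain u where u: "\<And>t. norm (proj (\<gamma> t)) = 1" "\<And>t. char_dir (proj (\<gamma> t)) (u t)"
    "\<And>t. ((\<lambda>t. proj (\<gamma> t)) has_vector_derivative speed \<gamma> t *\<^sub>R u t) (at t)"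
    "continuous_on UNIV (speed \<gamma>)" "\<And>t. speed \<gamma> t \<noteq> 0" "continuous_on UNIV (\<lambda>t. speed \<gamma> t *\<^sub>R u t)"
    "\<And>t. velocity \<gamma> t = speed \<gamma> t *\<^sub>R demb (proj (\<gamma> t)) (u t)"
    using characteristic_loop_pull_back[OF assms] by blast
  define a where "a t = cplx (\<gamma> t) \<bullet> demb (proj (\<gamma> t)) (u t)" for t
  have a: "\<bar>a t - 1\<bar> \<le> 12 * \<delta>" for t
    using action_density_near[OF u(2,1), of t] by (simp add: a_def)
  have f: "liouville_form (\<gamma> t) (velocity \<gamma> t) = speed \<gamma> t * a t / 2" for t
    by (simp add: liouville_form_cplx u(7) a_def)
  have rl: "regular_loop \<gamma>" using assms by (simp add: characteristic_loop_def)
  have "continuous_on UNIV (\<lambda>t. liouville_form (\<gamma> t) (velocity \<gamma> t))"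
  proof -
    have "continuous_on UNIV \<gamma>" using regular_loop_derivative[OF rl]
      by (auto intro: continuous_at_imp_continuous_on has_vector_derivative_continuous)
    moreover have "continuous_on UNIV (velocity \<gamma>)"
      using rl unfolding regular_loop_def C1_differentiable_on_eq by simp
    ultimately show ?thesis unfolding liouville_form_cplx
      by (intro continuous_intros bounded_linear.continuous_on[OF bounded_linear_cplx])
  qed
  then have "(\<lambda>t. liouville_form (\<gamma> t) (velocity \<gamma> t)) integrable_on {0..1}"
    by (intro integrable_continuous_interval) (auto intro: continuous_on_subset)
  then have fi: "((\<lambda>t. speed \<gamma> t * a t / 2) has_integral loop_action \<gamma>) {0..1}"
    unfolding loop_action_def f by (rule integrable_integral)
  have "speed \<gamma> integrable_on {0..1}"
    by (intro integrable_continuous_interval continuous_on_subset[OF u(4)]) auto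
  then have si: "(speed \<gamma> has_integral integral {0..1} (speed \<gamma>)) {0..1}" by (rule integrable_integral)
  { assume pos: "\<And>t. speed \<gamma> t > 0"
    have b: "speed \<gamma> t * (1/2 - 6 * \<delta>) \<le> speed \<gamma> t * a t / 2" "speed \<gamma> t * a t / 2 \<le> speed \<gamma> t * (1/2 + 6 * \<delta>)" for t
      using mult_left_mono[of "1/2 - 6 * \<delta>" "a t / 2" "speed \<gamma> t"] mult_left_mono[of "a t / 2" "1/2 + 6 * \<delta>" "speed \<gamma> t"]
        a[of t] pos[of t] by (auto simp: abs_le_iff)
    have "integral {0..1} (speed \<gamma>) * (1/2 - 6 * \<delta>) \<le> loop_action \<gamma>"
      by (rule has_integral_le[OF has_integral_mult_left[OF si] fi]) (rule b)
    moreover have "loop_action \<gamma> \<le> integral {0..1} (speed \<gamma>) * (1/2 + 6 * \<delta>)"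
      by (rule has_integral_le[OF fi has_integral_mult_left[OF si]]) (rule b)
    ultimately show "\<bar>loop_action \<gamma> - integral {0..1} (speed \<gamma>) / 2\<bar> \<le> 6 * \<delta> * integral {0..1} (speed \<gamma>)"
      by (simp add: algebra_simps abs_le_iff) }
  { assume neg: "\<And>t. speed \<gamma> t < 0"
    have "speed \<gamma> t * a t / 2 \<le> 0" for t
      using mult_nonpos_nonneg[of "speed \<gamma> t" "a t"] neg[of t] a[of t] small by simp
    then show "loop_action \<gamma> \<le> 0" using has_integral_le[OF fi has_integral_0] by blast }
  show "(\<forall>t. speed \<gamma> t > 0) \<or> (\<forall>t. speed \<gamma> t < 0)"
  proof (rule ccontr)
    assume "\<not> ((\<forall>t. speed \<gamma> t > 0) \<or> (\<forall>t. speed \<gamma> t < 0))"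
    then obtain p q where "speed \<gamma> p \<le> 0" "speed \<gamma> q \<ge> 0" by (auto simp: not_less)
    moreover have "connected (speed \<gamma> ` UNIV)" by (rule connected_continuous_image[OF u(4)]) simp
    ultimately have "0 \<in> speed \<gamma> ` UNIV" unfolding connected_iff_interval by blast
    then show False using u(5) by auto
  qed
qed

lemma characteristic_loop_reparam:
  assumes "characteristic_loop \<gamma>" "regular_loop g" "range g \<subseteq> range \<gamma>"
  shows "characteristic_loop g"
  unfolding characteristic_loop_def
proof (intro conjI allI)
  fix t
  obtain s k where sk: "g t = \<gamma> s" "velocity g t = k *\<^sub>R velocity \<gamma> s"
    using regular_loop_tangent[OF _ assms(2,3)] assms(1) unfolding characteristic_loop_def by blast
  have sc: "symp_form (k *\<^sub>R x) y = k * symp_form x y" for x y :: "(real \<times> real) ^ 'm"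
    by (simp add: symp_form_cplx cplx_linear)
  show "g t \<in> surf" "velocity g t \<in> symp_orth (tangent_space surf (g t))"
    using assms(1) unfolding sk characteristic_loop_def symp_orth_def by (auto simp: sc)
qed (rule assms(2))

text \<open>\<gamma> or its reverse has positive action, so the choice in
  \<open>oriented_param\<close> is not void. The chosen loop need not be either of them: tangency
  passes to it through its image, and positive action excludes negative speed.\<close>

lemma oriented_param_characteristic:
  assumes "P \<in> closed_characteristics surf"
  shows "characteristic_loop (oriented_param P)" "range (oriented_param P) = P" "\<And>t. speed (oriented_param P) t > 0"
proof -
  obtain \<gamma> where P: "P = range \<gamma>" and \<gamma>: "characteristic_loop \<gamma>"
    using assms unfolding closed_characteristics_def characteristic_loop_def by blast
  have pos_action: "0 < loop_action g" if "characteristic_loop g" "\<And>t. speed g t > 0" for g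
  proof -
    have u: "continuous_on UNIV (speed g)"
      using characteristic_loop_pull_back[OF that(1)] by blast
    have "0 < integral {0..1} (speed g)"
    proof -
      have c: "continuous_on {0..1} (speed g)" using u continuous_on_subset by blast
      obtain m where m: "m \<in> {0..1}" "\<And>t. t \<in> {0..1} \<Longrightarrow> speed g m \<le> speed g t"
        using continuous_attains_inf[OF _ _ c] by auto
      have "((\<lambda>_. speed g m) has_integral speed g m) {0..1::real}"
        using has_integral_const_real[of "speed g m" 0 1] by simp
      moreover have "(speed g has_integral integral {0..1} (speed g)) {0..1}"
        using c by (intro integrable_integral integrable_continuous_interval)
      ultimately have "speed g m \<le> integral {0..1} (speed g)" by (rule has_integral_le) (rule m(2))
      then show ?thesis using that(2)[of m] by simp
    qed
    moreover have "6 * \<delta> * integral {0..1} (speed g) \<le> (1/4) * integral {0..1} (speed g)"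
      by (rule mult_right_mono) (use small calculation in auto)
    ultimately show ?thesis using characteristic_loop_action(1)[OF that] by linarith
  qed
  have "\<exists>g. regular_loop g \<and> range g = P \<and> 0 < loop_action g"
  proof (cases "\<forall>t. speed \<gamma> t > 0")
    case True
    then show ?thesis using pos_action[OF \<gamma>] \<gamma> P unfolding characteristic_loop_def by blast
  next
    case False
    then have neg: "speed \<gamma> t < 0" for t using characteristic_loop_action(3)[OF \<gamma>] by blast
    have rl: "regular_loop \<gamma>" using \<gamma> by (simp add: characteristic_loop_def)
    define g where "g t = \<gamma> (- t)" for t
    have gd: "(g has_vector_derivative - velocity \<gamma> (- t)) (at t)" for t
    proof -
      have "((\<gamma> \<circ> uminus) has_vector_derivative (- 1) *\<^sub>R velocity \<gamma> (- t)) (at t)"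
        by (rule vector_diff_chain_at) (auto intro!: derivative_eq_intros regular_loop_derivative[OF rl])
      then show ?thesis by (simp add: o_def g_def[abs_def])
    qed
    have gv: "velocity g t = - velocity \<gamma> (- t)" for t by (rule vector_derivative_at[OF gd])
    have rg: "range g = P"
    proof -
      have "\<gamma> a \<in> range g" for a by (rule image_eqI[of _ _ "- a"]) (simp_all add: g_def)
      then show ?thesis by (auto simp: P g_def)
    qed
    have regg: "regular_loop g" unfolding regular_loop_def
    proof (intro conjI allI)
      have "continuous_on UNIV (\<lambda>t. - velocity \<gamma> (- t))"
      proof -
        have c: "continuous_on UNIV (velocity \<gamma>)" using rl unfolding regular_loop_def C1_differentiable_on_eq by simp
        show ?thesis by (intro continuous_intros continuous_on_compose2[OF c]) auto
      qed
      then show "g C1_differentiable_on UNIV" unfolding C1_differentiable_on_def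
        by (intro exI[of _ "\<lambda>t. - velocity \<gamma> (- t)"]) (use gd in auto)
      show "velocity g t \<noteq> 0" for t using rl gv by (simp add: regular_loop_def)
      show "g (t + 1) = g t" for t unfolding g_def regular_loop_eq_iff[OF rl] by simp
      show "inj_on g {0..<1}"
      proof (rule inj_onI)
        fix a b :: real assume ab: "a \<in> {0..<1}" "b \<in> {0..<1}" "g a = g b"
        then have "- a - (- b) \<in> \<int>" unfolding g_def regular_loop_eq_iff[OF rl] by simp
        then obtain m where "b - a = of_int m" by (auto elim: Ints_cases)
        moreover from this have "m < 1" "- 1 < m" using ab by auto
        ultimately show "a = b" by simp
      qed
    qed
    have cg: "characteristic_loop g" by (rule characteristic_loop_reparam[OF \<gamma> regg]) (simp add: rg P)
    have "speed g t = - speed \<gamma> (- t)" for t by (simp add: speed_def gv g_def cplx_linear)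
    then have "speed g t > 0" for t using neg[of "- t"] by simp
    then show ?thesis using pos_action[OF cg] regg rg by blast
  qed
  then have op: "regular_loop (oriented_param P)" "range (oriented_param P) = P" "0 < loop_action (oriented_param P)"
    unfolding oriented_param_def by (metis (mono_tags, lifting) someI_ex)+
  show "range (oriented_param P) = P" by (rule op)
  show c: "characteristic_loop (oriented_param P)"
    by (rule characteristic_loop_reparam[OF \<gamma> op(1)]) (use op(2) P in simp)
  show "speed (oriented_param P) t > 0" for t
    using characteristic_loop_action(2,3)[OF c] op(3) by (meson not_less)
qed

text \<open>The time change \<sigma> with derivative \<open>speed\<close> turns the pulled-back loop
  into a trajectory of the normalised field. T is the gain of \<sigma> over one turn, and it is the
  least period because \<gamma> is simply covered.\<close>

lemma characteristic_orbit:
  assumes "characteristic_loop \<gamma>" "\<And>t. speed \<gamma> t > 0"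
  obtains T yh \<sigma> where "T = integral {0..1} (speed \<gamma>)" "T > 0" "NR.orbit yh"
    "\<And>x. yh (x + T) = yh x" "\<And>s. 0 < s \<Longrightarrow> s < T \<Longrightarrow> yh s \<noteq> yh 0"
    "\<And>t. proj (\<gamma> t) = yh (\<sigma> t)" "\<And>x. yh x \<in> range (\<lambda>t. proj (\<gamma> t))" "\<sigma> 0 = 0"
    "\<And>t. speed \<gamma> (t + 1) = speed \<gamma> t"
proof -
  obtain u where u: "\<And>t. norm (proj (\<gamma> t)) = 1" "\<And>t. char_dir (proj (\<gamma> t)) (u t)"
    "\<And>t. ((\<lambda>t. proj (\<gamma> t)) has_vector_derivative speed \<gamma> t *\<^sub>R u t) (at t)"
    "continuous_on UNIV (speed \<gamma>)"
    using characteristic_loop_pull_back[OF assms(1)] by blast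
  have rl: "regular_loop \<gamma>" using assms(1) by (simp add: characteristic_loop_def)
  have per: "\<gamma> (t + 1) = \<gamma> t" for t using rl by (simp add: regular_loop_def)
  have vper: "velocity \<gamma> (t + 1) = velocity \<gamma> t" for t
  proof -
    have "((\<gamma> \<circ> (\<lambda>t. t + 1)) has_vector_derivative 1 *\<^sub>R velocity \<gamma> (t + 1)) (at t)"
      by (rule vector_diff_chain_at) (auto intro!: derivative_eq_intros regular_loop_derivative[OF rl])
    moreover have "\<gamma> \<circ> (\<lambda>t. t + 1) = \<gamma>" using per by auto
    ultimately show ?thesis using vector_derivative_at by force
  qed
  have sper: "speed \<gamma> (t + 1) = speed \<gamma> t" for t by (simp add: speed_def vper per)
  obtain \<sigma> where \<sigma>: "\<And>t. (\<sigma> has_real_derivative speed \<gamma> t) (at t)" "\<sigma> 0 = 0"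
    using continuous_antiderivative[OF u(4)] by blast
  define T where "T = integral {0..1} (speed \<gamma>)"
  have T1: "T = \<sigma> 1" unfolding T_def using integral_unique[OF has_integral_DERIV[OF \<sigma>(1), of 0 1]] \<sigma>(2) by simp
  have \<sigma>per: "\<sigma> (t + 1) = \<sigma> t + T" for t
  proof -
    have "((\<lambda>t. \<sigma> (t + 1) - \<sigma> t) has_real_derivative 0) (at t)" for t
    proof -
      have "((\<lambda>t. \<sigma> (t + 1)) has_real_derivative speed \<gamma> (t + 1)) (at t)"
        using \<sigma>(1)[of "t + 1"] by (rule DERIV_shift[THEN iffD1])
      from DERIV_diff[OF this \<sigma>(1)[of t]] show ?thesis by (simp add: sper)
    qed
    then have "\<sigma> (t + 1) - \<sigma> t = \<sigma> (0 + 1) - \<sigma> 0" using DERIV_isconst_all[of "\<lambda>t. \<sigma> (t + 1) - \<sigma> t"] by blast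
    then show ?thesis using T1 \<sigma>(2) by simp
  qed
  have "\<sigma> 0 < \<sigma> 1" by (rule DERIV_pos_imp_increasing) (use \<sigma>(1) assms(2) in auto)
  then have Tpos: "T > 0" using T1 \<sigma>(2) by simp
  obtain \<tau> where \<tau>: "\<And>x. \<sigma> (\<tau> x) = x" "\<And>t. \<tau> (\<sigma> t) = t" "\<And>x. (\<tau> has_real_derivative inverse (speed \<gamma> (\<tau> x))) (at x)"
    "\<And>x. \<tau> (x + T) = \<tau> x + 1"
    using periodic_reparametrization[OF \<sigma>(1) assms(2) \<sigma>per Tpos] by blast
  define yh where "yh x = proj (\<gamma> (\<tau> x))" for x
  have "NR.orbit yh" unfolding NR.orbit_def
  proof
    fix x
    have "(((\<lambda>t. proj (\<gamma> t)) \<circ> \<tau>) has_vector_derivative inverse (speed \<gamma> (\<tau> x)) *\<^sub>R (speed \<gamma> (\<tau> x) *\<^sub>R u (\<tau> x))) (at x)"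
      by (rule vector_diff_chain_at[OF _ u(3)]) (use \<tau>(3) in \<open>simp add: has_real_derivative_iff_has_vector_derivative\<close>)
    then have "(yh has_vector_derivative u (\<tau> x)) (at x)"
      using assms(2)[of "\<tau> x"] by (simp add: o_def yh_def[abs_def])
    then show "\<exists>w. (yh has_vector_derivative w) (at x) \<and> norm (yh x) = 1 \<and> char_dir (yh x) w"
      using u(1,2) by (auto simp: yh_def)
  qed
  moreover have "yh (x + T) = yh x" for x by (simp add: yh_def \<tau>(4) per)
  moreover have "yh s \<noteq> yh 0" if "0 < s" "s < T" for s
  proof
    assume "yh s = yh 0"
    then have "emb (yh s) = emb (yh 0)" by simp
    then have "\<gamma> (\<tau> s) = \<gamma> (\<tau> 0)" by (simp add: yh_def)
    then have "\<tau> s - \<tau> 0 \<in> \<int>" unfolding regular_loop_eq_iff[OF rl] .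
    moreover have "\<tau> 0 = 0" using \<tau>(2)[of 0] \<sigma>(2) by simp
    moreover have "0 < \<tau> s" "\<tau> s < 1"
    proof -
      have mono: "\<tau> a < \<tau> b" if "a < b" for a b
      proof (rule DERIV_pos_imp_increasing[OF that])
        fix x show "\<exists>D. (\<tau> has_real_derivative D) (at x) \<and> 0 < D"
          by (rule exI[of _ "inverse (speed \<gamma> (\<tau> x))"]) (use \<tau>(3) assms(2) in simp)
      qed
      show "0 < \<tau> s" using mono[OF that(1)] \<open>\<tau> 0 = 0\<close> by simp
      show "\<tau> s < 1" using mono[OF that(2)] \<tau>(2)[of 1] T1 by simp
    qed
    ultimately show False by (auto elim!: Ints_cases)
  qed
  moreover have "proj (\<gamma> t) = yh (\<sigma> t)" for t by (simp add: yh_def \<tau>(2))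
  moreover have "yh x \<in> range (\<lambda>t. proj (\<gamma> t))" for x by (simp add: yh_def)
  ultimately show ?thesis using that[of T yh \<sigma>] T_def Tpos \<sigma>(2) sper by blast
qed

text \<open>The flow deviates by \<kappa> = 12 \<delta> and \<open>short_prime_period\<close>
  requires \<kappa> K \<le> 1/50, hence the factor 600. In the short case half of the period error
  36 \<delta> K plus the density error 6 \<delta> K is 24 \<delta> K; in the long case 2/5 = 1/2 -
  1/10.\<close>

lemma action_dichotomy:
  assumes P: "P \<in> closed_characteristics surf" and K: "600 * \<delta> * K \<le> 1"
  shows "(\<bar>integral {0..1} (speed (oriented_param P)) - 2 * pi\<bar> \<le> 36 * \<delta> * K \<and> \<bar>char_action P - pi\<bar> \<le> 24 * \<delta> * K) \<or>
    (integral {0..1} (speed (oriented_param P)) > K \<and> char_action P \<ge> (2/5) * integral {0..1} (speed (oriented_param P)))"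
proof -
  note op = oriented_param_characteristic[OF P]
  obtain T yh \<sigma> where T: "T = integral {0..1} (speed (oriented_param P))" "T > 0" "NR.orbit yh"
    "\<And>x. yh (x + T) = yh x" "\<And>s. 0 < s \<Longrightarrow> s < T \<Longrightarrow> yh s \<noteq> yh 0"
    "\<And>t. proj (oriented_param P t) = yh (\<sigma> t)" "\<And>x. yh x \<in> range (\<lambda>t. proj (oriented_param P t))" "\<sigma> 0 = 0"
    "\<And>t. speed (oriented_param P) (t + 1) = speed (oriented_param P) t"
    by (rule characteristic_orbit[OF op(1,3)], rule that) assumption+
  have a: "\<bar>char_action P - T / 2\<bar> \<le> 6 * \<delta> * T"
    using characteristic_loop_action(1)[OF op(1,3)] T(1) by (simp add: char_action_def)
  show ?thesis
  proof (cases "T \<le> K")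
    case True
    have "\<bar>T - 2 * pi\<bar> \<le> 3 * (12 * \<delta>) * K"
      by (rule NR.short_prime_period[OF T(3,4,5,2) True]) (use K in auto)
    moreover have "6 * \<delta> * T \<le> 6 * \<delta> * K" using True small by (intro mult_left_mono) auto
    ultimately show ?thesis using a unfolding T(1)[symmetric] by (simp add: abs_le_iff)
  next
    case False
    have "6 * \<delta> * T \<le> (1/10) * T" using small T(2) by (intro mult_right_mono) auto
    then show ?thesis using a False unfolding T(1)[symmetric] by (simp add: abs_le_iff)
  qed
qed

end

section \<open>The Gauss linking integral as a degree\<close>

lemma herm_inner: "Re (herm a b) = a \<bullet> b"
  by (simp add: herm_def inner_prod_def inner_complex_def)

lemma herm_linear: "herm (a + b) x = herm a x + herm b x" "herm (r *\<^sub>R a) x = of_real r * herm a x"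
  "herm (a - b) x = herm a x - herm b x" "herm (- a) x = - herm a x"
  "herm x (a + b) = herm x a + herm x b" "herm x (r *\<^sub>R a) = of_real r * herm x a"
  "herm x (a - b) = herm x a - herm x b" "herm x (- a) = - herm x a"
  by (simp_all add: herm_def algebra_simps scaleR_conv_of_real)

lemma det2_linear: "det2 x (a + b) = det2 x a + det2 x b" "det2 x (r *\<^sub>R a) = of_real r * det2 x a"
  "det2 x (a - b) = det2 x a - det2 x b"
  by (simp_all add: det2_def algebra_simps scaleR_conv_of_real)

text \<open>The quaternionic frame respects orientations: the right-hand side is |n|^2 times the
  4-form \<open>symp_vol4\<close> of n, a, b, c, since the symplectic form of x and y is the
  imaginary part of \<open>herm y x\<close>. The proof is a polynomial identity in sixteen real
  coordinates.\<close>

lemma det3_cvec: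
  "det3 (cvec n a) (cvec n b) (cvec n c) = (n \<bullet> n) *
    (Im (herm a n) * Im (herm c b) - Im (herm b n) * Im (herm c a) + Im (herm c n) * Im (herm b a))"
proof -
  obtain n1 n2 n3 n4 where n: "n = (Complex n1 n2, Complex n3 n4)" by (metis complex_surj surj_pair)
  obtain a1 a2 a3 a4 where a: "a = (Complex a1 a2, Complex a3 a4)" by (metis complex_surj surj_pair)
  obtain b1 b2 b3 b4 where b: "b = (Complex b1 b2, Complex b3 b4)" by (metis complex_surj surj_pair)
  obtain c1 c2 c3 c4 where c: "c = (Complex c1 c2, Complex c3 c4)" by (metis complex_surj surj_pair)
  show ?thesis unfolding n a b c det3_def cvec_def herm_def det2_def inner_prod_def inner_complex_def
    by simp algebra
qed

definition pair_coords :: "'m \<Rightarrow> 'm \<Rightarrow> (real \<times> real) ^ 'm::finite \<Rightarrow> c2" where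
  "pair_coords i j x = (Complex (fst (x $ i)) (snd (x $ i)), Complex (fst (x $ j)) (snd (x $ j)))"

text \<open>The two coordinates of \<iota> are the Hermitian product with z and the complex
  determinant against z. They preserve \<open>herm\<close>, hence at once the inner product, the
  symplectic form and its square.\<close>

lemma unitary_coordinates:
  fixes z :: "(real \<times> real) ^ 'm::finite"
  assumes "CARD('m) = 2" "norm z = 1"
  obtains \<iota> :: "(real \<times> real) ^ 'm \<Rightarrow> c2" where "bounded_linear \<iota>" "\<And>x y. \<iota> x \<bullet> \<iota> y = x \<bullet> y"
    "\<And>x. \<iota> (cplx x) = (\<i> * fst (\<iota> x), \<i> * snd (\<iota> x))" "\<iota> z = (1, 0)"
    "\<And>n a b c. norm n = 1 \<Longrightarrow> symp_vol4 n a b c = det3 (cvec (\<iota> n) (\<iota> a)) (cvec (\<iota> n) (\<iota> b)) (cvec (\<iota> n) (\<iota> c))"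
proof -
  obtain i j :: 'm where ij: "i \<noteq> j" "UNIV = {i, j}"
    using assms(1) card_2_iff[of "UNIV :: 'm set"] by auto
  let ?p = "pair_coords i j"
  have sum2: "(\<Sum>k\<in>UNIV. f k) = f i + f j" for f :: "'m \<Rightarrow> real" unfolding ij(2) using ij(1) by simp
  have pl: "?p (x + y) = ?p x + ?p y" "?p (r *\<^sub>R x) = r *\<^sub>R ?p x" for x y r
    by (simp_all add: pair_coords_def complex_eq_iff)
  have pi: "?p x \<bullet> ?p y = x \<bullet> y" for x y
    by (simp add: pair_coords_def inner_vec_def sum2 inner_prod_def inner_complex_def)
  have pc: "?p (cplx x) = (\<i> * fst (?p x), \<i> * snd (?p x))" for x
    by (simp add: pair_coords_def cplx_def complex_eq_iff)
  have ps: "symp_form x y = Im (herm (?p y) (?p x))" for x y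
    by (simp add: symp_form_def sum2 pair_coords_def herm_def algebra_simps)
  define \<iota> where "\<iota> x = (herm (?p x) (?p z), det2 (?p z) (?p x))" for x
  have lin: "\<iota> (x + y) = \<iota> x + \<iota> y" "\<iota> (r *\<^sub>R x) = r *\<^sub>R \<iota> x" for x y r
    by (simp_all add: \<iota>_def pl herm_linear det2_linear scaleR_conv_of_real)
  have zz: "herm (?p z) (?p z) = 1"
  proof -
    have "?p z \<bullet> ?p z = 1" using assms(2) by (simp add: pi norm_eq_1)
    then show ?thesis by (simp add: complex_eq_iff herm_def inner_prod_def inner_complex_def algebra_simps)
  qed
  have herm: "herm (\<iota> x) (\<iota> y) = herm (?p x) (?p y)" for x y
  proof -
    have "herm (\<iota> x) (\<iota> y) = herm (?p z) (?p z) * herm (?p x) (?p y)"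
      by (simp add: \<iota>_def herm_def det2_def algebra_simps)
    then show ?thesis by (simp add: zz)
  qed
  have inner: "\<iota> x \<bullet> \<iota> y = x \<bullet> y" for x y
    using arg_cong[OF herm, of Re x y] by (simp add: herm_inner pi)
  have nrm: "norm (\<iota> x) = norm x" for x by (simp add: norm_eq_sqrt_inner inner)
  have bl: "bounded_linear \<iota>" by (rule bounded_linear_intro[of _ 1]) (simp_all add: lin nrm)
  moreover have "\<iota> (cplx x) = (\<i> * fst (\<iota> x), \<i> * snd (\<iota> x))" for x
    by (simp add: \<iota>_def pc herm_def det2_def algebra_simps)
  moreover have "\<iota> z = (1, 0)" by (simp add: \<iota>_def zz) (simp add: det2_def)
  moreover have "symp_vol4 n a b c = det3 (cvec (\<iota> n) (\<iota> a)) (cvec (\<iota> n) (\<iota> b)) (cvec (\<iota> n) (\<iota> c))"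
    if "norm n = 1" for n a b c
    unfolding det3_cvec using that by (simp add: inner symp_vol4_def ps herm norm_eq_1)
  ultimately show ?thesis using that inner by blast
qed

lemma c1_loop_inverse:
  assumes "c1_loop a" "\<And>t. a t \<noteq> (0::real)"
  shows "c1_loop (\<lambda>t. inverse (a t))"
proof -
  obtain a' where d: "\<And>t. (a has_real_derivative a' t) (at t)" "continuous_on UNIV a'" "\<And>t. a (t+1) = a t"
    using assms(1) unfolding c1_loop_def has_real_derivative_iff_has_vector_derivative by blast
  show ?thesis unfolding c1_loop_def has_real_derivative_iff_has_vector_derivative[symmetric]
    by (rule exI[of _ "\<lambda>t. - (a' t * inverse ((a t)\<^sup>2))"])
       (use assms(2) d in \<open>auto intro!: DERIV_cong[OF DERIV_inverse'[OF d(1)]] continuous_intros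
          c1_loop_continuous[OF assms(1)] simp: power2_eq_square\<close>)
qed

lemma c1_loop_regular: "regular_loop \<gamma> \<Longrightarrow> c1_loop \<gamma>"
  unfolding regular_loop_def C1_differentiable_on_def c1_loop_def by auto

lemma c1_loop_velocity:
  assumes "c1_loop \<gamma>" shows "(\<gamma> has_vector_derivative velocity \<gamma> t) (at t)"
  using assms unfolding c1_loop_def by (metis vector_derivative_at)

lemma cvec_scale: "cvec (r *\<^sub>R n) a = r *\<^sub>R cvec n a" "cvec (n + m) a = cvec n a + cvec m a" "cvec (n - m) a = cvec n a - cvec m a"
  "cvec n n = 0"
  by (simp_all add: cvec_def herm_def det2_def algebra_simps scaleR_conv_of_real zero_prod_def complex_eq_iff)

lemma norm_cvec_le: "norm (cvec x a) \<le> norm x * norm a"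
proof (rule power2_le_imp_le)
  show "(norm (cvec x a))\<^sup>2 \<le> (norm x * norm a)\<^sup>2"
    using norm_cvec[of x a] zero_le_power2[of "x \<bullet> a"]
    unfolding power_mult_distrib mult.commute[of "(norm x)\<^sup>2"] by linarith
qed simp

lemma norm_cvec_perp:
  assumes "x \<bullet> a = 0" shows "norm (cvec x a) = norm x * norm a"
proof (rule power2_eq_imp_eq)
  show "(norm (cvec x a))\<^sup>2 = (norm x * norm a)\<^sup>2"
    using norm_cvec[of x a] assms unfolding power_mult_distrib by (simp add: mult.commute)
qed simp_all

text \<open>The difference map has t-derivative - \<open>velocity \<beta>\<close>, whereas the Gauss
  integrand contains + \<open>velocity \<beta>\<close>. Using the frame at the outward normal -
  \<nu>, which is minus the frame at \<nu>, compensates this sign. Orthogonality to \<nu> makes the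
  frame preserve lengths.\<close>

lemma gauss_linking_torus_degree:
  fixes \<alpha> \<beta> :: "real \<Rightarrow> (real \<times> real) ^ 'm::finite"
  assumes bl: "bounded_linear \<iota>" and inner: "\<And>x y. \<iota> x \<bullet> \<iota> y = x \<bullet> y"
    and vol: "\<And>n a b c. norm n = 1 \<Longrightarrow> symp_vol4 n a b c = det3 (cvec (\<iota> n) (\<iota> a)) (cvec (\<iota> n) (\<iota> b)) (cvec (\<iota> n) (\<iota> c))"
    and n: "norm \<nu> = 1" and loops: "c1_loop \<alpha>" "c1_loop \<beta>" and perp: "\<And>s t. \<nu> \<bullet> (\<alpha> s - \<beta> t) = 0"
  shows "gauss_linking \<nu> \<alpha> \<beta> = torus_degree (\<lambda>s t. cvec (\<iota> (- \<nu>)) (\<iota> (\<alpha> s - \<beta> t)))"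
    "torus_map (\<lambda>s t. cvec (\<iota> (- \<nu>)) (\<iota> (\<alpha> s - \<beta> t)))"
proof -
  interpret bounded_linear \<iota> by (rule bl)
  let ?c = "\<lambda>w. cvec (\<iota> (- \<nu>)) (\<iota> w)"
  have blc: "bounded_linear ?c" by (rule bounded_linear_compose[OF bounded_linear_cvec bl])
  have c: "?c w = - cvec (\<iota> \<nu>) (\<iota> w)" for w
    using cvec_scale(1)[of "-1" "\<iota> \<nu>" "\<iota> w"] by (simp add: neg)
  have nrm: "norm (\<iota> x) = norm x" for x by (simp add: norm_eq_sqrt_inner inner)
  have fd: "?c (a - b) = ?c a - ?c b" for a b by (simp add: diff cvec_linear)
  have ds: "vector_derivative (\<lambda>s. ?c (\<alpha> s - \<beta> t)) (at s) = ?c (velocity \<alpha> s)" for s t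
    by (rule vector_derivative_at, rule bounded_linear.has_vector_derivative[OF blc])
       (use has_vector_derivative_diff[OF c1_loop_velocity[OF loops(1)] has_vector_derivative_const] in simp)
  have dt: "vector_derivative (\<lambda>t. ?c (\<alpha> s - \<beta> t)) (at t) = - ?c (velocity \<beta> t)" for s t
    by (rule vector_derivative_at, rule has_vector_derivative_eq_rhs[OF bounded_linear.has_vector_derivative[OF blc
         has_vector_derivative_diff[OF has_vector_derivative_const c1_loop_velocity[OF loops(2)]]]])
       (simp add: neg cvec_linear)
  have d3: "det3 (- a) (- b) (- (- d)) = det3 a b d" for a b d by (simp add: det3_def algebra_simps)
  have "det3 (?c (\<alpha> s - \<beta> t)) (?c (velocity \<alpha> s)) (- ?c (velocity \<beta> t)) / norm (?c (\<alpha> s - \<beta> t)) ^ 3 =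
     symp_vol4 \<nu> (\<alpha> s - \<beta> t) (velocity \<alpha> s) (velocity \<beta> t) / norm (\<alpha> s - \<beta> t) ^ 3" for s t
  proof -
    have "norm (?c (\<alpha> s - \<beta> t)) = norm (\<alpha> s - \<beta> t)"
      unfolding c norm_minus_cancel using perp n by (subst norm_cvec_perp) (auto simp: inner nrm)
    then show ?thesis unfolding vol[OF n] by (simp only: c d3)
  qed
  then show "gauss_linking \<nu> \<alpha> \<beta> = torus_degree (\<lambda>s t. ?c (\<alpha> s - \<beta> t))"
    unfolding gauss_linking_def torus_degree_def ds dt by simp
  have "torus_map (\<lambda>s t. 1 *\<^sub>R ?c (\<alpha> s) + 1 *\<^sub>R (- ?c (\<beta> t)))"
    by (intro torus_map_loops c1_loop_const c1_loop_bounded_linear[OF blc]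
       c1_loop_bounded_linear[OF bounded_linear_minus[OF blc]] loops)
  then show "torus_map (\<lambda>s t. ?c (\<alpha> s - \<beta> t))" by (simp add: fd)
qed

section \<open>Stereographic projection of the perturbed sphere compared with the round one\<close>

lemma sphere_inner_diff:
  fixes x z :: "'a::real_inner"
  assumes "norm x = 1" "norm z = 1"
  shows "1 - x \<bullet> z = (norm (z - x))\<^sup>2 / 2"
  using assms by (simp add: power2_norm_eq_inner inner_diff_left inner_diff_right norm_eq_1 inner_commute)

text \<open>This product of the three distances is the yardstick for the perturbation: an error
  bounded by a small multiple of it stays relatively small even when points collide.\<close>

lemma round_stereo_norm:
  fixes a b x :: "'a::real_inner"
  assumes "norm x = 1" "norm a = 1" "norm b = 1"
  defines "F \<equiv> (1 - x \<bullet> b) *\<^sub>R (a - x) - (1 - x \<bullet> a) *\<^sub>R (b - x)"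
  shows "norm F = norm (a - x) * norm (b - x) * norm (a - b) / 2" "x \<bullet> F = 0"
proof -
  have u: "x \<bullet> x = 1" "a \<bullet> a = 1" "b \<bullet> b = 1" using assms(1-3) by (simp_all add: norm_eq_1)
  show "x \<bullet> F = 0" unfolding F_def by (simp add: inner_diff_right u algebra_simps)
  show "norm F = norm (a - x) * norm (b - x) * norm (a - b) / 2"
  proof (rule power2_eq_imp_eq)
    have "(norm F)\<^sup>2 = (1 - x \<bullet> a) * (1 - x \<bullet> b) * (2 - 2 * (a \<bullet> b))"
      unfolding power2_norm_eq_inner F_def
      by (simp add: inner_diff_left inner_diff_right inner_commute u algebra_simps)
    also have "2 - 2 * (a \<bullet> b) = (norm (a - b))\<^sup>2"
      by (simp add: power2_norm_eq_inner inner_diff_left inner_diff_right inner_commute u)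
    finally show "(norm F)\<^sup>2 = (norm (a - x) * norm (b - x) * norm (a - b) / 2)\<^sup>2"
      unfolding sphere_inner_diff[OF assms(1,2)] sphere_inner_diff[OF assms(1,3)]
      by (simp add: power_mult_distrib power_divide)
  qed simp_all
qed

context near_sphere
begin

text \<open>
  With the outer normal \<open>n\<close> of \<open>surf\<close> at \<open>emb x\<close>, the difference of the stereographic projections of
  \<open>emb a\<close> and \<open>emb b\<close> is a positive multiple of \<open>N b (emb a - emb x) - N a (emb b - emb x)\<close>. It differs
  little from its counterpart on the round sphere, uniformly when two of the three points collide.
\<close>

lemma stereo_perturbation:
  assumes x: "norm x = 1" and a: "norm a = 1" and b: "norm b = 1"
    and n: "\<And>w. n \<bullet> demb x w = x \<bullet> w" "norm (n - x) \<le> 2 * \<delta>"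
  defines "N \<equiv> \<lambda>z. - (n \<bullet> (emb z - emb x))"
  shows "norm ((N b *\<^sub>R (emb a - emb x) - N a *\<^sub>R (emb b - emb x)) -
      ((1 - x \<bullet> b) *\<^sub>R (a - x) - (1 - x \<bullet> a) *\<^sub>R (b - x))) \<le> 4 * \<delta> * (norm (a - x) * norm (b - x) * norm (a - b))"
    "a \<noteq> x \<Longrightarrow> N a > 0"
proof -
  define \<rho> where "\<rho> z = (v z - v x) - v' x (z - x)" for z
  define M where "M z = 1 - x \<bullet> z" for z
  define w where "w z = v z - v x" for z
  have nn: "norm n \<le> 11/10" using norm_triangle_sub[of n x] n(2) x small by simp
  \<comment> \<open>The choice of n makes the linear part of the embedding contribute exactly 1 -
    \<open>x \<bullet> z\<close>; only the quadratic remainder \<rho> perturbs the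
    denominator.\<close>
  have Nz: "N z = M z - n \<bullet> \<rho> z" if "norm z = 1" for z
  proof -
    have "emb z - emb x = demb x (z - x) + \<rho> z" by (simp add: emb_def demb_def \<rho>_def)
    then have "N z = - (x \<bullet> (z - x)) - n \<bullet> \<rho> z" by (simp add: N_def inner_add_right n(1))
    then show ?thesis using x by (simp add: M_def inner_diff_right norm_eq_1)
  qed
  have V: "emb z - emb x = (z - x) + w z" for z by (simp add: emb_def w_def)
  have wb: "norm (w z) \<le> \<delta> * norm (z - x)" "norm (w z - w y) \<le> \<delta> * norm (z - y)" for z y
    unfolding w_def using v_lipschitz[of z x] v_lipschitz[of z y] by simp_all
  have \<rho>d: "norm (\<rho> z - \<rho> y) \<le> \<delta> * max (norm (z - x)) (norm (y - x)) * norm (z - y)" for z y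
  proof -
    have "\<rho> z - \<rho> y = (v z - v y) - v' x (z - y)" by (simp add: \<rho>_def blinfun.diff_right)
    then show ?thesis using remainder_bound by simp
  qed
  have \<rho>0: "norm (\<rho> z) \<le> \<delta> * norm (z - x) * norm (z - x)" for z
    using \<rho>d[of z x] by (simp add: \<rho>_def max_def split: if_splits)
  have e0: "\<bar>n \<bullet> r\<bar> \<le> (11/10) * K" if "norm r \<le> K" for r K
    using Cauchy_Schwarz_ineq2[of n r] mult_mono[OF nn that] by simp
  \<comment> \<open>Exchanging a and b only changes signs, so a may be the point nearer to x. Then
    each of the four error terms below carries all three distances A, B, D, with coefficients 5/4 +
    1 + 5/4 + 1/2 = 4.\<close>
  have half: "norm ((N b *\<^sub>R (emb a - emb x) - N a *\<^sub>R (emb b - emb x)) - (M b *\<^sub>R (a - x) - M a *\<^sub>R (b - x)))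
      \<le> 4 * \<delta> * (norm (a - x) * norm (b - x) * norm (a - b))"
    if a: "norm a = 1" and b: "norm b = 1" and ab: "norm (a - x) \<le> norm (b - x)" for a b
  proof -
    define A B D where "A = norm (a - x)" and "B = norm (b - x)" and "D = norm (a - b)"
    have ABD: "0 \<le> A" "0 \<le> B" "0 \<le> D" "A \<le> B" using ab by (simp_all add: A_def B_def D_def)
    define e1 where "e1 = n \<bullet> (\<rho> a - \<rho> b)"
    define e2 where "e2 = n \<bullet> \<rho> a"
    have "(N b *\<^sub>R (emb a - emb x) - N a *\<^sub>R (emb b - emb x)) - (M b *\<^sub>R (a - x) - M a *\<^sub>R (b - x)) =
      e1 *\<^sub>R (emb a - emb x) + (M b - M a) *\<^sub>R w a + e2 *\<^sub>R (emb b - emb a) + M a *\<^sub>R (w a - w b)"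
      unfolding Nz[OF a] Nz[OF b] V e1_def e2_def by (simp add: V[of b] V[of a] emb_def w_def inner_diff_right algebra_simps)
    moreover have "norm (e1 *\<^sub>R (emb a - emb x)) \<le> (5/4) * \<delta> * (A * B * D)"
    proof -
      have "\<bar>e1\<bar> \<le> (11/10) * (\<delta> * B * D)" unfolding e1_def B_def D_def
        by (rule e0) (use \<rho>d[of a b] ab in \<open>simp add: max_def\<close>)
      moreover have "norm (emb a - emb x) \<le> (11/10) * A"
        unfolding V A_def using norm_triangle_ineq[of "a - x" "w a"] wb(1)[of a] small
          mult_right_mono[of \<delta> "1/10" "norm (a - x)"] by simp
      ultimately have "norm (e1 *\<^sub>R (emb a - emb x)) \<le> ((11/10) * (\<delta> * B * D)) * ((11/10) * A)"
        unfolding norm_scaleR by (intro mult_mono) auto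
      also have "\<dots> = (121/100) * (\<delta> * (A * B * D))" by simp
      also have "\<dots> \<le> (5/4) * (\<delta> * (A * B * D))" using ABD small by (intro mult_right_mono) auto
      finally show ?thesis by simp
    qed
    moreover have "norm ((M b - M a) *\<^sub>R w a) \<le> \<delta> * (A * B * D)"
    proof -
      have "\<bar>M b - M a\<bar> \<le> B * D"
      proof -
        have "M b - M a = (B - A) * (B + A) / 2"
          unfolding M_def sphere_inner_diff[OF x a] sphere_inner_diff[OF x b] A_def B_def
          by (simp add: power2_eq_square field_simps)
        moreover have "\<bar>B - A\<bar> \<le> D" unfolding A_def B_def D_def
          using norm_triangle_ineq3[of "b - x" "a - x"] by (simp add: norm_minus_commute)
        then have "\<bar>(B - A) * (B + A)\<bar> \<le> D * (2 * B)"
          unfolding abs_mult using ABD by (intro mult_mono) auto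
        moreover have "D * (2 * B) = 2 * (B * D)" by simp
        ultimately show ?thesis unfolding abs_le_iff by linarith
      qed
      then have "norm ((M b - M a) *\<^sub>R w a) \<le> (B * D) * (\<delta> * A)"
        unfolding norm_scaleR using wb(1)[of a] ABD by (intro mult_mono) (auto simp: A_def)
      then show ?thesis by (simp add: ac_simps)
    qed
    moreover have "norm (e2 *\<^sub>R (emb b - emb a)) \<le> (5/4) * \<delta> * (A * B * D)"
    proof -
      have "\<bar>e2\<bar> \<le> (11/10) * (\<delta> * A * A)" unfolding e2_def A_def by (rule e0[OF \<rho>0])
      also have "\<dots> \<le> (11/10) * (\<delta> * A * B)" using ABD small by (intro mult_left_mono mult_mono) auto
      finally have "\<bar>e2\<bar> \<le> (11/10) * (\<delta> * A * B)" .
      moreover have "norm (emb b - emb a) \<le> (11/10) * D"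
      proof -
        have "emb b - emb a = (b - a) + (v b - v a)" by (simp add: emb_def)
        then show ?thesis unfolding D_def using norm_triangle_ineq[of "b - a" "v b - v a"] v_lipschitz[of b a] small
          mult_right_mono[of \<delta> "1/10" "norm (b - a)"] by (simp add: norm_minus_commute)
      qed
      ultimately have "norm (e2 *\<^sub>R (emb b - emb a)) \<le> ((11/10) * (\<delta> * A * B)) * ((11/10) * D)"
        unfolding norm_scaleR by (intro mult_mono) auto
      also have "\<dots> = (121/100) * (\<delta> * (A * B * D))" by simp
      also have "\<dots> \<le> (5/4) * (\<delta> * (A * B * D))" using ABD small by (intro mult_right_mono) auto
      finally show ?thesis by simp
    qed
    moreover have "norm (M a *\<^sub>R (w a - w b)) \<le> (1/2) * \<delta> * (A * B * D)"
    proof -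
      have "\<bar>M a\<bar> = A * A / 2" unfolding M_def sphere_inner_diff[OF x a] A_def by (simp add: power2_eq_square)
      then have "norm (M a *\<^sub>R (w a - w b)) \<le> (A * A / 2) * (\<delta> * D)"
        unfolding norm_scaleR using wb(2)[of a b] ABD by (intro mult_mono) (auto simp: D_def)
      also have "\<dots> \<le> (A * B / 2) * (\<delta> * D)" using ABD small by (intro mult_right_mono divide_right_mono mult_left_mono) auto
      finally show ?thesis by (simp add: ac_simps)
    qed
    ultimately have "norm ((N b *\<^sub>R (emb a - emb x) - N a *\<^sub>R (emb b - emb x)) - (M b *\<^sub>R (a - x) - M a *\<^sub>R (b - x)))
      \<le> (5/4) * \<delta> * (A * B * D) + \<delta> * (A * B * D) + (5/4) * \<delta> * (A * B * D) + (1/2) * \<delta> * (A * B * D)"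
      by (metis (no_types, lifting) norm_triangle_le add_mono)
    also have "\<dots> = 4 * \<delta> * (A * B * D)" by simp
    finally show ?thesis by (simp add: A_def B_def D_def)
  qed
  show "norm ((N b *\<^sub>R (emb a - emb x) - N a *\<^sub>R (emb b - emb x)) -
      ((1 - x \<bullet> b) *\<^sub>R (a - x) - (1 - x \<bullet> a) *\<^sub>R (b - x))) \<le> 4 * \<delta> * (norm (a - x) * norm (b - x) * norm (a - b))"
  proof (cases "norm (a - x) \<le> norm (b - x)")
    case True then show ?thesis using half[OF a b] by (simp add: M_def)
  next
    case False
    have e: "(N b *\<^sub>R (emb a - emb x) - N a *\<^sub>R (emb b - emb x)) - (M b *\<^sub>R (a - x) - M a *\<^sub>R (b - x)) =
      - ((N a *\<^sub>R (emb b - emb x) - N b *\<^sub>R (emb a - emb x)) - (M a *\<^sub>R (b - x) - M b *\<^sub>R (a - x)))" by simp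
    show ?thesis using half[OF b a] False unfolding M_def[symmetric] e norm_minus_cancel
      by (simp add: norm_minus_commute[of b a] ac_simps)
  qed
  assume "a \<noteq> x"
  then have p: "norm (a - x) * norm (a - x) > 0" by simp
  have "\<bar>n \<bullet> \<rho> a\<bar> \<le> (11/10) * (\<delta> * norm (a - x) * norm (a - x))" by (rule e0[OF \<rho>0])
  also have "\<dots> \<le> (1/4) * (norm (a - x) * norm (a - x))"
    using p small mult_right_mono[of "(11/10) * \<delta>" "1/4" "norm (a - x) * norm (a - x)"] by simp
  finally show "N a > 0" unfolding Nz[OF a] M_def sphere_inner_diff[OF x a] power2_eq_square using p by linarith
qed

end

context near_sphere
begin

text \<open>Up to positive factors the two maps are \<open>cvec n F\<close> and its round
  counterpart, of length Y / 2. Perturbing F costs at most 4 \<delta> Y and replacing n by x at most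
  2 \<delta> Y, together less than Y / 2; so the straight line between the maps avoids the
  origin.\<close>

lemma link_torus_degree:
  assumes bl: "bounded_linear \<iota>" and inner: "\<And>x y. \<iota> x \<bullet> \<iota> y = x \<bullet> y"
    and vol: "\<And>n a b c. norm n = 1 \<Longrightarrow> symp_vol4 n a b c = det3 (cvec (\<iota> n) (\<iota> a)) (cvec (\<iota> n) (\<iota> b)) (cvec (\<iota> n) (\<iota> c))"
    and conv: "surf \<in> Conv" and P: "P \<in> closed_characteristics surf" "P' \<in> closed_characteristics surf"
    and disj: "P \<inter> P' = {}" and ex: "\<exists>p. p \<in> surf - (P \<union> P')"
  obtains x where "norm x = 1" "\<And>s. proj (oriented_param P s) \<noteq> x" "\<And>t. proj (oriented_param P' t) \<noteq> x"
    "link surf P P' = torus_degree (\<lambda>s t. stereo_diff (\<iota> (proj (oriented_param P s))) (\<iota> (proj (oriented_param P' t))) (\<iota> x))"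
proof -
  interpret L: bounded_linear \<iota> by (rule bl)
  have nrm: "norm (\<iota> x) = norm x" for x by (simp add: norm_eq_sqrt_inner inner)
  \<comment> \<open>The centre chosen inside \<open>link\<close>; by \<open>ex\<close> it lies on
    the surface and off both knots, and nothing else is known about it.\<close>
  define X where "X = (SOME x. x \<in> surf - (P \<union> P'))"
  have X: "X \<in> surf" "X \<notin> P" "X \<notin> P'" using someI_ex[OF ex] by (auto simp: X_def)
  define x where "x = proj X"
  have x: "norm x = 1" "emb x = X" using X(1) by (simp_all add: x_def in_surf_iff)
  obtain n where n: "\<And>w. n \<bullet> demb x w = x \<bullet> w" "norm (n - x) \<le> 2 * \<delta>" "n \<noteq> 0"
    "inward_normal surf (emb x) = - ((1 / norm n) *\<^sub>R n)"
    using inward_normal_surf[OF conv x(1)] by blast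
  define \<nu> where "\<nu> = - ((1 / norm n) *\<^sub>R n)"
  have \<nu>: "norm \<nu> = 1" "\<nu> \<bullet> \<nu> = 1" using n(3) by (simp_all add: \<nu>_def power2_norm_eq_inner[symmetric] power2_eq_square flip: norm_eq_1)
  define g where "g = oriented_param P"
  define g' where "g' = oriented_param P'"
  define N where "N z = - (n \<bullet> (emb z - emb x))" for z
  note op = oriented_param_characteristic[OF P(1), folded g_def] oriented_param_characteristic[OF P(2), folded g'_def]
  have loops: "c1_loop g" "c1_loop g'" using op(1,4) c1_loop_regular by (auto simp: characteristic_loop_def)
  have ax: "proj (g s) \<noteq> x" for s
  proof
    assume "proj (g s) = x"
    then have "emb (proj (g s)) = X" using x(2) by simp
    then show False using op(2) X(2) by auto
  qed
  have bx: "proj (g' s) \<noteq> x" for s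
  proof
    assume "proj (g' s) = x"
    then have "emb (proj (g' s)) = X" using x(2) by simp
    then show False using op(5) X(3) by auto
  qed
  have ab: "proj (g s) \<noteq> proj (g' t)" for s t
  proof
    assume "proj (g s) = proj (g' t)"
    then have "emb (proj (g s)) = emb (proj (g' t))" by simp
    then have "g s = g' t" by simp
    moreover have "g s \<in> P" "g' t \<in> P'" using op(2,5) by auto
    ultimately show False using disj by auto
  qed
  have an: "norm (proj (g s)) = 1" "norm (proj (g' s)) = 1" for s
    using op(1,4) by (auto simp: characteristic_loop_def in_surf_iff)
  have \<nu>N: "\<nu> \<bullet> (emb z - X) = N z / norm n" for z by (simp add: \<nu>_def N_def x(2))
  have Npos: "N (proj (g s)) > 0" "N (proj (g' s)) > 0" for s
    unfolding N_def using stereo_perturbation(2)[OF x(1) _ _ n(1,2)] an ax bx by blast+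
  have nzg: "\<nu> \<bullet> (g s - X) \<noteq> 0" "\<nu> \<bullet> (g' s - X) \<noteq> 0" for s
    using \<nu>N[of "proj (g s)"] \<nu>N[of "proj (g' s)"] Npos[of s] n(3) by auto
  define \<alpha> where "\<alpha> = stereographic X \<nu> \<circ> g"
  define \<beta> where "\<beta> = stereographic X \<nu> \<circ> g'"
  have st: "c1_loop (stereographic X \<nu> \<circ> h)" "\<And>s. \<nu> \<bullet> (stereographic X \<nu> \<circ> h) s = 0"
    if "c1_loop h" "\<And>s. \<nu> \<bullet> (h s - X) \<noteq> 0" for h
  proof -
    have "c1_loop (\<lambda>s. inverse (\<nu> \<bullet> (h s - X)) *\<^sub>R (h s - X) - \<nu>)"
      by (intro c1_loop_diff c1_loop_scaleR c1_loop_inverse c1_loop_bounded_linear[OF bounded_linear_inner_right]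
          c1_loop_const that)
    then show "c1_loop (stereographic X \<nu> \<circ> h)" by (simp add: stereographic_def o_def inverse_eq_divide)
    show "\<nu> \<bullet> (stereographic X \<nu> \<circ> h) s = 0" for s
      using that(2)[of s] \<nu>(2) by (simp add: stereographic_def inner_diff_right[of \<nu> _ \<nu>])
  qed
  note stg = st[OF loops(1) nzg(1), folded \<alpha>_def] and stg' = st[OF loops(2) nzg(2), folded \<beta>_def]
  define f where "f s t = cvec (\<iota> (- \<nu>)) (\<iota> (\<alpha> s - \<beta> t))" for s t
  have perp: "\<nu> \<bullet> (\<alpha> s - \<beta> t) = 0" for s t using stg(2) stg'(2) by (simp add: inner_diff_right)
  note G = gauss_linking_torus_degree[OF bl inner vol \<nu>(1) stg(1) stg'(1) perp, folded f_def]
  define fr where "fr s t = stereo_diff (\<iota> (proj (g s))) (\<iota> (proj (g' t))) (\<iota> x)" for s t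
  have cl: "c1_loop (\<lambda>s. proj (h s))" if h: "characteristic_loop h" for h
  proof -
    obtain u where "\<forall>t. ((\<lambda>t. proj (h t)) has_vector_derivative speed h t *\<^sub>R u t) (at t)"
      "continuous_on UNIV (\<lambda>t. speed h t *\<^sub>R u t)"
      using characteristic_loop_pull_back[OF h] by blast
    moreover have "h (t + 1) = h t" for t using h by (simp add: characteristic_loop_def regular_loop_def)
    ultimately show ?thesis unfolding c1_loop_def by (intro exI[of _ "\<lambda>t. speed h t *\<^sub>R u t"]) auto
  qed
  have tmr: "torus_map fr" unfolding fr_def[abs_def]
  proof (rule torus_map_stereo_diff)
    show "c1_loop (\<lambda>s. \<iota> (proj (g s)))" "c1_loop (\<lambda>s. \<iota> (proj (g' s)))"
      using cl op(1,4) c1_loop_bounded_linear[OF bl] by auto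
    show "\<iota> (proj (g t)) \<noteq> 0" "\<iota> (proj (g' t)) \<noteq> 0" for t using an nrm by (metis norm_zero zero_neq_one)+
  qed
  have "torus_degree fr = torus_degree f"
  proof (rule torus_degree_straight_line[OF G(2)[folded f_def[abs_def]] tmr])
    fix \<tau> s t :: real assume \<tau>: "0 \<le> \<tau>" "\<tau> \<le> 1"
    define a where "a = proj (g s)"
    define b where "b = proj (g' t)"
    have gab: "g s = emb a" "g' t = emb b" by (simp_all add: a_def b_def)
    have nab: "norm a = 1" "norm b = 1" "a \<noteq> x" "b \<noteq> x" "a \<noteq> b" "N a > 0" "N b > 0"
      using an ax bx ab Npos by (simp_all add: a_def b_def)
    define F where "F = N b *\<^sub>R (emb a - emb x) - N a *\<^sub>R (emb b - emb x)"
    define Fr where "Fr = (1 - x \<bullet> b) *\<^sub>R (a - x) - (1 - x \<bullet> a) *\<^sub>R (b - x)"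
    define Y where "Y = norm (a - x) * norm (b - x) * norm (a - b)"
    have Y: "Y > 0" using nab by (simp add: Y_def)
    have FFr: "norm (F - Fr) \<le> 4 * \<delta> * Y"
      using stereo_perturbation(1)[OF x(1) nab(1,2) n(1,2)] by (simp add: F_def Fr_def N_def Y_def)
    note rs = round_stereo_norm[OF x(1) nab(1,2), folded Fr_def]
    have frF: "fr s t = cvec (\<iota> x) (\<iota> Fr)"
      unfolding fr_def Fr_def stereo_diff_def a_def[symmetric] b_def[symmetric]
      by (simp add: inner nrm nab x L.diff L.scaleR cvec_linear cvec_scale)
    have nfr: "norm (fr s t) = Y / 2"
      unfolding frF using rs x(1) by (subst norm_cvec_perp) (simp_all add: inner nrm Y_def)
    \<comment> \<open>The denominators N a and N b are cleared; the factor |n| of the projection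
      cancels against - \<nu> = n / |n|.\<close>
    have fF: "f s t = (1 / (N a * N b)) *\<^sub>R cvec (\<iota> n) (\<iota> F)"
    proof -
      have "\<alpha> s - \<beta> t = (norm n / N a) *\<^sub>R (emb a - emb x) - (norm n / N b) *\<^sub>R (emb b - emb x)"
        unfolding \<alpha>_def \<beta>_def o_def gab stereographic_def \<nu>N by (simp add: x(2))
      also have "\<dots> = (norm n / (N a * N b)) *\<^sub>R F" using nab by (simp add: F_def scaleR_diff_right)
      finally have "\<alpha> s - \<beta> t = (norm n / (N a * N b)) *\<^sub>R F" .
      moreover have "- \<nu> = (1 / norm n) *\<^sub>R n" by (simp add: \<nu>_def)
      ultimately show ?thesis using n(3) by (simp add: f_def L.scaleR cvec_linear cvec_scale)
    qed
    have d: "norm (cvec (\<iota> n) (\<iota> F) - fr s t) < norm (fr s t)"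
    proof -
      have "cvec (\<iota> n) (\<iota> F) - fr s t = cvec (\<iota> (n - x)) (\<iota> F) + cvec (\<iota> x) (\<iota> (F - Fr))"
        unfolding frF by (simp add: L.diff cvec_linear cvec_scale)
      then have "norm (cvec (\<iota> n) (\<iota> F) - fr s t) \<le> norm (n - x) * norm F + norm x * norm (F - Fr)"
        using norm_triangle_ineq[of "cvec (\<iota> (n - x)) (\<iota> F)" "cvec (\<iota> x) (\<iota> (F - Fr))"]
          norm_cvec_le[of "\<iota> (n - x)" "\<iota> F"] norm_cvec_le[of "\<iota> x" "\<iota> (F - Fr)"] unfolding nrm by simp
      also have "\<dots> \<le> (2 * \<delta>) * Y + 1 * (4 * \<delta> * Y)"
      proof (intro add_mono mult_mono)
        have "4 * \<delta> * Y \<le> (1/2) * Y" using small Y by (intro mult_right_mono) auto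
        then show "norm F \<le> Y" using norm_triangle_sub[of F Fr] FFr rs(1) by (simp add: Y_def)
      qed (use n FFr x small in auto)
      also have "\<dots> = (6 * \<delta>) * Y" by simp
      also have "\<dots> < (1/2) * Y" using small Y by (intro mult_strict_right_mono) auto
      finally show ?thesis using nfr by simp
    qed
    show "(1 - \<tau>) *\<^sub>R f s t + \<tau> *\<^sub>R fr s t \<noteq> 0"
    proof
      assume z: "(1 - \<tau>) *\<^sub>R f s t + \<tau> *\<^sub>R fr s t = 0"
      define K where "K = (1 - \<tau>) / (N a * N b)"
      have K: "K \<ge> 0" "K = 0 \<Longrightarrow> \<tau> = 1" using \<tau> nab by (auto simp: K_def)
      have "K *\<^sub>R cvec (\<iota> n) (\<iota> F) + \<tau> *\<^sub>R fr s t = 0" using z unfolding fF by (simp add: K_def)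
      then have e: "K *\<^sub>R (cvec (\<iota> n) (\<iota> F) - fr s t) = - ((K + \<tau>) *\<^sub>R fr s t)"
        by (simp add: algebra_simps add_eq_0_iff)
      have "K * norm (cvec (\<iota> n) (\<iota> F) - fr s t) = (K + \<tau>) * norm (fr s t)"
        using arg_cong[OF e, of norm] K \<tau> by simp
      moreover have "K * norm (cvec (\<iota> n) (\<iota> F) - fr s t) \<le> K * norm (fr s t)" using d K by (intro mult_left_mono) auto
      ultimately have "\<tau> * norm (fr s t) \<le> 0" by (simp add: algebra_simps)
      then have "\<tau> = 0" using nfr Y \<tau> by (simp add: mult_le_0_iff)
      moreover have "K > 0" using K \<open>\<tau> = 0\<close> by (cases "K = 0") auto
      ultimately show False using d \<open>K * norm (cvec (\<iota> n) (\<iota> F) - fr s t) = (K + \<tau>) * norm (fr s t)\<close> by simp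
    qed
  qed
  moreover have "link surf P P' = torus_degree f"
  proof -
    have "link surf P P' = gauss_linking \<nu> \<alpha> \<beta>"
      unfolding link_def Let_def X_def[symmetric] \<alpha>_def \<beta>_def g_def g'_def \<nu>_def n(4)[unfolded x(2), symmetric] ..
    then show ?thesis using G(1) by (simp add: f_def[abs_def])
  qed
  ultimately show ?thesis using that[OF x(1)] ax bx by (simp add: g_def g'_def fr_def[abs_def])
qed

end

section \<open>Linking with a knot close to a Hopf fibre\<close>

definition times_i :: "c2 \<Rightarrow> c2" where "times_i z = (\<i> * fst z, \<i> * snd z)"

text \<open>A C^1 step from 0 on x \<le> 1/4 to 1 on x \<ge> 1/2, to be applied to |w|^2. It removes
  the singularity of the argument at the origin without changing anything near the knot.\<close>

definition cutoff :: "real \<Rightarrow> real" where "cutoff x = (max 0 (1 - (max 0 (2 - 4 * x))\<^sup>2))\<^sup>2"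
definition cutoff' :: "real \<Rightarrow> real" where
  "cutoff' x = 16 * (max 0 (1 - (max 0 (2 - 4 * x))\<^sup>2) * max 0 (2 - 4 * x))"

lemma cutoff_derivative: "(cutoff has_real_derivative cutoff' x) (at x)"
proof -
  have "((\<lambda>x. 2 - 4 * x) has_real_derivative - 4) (at x)" by (auto intro!: derivative_eq_intros)
  from DERIV_chain2[OF DERIV_max0_sq this]
  have "((\<lambda>x. 1 - (max 0 (2 - 4 * x))\<^sup>2) has_real_derivative 0 - 2 * max 0 (2 - 4 * x) * - 4) (at x)"
    by (intro DERIV_diff DERIV_const)
  from DERIV_chain2[OF DERIV_max0_sq this]
  show ?thesis unfolding cutoff_def[abs_def] cutoff'_def by (rule DERIV_cong) simp
qed

lemma cutoff_bounds:
  "0 \<le> cutoff x" "cutoff x \<le> 1" "0 \<le> cutoff' x" "cutoff' x \<le> 16"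
  "x \<ge> 1/2 \<Longrightarrow> cutoff x = 1 \<and> cutoff' x = 0" "x \<le> 1/4 \<Longrightarrow> cutoff x = 0 \<and> cutoff' x = 0"
proof -
  have A: "0 \<le> max 0 (1 - (max 0 (2 - 4 * x))\<^sup>2)" "max 0 (1 - (max 0 (2 - 4 * x))\<^sup>2) \<le> 1" by auto
  show "0 \<le> cutoff x" "cutoff x \<le> 1" unfolding cutoff_def using A by (auto intro: power_le_one)
  show z: "x \<le> 1/4 \<Longrightarrow> cutoff x = 0 \<and> cutoff' x = 0"
  proof -
    assume "x \<le> 1/4"
    then have "1\<^sup>2 \<le> (max 0 (2 - 4 * x))\<^sup>2" by (intro power_mono) auto
    then show ?thesis by (simp add: cutoff_def cutoff'_def)
  qed
  show "x \<ge> 1/2 \<Longrightarrow> cutoff x = 1 \<and> cutoff' x = 0" by (simp add: cutoff_def cutoff'_def)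
  show "0 \<le> cutoff' x" unfolding cutoff'_def by simp
  show "cutoff' x \<le> 16"
  proof (cases "x \<le> 1/4")
    case True then show ?thesis using z by simp
  next
    case False
    then have B: "max 0 (2 - 4 * x) \<le> 1" by auto
    show ?thesis unfolding cutoff'_def using A mult_mono[OF A(2) B] by simp
  qed
qed

lemma cutoff_lipschitz: "\<bar>cutoff x - cutoff y\<bar> \<le> 16 * \<bar>x - y\<bar>"
proof -
  have "norm (cutoff x - cutoff y) \<le> 16 * norm (x - y)"
    by (rule field_differentiable_bound[of UNIV cutoff cutoff'])
       (use cutoff_derivative cutoff_bounds(3,4) in auto)
  then show ?thesis by simp
qed

lemma cutoff_continuous: "continuous_on UNIV cutoff" "continuous_on UNIV cutoff'"
  unfolding cutoff_def[abs_def] cutoff'_def[abs_def] by (intro continuous_intros)+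

section \<open>Periodic functions of the argument\<close>

lemma periodic_shift:
  fixes f :: "real \<Rightarrow> 'a"
  assumes "\<And>x. f (x + T) = f x"
  shows "f (x + of_int n * T) = f x"
proof (induction n rule: int_induct[of _ 0])
  case (step1 i)
  then show ?case using assms[of "x + of_int i * T"] by (simp add: algebra_simps)
next
  case (step2 i)
  then show ?case using assms[of "x + of_int (i - 1) * T"] by (simp add: algebra_simps)
qed simp

lemma periodic_int:
  fixes g :: "real \<Rightarrow> 'a"
  assumes "\<And>x. g (x + 2 * pi) = g x"
  shows "g (x + 2 * pi * of_int n) = g x"
  using periodic_shift[of g "2 * pi", OF assms] by (simp add: mult.commute)

lemma periodic_Arg:
  fixes g :: "real \<Rightarrow> 'a"
  assumes per: "\<And>x. g (x + 2 * pi) = g x" and w: "w = of_real r * cis x" "r > 0"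
  shows "g (Arg w) = g x"
proof -
  have "w \<noteq> 0" "norm w = r" using w by (auto simp: norm_mult)
  then have "of_real r * cis (Arg w) = of_real r * cis x"
    using w rcis_cmod_Arg[of w] by (simp add: rcis_def)
  then have c: "cis (Arg w) = cis x" using w(2) by simp
  then have "cos (Arg w) = cos x \<and> sin (Arg w) = sin x" by (simp add: cis.code)
  then obtain n where "Arg w = x + 2 * pi * of_int n" using sin_cos_eq_iff[of "Arg w" x] by (auto simp: ac_simps)
  then show ?thesis using periodic_int[of g x n] per by simp
qed

text \<open>\<open>Arg\<close> jumps across the negative axis. Under a periodic function it may be
  replaced by this branch based at w0, which is smooth near w0 because w / w0 is close to 1.\<close>

lemma periodic_Arg_local:
  fixes g :: "real \<Rightarrow> 'a"
  assumes per: "\<And>x. g (x + 2 * pi) = g x" and w: "w \<noteq> 0" "w0 \<noteq> 0"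
  shows "g (Arg w) = g (Arg w0 + Im (Ln (w / w0)))"
proof (rule periodic_Arg[where g = g, OF per])
  have "w = w0 * exp (Ln (w / w0))" using w by simp
  also have "\<dots> = (of_real (norm w0) * cis (Arg w0)) * (of_real (exp (Re (Ln (w / w0)))) * cis (Im (Ln (w / w0))))"
    using rcis_cmod_Arg[of w0] by (simp only: exp_eq_polar rcis_def)
  also have "\<dots> = of_real (norm w0 * exp (Re (Ln (w / w0)))) * cis (Arg w0 + Im (Ln (w / w0)))"
    by (simp add: cis_mult[symmetric])
  finally show "w = of_real (norm w0 * exp (Re (Ln (w / w0)))) * cis (Arg w0 + Im (Ln (w / w0)))" .
qed (use w in simp)

lemma isCont_periodic_Arg:
  fixes g :: "real \<Rightarrow> complex"
  assumes per: "\<And>x. g (x + 2 * pi) = g x" and c: "\<And>x. isCont g x" and w0: "w0 \<noteq> 0"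
  shows "isCont (\<lambda>w. g (Arg w)) w0"
proof -
  have "isCont (\<lambda>w. g (Arg w0 + Im (Ln (w / w0)))) w0"
    by (rule isCont_o2[OF _ c]) (use w0 in \<open>auto intro!: continuous_intros\<close>)
  moreover have "\<forall>\<^sub>F w in nhds w0. g (Arg w) = g (Arg w0 + Im (Ln (w / w0)))"
  proof -
    have "open (- {0::complex})" by auto
    from eventually_nhds_in_open[OF this, of w0] w0 have "\<forall>\<^sub>F w in nhds w0. w \<in> - {0}" by simp
    then show ?thesis by (rule eventually_mono) (use periodic_Arg_local[where g = g, OF per _ w0] in simp)
  qed
  ultimately show ?thesis using isCont_cong by fast
qed

lemma periodic_Arg_derivative:
  fixes g :: "real \<Rightarrow> complex"
  assumes per: "\<And>x. g (x + 2 * pi) = g x" and per': "\<And>x. g' (x + 2 * pi) = g' x"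
    and g: "\<And>x. (g has_vector_derivative g' x) (at x)"
    and w: "(w has_vector_derivative w') (at t)" "w t \<noteq> 0"
  shows "((\<lambda>t. g (Arg (w t))) has_vector_derivative Im (w' / w t) *\<^sub>R g' (Arg (w t))) (at t)"
proof -
  let ?\<phi> = "\<lambda>s. Arg (w t) + Im (Ln (w s / w t))"
  have "((Ln \<circ> (\<lambda>s. w s / w t)) has_vector_derivative (w' / w t) * inverse (w t / w t)) (at t)"
    by (rule field_vector_diff_chain_at)
       (use w in \<open>auto intro!: has_vector_derivative_divide DERIV_cong[OF has_field_derivative_Ln]\<close>)
  then have "((\<lambda>s. Ln (w s / w t)) has_vector_derivative w' / w t) (at t)" using w(2) by (simp add: o_def)
  from has_vector_derivative_add[OF has_vector_derivative_const
      bounded_linear.has_vector_derivative[OF bounded_linear_Im this]]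
  have "(?\<phi> has_vector_derivative Im (w' / w t)) (at t)" by simp
  from vector_diff_chain_at[OF this g]
  have d: "((\<lambda>s. g (?\<phi> s)) has_vector_derivative Im (w' / w t) *\<^sub>R g' (?\<phi> t)) (at t)" by (simp add: o_def)
  have "isCont w t" using w(1) has_vector_derivative_continuous by blast
  then have "\<forall>\<^sub>F s in nhds t. w s \<noteq> 0"
    using tendsto_imp_eventually_ne[OF isContD[where f = w] w(2)] w(2) by (simp add: eventually_nhds_conv_at)
  then have "\<forall>\<^sub>F s in nhds t. g (?\<phi> s) = g (Arg (w s))"
    by (rule eventually_mono) (use periodic_Arg_local[where g = g, OF per _ w(2)] in simp)
  then obtain S where "open S" "t \<in> S" "\<And>s. s \<in> S \<Longrightarrow> g (?\<phi> s) = g (Arg (w s))"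
    unfolding eventually_nhds by blast
  from has_vector_derivative_transform_within_open[OF d this]
  have "((\<lambda>s. g (Arg (w s))) has_vector_derivative Im (w' / w t) *\<^sub>R g' (?\<phi> t)) (at t)" .
  then show ?thesis using w(2) by simp
qed

section \<open>A knot that is a graph over the phase of its first coordinate\<close>

lemma norm_fst_sq: "norm z = 1 \<Longrightarrow> (norm (fst z))\<^sup>2 = 1 - (norm (snd z))\<^sup>2" for z :: c2
  by (cases z) (simp add: norm_Pair real_sqrt_eq_1_iff)

lemma norm_fst_snd_le: "norm (fst z) \<le> norm z" "norm (snd z) \<le> norm z" for z :: c2
  by (cases z, simp add: norm_Pair)+

text \<open>For the Hopf field the quotient is exactly \<i>; a deviation of w is amplified at most
  by the factor 1 / |fst z|.\<close>

lemma rate_near: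
  fixes w z :: c2
  assumes "norm (w - times_i z) \<le> \<kappa>" "fst z \<noteq> 0"
  shows "\<bar>Im (fst w / fst z) - 1\<bar> \<le> \<kappa> / norm (fst z)"
proof -
  have "Im (fst w / fst z) - 1 = Im ((fst w - \<i> * fst z) / fst z)" using assms(2) by (simp add: diff_divide_distrib)
  also have "\<bar>\<dots>\<bar> \<le> norm ((fst w - \<i> * fst z) / fst z)" by (rule abs_Im_le_cmod)
  also have "\<dots> = norm (fst (w - times_i z)) / norm (fst z)" by (simp add: norm_divide times_i_def)
  also have "\<dots> \<le> \<kappa> / norm (fst z)" using norm_fst_snd_le(1)[of "w - times_i z"] assms(1) by (intro divide_right_mono) auto
  finally show ?thesis .
qed

lemma polar_lift_loop:
  fixes w w' :: "real \<Rightarrow> complex"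
  assumes w: "\<And>t. (w has_vector_derivative w' t) (at t)" "continuous_on UNIV w'" "\<And>t. w t \<noteq> 0"
    and per: "\<And>t. w (t + 1) = w t"
  obtains \<theta> and n :: int where "\<And>t. (\<theta> has_real_derivative Im (w' t / w t)) (at t)"
    "\<And>t. w t = of_real (norm (w t)) * cis (\<theta> t)" "continuous_on UNIV (\<lambda>t. Im (w' t / w t))"
    "\<And>t. \<theta> (t + 1) = \<theta> t + 2 * pi * of_int n"
proof -
  obtain \<theta> where \<theta>: "\<And>t. (\<theta> has_real_derivative Im (w' t / w t)) (at t)"
    "\<And>t. w t = of_real (norm (w t)) * cis (\<theta> t)" "continuous_on UNIV (\<lambda>t. Im (w' t / w t))" "\<theta> 0 = Arg (w 0)"
    by (rule polar_lift[OF w], rule that) assumption+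
  have wper: "w' (t + 1) = w' t" for t
  proof -
    have "((w \<circ> (\<lambda>t. t + 1)) has_vector_derivative 1 *\<^sub>R w' (t + 1)) (at t)"
      by (rule vector_diff_chain_at[OF _ w(1)]) (auto intro!: derivative_eq_intros)
    moreover have "w \<circ> (\<lambda>t. t + 1) = w" using per by auto
    ultimately show ?thesis using vector_derivative_unique_at[OF _ w(1)[of t]] by simp
  qed
  have diff: "\<theta> (t + 1) - \<theta> t = \<theta> 1 - \<theta> 0" for t
  proof -
    have "((\<lambda>t. \<theta> (t + 1) - \<theta> t) has_real_derivative 0) (at t)" for t
    proof -
      have "((\<lambda>t. \<theta> (t + 1)) has_real_derivative Im (w' (t + 1) / w (t + 1))) (at t)"
        using \<theta>(1)[of "t + 1"] by (rule DERIV_shift[THEN iffD1])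
      from DERIV_diff[OF this \<theta>(1)[of t]] show ?thesis unfolding wper per by simp
    qed
    then have "\<theta> (t + 1) - \<theta> t = \<theta> (0 + 1) - \<theta> 0" using DERIV_isconst_all[of "\<lambda>t. \<theta> (t + 1) - \<theta> t"] by blast
    then show ?thesis by simp
  qed
  have "cis (\<theta> 1) = cis (\<theta> 0)"
  proof -
    have "w 1 = w 0" using per[of 0] by simp
    moreover have "norm (w 0) \<noteq> 0" using w(3) by simp
    moreover have "of_real (norm (w 1)) * cis (\<theta> 1) = of_real (norm (w 0)) * cis (\<theta> 0)"
      using \<theta>(2)[of 1] \<theta>(2)[of 0] \<open>w 1 = w 0\<close> by metis
    ultimately show ?thesis by simp
  qed
  then have "cos (\<theta> 1) = cos (\<theta> 0) \<and> sin (\<theta> 1) = sin (\<theta> 0)" by (simp add: cis.code)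
  then obtain n :: int where "\<theta> 1 = \<theta> 0 + 2 * pi * of_int n" using sin_cos_eq_iff[of "\<theta> 1" "\<theta> 0"] by (auto simp: ac_simps)
  then have "\<theta> (t + 1) = \<theta> t + 2 * pi * of_int n" for t using diff[of t] by simp
  then show ?thesis using that \<theta> by blast
qed

text \<open>y runs near the Hopf fibre z2 = 0, its phase \<theta> turns once per period, and \<tau>
  is the inverse of \<theta>. In the application \<kappa> is 24 \<delta>, and 7 \<kappa> bounds the
  drift during one turn. The shear needs 462 \<kappa> \<le> 1/2 and the winding estimate 288
  \<kappa> \<le> 3/10; both follow from \<kappa> \<le> 1/2000.\<close>

locale phase_knot =
  fixes y u :: "real \<Rightarrow> c2" and c \<theta> \<tau> :: "real \<Rightarrow> real" and \<kappa> :: real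
  assumes \<kappa>: "0 \<le> \<kappa>" "\<kappa> \<le> 1/2000"
    and y_deriv: "\<And>s. (y has_vector_derivative c s *\<^sub>R u s) (at s)"
    and cc: "continuous_on UNIV c" and cu: "continuous_on UNIV (\<lambda>s. c s *\<^sub>R u s)" and cpos: "\<And>s. c s > 0"
    and y_per: "\<And>s. y (s + 1) = y s" and y_norm: "\<And>s. norm (y s) = 1"
    and u_near: "\<And>s. norm (u s - times_i (y s)) \<le> \<kappa>" and y_snd: "\<And>s. norm (snd (y s)) \<le> 7 * \<kappa>"
    and \<theta>: "\<And>s. (\<theta> has_real_derivative c s * Im (fst (u s) / fst (y s))) (at s)"
      "\<And>s. \<theta> (s + 1) = \<theta> s + 2 * pi" "\<And>s. fst (y s) = of_real (norm (fst (y s))) * cis (\<theta> s)"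
    and \<tau>: "\<And>x. \<theta> (\<tau> x) = x" "\<And>s. \<tau> (\<theta> s) = s" "\<And>x. \<tau> (x + 2 * pi) = \<tau> x + 1"
      "\<And>x. (\<tau> has_real_derivative inverse (c (\<tau> x) * Im (fst (u (\<tau> x)) / fst (y (\<tau> x))))) (at x)"
begin

definition rate :: "real \<Rightarrow> real" where "rate s = Im (fst (u s) / fst (y s))"
definition \<eta> :: "real \<Rightarrow> complex" where "\<eta> x = snd (y (\<tau> x))"
text \<open>c and u are kept together because their product is the derivative of y, whose
  periodicity and continuity are at hand; c cancels in \<open>\<eta>'_eq\<close>.\<close>

definition \<eta>' :: "real \<Rightarrow> complex" where "\<eta>' x = inverse (c (\<tau> x) * rate (\<tau> x)) *\<^sub>R (c (\<tau> x) *\<^sub>R snd (u (\<tau> x)))"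
definition q :: "complex \<Rightarrow> complex" where "q w = cutoff ((norm w)\<^sup>2) *\<^sub>R \<eta> (Arg w)"

lemma fst_large: "norm (fst (y s)) \<ge> 9/10" "(norm (fst (y s)))\<^sup>2 \<ge> 1/2" "fst (y s) \<noteq> 0"
proof -
  have "(norm (snd (y s)))\<^sup>2 \<le> (7/2000)\<^sup>2" using y_snd[of s] \<kappa> by (intro power_mono) auto
  then have "(norm (fst (y s)))\<^sup>2 \<ge> (9/10)\<^sup>2" unfolding norm_fst_sq[OF y_norm] by (simp add: power2_eq_square)
  then show l: "norm (fst (y s)) \<ge> 9/10" by (rule power2_le_imp_le) simp
  show "(norm (fst (y s)))\<^sup>2 \<ge> 1/2" using power_mono[OF l, of 2] by (simp add: power2_eq_square)
  show "fst (y s) \<noteq> 0" using l by auto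
qed

lemma rate_bound: "rate s \<ge> 9/10" "rate s > 0"
proof -
  have "\<bar>rate s - 1\<bar> \<le> \<kappa> / norm (fst (y s))" unfolding rate_def by (rule rate_near[OF u_near fst_large(3)])
  also have "\<dots> \<le> \<kappa> / (9/10)" using fst_large(1)[of s] \<kappa> by (intro divide_left_mono) auto
  finally have "\<bar>rate s - 1\<bar> \<le> \<kappa> / (9/10)" .
  moreover have "\<kappa> / (9/10) \<le> 1/10" using \<kappa> by simp
  ultimately show "rate s \<ge> 9/10" using abs_ge_minus_self[of "rate s - 1"] by linarith
  then show "rate s > 0" by simp
qed

lemma snd_u: "norm (snd (u s)) \<le> 8 * \<kappa>"
proof -
  have "snd (u s) = snd (u s - times_i (y s)) + \<i> * snd (y s)" by (simp add: times_i_def)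
  then have "norm (snd (u s)) \<le> norm (snd (u s - times_i (y s))) + norm (\<i> * snd (y s))" by (metis norm_triangle_ineq)
  then show ?thesis using norm_fst_snd_le(2)[of "u s - times_i (y s)"] u_near[of s] y_snd[of s] by (simp add: norm_mult)
qed

lemma u_norm: "norm (u s) \<le> 11/10"
proof -
  have "norm (times_i (y s)) = 1" using y_norm[of s] by (cases "y s") (simp add: times_i_def norm_Pair norm_mult)
  then show ?thesis using norm_triangle_sub[of "u s" "times_i (y s)"] u_near[of s] \<kappa> by simp
qed

lemma \<eta>'_eq: "\<eta>' x = (1 / rate (\<tau> x)) *\<^sub>R snd (u (\<tau> x))"
proof -
  have "inverse (c (\<tau> x) * rate (\<tau> x)) * c (\<tau> x) = 1 / rate (\<tau> x)"
    using cpos[of "\<tau> x"] rate_bound(2)[of "\<tau> x"] by (simp add: field_simps)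
  then show ?thesis unfolding \<eta>'_def scaleR_scaleR by simp
qed

lemma \<eta>_bounds: "norm (\<eta> x) \<le> 7 * \<kappa>" "norm (\<eta>' x) \<le> 9 * \<kappa>"
proof -
  show "norm (\<eta> x) \<le> 7 * \<kappa>" unfolding \<eta>_def by (rule y_snd)
  have "norm (\<eta>' x) \<le> (1 / (9/10)) * (8 * \<kappa>)"
    unfolding \<eta>'_eq norm_scaleR using rate_bound[of "\<tau> x"] snd_u[of "\<tau> x"] \<kappa>
    by (intro mult_mono) (auto simp: divide_simps)
  then show "norm (\<eta>' x) \<le> 9 * \<kappa>" using \<kappa> by simp
qed

lemma \<eta>_periodic: "\<eta> (x + 2 * pi) = \<eta> x" "\<eta>' (x + 2 * pi) = \<eta>' x"
proof -
  show "\<eta> (x + 2 * pi) = \<eta> x" by (simp add: \<eta>_def \<tau>(3) y_per)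
  have e: "c (s + 1) *\<^sub>R u (s + 1) = c s *\<^sub>R u s" for s
  proof -
    have "((y \<circ> (\<lambda>s. s + 1)) has_vector_derivative 1 *\<^sub>R (c (s + 1) *\<^sub>R u (s + 1))) (at s)"
      by (rule vector_diff_chain_at[OF _ y_deriv]) (auto intro!: derivative_eq_intros)
    moreover have "y \<circ> (\<lambda>s. s + 1) = y" using y_per by auto
    ultimately show ?thesis using vector_derivative_unique_at[OF _ y_deriv[of s]] by simp
  qed
  have "c s * rate s = Im (fst (c s *\<^sub>R u s) / fst (y s))" for s
    by (simp add: rate_def scaleR_conv_of_real flip: times_divide_eq_right)
  then have "c (s + 1) * rate (s + 1) = c s * rate s" for s using e y_per by metis
  moreover have "c (s + 1) *\<^sub>R snd (u (s + 1)) = c s *\<^sub>R snd (u s)" for s using arg_cong[OF e, of snd] by simp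
  ultimately show "\<eta>' (x + 2 * pi) = \<eta>' x" unfolding \<eta>'_def \<tau>(3) by metis
qed

lemma \<eta>_deriv: "(\<eta> has_vector_derivative \<eta>' x) (at x)"
proof -
  have "((\<lambda>s. snd (y s)) has_vector_derivative c s *\<^sub>R snd (u s)) (at s)" for s
    using bounded_linear.has_vector_derivative[OF bounded_linear_snd y_deriv[of s]] by simp
  from vector_diff_chain_at[OF _ this, of \<tau>] \<tau>(4)[of x]
  show ?thesis unfolding \<eta>_def[abs_def] \<eta>'_def rate_def by (simp add: o_def has_real_derivative_iff_has_vector_derivative)
qed

lemma y_cont: "isCont y s"
  using y_deriv has_vector_derivative_continuous by blast

lemma \<eta>_cont: "isCont \<eta> x" "isCont \<eta>' x"
proof -
  show "isCont \<eta> x" using \<eta>_deriv has_vector_derivative_continuous by blast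
  have t: "isCont \<tau> x" using \<tau>(4) DERIV_isCont by blast
  have i: "isCont (\<lambda>s. c s *\<^sub>R u s) s" "isCont (\<lambda>s. c s * rate s) s" for s
  proof -
    show cu': "isCont (\<lambda>s. c s *\<^sub>R u s) s" using cu by (simp add: continuous_on_eq_continuous_at)
    have "isCont (\<lambda>s. Im (fst (c s *\<^sub>R u s) / fst (y s))) s"
      using fst_large(3)[of s] by (intro isCont_Im isCont_divide isCont_fst cu' y_cont)
    then show "isCont (\<lambda>s. c s * rate s) s"
      by (simp add: rate_def scaleR_conv_of_real flip: times_divide_eq_right)
  qed
  have "isCont (\<lambda>s. inverse (c s * rate s) *\<^sub>R snd (c s *\<^sub>R u s)) s" for s
    using cpos[of s] rate_bound(2)[of s] by (intro continuous_intros i) auto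
  from isCont_o2[OF t this]
  show "isCont \<eta>' x" unfolding \<eta>'_def[abs_def] by simp
qed

lemma q_small: "norm (q w) \<le> 7 * \<kappa>"
proof -
  have "norm (q w) \<le> 1 * (7 * \<kappa>)"
    unfolding q_def norm_scaleR using cutoff_bounds(1,2) \<eta>_bounds(1) by (intro mult_mono) auto
  then show ?thesis by simp
qed

lemma q_zero: "norm w \<le> 1/2 \<Longrightarrow> q w = 0"
  using power_mono[of "norm w" "1/2" 2] cutoff_bounds(6)[of "(norm w)\<^sup>2"] by (simp add: q_def power2_eq_square)

lemma q_continuous: "continuous_on UNIV q"
proof -
  have "isCont q w" for w
  proof (cases "w = 0")
    case True
    have "\<forall>\<^sub>F w in nhds 0. q w = 0"
      using eventually_nhds_in_open[of "ball 0 (1/2)" "0::complex"] by (auto elim!: eventually_mono intro!: q_zero)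
    then have "isCont q w \<longleftrightarrow> isCont (\<lambda>_. 0::complex) w" unfolding True by (rule isCont_cong)
    then show ?thesis by simp
  next
    case False
    have "isCont cutoff x" for x using cutoff_continuous(1) by (simp add: continuous_on_eq_continuous_at)
    moreover have "isCont (\<lambda>w::complex. (norm w)\<^sup>2) w" by (intro continuous_intros)
    ultimately have cn: "isCont (\<lambda>w. cutoff ((norm w)\<^sup>2)) w" by (rule isCont_o2[rotated])
    show ?thesis unfolding q_def[abs_def]
      by (intro isCont_scaleR cn isCont_periodic_Arg[where g = \<eta>, OF \<eta>_periodic(1) \<eta>_cont(1) False])
  qed
  then show ?thesis by (simp add: continuous_at_imp_continuous_on)
qed

text \<open>The derivative of q at w in the direction w'. The quotient at w = 0 is harmless because
  \<open>cutoff\<close> and \<open>cutoff'\<close> vanish there.\<close>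

definition dq :: "complex \<Rightarrow> complex \<Rightarrow> complex" where
  "dq w w' = cutoff ((norm w)\<^sup>2) *\<^sub>R Im (w' / w) *\<^sub>R \<eta>' (Arg w) + (cutoff' ((norm w)\<^sup>2) * (2 * (w \<bullet> w'))) *\<^sub>R \<eta> (Arg w)"

lemma q_curve_derivative:
  assumes "(w has_vector_derivative w') (at t)"
  shows "((\<lambda>t. q (w t)) has_vector_derivative dq (w t) w') (at t)"
proof (cases "w t = 0")
  case True
  have "isCont w t" using assms has_vector_derivative_continuous by blast
  then have "\<forall>\<^sub>F s in at t. dist (w s) 0 < 1/2" using True unfolding isCont_def tendsto_iff by (auto dest!: spec[of _ "1/2"])
  then have "\<forall>\<^sub>F s in nhds t. dist (w s) 0 < 1/2" using True by (simp add: eventually_nhds_conv_at)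
  then have "\<forall>\<^sub>F s in nhds t. 0 = q (w s)" by (rule eventually_mono) (simp add: q_zero)
  then obtain S where S: "open S" "t \<in> S" "\<And>s. s \<in> S \<Longrightarrow> 0 = q (w s)"
    unfolding eventually_nhds by blast
  have "((\<lambda>_. 0::complex) has_vector_derivative 0) (at t)" by simp
  from has_vector_derivative_transform_within_open[OF this S]
  have "((\<lambda>s. q (w s)) has_vector_derivative 0) (at t)" .
  moreover have "dq (w t) w' = 0" unfolding dq_def True using cutoff_bounds(6)[of 0] by simp
  ultimately show ?thesis by simp
next
  case False
  have "((\<lambda>t. w t \<bullet> w t) has_real_derivative (w t \<bullet> w' + w' \<bullet> w t)) (at t)"
    unfolding has_real_derivative_iff_has_vector_derivative
    by (rule bounded_bilinear.has_vector_derivative[OF bounded_bilinear_inner assms assms])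
  then have "((\<lambda>t. (norm (w t))\<^sup>2) has_real_derivative 2 * (w t \<bullet> w')) (at t)"
    by (simp add: power2_norm_eq_inner inner_commute)
  from DERIV_chain2[OF cutoff_derivative this]
  have "((\<lambda>t. cutoff ((norm (w t))\<^sup>2)) has_real_derivative cutoff' ((norm (w t))\<^sup>2) * (2 * (w t \<bullet> w'))) (at t)" .
  from has_vector_derivative_scaleR[OF this periodic_Arg_derivative[where g = \<eta> and g' = \<eta>', OF \<eta>_periodic \<eta>_deriv assms False]]
  show ?thesis unfolding q_def dq_def .
qed

lemma q_loop:
  assumes "c1_loop w" shows "c1_loop (\<lambda>t. q (w t))"
proof -
  obtain w' where w: "\<And>t. (w has_vector_derivative w' t) (at t)" "continuous_on UNIV w'" "\<And>t. w (t + 1) = w t"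
    using assms unfolding c1_loop_def by blast
  have wc: "isCont w t" "isCont w' t" for t
    using w(1) has_vector_derivative_continuous w(2) by (blast, simp add: continuous_on_eq_continuous_at)
  have "isCont (\<lambda>t. dq (w t) (w' t)) t" for t
  proof (cases "w t = 0")
    case True
    have "\<forall>\<^sub>F s in at t. dist (w s) 0 < 1/2" using wc(1)[of t] True unfolding isCont_def tendsto_iff by (auto dest!: spec[of _ "1/2"])
    then have "\<forall>\<^sub>F s in nhds t. dist (w s) 0 < 1/2" using True by (simp add: eventually_nhds_conv_at)
    then have "\<forall>\<^sub>F s in nhds t. dq (w s) (w' s) = 0"
    proof (rule eventually_mono)
      fix s assume "dist (w s) 0 < 1/2"
      then have "(norm (w s))\<^sup>2 \<le> 1/4" using power_mono[of "norm (w s)" "1/2" 2] by (simp add: power2_eq_square)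
      then show "dq (w s) (w' s) = 0" unfolding dq_def using cutoff_bounds(6) by simp
    qed
    then have "isCont (\<lambda>t. dq (w t) (w' t)) t \<longleftrightarrow> isCont (\<lambda>_. 0::complex) t" by (rule isCont_cong)
    then show ?thesis by simp
  next
    case False
    have cf: "isCont cutoff x" "isCont cutoff' x" for x using cutoff_continuous by (simp_all add: continuous_on_eq_continuous_at)
    have n2: "isCont (\<lambda>t. (norm (w t))\<^sup>2) t" by (intro continuous_intros wc)
    show ?thesis unfolding dq_def
      by (intro continuous_intros isCont_Im[OF isCont_divide[OF wc(2) wc(1) False]] wc isCont_o2[OF n2 cf(1)] isCont_o2[OF n2 cf(2)]
          isCont_o2[OF wc(1) isCont_periodic_Arg[where g = \<eta>, OF \<eta>_periodic(1) \<eta>_cont(1) False]]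
          isCont_o2[OF wc(1) isCont_periodic_Arg[where g = \<eta>', OF \<eta>_periodic(2) \<eta>_cont(2) False]] False)
  qed
  then have "continuous_on UNIV (\<lambda>t. dq (w t) (w' t))" by (simp add: continuous_at_imp_continuous_on)
  then show ?thesis unfolding c1_loop_def using q_curve_derivative[OF w(1)] w(3)
    by (intro exI[of _ "\<lambda>t. dq (w t) (w' t)"]) auto
qed

lemma q_on_knot: "q (fst (y s)) = snd (y s)"
proof -
  have "\<eta> (Arg (fst (y s))) = \<eta> (\<theta> s)"
    by (rule periodic_Arg[where g = \<eta>, OF \<eta>_periodic(1) \<theta>(3)]) (use fst_large(3) in simp)
  then show ?thesis using cutoff_bounds(5)[OF fst_large(2)] by (simp add: q_def \<eta>_def \<tau>(2))
qed

lemma same_phase: "z \<noteq> 0 \<Longrightarrow> fst (y (\<tau> (Arg z))) = of_real (norm (fst (y (\<tau> (Arg z))))) * cis (Arg z)" for z :: complex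
  using \<theta>(3)[of "\<tau> (Arg z)"] by (simp add: \<tau>(1))

text \<open>A unit vector on the graph has a small second coordinate, so |z1|^2 \<ge> 1/2, where q
  depends on the phase alone. The knot point of the same phase then has the same z2 and, by the unit
  norm, the same |z1|.\<close>

lemma graph_is_knot:
  assumes "norm z = 1" "snd z = q (fst z)"
  shows "\<exists>s. z = y s"
proof -
  have "(norm (snd z))\<^sup>2 \<le> (1/2)\<^sup>2" using assms(2) q_small[of "fst z"] \<kappa> by (intro power_mono) auto
  then have f: "(norm (fst z))\<^sup>2 \<ge> 1/2" unfolding norm_fst_sq[OF assms(1)] by (simp add: power2_eq_square)
  then have nz: "fst z \<noteq> 0" by auto
  define p where "p = y (\<tau> (Arg (fst z)))"
  have s: "snd z = snd p" unfolding assms(2) q_def p_def using cutoff_bounds(5)[OF f] by (simp add: \<eta>_def)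
  have "(norm (fst z))\<^sup>2 = (norm (fst p))\<^sup>2" unfolding norm_fst_sq[OF assms(1)] p_def norm_fst_sq[OF y_norm] using s by (simp add: p_def)
  then have "norm (fst z) = norm (fst p)" by simp
  then have n: "of_real (norm (fst z)) * cis (Arg (fst z)) = of_real (norm (fst p)) * cis (Arg (fst z))" by simp
  have "fst z = of_real (norm (fst z)) * cis (Arg (fst z))" using rcis_cmod_Arg[of "fst z"] by (simp add: rcis_def)
  from trans[OF this n] have "fst z = fst p" using same_phase[OF nz, folded p_def] by (metis (no_types))
  then have "z = p" using s by (simp add: prod_eq_iff)
  then show ?thesis unfolding p_def by blast
qed

lemma shear_nonzero:
  assumes "norm z = 1" shows "shear q t z \<noteq> 0"
proof
  assume "shear q t z = 0"
  then have "fst z = 0" "snd z = t *\<^sub>R q (fst z)" by (simp_all add: shear_def prod_eq_iff)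
  then have "z = 0" using q_zero[of 0] by (simp add: prod_eq_iff)
  then show False using assms by simp
qed

text \<open>The first coordinates lie on one ray, so only the cutoff tells q at the two points apart
  and |w2 - r z2| is of order \<kappa> (1 - r). But the unit norms give |w2|^2 - |r z2|^2 = 1 - r^2,
  so this distance is at least (1 - r^2) / 2. For small \<kappa> only r = 1 is left.\<close>

lemma shear_injective_aux:
  assumes t: "0 \<le> t" "t \<le> 1" and z: "norm z = 1" "norm w = 1"
    and r: "0 < r" "r \<le> 1" "shear q t w = r *\<^sub>R shear q t z"
  shows "z = w"
proof -
  have f: "fst w = r *\<^sub>R fst z" and "snd w - t *\<^sub>R q (fst w) = r *\<^sub>R (snd z - t *\<^sub>R q (fst z))"
    using arg_cong[OF r(3), of fst] arg_cong[OF r(3), of snd] by (simp_all only: shear_def fst_conv snd_conv fst_scaleR snd_scaleR)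
  then have s: "snd w - r *\<^sub>R snd z = t *\<^sub>R (q (fst w) - r *\<^sub>R q (fst z))" by (simp add: algebra_simps)
  have E: "\<eta> (Arg (fst w)) = \<eta> (Arg (fst z))" if "fst z \<noteq> 0"
  proof (rule periodic_Arg[where g = \<eta>, OF \<eta>_periodic(1)])
    show "fst w = of_real (r * norm (fst z)) * cis (Arg (fst z))"
      unfolding f using rcis_cmod_Arg[of "fst z"] by (simp add: rcis_def scaleR_conv_of_real mult.assoc)
  qed (use r that in simp)
  define \<rho> where "\<rho> = (norm (fst z))\<^sup>2"
  have "\<rho> \<le> 1" unfolding \<rho>_def norm_fst_sq[OF z(1)] using zero_le_power2[of "norm (snd z)"] by linarith
  moreover have "0 \<le> \<rho>" by (simp add: \<rho>_def)
  moreover have "(norm (fst w))\<^sup>2 = r\<^sup>2 * \<rho>" by (simp add: f \<rho>_def power_mult_distrib)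
  ultimately have \<rho>: "0 \<le> \<rho>" "\<rho> \<le> 1" "(norm (fst w))\<^sup>2 = r\<^sup>2 * \<rho>" by blast+
  have r2: "1 - r\<^sup>2 \<le> 2 * (1 - r)" "0 \<le> 1 - r\<^sup>2"
    using zero_le_power2[of "1 - r"] power_le_one[of r 2] r by (simp_all add: power2_diff)
  have qd: "norm (q (fst w) - r *\<^sub>R q (fst z)) \<le> (33 * (1 - r)) * (7 * \<kappa>)"
  proof (cases "fst z = 0")
    case True
    then show ?thesis using f q_zero[of 0] r \<kappa> by simp
  next
    case False
    have "q (fst w) - r *\<^sub>R q (fst z) = (cutoff (r\<^sup>2 * \<rho>) - r * cutoff \<rho>) *\<^sub>R \<eta> (Arg (fst z))"
      unfolding q_def E[OF False] \<rho>(3) by (simp add: \<rho>_def algebra_simps)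
    \<comment> \<open>33 = 32 + 1: the Lipschitz constant 16 times 1 - r^2 \<le> 2 (1 - r), plus the
      term (1 - r) \<open>cutoff \<rho>\<close>.\<close>
    moreover have "\<bar>cutoff (r\<^sup>2 * \<rho>) - r * cutoff \<rho>\<bar> \<le> 33 * (1 - r)"
    proof -
      have "\<bar>cutoff (r\<^sup>2 * \<rho>) - cutoff \<rho>\<bar> \<le> 16 * \<bar>r\<^sup>2 * \<rho> - \<rho>\<bar>" by (rule cutoff_lipschitz)
      also have "\<bar>r\<^sup>2 * \<rho> - \<rho>\<bar> = (1 - r\<^sup>2) * \<rho>" 
        proof -
          have "r\<^sup>2 * \<rho> - \<rho> = - ((1 - r\<^sup>2) * \<rho>)" by (simp add: algebra_simps)
          then show ?thesis using mult_nonneg_nonneg[OF r2(2) \<rho>(1)] by simp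
        qed
      also have "16 * ((1 - r\<^sup>2) * \<rho>) \<le> 16 * (2 * (1 - r) * 1)" using r2 \<rho> r by (intro mult_left_mono mult_mono) auto
      finally have "\<bar>cutoff (r\<^sup>2 * \<rho>) - cutoff \<rho>\<bar> \<le> 32 * (1 - r)" by simp
      moreover have "\<bar>(1 - r) * cutoff \<rho>\<bar> \<le> (1 - r) * 1"
        unfolding abs_mult using r cutoff_bounds(1,2)[of \<rho>] by (intro mult_mono) auto
      moreover have "cutoff (r\<^sup>2 * \<rho>) - r * cutoff \<rho> = (cutoff (r\<^sup>2 * \<rho>) - cutoff \<rho>) + (1 - r) * cutoff \<rho>" by (simp add: algebra_simps)
      ultimately show ?thesis by linarith
    qed
    ultimately show ?thesis using \<eta>_bounds(1)[of "Arg (fst z)"] \<kappa> r by (simp only: norm_scaleR) (intro mult_mono; simp)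
  qed
  have up: "norm (snd w - r *\<^sub>R snd z) \<le> (33 * (1 - r)) * (7 * \<kappa>)"
  proof -
    have "norm (snd w - r *\<^sub>R snd z) \<le> 1 * norm (q (fst w) - r *\<^sub>R q (fst z))"
      unfolding s norm_scaleR using t by (intro mult_right_mono) auto
    then show ?thesis using qd by simp
  qed
  have sq: "(norm (snd w))\<^sup>2 - (r * norm (snd z))\<^sup>2 = 1 - r\<^sup>2"
  proof -
    have a: "(norm (snd w))\<^sup>2 = 1 - r\<^sup>2 * \<rho>" using norm_fst_sq[OF z(2)] \<rho>(3) by linarith
    have b: "(norm (snd z))\<^sup>2 = 1 - \<rho>" using norm_fst_sq[OF z(1)] unfolding \<rho>_def by linarith
    show ?thesis unfolding power_mult_distrib a b by (simp add: algebra_simps)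
  qed
  have le1: "norm (snd w) \<le> 1" "norm (snd z) \<le> 1" using norm_fst_snd_le(2) z by metis+
  have "1 - r\<^sup>2 = (norm (snd w) - r * norm (snd z)) * (norm (snd w) + r * norm (snd z))"
    unfolding sq[symmetric] by (simp add: power2_eq_square algebra_simps)
  also have "\<dots> \<le> norm (snd w - r *\<^sub>R snd z) * 2"
  proof -
    have "norm (snd w) - r * norm (snd z) \<le> norm (snd w - r *\<^sub>R snd z)"
      using norm_triangle_ineq2[of "snd w" "r *\<^sub>R snd z"] r by simp
    moreover have "norm (snd w) + r * norm (snd z) \<le> 2" using le1 r mult_mono[of r 1 "norm (snd z)" 1] by simp
    ultimately show ?thesis using r by (intro mult_mono) auto
  qed
  also have "\<dots> \<le> ((33 * (1 - r)) * (7 * \<kappa>)) * 2" using up by linarith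
  also have "\<dots> = (462 * \<kappa>) * (1 - r)" by simp
  also have "\<dots> \<le> (1/2) * (1 - r)" using \<kappa> r by (intro mult_right_mono) auto
  finally have "1 - r\<^sup>2 \<le> (1/2) * (1 - r)" .
  moreover have "(1 - r) * (1/2 + r) = (1 - r\<^sup>2) - (1/2) * (1 - r)" by (simp add: power2_eq_square field_simps)
  ultimately have "(1 - r) * (1/2 + r) \<le> 0" by linarith
  then have "r = 1" using r by (auto simp: mult_le_0_iff)
  then have "fst w = fst z" "snd w = snd z" using f s by auto
  then show ?thesis by (simp add: prod_eq_iff)
qed

lemma shear_injective:
  assumes t: "0 \<le> t" "t \<le> 1" and z: "norm z = 1" "norm w = 1" and d: "same_dir (shear q t z) (shear q t w)"
  shows "z = w"
proof -
  obtain r where r: "r > 0" "shear q t w = r *\<^sub>R shear q t z" using d unfolding same_dir_def by blast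
  show ?thesis
  proof (cases "r \<le> 1")
    case True
    then show ?thesis using shear_injective_aux[OF t z r(1)] r(2) by blast
  next
    case False
    have "shear q t z = (1 / r) *\<^sub>R shear q t w" using r by simp
    moreover have "0 < 1 / r" "1 / r \<le> 1" using False by auto
    ultimately show ?thesis using shear_injective_aux[OF t z(2,1)] by blast
  qed
qed

text \<open>\<zeta> measures the position of z relative to the graph, and the left-hand side is its
  velocity along w minus that of a pure rotation. Near the knot z is compared with the knot point of
  equal phase, to which the Lipschitz hypothesis applies; far from it \<zeta> itself is
  large.\<close>

lemma winding_rate:
  assumes z: "norm z = 1" and w: "norm (w - times_i z) \<le> \<kappa>"
    and lip: "\<And>s. norm ((w - u s) - times_i (z - y s)) \<le> \<kappa> * norm (z - y s)"
  defines "\<zeta> \<equiv> snd z - q (fst z)"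
  shows "norm ((snd w - dq (fst z) (fst w)) - \<i> * \<zeta>) \<le> norm \<zeta> / 2"
proof (cases "(norm (fst z))\<^sup>2 \<ge> 1/2")
  case True
  have nz: "fst z \<noteq> 0" using True by auto
  have fz: "norm (fst z) \<ge> 7/10"
    by (rule power2_le_imp_le) (use True in \<open>auto simp: power2_eq_square\<close>)
  \<comment> \<open>p is the knot point with the phase of z; q takes the value \<open>snd p\<close>
    at \<open>fst z\<close>, so \<zeta> is the second coordinate of e = z - p.\<close>
  define s where "s = \<tau> (Arg (fst z))"
  define p where "p = y s"
  define e where "e = z - p"
  have c1: "cutoff ((norm (fst z))\<^sup>2) = 1" "cutoff' ((norm (fst z))\<^sup>2) = 0" using cutoff_bounds(5)[OF True] by auto
  have \<zeta>: "\<zeta> = snd e" unfolding \<zeta>_def q_def c1 by (simp add: e_def p_def s_def \<eta>_def)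
  define X where "X = Im (fst w / fst z)"
  have dq: "dq (fst z) (fst w) = (X / rate s) *\<^sub>R snd (u s)"
    unfolding dq_def c1 by (simp add: \<eta>'_eq s_def X_def)
  have pf: "norm (fst p) \<ge> 9/10" "norm p = 1" "norm (snd p) \<le> 1" using fst_large(1) y_norm norm_fst_snd_le(2)[of p] by (auto simp: p_def)
  \<comment> \<open>Both points are unit vectors of equal phase, so the difference of the moduli of
    their first coordinates is controlled by that of their second coordinates.\<close>
  have e1: "norm (fst e) \<le> 2 * norm \<zeta>"
  proof -
    have "fst e = of_real (norm (fst z) - norm (fst p)) * cis (Arg (fst z))"
      using same_phase[OF nz] rcis_cmod_Arg[of "fst z"] by (simp add: e_def p_def s_def rcis_def algebra_simps)
    then have ne: "norm (fst e) = \<bar>norm (fst z) - norm (fst p)\<bar>"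
      by (simp only: norm_mult norm_of_real norm_cis mult_1_right)
    have "(norm (fst z) - norm (fst p)) * (norm (fst z) + norm (fst p)) = (norm (snd p) - norm (snd z)) * (norm (snd p) + norm (snd z))"
      using norm_fst_sq[OF z] norm_fst_sq[OF pf(2)] by (simp add: power2_eq_square algebra_simps)
    from arg_cong[OF this, of abs]
    have "\<bar>norm (fst z) - norm (fst p)\<bar> * (norm (fst z) + norm (fst p)) = \<bar>norm (snd p) - norm (snd z)\<bar> * (norm (snd p) + norm (snd z))"
      by (simp only: abs_mult abs_of_nonneg[OF add_nonneg_nonneg[OF norm_ge_zero norm_ge_zero]])
    also have "\<dots> \<le> norm \<zeta> * 2"
    proof (intro mult_mono)
      show "\<bar>norm (snd p) - norm (snd z)\<bar> \<le> norm \<zeta>"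
        unfolding \<zeta> e_def using norm_triangle_ineq3[of "snd p" "snd z"] by (simp add: norm_minus_commute)
      show "norm (snd p) + norm (snd z) \<le> 2" using pf norm_fst_snd_le(2)[of z] z by simp
    qed auto
    finally have "\<bar>norm (fst z) - norm (fst p)\<bar> * (norm (fst z) + norm (fst p)) \<le> 2 * norm \<zeta>" by simp
    moreover have "\<bar>norm (fst z) - norm (fst p)\<bar> * 1 \<le> \<bar>norm (fst z) - norm (fst p)\<bar> * (norm (fst z) + norm (fst p))"
      using fz pf by (intro mult_left_mono) auto
    ultimately show ?thesis using ne by simp
  qed
  have ne: "norm e \<le> 3 * norm \<zeta>"
    using norm_Pair_le[of "fst e" "snd e"] e1 \<zeta> by simp
  have lp: "norm ((w - u s) - times_i e) \<le> \<kappa> * norm e" using lip[of s] by (simp add: e_def p_def)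
  have wu: "norm (fst w - fst (u s)) \<le> (11/10) * norm e"
  proof -
    have "norm (times_i e) = norm e" by (cases e) (simp add: times_i_def norm_Pair norm_mult)
    then have "norm (w - u s) \<le> norm e + \<kappa> * norm e" using lp norm_triangle_sub[of "w - u s" "times_i e"] by simp
    moreover have "\<kappa> * norm e \<le> (1/10) * norm e" using \<kappa> by (intro mult_right_mono) auto
    ultimately show ?thesis using norm_fst_snd_le(1)[of "w - u s"] by simp
  qed
  \<comment> \<open>\<open>dq\<close> is the second component of the knot's velocity rescaled by the
    ratio of the phase speeds X and \<open>rate s\<close>. These differ by a multiple of |e|, and
    that component is of order \<kappa>, so the rescaling costs only order \<kappa> |e|.\<close>
  have Xc: "\<bar>rate s - X\<bar> \<le> 4 * norm e"
  proof -
    have fpnz: "fst p \<noteq> 0" using pf(1) by auto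
    have eq: "fst (u s) / fst p - fst w / fst z = (fst (u s) - fst w) / fst z + fst (u s) * (fst z - fst p) / (fst p * fst z)"
      using nz fpnz by (simp add: field_simps)
    have "\<bar>rate s - X\<bar> = \<bar>Im (fst (u s) / fst p - fst w / fst z)\<bar>" by (simp add: rate_def X_def p_def)
    also have "\<dots> \<le> norm (fst (u s) / fst p - fst w / fst z)" by (rule abs_Im_le_cmod)
    also have "\<dots> \<le> norm (fst (u s) - fst w) / norm (fst z) + norm (fst (u s)) * norm (fst z - fst p) / (norm (fst p) * norm (fst z))"
      unfolding eq using norm_triangle_ineq[of "(fst (u s) - fst w) / fst z" "fst (u s) * (fst z - fst p) / (fst p * fst z)"]
      by (simp add: norm_divide norm_mult)
    also have "\<dots> \<le> ((11/10) * norm e) / (7/10) + ((11/10) * norm e) / ((9/10) * (7/10))"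
    proof (intro add_mono frac_le)
      show "norm (fst (u s) - fst w) \<le> (11/10) * norm e" using wu by (simp add: norm_minus_commute)
      show "norm (fst (u s)) * norm (fst z - fst p) \<le> (11/10) * norm e"
        using norm_fst_snd_le(1)[of "u s"] u_norm[of s] norm_fst_snd_le(1)[of e] by (intro mult_mono) (auto simp: e_def)
      show "9/10 * (7/10) \<le> norm (fst p) * norm (fst z)" using fz pf by (intro mult_mono) auto
    qed (use fz in auto)
    also have "\<dots> \<le> 4 * norm e" by simp
    finally show ?thesis .
  qed
  have split: "(snd w - dq (fst z) (fst w)) - \<i> * \<zeta> = snd ((w - u s) - times_i e) + ((rate s - X) / rate s) *\<^sub>R snd (u s)"
    using rate_bound(2)[of s] unfolding dq \<zeta> by (simp add: times_i_def diff_divide_distrib algebra_simps)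
  have "norm ((snd w - dq (fst z) (fst w)) - \<i> * \<zeta>) \<le> \<kappa> * norm e + norm (((rate s - X) / rate s) *\<^sub>R snd (u s))"
    unfolding split
    using norm_triangle_ineq[of "snd ((w - u s) - times_i e)" "((rate s - X) / rate s) *\<^sub>R snd (u s)"]
      norm_fst_snd_le(2)[of "(w - u s) - times_i e"] lp by linarith
  also have "norm (((rate s - X) / rate s) *\<^sub>R snd (u s)) \<le> (4 * norm e / (9/10)) * (8 * \<kappa>)"
    unfolding norm_scaleR real_norm_def abs_divide
    using Xc rate_bound[of s] snd_u[of s] \<kappa> by (intro mult_mono frac_le) auto
  also have "\<kappa> * norm e + (4 * norm e / (9/10)) * (8 * \<kappa>) \<le> 40 * \<kappa> * norm e"
    using \<kappa> by (simp add: mult_nonneg_nonneg)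
  also have "\<dots> \<le> 40 * \<kappa> * (3 * norm \<zeta>)" using ne \<kappa> by (intro mult_left_mono) auto
  also have "\<dots> \<le> (1/2) * norm \<zeta>" using \<kappa> mult_right_mono[of "120 * \<kappa>" "1/2" "norm \<zeta>"] by simp
  finally show ?thesis by simp
next
  \<comment> \<open>Here |\<zeta>| \<ge> 6/10, while all deviations together are at most \<kappa> +
    7 \<kappa> + 280 \<kappa> = 288 \<kappa>.\<close>
  case False
  have s2: "(norm (snd z))\<^sup>2 \<ge> 1/2" using False norm_fst_sq[OF z] by simp
  have "norm (snd z) \<ge> 7/10" by (rule power2_le_imp_le) (use s2 in \<open>auto simp: power2_eq_square\<close>)
  then have \<zeta>l: "norm \<zeta> \<ge> 6/10" unfolding \<zeta>_def using norm_triangle_ineq2[of "snd z" "q (fst z)"] q_small[of "fst z"] \<kappa> by simp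
  have wn: "norm (fst w) \<le> 11/10"
  proof -
    have "norm (times_i z) = 1" using z by (cases z) (simp add: times_i_def norm_Pair norm_mult)
    then show ?thesis using norm_triangle_sub[of w "times_i z"] w \<kappa> norm_fst_snd_le(1)[of w] by simp
  qed
  have fz1: "norm (fst z) \<le> 1" using norm_fst_snd_le(1)[of z] z by simp
  have d1: "norm (cutoff ((norm (fst z))\<^sup>2) *\<^sub>R Im (fst w / fst z) *\<^sub>R \<eta>' (Arg (fst z))) \<le> 1 * (3 * (9 * \<kappa>))"
  proof (cases "norm (fst z) \<le> 1/2")
    case True
    then have "(norm (fst z))\<^sup>2 \<le> 1/4" using power_mono[of "norm (fst z)" "1/2" 2] by (simp add: power2_eq_square)
    then show ?thesis using cutoff_bounds(6) \<kappa> by simp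
  next
    case False
    have "\<bar>Im (fst w / fst z)\<bar> \<le> norm (fst w) / norm (fst z)" using abs_Im_le_cmod[of "fst w / fst z"] by (simp add: norm_divide)
    also have "\<dots> \<le> (11/10) / (1/2)" using wn False by (intro frac_le) auto
    finally have "\<bar>Im (fst w / fst z)\<bar> \<le> 3" by simp
    then show ?thesis unfolding norm_scaleR real_norm_def
      using cutoff_bounds(1,2)[of "(norm (fst z))\<^sup>2"] \<eta>_bounds(2) by (intro mult_mono) auto
  qed
  have d2: "norm ((cutoff' ((norm (fst z))\<^sup>2) * (2 * (fst z \<bullet> fst w))) *\<^sub>R \<eta> (Arg (fst z))) \<le> (16 * (2 * (11/10))) * (7 * \<kappa>)"
  proof -
    have "\<bar>fst z \<bullet> fst w\<bar> \<le> 1 * (11/10)"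
      using Cauchy_Schwarz_ineq2[of "fst z" "fst w"] mult_mono[OF fz1 wn] by simp
    then have "\<bar>cutoff' ((norm (fst z))\<^sup>2) * (2 * (fst z \<bullet> fst w))\<bar> \<le> 16 * (2 * (11/10))"
      unfolding abs_mult using cutoff_bounds(3,4)[of "(norm (fst z))\<^sup>2"] by (intro mult_mono) auto
    then show ?thesis unfolding norm_scaleR real_norm_def using \<eta>_bounds(1) by (intro mult_mono) auto
  qed
  have dqb: "norm (dq (fst z) (fst w)) \<le> 280 * \<kappa>"
    unfolding dq_def using norm_triangle_le[OF add_mono[OF d1 d2]] \<kappa> by simp
  have "(snd w - dq (fst z) (fst w)) - \<i> * \<zeta> = snd (w - times_i z) + (\<i> * q (fst z) - dq (fst z) (fst w))"
    by (simp add: \<zeta>_def times_i_def algebra_simps)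
  then have "norm ((snd w - dq (fst z) (fst w)) - \<i> * \<zeta>) \<le> norm (snd (w - times_i z)) + norm (\<i> * q (fst z) - dq (fst z) (fst w))"
    by (metis norm_triangle_ineq)
  also have "\<dots> \<le> \<kappa> + (7 * \<kappa> + 280 * \<kappa>)"
    using norm_fst_snd_le(2)[of "w - times_i z"] w norm_triangle_ineq4[of "\<i> * q (fst z)" "dq (fst z) (fst w)"] q_small[of "fst z"] dqb
    by (simp add: norm_mult)
  also have "\<dots> \<le> 3/10" using \<kappa> by simp
  finally show ?thesis using \<zeta>l by simp
qed

lemma dq_scaleR: "dq z (r *\<^sub>R w) = r *\<^sub>R dq z w"
proof -
  have "Im (r *\<^sub>R w / z) = r * Im (w / z)" by (simp add: scaleR_conv_of_real flip: times_divide_eq_right)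
  then show ?thesis by (simp add: dq_def scaleR_right_distrib ac_simps)
qed

text \<open>By \<open>winding_rate\<close> the argument of \<zeta> along b grows with speed at least
  \<open>cb t / 2\<close>. Its total growth is 2 pi n, and \<open>linking_winding\<close> identifies
  n with the linking number.\<close>

lemma linking_bound:
  fixes b w :: "real \<Rightarrow> c2" and cb :: "real \<Rightarrow> real"
  assumes b: "\<And>t. (b has_vector_derivative cb t *\<^sub>R w t) (at t)" "continuous_on UNIV (\<lambda>t. cb t *\<^sub>R w t)"
      "continuous_on UNIV cb" "\<And>t. cb t > 0" "\<And>t. b (t + 1) = b t" "\<And>t. norm (b t) = 1"
    and near: "\<And>t. norm (w t - times_i (b t)) \<le> \<kappa>"
    and lip: "\<And>s t. norm ((w t - u s) - times_i (b t - y s)) \<le> \<kappa> * norm (b t - y s)"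
    and x: "norm x = 1" and disj: "\<And>s t. y s \<noteq> b t" "\<And>s. y s \<noteq> x" "\<And>t. b t \<noteq> x"
  shows "\<exists>n::int. torus_degree (\<lambda>s t. stereo_diff (y s) (b t) x) = of_int n \<and> integral {0..1} cb / (4 * pi) \<le> of_int n"
proof -
  have yl: "c1_loop y" unfolding c1_loop_def
    by (intro exI[of _ "\<lambda>s. c s *\<^sub>R u s"]) (use y_deriv cu y_per in auto)
  have bl: "c1_loop b" unfolding c1_loop_def
    by (intro exI[of _ "\<lambda>t. cb t *\<^sub>R w t"]) (use b in auto)
  have qy: "c1_loop (\<lambda>s. q (fst (y s)))" and qb: "c1_loop (\<lambda>s. q (fst (b s)))"
    by (intro q_loop c1_loop_bounded_linear[OF bounded_linear_fst] yl bl)+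
  define \<zeta> where "\<zeta> t = snd (b t) - q (fst (b t))" for t
  define Z where "Z t = snd (w t) - dq (fst (b t)) (fst (w t))" for t
  have \<zeta>l: "c1_loop \<zeta>" unfolding \<zeta>_def[abs_def]
    by (intro c1_loop_diff qb c1_loop_bounded_linear[OF bounded_linear_snd] bl)
  have \<zeta>d: "(\<zeta> has_vector_derivative cb t *\<^sub>R Z t) (at t)" for t
  proof -
    have "((\<lambda>t. fst (b t)) has_vector_derivative cb t *\<^sub>R fst (w t)) (at t)"
      using bounded_linear.has_vector_derivative[OF bounded_linear_fst b(1)[of t]] by simp
    from has_vector_derivative_diff[OF bounded_linear.has_vector_derivative[OF bounded_linear_snd b(1)[of t]] q_curve_derivative[OF this]]
    show ?thesis unfolding \<zeta>_def[abs_def] Z_def dq_scaleR by (simp add: scaleR_diff_right)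
  qed
  \<comment> \<open>That \<zeta> is a C^1 loop provides a continuous derivative; uniqueness of
    derivatives passes the continuity to the explicit formula.\<close>
  obtain d where d: "\<And>t. (\<zeta> has_vector_derivative d t) (at t)" "continuous_on UNIV d" "\<And>t. \<zeta> (t + 1) = \<zeta> t"
    using \<zeta>l unfolding c1_loop_def by blast
  have "d t = cb t *\<^sub>R Z t" for t using vector_derivative_unique_at[OF d(1) \<zeta>d] .
  then have Zc: "continuous_on UNIV (\<lambda>t. cb t *\<^sub>R Z t)" using d(2) by simp
  have bnk: "\<nexists>s. b t = y s" for t using disj(1) by metis
  have \<zeta>nz: "\<zeta> t \<noteq> 0" for t
    using graph_is_knot[OF b(6)[of t]] bnk[of t] by (auto simp: \<zeta>_def)
  obtain \<Theta> and n :: int where \<Theta>: "\<And>t. (\<Theta> has_real_derivative Im (cb t *\<^sub>R Z t / \<zeta> t)) (at t)"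
    "\<And>t. \<zeta> t = of_real (norm (\<zeta> t)) * cis (\<Theta> t)" "continuous_on UNIV (\<lambda>t. Im (cb t *\<^sub>R Z t / \<zeta> t))"
    "\<And>t. \<Theta> (t + 1) = \<Theta> t + 2 * pi * of_int n"
    by (rule polar_lift_loop[OF \<zeta>d Zc \<zeta>nz d(3)], rule that) assumption+
  have rate: "Im (cb t *\<^sub>R Z t / \<zeta> t) \<ge> cb t / 2" for t
  proof -
    have "norm (Z t - \<i> * \<zeta> t) \<le> norm (\<zeta> t) / 2"
      unfolding Z_def \<zeta>_def using winding_rate[OF b(6) near lip] .
    then have "norm ((Z t - \<i> * \<zeta> t) / \<zeta> t) \<le> 1/2" using \<zeta>nz[of t] by (simp add: norm_divide divide_simps)
    moreover have "(Z t - \<i> * \<zeta> t) / \<zeta> t = Z t / \<zeta> t - \<i>" using \<zeta>nz[of t] by (simp add: diff_divide_distrib)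
    ultimately have "\<bar>Im (Z t / \<zeta> t) - 1\<bar> \<le> 1/2" using abs_Im_le_cmod[of "Z t / \<zeta> t - \<i>"] by simp
    then have "Im (Z t / \<zeta> t) \<ge> 1/2" using abs_ge_minus_self[of "Im (Z t / \<zeta> t) - 1"] by linarith
    then have "cb t * Im (Z t / \<zeta> t) \<ge> cb t * (1/2)" using b(4)[of t] by (intro mult_left_mono) auto
    then show ?thesis by (simp add: scaleR_conv_of_real flip: times_divide_eq_right)
  qed
  have n: "\<Theta> 1 - \<Theta> 0 = 2 * pi * of_int n" using \<Theta>(4)[of 0] by simp
  have "integral {0..1} cb / 2 \<le> \<Theta> 1 - \<Theta> 0"
  proof (rule has_integral_le)
    have "(cb has_integral integral {0..1} cb) {0..1}"
      by (intro integrable_integral integrable_continuous_interval continuous_on_subset[OF b(3)]) auto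
    then show "((\<lambda>t. cb t / 2) has_integral integral {0..1} cb / 2) {0..1}" by (rule has_integral_divide)
    show "((\<lambda>t. Im (cb t *\<^sub>R Z t / \<zeta> t)) has_integral \<Theta> 1 - \<Theta> 0) {0..1}" by (rule has_integral_DERIV[OF \<Theta>(1)]) simp
  qed (rule rate)
  then have lower: "integral {0..1} cb / (4 * pi) \<le> of_int n" unfolding n by (simp add: divide_simps ac_simps)
  have "torus_degree (\<lambda>s t. stereo_diff (y s) (b t) x) = of_int n"
  proof (rule linking_winding[where q = q and \<theta> = \<theta> and \<Theta> = \<Theta>, OF yl y_norm bl b(6) x q_continuous qy qb
      shear_injective shear_nonzero])
    show "snd (y s) = q (fst (y s))" for s by (simp add: q_on_knot)
    show "snd x \<noteq> q (fst x)" using graph_is_knot[OF x] disj(2) by metis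
    show "snd (b t) \<noteq> q (fst (b t))" for t using \<zeta>nz[of t] by (simp add: \<zeta>_def)
    show "fst (y s) = of_real (norm (fst (y s))) * cis (\<theta> s)" for s by (rule \<theta>(3))
    show "(\<theta> has_real_derivative c s * rate s) (at s)" for s unfolding rate_def by (rule \<theta>(1))
    show "continuous_on UNIV (\<lambda>s. c s * rate s)"
    proof -
      have "continuous_on UNIV (\<lambda>s. Im (fst (c s *\<^sub>R u s) / fst (y s)))"
        using fst_large(3) by (intro continuous_on_Im continuous_on_divide continuous_on_fst cu c1_loop_continuous[OF yl]) auto
      then show ?thesis by (simp add: rate_def scaleR_conv_of_real flip: times_divide_eq_right)
    qed
    show "\<theta> (s + 1) = \<theta> s + 2 * pi" for s by (rule \<theta>(2))
    show "(\<Theta> has_real_derivative Im (cb t *\<^sub>R Z t / \<zeta> t)) (at t)" for t by (rule \<Theta>(1))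
    show "continuous_on UNIV (\<lambda>t. Im (cb t *\<^sub>R Z t / \<zeta> t))" by (rule \<Theta>(3))
    show "\<Theta> (t + 1) = \<Theta> t + 2 * pi * of_int n" for t by (rule \<Theta>(4))
    show "snd (b t) - q (fst (b t)) = of_real (norm (snd (b t) - q (fst (b t)))) * cis (\<Theta> t)" for t
      using \<Theta>(2)[of t] by (simp add: \<zeta>_def)
  qed (use disj in auto)
  then show ?thesis using lower by blast
qed

end

section \<open>Short and long orbits\<close>

lemma snd_rot:
  fixes \<iota> :: "(real \<times> real) ^ 'm::finite \<Rightarrow> c2"
  assumes "bounded_linear \<iota>" "\<And>x. \<iota> (cplx x) = times_i (\<iota> x)"
  shows "snd (\<iota> (rot t z)) = cis t * snd (\<iota> z)"
proof -
  interpret bounded_linear \<iota> by fact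
  show ?thesis by (simp add: rot_def add scaleR assms(2) times_i_def complex_eq_iff)
qed

lemma norm_isometry:
  assumes "\<And>x y. f x \<bullet> f y = x \<bullet> y" shows "norm (f x) = norm x"
  using assms[of x x] by (simp add: norm_eq_sqrt_inner)

lemma times_i_diff: "times_i (a - b) = times_i a - times_i b"
  by (simp add: times_i_def prod_eq_iff right_diff_distrib)

context near_sphere
begin

text \<open>Trajectories that meet agree afterwards, by the Gronwall bound with initial difference
  0. The bound runs forward in time only, so periodicity first moves the given point of P to a later
  time.\<close>

lemma characteristic_subset:
  assumes P: "P \<in> closed_characteristics surf" "P' \<in> closed_characteristics surf" and p: "p \<in> P" "p \<in> P'"
  shows "P \<subseteq> P'"
proof
  note g = oriented_param_characteristic[OF P(1)] and g' = oriented_param_characteristic[OF P(2)]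
  obtain T yh \<sigma> where T: "T > 0" "NR.orbit yh" "\<And>x. yh (x + T) = yh x"
    "\<And>t. proj (oriented_param P t) = yh (\<sigma> t)"
    by (rule characteristic_orbit[OF g(1,3)], rule that) assumption+
  obtain yh' \<sigma>' where T': "NR.orbit yh'" "\<And>t. proj (oriented_param P' t) = yh' (\<sigma>' t)"
    "\<And>x. yh' x \<in> range (\<lambda>t. proj (oriented_param P' t))"
    by (rule characteristic_orbit[OF g'(1,3)], rule that) assumption+
  obtain s t where "oriented_param P s = p" "oriented_param P' t = p" using p g(2) g'(2) by (metis rangeE)
  then have 0: "yh (\<sigma> s) = yh' (\<sigma>' t)" using T(4)[of s] T'(2)[of t] by simp
  have eq: "yh (r + \<sigma> s) = yh' (r + \<sigma>' t)" if "0 \<le> r" for r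
    using NR.orbit_diff(1)[OF NR.orbit_shift[OF T(2), of "\<sigma> s"] NR.orbit_shift[OF T'(1), of "\<sigma>' t"] that] 0 by simp
  fix q assume "q \<in> P"
  then obtain a where a: "q = oriented_param P a" using g(2) by blast
  define n where "n = \<lceil>\<bar>\<sigma> s - \<sigma> a\<bar> / T\<rceil>"
  have "\<bar>\<sigma> s - \<sigma> a\<bar> / T \<le> of_int n" unfolding n_def by (rule le_of_int_ceiling)
  then have n: "\<bar>\<sigma> s - \<sigma> a\<bar> \<le> of_int n * T" using T(1) by (simp add: divide_simps)
  have "proj q = yh (\<sigma> a + of_int n * T)" using a T(4) periodic_shift[of yh T, OF T(3)] by simp
  also have "\<dots> = yh' (\<sigma> a + of_int n * T - \<sigma> s + \<sigma>' t)" using eq[of "\<sigma> a + of_int n * T - \<sigma> s"] n by simp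
  finally obtain b where "proj q = proj (oriented_param P' b)" using T'(3) by (metis (no_types, lifting) rangeE)
  then have "q = oriented_param P' b" by (metis emb_proj)
  then show "q \<in> P'" using g'(2) by blast
qed

text \<open>The cone over a differentiable closed curve is the image of a plane and hence negligible
  in dimension 4; two such cones cannot fill the space.\<close>

lemma surf_not_covered:
  assumes "CARD('m) = 2" and P: "P \<in> closed_characteristics surf" "P' \<in> closed_characteristics surf"
  shows "\<exists>p. p \<in> surf - (P \<union> P')"
proof (rule ccontr)
  assume "\<not> ?thesis"
  then have sub: "surf \<subseteq> P \<union> P'" by blast
  define G where "G Q = (\<lambda>z. fst z *\<^sub>R proj (oriented_param Q (snd z)))" for Q :: "((real \<times> real) ^ 'm) set"
  have neg: "negligible (range (G Q))" if Q: "Q \<in> closed_characteristics surf" for Q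
  proof (rule negligible_differentiable_image_lowdim)
    show "DIM(real \<times> real) < DIM((real \<times> real) ^ 'm)" using assms(1) by simp
    obtain u where "\<And>t. ((\<lambda>t. proj (oriented_param Q t)) has_vector_derivative speed (oriented_param Q) t *\<^sub>R u t) (at t)"
      using characteristic_loop_pull_back[OF oriented_param_characteristic(1)[OF Q]] by blast
    then have "(\<lambda>t. proj (oriented_param Q t)) differentiable (at t)" for t
      by (rule differentiableI_vector)
    then have "(\<lambda>z. proj (oriented_param Q (snd z))) differentiable (at z)" for z :: "real \<times> real"
      by (rule differentiable_compose[where g = snd]) (rule bounded_linear_imp_differentiable[OF bounded_linear_snd])
    then show "G Q differentiable_on UNIV" unfolding G_def differentiable_on_def
      by (intro ballI) (rule differentiable_scaleR[OF bounded_linear_imp_differentiable[OF bounded_linear_fst]])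
  qed
  have "x \<in> range (G P) \<union> range (G P')" for x
  proof (cases "x = 0")
    case True then show ?thesis by (auto simp: G_def intro!: range_eqI[of _ _ "(0, 0)"])
  next
    case False
    then have "norm (x /\<^sub>R norm x) = 1" by simp
    then have "emb (x /\<^sub>R norm x) \<in> P \<union> P'" using sub in_surf_iff[of "emb (x /\<^sub>R norm x)"] by (metis proj_emb subsetD)
    then obtain Q t where Q: "Q = P \<or> Q = P'" "emb (x /\<^sub>R norm x) = oriented_param Q t"
      using oriented_param_characteristic(2)[OF P(1)] oriented_param_characteristic(2)[OF P(2)] by (metis Un_iff rangeE)
    have "x /\<^sub>R norm x = proj (oriented_param Q t)" using Q(2) by (metis proj_emb)
    then have "x = norm x *\<^sub>R proj (oriented_param Q t)" using False by (metis scaleR_one scaleR_scaleR right_inverse norm_eq_zero)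
    then have "x = G Q (norm x, t)" by (simp add: G_def)
    then show ?thesis using Q(1) by blast
  qed
  then have "range (G P) \<union> range (G P') = (UNIV :: ((real \<times> real) ^ 'm) set)" by blast
  then show False using negligible_Un[OF neg[OF P(1)] neg[OF P(2)]] non_negligible_UNIV by metis
qed

text \<open>In unitary coordinates with starting point (1, 0) the Hopf orbit of that point is the
  fibre z2 = 0. Drift over one period therefore bounds the second coordinate, and the phase of the
  first one turns almost at unit rate.\<close>

lemma phase_knot_characteristic:
  assumes \<gamma>: "characteristic_loop \<gamma>" "\<And>t. speed \<gamma> t > 0" and d: "\<delta> \<le> 1/48000"
    and T: "\<bar>integral {0..1} (speed \<gamma>) - 2 * pi\<bar> \<le> 1/2"
    and bl: "bounded_linear \<iota>" and inner: "\<And>x y. \<iota> x \<bullet> \<iota> y = x \<bullet> y" and J: "\<And>x. \<iota> (cplx x) = times_i (\<iota> x)"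
    and start: "\<iota> (proj (\<gamma> 0)) = (1, 0)"
    and y: "\<And>t. norm (proj (\<gamma> t)) = 1" and u: "\<And>t. char_dir (proj (\<gamma> t)) (u t)"
      "\<And>t. ((\<lambda>t. proj (\<gamma> t)) has_vector_derivative speed \<gamma> t *\<^sub>R u t) (at t)"
      "continuous_on UNIV (speed \<gamma>)" "continuous_on UNIV (\<lambda>t. speed \<gamma> t *\<^sub>R u t)"
  obtains \<theta> \<tau> where "phase_knot (\<lambda>t. \<iota> (proj (\<gamma> t))) (\<lambda>t. \<iota> (u t)) (speed \<gamma>) \<theta> \<tau> (24 * \<delta>)"
proof -
  interpret bounded_linear \<iota> by (rule bl)
  have niota: "norm (\<iota> x) = norm x" for x by (rule norm_isometry) (rule inner)
  define Y where "Y t = \<iota> (proj (\<gamma> t))" for t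
  define U where "U t = \<iota> (u t)" for t
  let ?c = "speed \<gamma>"
  let ?\<rho> = "\<lambda>t. Im (fst (U t) / fst (Y t))"
  have Yd: "(Y has_vector_derivative ?c t *\<^sub>R U t) (at t)" for t
    using bounded_linear.has_vector_derivative[OF bl u(2)] by (simp add: Y_def[abs_def] U_def scaleR)
  have UC: "continuous_on UNIV (\<lambda>t. ?c t *\<^sub>R U t)"
    using bounded_linear.continuous_on[OF bl u(4)] by (simp add: U_def scaleR)
  have Yn: "norm (Y t) = 1" for t by (simp add: Y_def niota y)
  have \<gamma>per: "\<gamma> (t + 1) = \<gamma> t" for t using \<gamma>(1) unfolding characteristic_loop_def regular_loop_def by blast
  have Yper: "Y (t + 1) = Y t" for t by (simp add: Y_def \<gamma>per)
  have near: "norm (U t - times_i (Y t)) \<le> 24 * \<delta>" for t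
  proof -
    have "U t - times_i (Y t) = \<iota> (u t - cplx (proj (\<gamma> t)))" by (simp add: U_def Y_def diff J)
    then show ?thesis using char_dir_near[OF u(1) y, of t] small by (simp add: niota)
  qed
  have Ysnd: "norm (snd (Y t)) \<le> 7 * (24 * \<delta>)" for t
  proof -
    obtain T yh \<sigma> where o: "T = integral {0..1} (speed \<gamma>)" "T > 0" "NR.orbit yh"
      "\<And>x. yh (x + T) = yh x" "\<And>t. proj (\<gamma> t) = yh (\<sigma> t)" "\<sigma> 0 = 0"
      by (rule characteristic_orbit[OF \<gamma>], rule that) assumption+
    \<comment> \<open>The drift bound grows with time, so the time is first reduced to the interval
      [0, T].\<close>
    define x where "x = \<sigma> t + of_int (- \<lfloor>\<sigma> t / T\<rfloor>) * T"
    have yx: "yh x = yh (\<sigma> t)" unfolding x_def by (rule periodic_shift[of yh T, OF o(4)])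
    have "of_int \<lfloor>\<sigma> t / T\<rfloor> \<le> \<sigma> t / T" "\<sigma> t / T \<le> of_int \<lfloor>\<sigma> t / T\<rfloor> + 1" by linarith+
    then have "of_int \<lfloor>\<sigma> t / T\<rfloor> * T \<le> \<sigma> t" "\<sigma> t \<le> (of_int \<lfloor>\<sigma> t / T\<rfloor> + 1) * T"
      using o(2) by (simp_all only: pos_le_divide_eq pos_divide_le_eq)
    then have x: "0 \<le> x" "x \<le> T" unfolding x_def by (simp_all add: algebra_simps)
    have "cis (- x) * snd (Y t) = snd (\<iota> (rot (- x) (yh x) - yh 0))"
      using start o(5)[of 0] o(6) snd_rot[OF bl J, of "- x" "yh x"] by (simp add: diff Y_def o(5) yx)
    then have "norm (snd (Y t)) = norm (snd (\<iota> (rot (- x) (yh x) - yh 0)))"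
      by (metis norm_cis norm_mult mult_1)
    also have "\<dots> \<le> norm (rot (- x) (yh x) - yh 0)" using norm_fst_snd_le(2) niota by metis
    also have "\<dots> \<le> 12 * \<delta> * x" by (rule NR.orbit_drift[OF o(3) x(1)])
    also have "x \<le> 14" using x(2) T o(1) pi_less_4 unfolding abs_le_iff by linarith
    then have "12 * \<delta> * x \<le> 12 * \<delta> * 14" using small by (intro mult_left_mono) auto
    finally show ?thesis by simp
  qed
  have fst_large: "norm (fst (Y t)) \<ge> 9/10" for t
  proof (rule power2_le_imp_le)
    have "(norm (snd (Y t)))\<^sup>2 \<le> (1/10)\<^sup>2" using Ysnd[of t] d by (intro power_mono) auto
    then show "(9/10)\<^sup>2 \<le> (norm (fst (Y t)))\<^sup>2" using norm_fst_sq[OF Yn[of t]] by (simp add: power2_eq_square)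
  qed simp
  then have nz: "fst (Y t) \<noteq> 0" for t by (metis norm_zero not_le divide_pos_pos zero_less_numeral)
  have rho: "\<bar>?\<rho> t - 1\<bar> \<le> 1/1000" for t
  proof -
    have "\<bar>?\<rho> t - 1\<bar> \<le> 24 * \<delta> / norm (fst (Y t))" by (rule rate_near[OF near nz])
    also have "\<dots> \<le> (1/2000) / (9/10)" using fst_large[of t] d small by (intro frac_le) auto
    finally show ?thesis by simp
  qed
  obtain \<theta> and n :: int where th0: "\<And>t. (\<theta> has_real_derivative Im ((?c t *\<^sub>R fst (U t)) / fst (Y t))) (at t)"
    "\<And>t. fst (Y t) = of_real (norm (fst (Y t))) * cis (\<theta> t)"
    "continuous_on UNIV (\<lambda>t. Im ((?c t *\<^sub>R fst (U t)) / fst (Y t)))"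
    "\<And>t. \<theta> (t + 1) = \<theta> t + 2 * pi * of_int n"
  proof (rule polar_lift_loop[of "\<lambda>t. fst (Y t)" "\<lambda>t. ?c t *\<^sub>R fst (U t)"])
    show "((\<lambda>t. fst (Y t)) has_vector_derivative ?c t *\<^sub>R fst (U t)) (at t)" for t
      using bounded_linear.has_vector_derivative[OF bounded_linear_fst Yd] by simp
    show "continuous_on UNIV (\<lambda>t. ?c t *\<^sub>R fst (U t))" using continuous_on_fst[OF UC] by simp
  qed (auto simp: nz Yper)
  have im: "Im ((?c t *\<^sub>R fst (U t)) / fst (Y t)) = ?c t * ?\<rho> t" for t
    by (simp add: scaleR_conv_of_real flip: times_divide_eq_right)
  note th = th0(1,3)[unfolded im] th0(2,4)
  have "((\<lambda>t. ?c t * ?\<rho> t) has_integral \<theta> 1 - \<theta> 0) {0..1}"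
    by (rule fundamental_theorem_of_calculus)
       (use th(1) in \<open>auto simp: has_real_derivative_iff_has_vector_derivative intro: has_vector_derivative_at_within\<close>)
  moreover have "\<theta> 1 - \<theta> 0 = 2 * pi * of_int n" using th(4)[of 0] by simp
  ultimately have hi: "((\<lambda>t. ?c t * ?\<rho> t) has_integral 2 * pi * of_int n) {0..1}" by simp
  have ci: "(?c has_integral integral {0..1} ?c) {0..1}"
    by (intro integrable_integral integrable_continuous_real continuous_on_subset[OF u(3)]) simp
  have l: "(999/1000) * ?c t \<le> ?c t * ?\<rho> t" "?c t * ?\<rho> t \<le> (1001/1000) * ?c t" for t
  proof -
    have "?\<rho> t \<ge> 999/1000" "?\<rho> t \<le> 1001/1000" using rho[of t] unfolding abs_le_iff by linarith+
    then have "?c t * (999/1000) \<le> ?c t * ?\<rho> t" "?c t * ?\<rho> t \<le> ?c t * (1001/1000)"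
      using \<gamma>(2)[of t] by (auto intro!: mult_left_mono)
    then show "(999/1000) * ?c t \<le> ?c t * ?\<rho> t" "?c t * ?\<rho> t \<le> (1001/1000) * ?c t" by simp_all
  qed
  \<comment> \<open>The phase gain 2 pi n equals T up to a relative error of 1/1000, and T is within
    1/2 of 2 pi; this leaves n = 1.\<close>
  have "(999/1000) * integral {0..1} ?c \<le> 2 * pi * of_int n"
    by (rule has_integral_le[OF has_integral_mult_right[OF ci] hi]) (rule l)
  moreover have "2 * pi * of_int n \<le> (1001/1000) * integral {0..1} ?c"
    by (rule has_integral_le[OF hi has_integral_mult_right[OF ci]]) (rule l)
  ultimately have "0 < pi * of_int n" "pi * of_int n < pi * 2" using T pi_gt3 unfolding abs_le_iff by linarith+
  then have "0 < (of_int n :: real)" "of_int n < (2::real)" by (simp_all add: zero_less_mult_iff)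
  then have n: "n = 1" by linarith
  have per: "\<theta> (t + 1) = \<theta> t + 2 * pi" for t using th(4) n by simp
  have pos: "?c t * ?\<rho> t > 0" for t using l(1)[of t] \<gamma>(2)[of t] by linarith
  obtain \<tau> where \<tau>: "\<And>x. \<theta> (\<tau> x) = x" "\<And>t. \<tau> (\<theta> t) = t"
    "\<And>x. (\<tau> has_real_derivative inverse (?c (\<tau> x) * ?\<rho> (\<tau> x))) (at x)" "\<And>x. \<tau> (x + 2 * pi) = \<tau> x + 1"
    by (rule periodic_reparametrization[OF th(1) pos per _ that]) auto
  have "phase_knot Y U ?c \<theta> \<tau> (24 * \<delta>)"
    by unfold_locales (use small d Yd u(3) UC \<gamma>(2) Yper Yn near Ysnd th per \<tau> in auto)
  then show ?thesis using that unfolding Y_def[abs_def] U_def[abs_def] by blast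
qed

text \<open>The coordinates and the graph q are adapted to P, and the winding is measured along P'.
  The ceiling 1/48000 makes \<kappa> = 24 \<delta> at most 1/2000.\<close>

lemma link_lower_bound:
  assumes m: "CARD('m) = 2" and conv: "surf \<in> Conv" and d: "\<delta> \<le> 1/48000"
    and P: "P \<in> closed_characteristics surf" "P' \<in> closed_characteristics surf" and disj: "P \<inter> P' = {}"
    and T: "\<bar>integral {0..1} (speed (oriented_param P)) - 2 * pi\<bar> \<le> 1/2"
  shows "integral {0..1} (speed (oriented_param P')) / (4 * pi) \<le> link surf P P'"
proof -
  note g = oriented_param_characteristic[OF P(1)] and g' = oriented_param_characteristic[OF P(2)]
  let ?g = "oriented_param P" and ?h = "oriented_param P'"
  obtain u where u: "\<And>t. norm (proj (?g t)) = 1" "\<And>t. char_dir (proj (?g t)) (u t)"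
    "\<And>t. ((\<lambda>t. proj (?g t)) has_vector_derivative speed ?g t *\<^sub>R u t) (at t)"
    "continuous_on UNIV (speed ?g)" "continuous_on UNIV (\<lambda>t. speed ?g t *\<^sub>R u t)"
    using characteristic_loop_pull_back[OF g(1)] by blast
  obtain w where w: "\<And>t. norm (proj (?h t)) = 1" "\<And>t. char_dir (proj (?h t)) (w t)"
    "\<And>t. ((\<lambda>t. proj (?h t)) has_vector_derivative speed ?h t *\<^sub>R w t) (at t)"
    "continuous_on UNIV (speed ?h)" "continuous_on UNIV (\<lambda>t. speed ?h t *\<^sub>R w t)"
    using characteristic_loop_pull_back[OF g'(1)] by blast
  obtain \<iota> :: "(real \<times> real) ^ 'm \<Rightarrow> c2" where bl: "bounded_linear \<iota>" and inner: "\<And>x y. \<iota> x \<bullet> \<iota> y = x \<bullet> y"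
    and J0: "\<And>x. \<iota> (cplx x) = (\<i> * fst (\<iota> x), \<i> * snd (\<iota> x))" and start: "\<iota> (proj (?g 0)) = (1, 0)"
    and vol: "\<And>n a b c. norm n = 1 \<Longrightarrow> symp_vol4 n a b c = det3 (cvec (\<iota> n) (\<iota> a)) (cvec (\<iota> n) (\<iota> b)) (cvec (\<iota> n) (\<iota> c))"
    by (rule unitary_coordinates[OF m u(1)[of 0]], rule that) assumption+
  have J: "\<iota> (cplx x) = times_i (\<iota> x)" for x by (simp add: J0 times_i_def)
  interpret \<iota>: bounded_linear \<iota> by (rule bl)
  have niota: "norm (\<iota> x) = norm x" for x by (rule norm_isometry) (rule inner)
  have inj: "\<iota> a = \<iota> b \<Longrightarrow> a = b" for a b using niota[of "a - b"] by (simp add: \<iota>.diff)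
  obtain x where x: "norm x = 1" "\<And>s. proj (?g s) \<noteq> x" "\<And>t. proj (?h t) \<noteq> x"
    "link surf P P' = torus_degree (\<lambda>s t. stereo_diff (\<iota> (proj (?g s))) (\<iota> (proj (?h t))) (\<iota> x))"
  proof (rule link_torus_degree[OF bl inner vol conv P disj surf_not_covered[OF m P]])
    fix x assume a: "norm x = 1" "\<And>s. proj (?g s) \<noteq> x" "\<And>t. proj (?h t) \<noteq> x"
      "link surf P P' = torus_degree (\<lambda>s t. stereo_diff (\<iota> (proj (?g s))) (\<iota> (proj (?h t))) (\<iota> x))"
    show thesis by (rule that[OF a])
  qed
  obtain \<theta> \<tau> where pk: "phase_knot (\<lambda>t. \<iota> (proj (?g t))) (\<lambda>t. \<iota> (u t)) (speed ?g) \<theta> \<tau> (24 * \<delta>)"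
    by (rule phase_knot_characteristic[OF g(1,3) d T bl inner J start u], rule that) assumption+
  interpret K: phase_knot "\<lambda>t. \<iota> (proj (?g t))" "\<lambda>t. \<iota> (u t)" "speed ?g" \<theta> \<tau> "24 * \<delta>" by (rule pk)
  have "\<exists>n::int. torus_degree (\<lambda>s t. stereo_diff (\<iota> (proj (?g s))) (\<iota> (proj (?h t))) (\<iota> x)) = of_int n \<and>
      integral {0..1} (speed ?h) / (4 * pi) \<le> of_int n"
  proof (rule K.linking_bound[of "\<lambda>t. \<iota> (proj (?h t))" "speed ?h" "\<lambda>t. \<iota> (w t)"])
    show "((\<lambda>t. \<iota> (proj (?h t))) has_vector_derivative speed ?h t *\<^sub>R \<iota> (w t)) (at t)" for t
      using bounded_linear.has_vector_derivative[OF bl w(3)] by (simp add: \<iota>.scaleR)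
    show "continuous_on UNIV (\<lambda>t. speed ?h t *\<^sub>R \<iota> (w t))"
      using bounded_linear.continuous_on[OF bl w(5)] by (simp add: \<iota>.scaleR)
    show "\<iota> (proj (?h (t + 1))) = \<iota> (proj (?h t))" for t
      using g'(1) unfolding characteristic_loop_def regular_loop_def by metis
    show "norm (\<iota> (w t) - times_i (\<iota> (proj (?h t)))) \<le> 24 * \<delta>" for t
    proof -
      have "\<iota> (w t) - times_i (\<iota> (proj (?h t))) = \<iota> (w t - cplx (proj (?h t)))" by (simp add: \<iota>.diff J)
      then show ?thesis using char_dir_near[OF w(2) w(1), of t] small by (simp add: niota)
    qed
    show "norm ((\<iota> (w t) - \<iota> (u s)) - times_i (\<iota> (proj (?h t)) - \<iota> (proj (?g s)))) \<le>
        24 * \<delta> * norm (\<iota> (proj (?h t)) - \<iota> (proj (?g s)))" for s t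
    proof -
      have e: "(\<iota> (w t) - \<iota> (u s)) - times_i (\<iota> (proj (?h t)) - \<iota> (proj (?g s))) =
          \<iota> ((w t - u s) - cplx (proj (?h t) - proj (?g s)))" by (simp add: \<iota>.diff J times_i_diff)
      have "norm ((w t - u s) - cplx (proj (?h t) - proj (?g s))) \<le> 12 * \<delta> * norm (proj (?h t) - proj (?g s))"
        by (rule char_dir_lipschitz[OF w(2) w(1) u(2) u(1)])
      also have "\<dots> \<le> 24 * \<delta> * norm (proj (?h t) - proj (?g s))" using small by (intro mult_right_mono) auto
      finally show ?thesis unfolding e by (simp only: niota flip: \<iota>.diff)
    qed
    show "\<iota> (proj (?g s)) \<noteq> \<iota> (proj (?h t))" for s t
    proof
      assume "\<iota> (proj (?g s)) = \<iota> (proj (?h t))"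
      then have "?g s = ?h t" using inj by (metis emb_proj)
      then show False using disj g(2) g'(2) by blast
    qed
    show "\<iota> (proj (?g s)) \<noteq> \<iota> x" for s using inj x(2) by metis
    show "\<iota> (proj (?h t)) \<noteq> \<iota> x" for t using inj x(3) by metis
  qed (use w(1,4) g'(3) x(1) in \<open>simp_all add: niota\<close>)
  then show ?thesis using x(4) by auto
qed

end

section \<open>Choice of the neighbourhoods\<close>

lemma near_nbhd_mono: "a \<le> b \<Longrightarrow> near_nbhd a \<subseteq> near_nbhd b"
  unfolding near_nbhd_def by force

theorem theorem1p6:
  fixes \<epsilon> :: real
  assumes "\<epsilon> > 0"
  shows "\<exists>U :: ((real \<times> real) ^ 'm::finite) set set.
    openin C2_topology U \<and> sphere 0 1 \<in> U \<and>
    (\<forall>S\<in>U. \<forall>P\<in>closed_characteristics S. short_orbit \<epsilon> P \<or> long_orbit \<epsilon> P) \<and>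
    (CARD('m) = 2 \<longrightarrow>
      (\<forall>k::nat. k \<ge> 1 \<longrightarrow>
        (\<exists>V. V \<subseteq> U \<and> openin C2_topology V \<and> sphere 0 1 \<in> V \<and>
          (\<forall>S\<in>V. \<forall>P\<in>closed_characteristics S. \<forall>P'\<in>closed_characteristics S.
             short_orbit \<epsilon> P \<and> long_orbit \<epsilon> P' \<and> \<not> short_orbit \<epsilon> P' \<longrightarrow> link S P P' \<ge> real k))))"
proof -
  \<comment> \<open>A period above K yields an action above (2/5) K = 6 / (5 \<epsilon>), which
    exceeds 1 / \<epsilon>.\<close>
  define K where "K = 3 / \<epsilon>"
  have K: "K > 0" using assms by (simp add: K_def)
  \<comment> \<open>The last two terms provide 600 \<delta> K \<le> 1, the hypothesis of
    \<open>action_dichotomy\<close>, and 24 \<delta> K \<le> \<epsilon>, its error for short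
    orbits.\<close>
  define \<delta>0 where "\<delta>0 = min (1/100) (min (1 / (600 * K)) (\<epsilon> / (24 * K)))"
  have d0: "\<delta>0 > 0" "\<delta>0 \<le> 1/100" using assms K by (simp_all add: \<delta>0_def)
  have scale: "600 * \<delta> * L \<le> 1 \<and> 24 * \<delta> * L \<le> \<epsilon>"
    if "\<delta> \<le> min (1 / (600 * L)) (\<epsilon> / (24 * L))" "L > 0" for \<delta> L
    using that by (simp add: field_simps)
  have dichotomy: "(\<forall>P\<in>closed_characteristics S. short_orbit \<epsilon> P \<or> long_orbit \<epsilon> P)"
    if nbhd: "S \<in> near_nbhd \<delta>0" for S :: "((real \<times> real) ^ 'm) set"
  proof
    fix P assume P: "P \<in> closed_characteristics S"
    obtain \<delta> v v' where d: "\<delta> < \<delta>0" and ns: "near_sphere v v' \<delta>" and S: "S = near_sphere.surf v"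
      using nbhd unfolding near_nbhd_def by blast
    interpret near_sphere v v' \<delta> by (rule ns)
    have sm: "600 * \<delta> * K \<le> 1" "24 * \<delta> * K \<le> \<epsilon>" using scale[of \<delta> K] d K unfolding \<delta>0_def by auto
    show "short_orbit \<epsilon> P \<or> long_orbit \<epsilon> P"
    proof (rule disjE[OF action_dichotomy[OF P[unfolded S] sm(1)]], goal_cases)
      case 1
      then have "\<bar>char_action P - pi\<bar> \<le> \<epsilon>" using sm(2) by linarith
      then show ?case unfolding short_orbit_def abs_le_iff by auto
    next
      case 2
      then have "char_action P > (2/5) * K" by linarith
      moreover have "(2/5) * K > 1 / \<epsilon>" using assms by (simp add: K_def field_simps)
      ultimately show ?case unfolding long_orbit_def by linarith
    qed
  qed
  have linking: "\<exists>V :: ((real \<times> real) ^ 'm) set set. V \<subseteq> near_nbhd \<delta>0 \<and> openin C2_topology V \<and> sphere 0 1 \<in> V \<and>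
      (\<forall>S\<in>V. \<forall>P\<in>closed_characteristics S. \<forall>P'\<in>closed_characteristics S.
         short_orbit \<epsilon> P \<and> long_orbit \<epsilon> P' \<and> \<not> short_orbit \<epsilon> P' \<longrightarrow> link S P P' \<ge> real k)"
    if m: "CARD('m) = 2" for k :: nat
  proof -
    \<comment> \<open>(2/5) L > pi + \<epsilon> keeps actions of orbits with period above L out of
      the short range, and L \<ge> 16 k \<ge> 4 pi k makes the lower bound for the linking number at
      least k.\<close>
    define L where "L = 10 + 3 * \<epsilon> + 16 * real k"
    have L: "L > 0" "(2/5) * L > pi + \<epsilon>" "L \<ge> 16 * real k"
      using assms pi_less_4 by (simp_all add: L_def)
    define \<delta>1 where "\<delta>1 = min \<delta>0 (min (1/48000) (min (1 / (600 * L)) (\<epsilon> / (24 * L))))"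
    have d1: "\<delta>1 > 0" "\<delta>1 \<le> \<delta>0" "\<delta>1 \<le> 1/48000" using assms d0 L by (simp_all add: \<delta>1_def)
    have "real k \<le> link S P P'"
      if S0: "S \<in> near_nbhd \<delta>1" and P0: "P \<in> closed_characteristics S" "P' \<in> closed_characteristics S"
        and sl: "short_orbit \<epsilon> P" "\<not> short_orbit \<epsilon> P'" for S P P' :: "((real \<times> real) ^ 'm) set"
    proof -
      obtain \<delta> v v' where d: "\<delta> < \<delta>1" and ns: "near_sphere v v' \<delta>" and S: "S = near_sphere.surf v" and conv: "S \<in> Conv"
        using S0 unfolding near_nbhd_def by blast
      interpret near_sphere v v' \<delta> by (rule ns)
      note P = P0[unfolded S]
      have sm: "600 * \<delta> * L \<le> 1" "24 * \<delta> * L \<le> \<epsilon>" using scale[of \<delta> L] d L(1) unfolding \<delta>1_def by auto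
      \<comment> \<open>For a period up to L the error 36 \<delta> L is at most 3/50; a longer
        period would contradict that P is short.\<close>
      have T: "\<bar>integral {0..1} (speed (oriented_param P)) - 2 * pi\<bar> \<le> 1/2"
      proof (rule disjE[OF action_dichotomy[OF P(1) sm(1)]], goal_cases)
        case 1 then show ?case using sm(1) by linarith
      next
        case 2
        then have "char_action P > pi + \<epsilon>" using L(2) by linarith
        then show ?case using sl(1) unfolding short_orbit_def by simp
      qed
      have T': "integral {0..1} (speed (oriented_param P')) > L"
      proof (rule disjE[OF action_dichotomy[OF P(2) sm(1)]], goal_cases)
        case 1
        then have "\<bar>char_action P' - pi\<bar> \<le> \<epsilon>" using sm(2) by linarith
        then have "short_orbit \<epsilon> P'" unfolding short_orbit_def abs_le_iff by auto
        then show ?case using sl(2) by simp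
      qed simp
      \<comment> \<open>P is short and P' is not, so they differ, and distinct characteristics
        cannot meet.\<close>
      have "P \<inter> P' = {}"
      proof (rule ccontr)
        assume "P \<inter> P' \<noteq> {}"
        then obtain p where p: "p \<in> P" "p \<in> P'" by blast
        have "P = P'" using characteristic_subset[OF P p] characteristic_subset[OF P(2,1) p(2,1)] by (rule subset_antisym)
        then show False using sl by simp
      qed
      then have "integral {0..1} (speed (oriented_param P')) / (4 * pi) \<le> link S P P'"
        using link_lower_bound[OF m conv[unfolded S] _ P _ T] d d1(3) unfolding S by simp
      moreover have "real k \<le> integral {0..1} (speed (oriented_param P')) / (4 * pi)"
      proof -
        have "real k * pi \<le> real k * 4" using pi_less_4 by (intro mult_left_mono) auto
        then have "real k * (4 * pi) \<le> integral {0..1} (speed (oriented_param P'))" using L(3) T' by linarith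
        then show ?thesis by (simp add: pos_le_divide_eq)
      qed
      ultimately show ?thesis by linarith
    qed
    then show ?thesis
      using near_nbhd_mono[OF d1(2)] openin_near_nbhd[of \<delta>1] sphere_in_near_nbhd[OF d1(1)] d1(3)
      by (intro exI[of _ "near_nbhd \<delta>1"]) auto
  qed
  show ?thesis
    using openin_near_nbhd[OF d0(2)] sphere_in_near_nbhd[OF d0(1)] dichotomy linking
    by (intro exI[of _ "near_nbhd \<delta>0"]) blast
qed

end
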